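(* Let $\mathcal{B}$ be a unital $C^*$-algebra, let $E_+$ be a Hilbert $\mathcal{B}$-module, let $\mathbb{T}$ be either $[0,\infty)$ or $\mathbb{N}_0$, and let $\vartheta=(\vartheta_t)_{t\in\mathbb{T}}$ be a spatial strict $E_0$-semigroup on $\mathscr{B}^a(E_+)$. Then there exist a correspondence $E_-$ over $\mathcal{B}$ and a semigroup $w=(w_t)_{t\in\mathbb{T}}$ of unitaries $w_t\in\mathscr{B}^a(E)$ on $E:=E_+\odot E_-$ such that: (1) the canonical homomorphism $\mathscr{B}^a(E_+)\to\mathscr{B}^a(E_+)\odot\mathrm{id}_{E_-}\subset\mathscr{B}^a(E)$, $a\mapsto a\odot\mathrm{id}_{E_-}$, is an isomorphism; and (2) for every $t\in\mathbb{T}$ the restriction of $\alpha_t:=w_t\bullet w_t^*$ to $\mathscr{B}^a(E_+)\odot\mathrm{id}_{E_-}$ is $\vartheta_t\odot\mathrm{id}_{E_-}$, that is, $w_t(a\odot\mathrm{id}_{E_-})w_t^*=\vartheta_t(a)\odot\mathrm{id}_{E_-}$ for all $a\in\mathscr{B}^a(E_+)$.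
   Context: Conventions. $\mathscr{B}^a(E)$ is the $C^*$-algebra of all adjointable operators on a Hilbert module $E$. Inner products are linear in the second variable. For $x,y\in E$, $xy^*$ denotes the rank-one operator $z\mapsto x\langle y,z\rangle$, and $\mathscr{K}(E)$ is the closed linear span of $\{xy^*: x,y\in E\}$. A correspondence over $\mathcal{B}$ is a Hilbert $\mathcal{B}$-module with a nondegenerate left action of $\mathcal{B}$ by adjointable operators (a $*$-representation). More generally, a correspondence from $\mathcal{A}$ to $\mathcal{B}$ is a Hilbert $\mathcal{B}$-module with a nondegenerate left action of $\mathcal{A}$ by adjointable operators. The symbol $\odot$ denotes the internal tensor product (over $\mathcal{B}$ unless indicated otherwise). $\mathbb{T}$ is regarded as a semigroup with identity under addition. Semigroups $(s_t)_{t\in\mathbb{T}}$ satisfy $s_0=\mathrm{id}$ and $s_{s+t}=s_s s_t$. No continuity in $t$ is assumed. $E_0$-semigroup. An $E_0$-semigroup on $\mathscr{B}^a(E_+)$ is a semigroup $\vartheta=(\vartheta_t)_{t\in\mathbb{T}}$ of unital ($*$-)endomorphisms of $\mathscr{B}^a(E_+)$. It is strict if each $\vartheta_t$ is strict, meaning that the restriction of $\vartheta_t$ to $\mathscr{K}(E_+)$ acts nondegenerately on $E_+$. Product system. A product system is a family $E^\odot=(E_t)_{t\in\mathbb{T}}$ of correspondences over $\mathcal{B}$ with $E_0=\mathcal{B}$ and an associative family of bilinear unitaries $u_{st}\colon E_s\odot E_t\to E_{s+t}$, which are the canonical identifications when $s=0$ or $t=0$. Product system of $\vartheta$. Let $E_+^*$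 be the dual correspondence of $E_+$, from $\mathcal{B}$ to $\mathscr{B}^a(E_+)$, with inner product $\langle x^*,y^*\rangle=xy^*$ and bimodule operations $b\,x^*\,a=(a^*xb^* )^*$. Let ${}_{\vartheta_t}E_+$ be $E_+$ viewed as a correspondence from $\mathscr{B}^a(E_+)$ to $\mathcal{B}$ with left action of $\mathscr{B}^a(E_+)$ via $\vartheta_t$. The product system associated with a strict $E_0$-semigroup $\vartheta$ is $E_0=\mathcal{B}$ and $E_t:=E_+^*\odot{}_{\vartheta_t}E_+$ for $t>0$ (tensor product over $\mathscr{B}^a(E_+)$, elementary tensors written $x^*\odot_t y$), with $u_{st}$ determined by $u_{st}\big((x^*\odot_s x')\odot(y^*\odot_t y')\big)=x^*\odot_{s+t}\vartheta_t(x'y^* )y'$. (If $E_+$ is full, that is, if the closed linear span of $\langle E_+,E_+\rangle$ is $\mathcal{B}$, the formula for $E_t$ applies also at $t=0$, with $x^*\odot_0 y$ identified with $\langle x,y\rangle$.) Spatiality. A unit for a product system $E^\odot$ is a family $\xi^\odot=(\xi_t)_{t\in\mathbb{T}}$ with $\xi_t\in E_t$, $u_{st}(\xi_s\odot\xi_t)=\xi_{s+t}$ and $\xi_0=\mathbf{1}\in E_0=\mathcal{B}$. A unit $\omega^\odot$ is central if $b\omega_t=\omega_t b$ for all $t\in\mathbb{T}$, $b\in\mathcal{B}$, and unital if $\langle\omega_t,\omega_t\rangle=\mathbf{1}$ for all $t\in\mathbb{T}$. A product system is spatial if it admits a central unital unit. A strict $E_0$-semigroup is spatial if its associated product system is spatial.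 *)

theory Defs
  imports "HOL-Analysis.Analysis"
begin

section \<open>Unital C*-algebras\<close>

text \<open>Built on \<^class>\<open>monoid_mult\<close> and not on \<^class>\<open>real_normed_algebra_1\<close>, so that the zero algebra is
  admitted.\<close>

class unital_cstar_algebra = real_normed_algebra + banach + monoid_mult +
  fixes scaleC :: "complex \<Rightarrow> 'a \<Rightarrow> 'a" (infixr "*\<^sub>C" 75)
    and star :: "'a \<Rightarrow> 'a"
  assumes scaleC_add_right: "c *\<^sub>C (x + y) = c *\<^sub>C x + c *\<^sub>C y"
    and scaleC_add_left: "(c + d) *\<^sub>C x = c *\<^sub>C x + d *\<^sub>C x"
    and scaleC_scaleC: "c *\<^sub>C (d *\<^sub>C x) = (c * d) *\<^sub>C x"
    and scaleC_of_real: "complex_of_real r *\<^sub>C x = r *\<^sub>R x"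
    and mult_scaleC_left: "(c *\<^sub>C x) * y = c *\<^sub>C (x * y)"
    and mult_scaleC_right: "x * (c *\<^sub>C y) = c *\<^sub>C (x * y)"
    and norm_scaleC: "norm (c *\<^sub>C x) = cmod c * norm x"
    and star_add: "star (x + y) = star x + star y"
    and star_scaleC: "star (c *\<^sub>C x) = cnj c *\<^sub>C star x"
    and star_mult: "star (x * y) = star y * star x"
    and star_star: "star (star x) = x"
    and cstar_identity: "norm (star x * x) = (norm x)\<^sup>2"

definition cstar_positive :: "'a::unital_cstar_algebra \<Rightarrow> bool" where
  "cstar_positive a \<longleftrightarrow> (\<exists>c. a = star c * c)"

section \<open>Hilbert modules and correspondences\<close>

text \<open>Elements live in \<open>'e\<close>, inner products in \<open>'b\<close>. The coefficient type is not restricted to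
  the class above at the level of the records, because the dual of a Hilbert module \<open>E\<close> has
  inner products in the algebra of adjointable operators on \<open>E\<close>.\<close>

record ('e, 'b) hilbert_mod =
  hm_carrier :: "'e set"
  hm_add :: "'e \<Rightarrow> 'e \<Rightarrow> 'e"
  hm_zero :: 'e
  hm_scale :: "complex \<Rightarrow> 'e \<Rightarrow> 'e"
  hm_act :: "'e \<Rightarrow> 'b \<Rightarrow> 'e"
  hm_inner :: "'e \<Rightarrow> 'e \<Rightarrow> 'b"

record ('e, 'b, 'a) corr = "('e, 'b) hilbert_mod" +
  hm_lact :: "'a \<Rightarrow> 'e \<Rightarrow> 'e"

definition hm_diff :: "('e, 'b, 'z) hilbert_mod_scheme \<Rightarrow> 'e \<Rightarrow> 'e \<Rightarrow> 'e" where
  "hm_diff E x y = hm_add E x (hm_scale E (- 1) y)"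

definition hm_norm :: "('e, 'b::unital_cstar_algebra, 'z) hilbert_mod_scheme \<Rightarrow> 'e \<Rightarrow> real" where
  "hm_norm E x = sqrt (norm (hm_inner E x x))"

locale hilbert_module =
  fixes E :: "('e, 'b::unital_cstar_algebra, 'z) hilbert_mod_scheme"
  assumes add_closed: "\<lbrakk>x \<in> hm_carrier E; y \<in> hm_carrier E\<rbrakk> \<Longrightarrow> hm_add E x y \<in> hm_carrier E"
    and zero_closed: "hm_zero E \<in> hm_carrier E"
    and scale_closed: "x \<in> hm_carrier E \<Longrightarrow> hm_scale E c x \<in> hm_carrier E"
    and act_closed: "x \<in> hm_carrier E \<Longrightarrow> hm_act E x b \<in> hm_carrier E"
    and add_assoc: "\<lbrakk>x \<in> hm_carrier E; y \<in> hm_carrier E; z \<in> hm_carrier E\<rbrakk> \<Longrightarrow>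
      hm_add E (hm_add E x y) z = hm_add E x (hm_add E y z)"
    and add_commute: "\<lbrakk>x \<in> hm_carrier E; y \<in> hm_carrier E\<rbrakk> \<Longrightarrow> hm_add E x y = hm_add E y x"
    and zero_add: "x \<in> hm_carrier E \<Longrightarrow> hm_add E (hm_zero E) x = x"
    and diff_self: "x \<in> hm_carrier E \<Longrightarrow> hm_diff E x x = hm_zero E"
    and scale_add: "\<lbrakk>x \<in> hm_carrier E; y \<in> hm_carrier E\<rbrakk> \<Longrightarrow>
      hm_scale E c (hm_add E x y) = hm_add E (hm_scale E c x) (hm_scale E c y)"
    and add_scale: "x \<in> hm_carrier E \<Longrightarrow>
      hm_scale E (c + d) x = hm_add E (hm_scale E c x) (hm_scale E d x)"
    and scale_scale: "x \<in> hm_carrier E \<Longrightarrow> hm_scale E c (hm_scale E d x) = hm_scale E (c * d) x"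
    and scale_one: "x \<in> hm_carrier E \<Longrightarrow> hm_scale E 1 x = x"
    and add_act: "\<lbrakk>x \<in> hm_carrier E; y \<in> hm_carrier E\<rbrakk> \<Longrightarrow>
      hm_act E (hm_add E x y) b = hm_add E (hm_act E x b) (hm_act E y b)"
    and act_add: "x \<in> hm_carrier E \<Longrightarrow> hm_act E x (b + b') = hm_add E (hm_act E x b) (hm_act E x b')"
    and act_act: "x \<in> hm_carrier E \<Longrightarrow> hm_act E (hm_act E x b) b' = hm_act E x (b * b')"
    and act_one: "x \<in> hm_carrier E \<Longrightarrow> hm_act E x 1 = x"
    and scale_act: "x \<in> hm_carrier E \<Longrightarrow> hm_act E (hm_scale E c x) b = hm_scale E c (hm_act E x b)"
    and act_scale: "x \<in> hm_carrier E \<Longrightarrow> hm_act E x (c *\<^sub>C b) = hm_scale E c (hm_act E x b)"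
    and inner_add: "\<lbrakk>x \<in> hm_carrier E; y \<in> hm_carrier E; z \<in> hm_carrier E\<rbrakk> \<Longrightarrow>
      hm_inner E x (hm_add E y z) = hm_inner E x y + hm_inner E x z"
    and inner_scale: "\<lbrakk>x \<in> hm_carrier E; y \<in> hm_carrier E\<rbrakk> \<Longrightarrow>
      hm_inner E x (hm_scale E c y) = c *\<^sub>C hm_inner E x y"
    and inner_act: "\<lbrakk>x \<in> hm_carrier E; y \<in> hm_carrier E\<rbrakk> \<Longrightarrow>
      hm_inner E x (hm_act E y b) = hm_inner E x y * b"
    and star_inner: "\<lbrakk>x \<in> hm_carrier E; y \<in> hm_carrier E\<rbrakk> \<Longrightarrow>
      star (hm_inner E x y) = hm_inner E y x"
    and inner_positive: "x \<in> hm_carrier E \<Longrightarrow> cstar_positive (hm_inner E x x)"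
    and inner_definite: "\<lbrakk>x \<in> hm_carrier E; hm_inner E x x = 0\<rbrakk> \<Longrightarrow> x = hm_zero E"
    and complete: "\<lbrakk>\<And>n. u n \<in> hm_carrier E;
        \<And>e. e > 0 \<Longrightarrow> \<exists>N. \<forall>m\<ge>N. \<forall>n\<ge>N. hm_norm E (hm_diff E (u m) (u n)) < e\<rbrakk> \<Longrightarrow>
      \<exists>x\<in>hm_carrier E. (\<lambda>n. hm_norm E (hm_diff E (u n) x)) \<longlonglongrightarrow> 0"

inductive_set lin_span :: "('e, 'b, 'z) hilbert_mod_scheme \<Rightarrow> 'e set \<Rightarrow> 'e set"
  for E :: "('e, 'b, 'z) hilbert_mod_scheme" and S :: "'e set" where
  span_zero: "hm_zero E \<in> lin_span E S"
| span_step: "\<lbrakk>x \<in> S; y \<in> lin_span E S\<rbrakk> \<Longrightarrow> hm_add E (hm_scale E c x) y \<in> lin_span E S"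

definition closed_span ::
  "('e, 'b::unital_cstar_algebra, 'z) hilbert_mod_scheme \<Rightarrow> 'e set \<Rightarrow> 'e set" where
  "closed_span E S =
    {x \<in> hm_carrier E. \<forall>e>0. \<exists>y\<in>lin_span E S. hm_norm E (hm_diff E x y) < e}"

locale correspondence = hilbert_module F
  for F :: "('f, 'b::unital_cstar_algebra, 'a::unital_cstar_algebra, 'z) corr_scheme" +
  assumes lact_closed: "y \<in> hm_carrier F \<Longrightarrow> hm_lact F a y \<in> hm_carrier F"
    and lact_star: "\<lbrakk>x \<in> hm_carrier F; y \<in> hm_carrier F\<rbrakk> \<Longrightarrow>
      hm_inner F (hm_lact F a x) y = hm_inner F x (hm_lact F (star a) y)"
    and lact_add: "y \<in> hm_carrier F \<Longrightarrow>
      hm_lact F (a + a') y = hm_add F (hm_lact F a y) (hm_lact F a' y)"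
    and lact_scale: "y \<in> hm_carrier F \<Longrightarrow> hm_lact F (c *\<^sub>C a) y = hm_scale F c (hm_lact F a y)"
    and lact_mult: "y \<in> hm_carrier F \<Longrightarrow> hm_lact F (a * a') y = hm_lact F a (hm_lact F a' y)"
    and lact_nondegenerate:
      "closed_span F {hm_lact F a y | a y. y \<in> hm_carrier F} = hm_carrier F"

section \<open>Adjointable operators\<close>

text \<open>Operators are extensional functions on the carrier, so that equality of operators is
  equality of functions. Linearity, \<open>\<B>\<close>-linearity and boundedness of an operator that has an
  adjoint are automatic, and so are linearity and adjointability of an inner product preserving
  surjection.\<close>

definition adj_ops :: "('e, 'b, 'z) hilbert_mod_scheme \<Rightarrow> ('e \<Rightarrow> 'e) set" where
  "adj_ops E = {a \<in> hm_carrier E \<rightarrow>\<^sub>E hm_carrier E. \<exists>b \<in> hm_carrier E \<rightarrow>\<^sub>E hm_carrier E.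
      \<forall>x\<in>hm_carrier E. \<forall>y\<in>hm_carrier E. hm_inner E (a x) y = hm_inner E x (b y)}"

definition op_adjoint :: "('e, 'b, 'z) hilbert_mod_scheme \<Rightarrow> ('e \<Rightarrow> 'e) \<Rightarrow> 'e \<Rightarrow> 'e" where
  "op_adjoint E a = (THE b. b \<in> hm_carrier E \<rightarrow>\<^sub>E hm_carrier E \<and>
      (\<forall>x\<in>hm_carrier E. \<forall>y\<in>hm_carrier E. hm_inner E (a x) y = hm_inner E x (b y)))"

definition op_id :: "('e, 'b, 'z) hilbert_mod_scheme \<Rightarrow> 'e \<Rightarrow> 'e" where
  "op_id E = (\<lambda>x\<in>hm_carrier E. x)"

definition op_zero :: "('e, 'b, 'z) hilbert_mod_scheme \<Rightarrow> 'e \<Rightarrow> 'e" where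
  "op_zero E = (\<lambda>x\<in>hm_carrier E. hm_zero E)"

definition op_add ::
  "('e, 'b, 'z) hilbert_mod_scheme \<Rightarrow> ('e \<Rightarrow> 'e) \<Rightarrow> ('e \<Rightarrow> 'e) \<Rightarrow> 'e \<Rightarrow> 'e" where
  "op_add E a b = (\<lambda>x\<in>hm_carrier E. hm_add E (a x) (b x))"

definition op_scale :: "('e, 'b, 'z) hilbert_mod_scheme \<Rightarrow> complex \<Rightarrow> ('e \<Rightarrow> 'e) \<Rightarrow> 'e \<Rightarrow> 'e" where
  "op_scale E c a = (\<lambda>x\<in>hm_carrier E. hm_scale E c (a x))"

definition op_mult ::
  "('e, 'b, 'z) hilbert_mod_scheme \<Rightarrow> ('e \<Rightarrow> 'e) \<Rightarrow> ('e \<Rightarrow> 'e) \<Rightarrow> 'e \<Rightarrow> 'e" where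
  "op_mult E a b = compose (hm_carrier E) a b"

definition op_norm ::
  "('e, 'b::unital_cstar_algebra, 'z) hilbert_mod_scheme \<Rightarrow> ('e \<Rightarrow> 'e) \<Rightarrow> real" where
  "op_norm E a = (SUP x \<in> {x \<in> hm_carrier E. hm_norm E x \<le> 1}. hm_norm E (a x))"

definition rank_one :: "('e, 'b, 'z) hilbert_mod_scheme \<Rightarrow> 'e \<Rightarrow> 'e \<Rightarrow> 'e \<Rightarrow> 'e" where
  "rank_one E x y = (\<lambda>z\<in>hm_carrier E. hm_act E x (hm_inner E y z))"

inductive_set finite_rank_ops :: "('e, 'b, 'z) hilbert_mod_scheme \<Rightarrow> ('e \<Rightarrow> 'e) set"
  for E :: "('e, 'b, 'z) hilbert_mod_scheme" where
  finite_rank_zero: "op_zero E \<in> finite_rank_ops E"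
| finite_rank_step: "\<lbrakk>x \<in> hm_carrier E; y \<in> hm_carrier E; f \<in> finite_rank_ops E\<rbrakk> \<Longrightarrow>
    op_add E (op_scale E c (rank_one E x y)) f \<in> finite_rank_ops E"

definition compact_ops ::
  "('e, 'b::unital_cstar_algebra, 'z) hilbert_mod_scheme \<Rightarrow> ('e \<Rightarrow> 'e) set" where
  "compact_ops E = {a \<in> adj_ops E. \<forall>e>0. \<exists>f\<in>finite_rank_ops E.
      op_norm E (op_add E a (op_scale E (- 1) f)) < e}"

definition hm_unitary ::
  "('e, 'b, 'y) hilbert_mod_scheme \<Rightarrow> ('f, 'b, 'z) hilbert_mod_scheme \<Rightarrow> ('e \<Rightarrow> 'f) \<Rightarrow> bool" where
  "hm_unitary E F u \<longleftrightarrow> u \<in> hm_carrier E \<rightarrow>\<^sub>E hm_carrier F \<and> u ` hm_carrier E = hm_carrier F \<and>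
    (\<forall>x\<in>hm_carrier E. \<forall>y\<in>hm_carrier E. hm_inner F (u x) (u y) = hm_inner E x y)"

definition star_hom :: "('e, 'b, 'y) hilbert_mod_scheme \<Rightarrow> ('f, 'c, 'z) hilbert_mod_scheme \<Rightarrow>
    (('e \<Rightarrow> 'e) \<Rightarrow> 'f \<Rightarrow> 'f) \<Rightarrow> bool" where
  "star_hom E F h \<longleftrightarrow> h \<in> adj_ops E \<rightarrow> adj_ops F \<and>
    (\<forall>a\<in>adj_ops E. \<forall>b\<in>adj_ops E. h (op_add E a b) = op_add F (h a) (h b)) \<and>
    (\<forall>c. \<forall>a\<in>adj_ops E. h (op_scale E c a) = op_scale F c (h a)) \<and>
    (\<forall>a\<in>adj_ops E. \<forall>b\<in>adj_ops E. h (op_mult E a b) = op_mult F (h a) (h b)) \<and>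
    (\<forall>a\<in>adj_ops E. h (op_adjoint E a) = op_adjoint F (h a))"

section \<open>Internal tensor product\<close>

text \<open>Formal sums of elementary tensors are lists of pairs. They carry the semi-inner product
  determined by \<open>\<langle>x \<odot> y, x' \<odot> y'\<rangle> = \<langle>y, \<langle>x, x'\<rangle> y'\<rangle>\<close>. The tensor product is the Hausdorff
  completion: Cauchy sequences of formal sums modulo sequences with distance tending to 0.\<close>

definition formal_inner ::
  "('e, 'a, 'y) hilbert_mod_scheme \<Rightarrow> ('f, 'b::unital_cstar_algebra, 'a, 'z) corr_scheme \<Rightarrow>
    ('e \<times> 'f) list \<Rightarrow> ('e \<times> 'f) list \<Rightarrow> 'b" where
  "formal_inner E F s r =
    (\<Sum>(x, y)\<leftarrow>s. \<Sum>(x', y')\<leftarrow>r. hm_inner F y (hm_lact F (hm_inner E x x') y'))"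

definition formal_dist ::
  "('e, 'a, 'y) hilbert_mod_scheme \<Rightarrow> ('f, 'b::unital_cstar_algebra, 'a, 'z) corr_scheme \<Rightarrow>
    ('e \<times> 'f) list \<Rightarrow> ('e \<times> 'f) list \<Rightarrow> real" where
  "formal_dist E F s r =
    (let d = s @ map (\<lambda>(x, y). (hm_scale E (- 1) x, y)) r in sqrt (norm (formal_inner E F d d)))"

definition formal_cauchy ::
  "('e, 'a, 'y) hilbert_mod_scheme \<Rightarrow> ('f, 'b::unital_cstar_algebra, 'a, 'z) corr_scheme \<Rightarrow>
    (nat \<Rightarrow> ('e \<times> 'f) list) set" where
  "formal_cauchy E F = {u. (\<forall>n. u n \<in> lists (hm_carrier E \<times> hm_carrier F)) \<and>
      (\<forall>e>0. \<exists>N. \<forall>m\<ge>N. \<forall>n\<ge>N. formal_dist E F (u m) (u n) < e)}"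

definition formal_rel ::
  "('e, 'a, 'y) hilbert_mod_scheme \<Rightarrow> ('f, 'b::unital_cstar_algebra, 'a, 'z) corr_scheme \<Rightarrow>
    (nat \<Rightarrow> ('e \<times> 'f) list) rel" where
  "formal_rel E F = {(u, v). u \<in> formal_cauchy E F \<and> v \<in> formal_cauchy E F \<and>
      (\<lambda>n. formal_dist E F (u n) (v n)) \<longlonglongrightarrow> 0}"

text \<open>The operation on classes induced by applying \<open>g\<close> to every elementary tensor.\<close>

definition tensor_map ::
  "('e, 'a, 'y) hilbert_mod_scheme \<Rightarrow> ('f, 'b::unital_cstar_algebra, 'a, 'z) corr_scheme \<Rightarrow>
    ('e \<times> 'f \<Rightarrow> 'e \<times> 'f) \<Rightarrow> (nat \<Rightarrow> ('e \<times> 'f) list) set \<Rightarrow> (nat \<Rightarrow> ('e \<times> 'f) list) set" where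
  "tensor_map E F g X = (\<Union>u\<in>X. formal_rel E F `` {\<lambda>n. map g (u n)})"

definition tensor ::
  "('e, 'a, 'y) hilbert_mod_scheme \<Rightarrow> ('f, 'b::unital_cstar_algebra, 'a, 'z) corr_scheme \<Rightarrow>
    ((nat \<Rightarrow> ('e \<times> 'f) list) set, 'b) hilbert_mod" where
  "tensor E F = \<lparr>
    hm_carrier = formal_cauchy E F // formal_rel E F,
    hm_add = (\<lambda>X Y. \<Union>u\<in>X. \<Union>v\<in>Y. formal_rel E F `` {\<lambda>n. u n @ v n}),
    hm_zero = formal_rel E F `` {\<lambda>n. []},
    hm_scale = (\<lambda>c. tensor_map E F (\<lambda>(x, y). (hm_scale E c x, y))),
    hm_act = (\<lambda>X b. tensor_map E F (\<lambda>(x, y). (x, hm_act F y b)) X),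
    hm_inner = (\<lambda>X Y. THE c. \<forall>u\<in>X. \<forall>v\<in>Y. (\<lambda>n. formal_inner E F (u n) (v n)) \<longlonglongrightarrow> c)\<rparr>"

definition elem_tensor ::
  "('e, 'a, 'y) hilbert_mod_scheme \<Rightarrow> ('f, 'b::unital_cstar_algebra, 'a, 'z) corr_scheme \<Rightarrow>
    'e \<Rightarrow> 'f \<Rightarrow> (nat \<Rightarrow> ('e \<times> 'f) list) set" where
  "elem_tensor E F x y = formal_rel E F `` {\<lambda>n. [(x, y)]}"

definition amplification ::
  "('e, 'a, 'y) hilbert_mod_scheme \<Rightarrow> ('f, 'b::unital_cstar_algebra, 'a, 'z) corr_scheme \<Rightarrow>
    ('e \<Rightarrow> 'e) \<Rightarrow> (nat \<Rightarrow> ('e \<times> 'f) list) set \<Rightarrow> (nat \<Rightarrow> ('e \<times> 'f) list) set" where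
  \<comment> \<open>\<open>a \<odot> id\<close>\<close>
  "amplification E F a =
    (\<lambda>X\<in>hm_carrier (tensor E F). tensor_map E F (\<lambda>(x, y). (a x, y)) X)"

definition with_lact ::
  "('e, 'b, 'z) hilbert_mod_scheme \<Rightarrow> ('a \<Rightarrow> 'e \<Rightarrow> 'e) \<Rightarrow> ('e, 'b, 'a) corr" where
  "with_lact E l = \<lparr>hm_carrier = hm_carrier E, hm_add = hm_add E, hm_zero = hm_zero E,
    hm_scale = hm_scale E, hm_act = hm_act E, hm_inner = hm_inner E, hm_lact = l\<rparr>"

definition tensor_corr ::
  "('e, 'a, 'd, 'y) corr_scheme \<Rightarrow> ('f, 'b::unital_cstar_algebra, 'a, 'z) corr_scheme \<Rightarrow>
    ((nat \<Rightarrow> ('e \<times> 'f) list) set, 'b, 'd) corr" where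
  "tensor_corr E F = with_lact (tensor E F) (\<lambda>d. amplification E F (hm_lact E d))"

section \<open>E0-semigroups\<close>

definition E0_semigroup :: "real set \<Rightarrow> ('e, 'b::unital_cstar_algebra) hilbert_mod \<Rightarrow>
    (real \<Rightarrow> ('e \<Rightarrow> 'e) \<Rightarrow> 'e \<Rightarrow> 'e) \<Rightarrow> bool" where
  "E0_semigroup T E \<theta> \<longleftrightarrow>
    (\<forall>t\<in>T. star_hom E E (\<theta> t) \<and> \<theta> t (op_id E) = op_id E) \<and>
    (\<forall>a\<in>adj_ops E. \<theta> 0 a = a) \<and>
    (\<forall>s\<in>T. \<forall>t\<in>T. \<forall>a\<in>adj_ops E. \<theta> (s + t) a = \<theta> s (\<theta> t a))"

definition strict_E0_semigroup :: "real set \<Rightarrow> ('e, 'b::unital_cstar_algebra) hilbert_mod \<Rightarrow>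
    (real \<Rightarrow> ('e \<Rightarrow> 'e) \<Rightarrow> 'e \<Rightarrow> 'e) \<Rightarrow> bool" where
  "strict_E0_semigroup T E \<theta> \<longleftrightarrow> E0_semigroup T E \<theta> \<and>
    (\<forall>t\<in>T. closed_span E {\<theta> t k x | k x. k \<in> compact_ops E \<and> x \<in> hm_carrier E} = hm_carrier E)"

section \<open>The product system of an E0-semigroup\<close>

text \<open>In the dual \<open>x\<^sup>*\<close> is represented by \<open>x\<close>; the scalar multiplication is therefore
  conjugated.\<close>

definition dual_corr ::
  "('e, 'b::unital_cstar_algebra) hilbert_mod \<Rightarrow> ('e, 'e \<Rightarrow> 'e, 'b) corr" where
  "dual_corr E = \<lparr>hm_carrier = hm_carrier E, hm_add = hm_add E, hm_zero = hm_zero E,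
    hm_scale = (\<lambda>c. hm_scale E (cnj c)),
    hm_act = (\<lambda>x a. op_adjoint E a x),
    hm_inner = rank_one E,
    hm_lact = (\<lambda>b x. hm_act E x (star b))\<rparr>"

definition algebra_corr :: "('b::unital_cstar_algebra, 'b, 'b) corr" where
  "algebra_corr = \<lparr>hm_carrier = UNIV, hm_add = (+), hm_zero = 0, hm_scale = (*\<^sub>C), hm_act = (*),
    hm_inner = (\<lambda>x y. star x * y), hm_lact = (*)\<rparr>"

text \<open>Transport of structure along an injection \<open>j\<close> with left inverse \<open>k\<close>.\<close>

definition relabel ::
  "('e \<Rightarrow> 'f) \<Rightarrow> ('f \<Rightarrow> 'e) \<Rightarrow> ('e, 'b, 'a) corr \<Rightarrow> ('f, 'b, 'a) corr" where
  "relabel j k E = \<lparr>hm_carrier = j ` hm_carrier E,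
    hm_add = (\<lambda>x y. j (hm_add E (k x) (k y))),
    hm_zero = j (hm_zero E),
    hm_scale = (\<lambda>c x. j (hm_scale E c (k x))),
    hm_act = (\<lambda>x b. j (hm_act E (k x) b)),
    hm_inner = (\<lambda>x y. hm_inner E (k x) (k y)),
    hm_lact = (\<lambda>a x. j (hm_lact E a (k x)))\<rparr>"

text \<open>The members of a product system must share one type. It is a sum type, whose left summand
  holds \<open>E\<^sub>0 = \<B>\<close> and whose right summand holds \<open>E\<^sub>t\<close> for \<open>t > 0\<close>.\<close>

type_synonym ('e, 'b) ps_elem = "'b + (nat \<Rightarrow> ('e \<times> 'e) list) set"

definition ps_elem_tensor :: "('e, 'b::unital_cstar_algebra) hilbert_mod \<Rightarrow>
    (real \<Rightarrow> ('e \<Rightarrow> 'e) \<Rightarrow> 'e \<Rightarrow> 'e) \<Rightarrow> real \<Rightarrow> 'e \<Rightarrow> 'e \<Rightarrow> ('e, 'b) ps_elem" where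
  \<comment> \<open>\<open>x\<^sup>* \<odot>\<^sub>t y\<close>, for \<open>t > 0\<close>\<close>
  "ps_elem_tensor E \<theta> t x y = Inr (elem_tensor (dual_corr E) (with_lact E (\<theta> t)) x y)"

definition ps_fibre :: "('e, 'b::unital_cstar_algebra) hilbert_mod \<Rightarrow>
    (real \<Rightarrow> ('e \<Rightarrow> 'e) \<Rightarrow> 'e \<Rightarrow> 'e) \<Rightarrow> real \<Rightarrow> (('e, 'b) ps_elem, 'b, 'b) corr" where
  "ps_fibre E \<theta> t =
    (if t = 0 then relabel Inl projl algebra_corr
     else relabel Inr projr (tensor_corr (dual_corr E) (with_lact E (\<theta> t))))"

definition ps_product :: "('e, 'b::unital_cstar_algebra) hilbert_mod \<Rightarrow>
    (real \<Rightarrow> ('e \<Rightarrow> 'e) \<Rightarrow> 'e \<Rightarrow> 'e) \<Rightarrow> real \<Rightarrow> real \<Rightarrow>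
    (nat \<Rightarrow> (('e, 'b) ps_elem \<times> ('e, 'b) ps_elem) list) set \<Rightarrow> ('e, 'b) ps_elem" where
  \<comment> \<open>the unitary \<open>u\<^sub>s\<^sub>t\<close>\<close>
  "ps_product E \<theta> s t = (THE u.
    hm_unitary (tensor (ps_fibre E \<theta> s) (ps_fibre E \<theta> t)) (ps_fibre E \<theta> (s + t)) u \<and>
    (s = 0 \<longrightarrow> (\<forall>b. \<forall>y\<in>hm_carrier (ps_fibre E \<theta> t).
      u (elem_tensor (ps_fibre E \<theta> s) (ps_fibre E \<theta> t) (Inl b) y) = hm_lact (ps_fibre E \<theta> t) b y)) \<and>
    (t = 0 \<longrightarrow> (\<forall>x\<in>hm_carrier (ps_fibre E \<theta> s). \<forall>b.
      u (elem_tensor (ps_fibre E \<theta> s) (ps_fibre E \<theta> t) x (Inl b)) = hm_act (ps_fibre E \<theta> s) x b)) \<and>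
    (s \<noteq> 0 \<and> t \<noteq> 0 \<longrightarrow>
      (\<forall>x\<in>hm_carrier E. \<forall>x'\<in>hm_carrier E. \<forall>y\<in>hm_carrier E. \<forall>y'\<in>hm_carrier E.
        u (elem_tensor (ps_fibre E \<theta> s) (ps_fibre E \<theta> t)
            (ps_elem_tensor E \<theta> s x x') (ps_elem_tensor E \<theta> t y y')) =
        ps_elem_tensor E \<theta> (s + t) x (\<theta> t (rank_one E x' y) y'))))"

section \<open>Units and spatiality\<close>

definition ps_unit :: "real set \<Rightarrow> ('e, 'b::unital_cstar_algebra) hilbert_mod \<Rightarrow>
    (real \<Rightarrow> ('e \<Rightarrow> 'e) \<Rightarrow> 'e \<Rightarrow> 'e) \<Rightarrow> (real \<Rightarrow> ('e, 'b) ps_elem) \<Rightarrow> bool" where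
  "ps_unit T E \<theta> \<xi> \<longleftrightarrow>
    (\<forall>t\<in>T. \<xi> t \<in> hm_carrier (ps_fibre E \<theta> t)) \<and>
    (\<forall>s\<in>T. \<forall>t\<in>T. ps_product E \<theta> s t
        (elem_tensor (ps_fibre E \<theta> s) (ps_fibre E \<theta> t) (\<xi> s) (\<xi> t)) = \<xi> (s + t)) \<and>
    \<xi> 0 = Inl 1"

definition central_unit :: "real set \<Rightarrow> ('e, 'b::unital_cstar_algebra) hilbert_mod \<Rightarrow>
    (real \<Rightarrow> ('e \<Rightarrow> 'e) \<Rightarrow> 'e \<Rightarrow> 'e) \<Rightarrow> (real \<Rightarrow> ('e, 'b) ps_elem) \<Rightarrow> bool" where
  "central_unit T E \<theta> \<omega> \<longleftrightarrow> ps_unit T E \<theta> \<omega> \<and>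
    (\<forall>t\<in>T. \<forall>b. hm_lact (ps_fibre E \<theta> t) b (\<omega> t) = hm_act (ps_fibre E \<theta> t) (\<omega> t) b)"

definition unital_unit :: "real set \<Rightarrow> ('e, 'b::unital_cstar_algebra) hilbert_mod \<Rightarrow>
    (real \<Rightarrow> ('e \<Rightarrow> 'e) \<Rightarrow> 'e \<Rightarrow> 'e) \<Rightarrow> (real \<Rightarrow> ('e, 'b) ps_elem) \<Rightarrow> bool" where
  "unital_unit T E \<theta> \<omega> \<longleftrightarrow> ps_unit T E \<theta> \<omega> \<and>
    (\<forall>t\<in>T. hm_inner (ps_fibre E \<theta> t) (\<omega> t) (\<omega> t) = 1)"

definition spatial :: "real set \<Rightarrow> ('e, 'b::unital_cstar_algebra) hilbert_mod \<Rightarrow>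
    (real \<Rightarrow> ('e \<Rightarrow> 'e) \<Rightarrow> 'e \<Rightarrow> 'e) \<Rightarrow> bool" where
  "spatial T E \<theta> \<longleftrightarrow> (\<exists>\<omega>. central_unit T E \<theta> \<omega> \<and> unital_unit T E \<theta> \<omega>)"

section \<open>Unitary semigroups\<close>

definition unitary_semigroup ::
  "real set \<Rightarrow> ('e, 'b, 'z) hilbert_mod_scheme \<Rightarrow> (real \<Rightarrow> 'e \<Rightarrow> 'e) \<Rightarrow> bool" where
  "unitary_semigroup T E w \<longleftrightarrow>
    (\<forall>t\<in>T. w t \<in> adj_ops E \<and> hm_unitary E E (w t)) \<and>
    w 0 = op_id E \<and>
    (\<forall>s\<in>T. \<forall>t\<in>T. w (s + t) = op_mult E (w s) (w t))"

text \<open>HOL cannot quantify existentially over types, so an existence claim for a correspondence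
  must name the type of its elements. The type below holds equivalence classes of Cauchy sequences of
  formal sums, each tagged with the index of the product system member it belongs to; that is
  enough room for completed inductive limits of the members \<open>E\<^sub>t\<close>.\<close>

type_synonym 'e limit_elem = "(nat \<Rightarrow> real \<times> ('e \<times> 'e) list) set"

end

theory Submission
  imports Defs
begin

text \<open>A central unital unit \<open>\<omega>\<close> yields isometries \<open>W\<^sub>t x = x \<odot> \<omega>\<^sub>t\<close> of \<open>E\<^sub>+\<close> with
  \<open>\<theta>\<^sub>t(a) W\<^sub>t = W\<^sub>t a\<close> and \<open>W\<^sub>s\<^sub>+\<^sub>t = W\<^sub>s W\<^sub>t\<close>; they are adjointable by centrality and strictness. Let \<open>H\<close> be
  the completed inductive limit of copies of \<open>E\<^sub>+\<close> along these isometries. The operators \<open>a\<close> act on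
  the copy with index \<open>t\<close> by \<open>\<theta>\<^sub>t(a)\<close>, and lowering the index by \<open>s\<close> is a unitary \<open>w\<^sub>s\<close> of \<open>H\<close> that
  extends \<open>W\<^sub>s\<close> and implements \<open>\<theta>\<^sub>s\<close>. Since \<open>\<langle>\<omega>\<^sub>1, \<omega>\<^sub>1\<rangle> = 1\<close> lies in the closed ideal generated by
  \<open>\<langle>E\<^sub>+, E\<^sub>+\<rangle>\<close>, there are finitely many \<open>g\<close> in \<open>E\<^sub>+\<close> with \<open>\<Sum>\<langle>g, g\<rangle> = 1\<close>. Hence \<open>E\<^sub>+\<^sup>* \<odot> F\<close> is, for every
  module \<open>F\<close> on which the operators act, the algebraic module of intertwiners \<open>E\<^sub>+ \<rightarrow> F\<close>. This gives
  models of all members of the product system, and \<open>E\<^sub>-\<close> is the module of intertwiners \<open>E\<^sub>+ \<rightarrow> H\<close>,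
  with \<open>E\<^sub>+ \<odot> E\<^sub>- = H\<close> by evaluation.\<close>

section \<open>The positive cone of a unital C*-algebra\<close>

text \<open>Two obstacles shape the proof. The tensor product is a concrete set of classes of
  sequences, about which nothing is known until the classes are matched with the points of a Hilbert
  module. For \<open>E^* \<odot> F\<close> this matching needs the frame with
  \<open>\<Sum>\<langle>g, g\<rangle> = 1\<close>, while the frame has to be extracted from a unit
  vector of such a tensor product. The circle is broken by proving positivity and Cauchy-Schwarz
  directly for formal sums, with an approximate unit in the role of the frame. Moreover the
  adjointable operators are a set of functions and not an instance of the algebra class, so
  boundedness, square roots and contractivity of representations are proved on vectors. Strictness
  enters three times: it makes products span the fibres, makes the isometries adjointable, and makes
  evaluation reach all of \<open>H\<close>. Constructing \<open>H\<close> first and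
  \<open>E_-\<close> from it avoids a limit of the fibres themselves: products of fibres become
  compositions of maps, and the unitaries become translations of the index.\<close>

lemma star_zero [simp]: "star (0::'a::unital_cstar_algebra) = 0"
  by (metis add_cancel_right_right star_add)

lemma star_uminus [simp]: "star (- x) = - star (x::'a::unital_cstar_algebra)"
  by (metis add.right_inverse add_eq_0_iff star_add star_zero)

lemma star_diff: "star (x - y) = star x - star (y::'a::unital_cstar_algebra)"
  by (metis diff_conv_add_uminus star_add star_uminus)

lemma star_one [simp]: "star (1::'a::unital_cstar_algebra) = 1"
  by (metis mult.left_neutral mult.right_neutral star_mult star_star)

lemma star_scaleR: "star (r *\<^sub>R x) = r *\<^sub>R star (x::'a::unital_cstar_algebra)"
  by (metis complex_cnj_complex_of_real scaleC_of_real star_scaleC)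

lemma star_sum_list: "star (sum_list xs) = sum_list (map star (xs::'a::unital_cstar_algebra list))"
  by (induction xs) (simp_all add: star_add)

lemma scaleC_one [simp]: "1 *\<^sub>C x = (x::'a::unital_cstar_algebra)"
  by (metis of_real_1 scaleC_of_real scaleR_one)

lemma scaleC_minus_one [simp]: "(- 1) *\<^sub>C x = - (x::'a::unital_cstar_algebra)"
  by (metis of_real_1 of_real_minus scaleC_of_real scaleR_minus1_left)

lemma scaleC_zero_left [simp]: "0 *\<^sub>C x = (0::'a::unital_cstar_algebra)"
  by (metis of_real_0 scaleC_of_real scaleR_zero_left)

lemma scaleC_zero_right [simp]: "c *\<^sub>C 0 = (0::'a::unital_cstar_algebra)"
  by (metis add_cancel_right_right scaleC_add_right)

lemma norm_star [simp]: "norm (star x) = norm (x::'a::unital_cstar_algebra)"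
proof -
  have le: "norm y \<le> norm (star y)" for y :: 'a
  proof (cases "norm y = 0")
    case False
    have "norm y * norm y = norm (star y * y)"
      using cstar_identity[of y] by (simp add: power2_eq_square)
    also have "\<dots> \<le> norm (star y) * norm y" by (rule norm_mult_ineq)
    finally show ?thesis using False by simp
  qed simp
  show ?thesis using le[of x] le[of "star x"] by (simp add: star_star)
qed

lemma cstar_norm_one_le: "norm (1::'a::unital_cstar_algebra) \<le> 1"
proof -
  have "norm (1::'a) = (norm (1::'a))\<^sup>2" using cstar_identity[of "1::'a"] by simp
  then have "norm (1::'a) = 0 \<or> norm (1::'a) = 1" by (simp add: power2_eq_square)
  then show ?thesis by auto
qed

lemma cstar_norm_power_le: "norm (x ^ n) \<le> norm (x::'a::unital_cstar_algebra) ^ n"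
proof (induction n)
  case (Suc n)
  have "norm (x ^ Suc n) \<le> norm x * norm (x ^ n)" by (simp add: norm_mult_ineq)
  also have "\<dots> \<le> norm x * norm x ^ n" using Suc by (simp add: mult_left_mono)
  finally show ?case by simp
qed (simp add: cstar_norm_one_le)

lemma norm_selfadjoint_square:
  "star a = a \<Longrightarrow> norm (a * a) = (norm (a::'a::unital_cstar_algebra))\<^sup>2"
  using cstar_identity[of a] by simp

lemma tendsto_star:
  assumes "(f \<longlongrightarrow> (l::'a::unital_cstar_algebra)) F"
  shows "((\<lambda>x. star (f x)) \<longlongrightarrow> star l) F"
proof -
  have "bounded_linear (star :: 'a \<Rightarrow> 'a)"
    by (rule bounded_linear_intro[of _ 1]) (simp_all add: star_add star_scaleR)
  from bounded_linear.tendsto[OF this assms] show ?thesis .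
qed

text \<open>Majorant of the iteration \<open>r \<mapsto> (x + r\<^sup>2) / 2\<close>, whose limit \<open>r\<close> satisfies
  \<open>(1 - r)\<^sup>2 = 1 - x\<close>.\<close>

primrec sqrt_bound :: "nat \<Rightarrow> real" where
  "sqrt_bound 0 = 0"
| "sqrt_bound (Suc n) = (1 + (sqrt_bound n)\<^sup>2) / 2"

lemma sqrt_bound_range: "0 \<le> sqrt_bound n \<and> sqrt_bound n \<le> 1"
  by (induction n) (auto simp: power_le_one)

lemma sqrt_bound_Suc_le: "sqrt_bound n \<le> sqrt_bound (Suc n)"
proof -
  have "0 \<le> (1 - sqrt_bound n)\<^sup>2" by simp
  then show ?thesis by (simp add: power2_eq_square algebra_simps)
qed

text \<open>A difference of squares, in exactly the shape of the increments of the iteration for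
  commuting iterates; those increments are therefore dominated term by term.\<close>

lemma sqrt_bound_step:
  "sqrt_bound (Suc (Suc n)) - sqrt_bound (Suc n) =
    (sqrt_bound (Suc n) + sqrt_bound n) * (sqrt_bound (Suc n) - sqrt_bound n) / 2"
  by (simp add: power2_eq_square field_simps)

lemma Cauchy_sqrt_bound: "Cauchy sqrt_bound"
proof -
  have "incseq sqrt_bound" using sqrt_bound_Suc_le by (rule incseq_SucI)
  then have "convergent sqrt_bound"
    using sqrt_bound_range by (auto intro!: Bseq_monoseq_convergent BseqI'[of _ 1] incseq_imp_monoseq)
  then show ?thesis by (rule convergent_Cauchy)
qed

text \<open>The iteration converges even for \<open>norm x = 1\<close>, because its increments are
  dominated by those of the bounded monotone sequence \<open>sqrt_bound\<close>. All iterates are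
  built from \<open>x\<close>, so the limit commutes with whatever commutes with \<open>x\<close>;
  this clause replaces a functional calculus. The bound on \<open>1 - r\<close> is what makes
  \<open>r\<close> itself positive in the sense of \<open>spectrally_positive\<close>.\<close>

lemma sqrt_one_minus:
  fixes x :: "'a::unital_cstar_algebra"
  assumes "norm x \<le> 1"
  obtains r where "r * r = 1 - x" "star x = x \<Longrightarrow> star r = r"
    "\<And>y. x * y = y * x \<Longrightarrow> r * y = y * r" "norm (1 - r) \<le> 1"
proof -
  define R where "R = rec_nat (0::'a) (\<lambda>_ r. (1/2) *\<^sub>R (x + r * r))"
  have R0: "R 0 = 0" and RS: "R (Suc n) = (1/2) *\<^sub>R (x + R n * R n)" for n
    by (simp_all add: R_def)
  have comm: "R n * y = y * R n" if "x * y = y * x" for n y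
  proof (induction n)
    case (Suc n)
    have "R n * R n * y = y * (R n * R n)" by (metis Suc mult.assoc)
    then show ?case using that by (simp add: RS algebra_simps)
  qed (simp add: R0)
  have RR: "R m * R n = R n * R m" for m n by (intro comm comm[symmetric]) simp
  have bound: "norm (R n) \<le> sqrt_bound n" for n
  proof (induction n)
    case (Suc n)
    have "norm (R n * R n) \<le> norm (R n) * norm (R n)" by (rule norm_mult_ineq)
    also have "\<dots> \<le> sqrt_bound n * sqrt_bound n" using Suc sqrt_bound_range by (intro mult_mono) auto
    finally have "norm (x + R n * R n) \<le> 1 + (sqrt_bound n)\<^sup>2"
      using assms norm_triangle_ineq[of x "R n * R n"] by (simp add: power2_eq_square)
    then show ?case by (simp add: RS)
  qed (simp add: R0)
  have step: "norm (R (Suc n) - R n) \<le> sqrt_bound (Suc n) - sqrt_bound n" for n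
  proof (induction n)
    case (Suc n)
    have "R (Suc (Suc n)) - R (Suc n) = (1/2) *\<^sub>R (R (Suc n) * R (Suc n) - R n * R n)"
      unfolding RS[of "Suc n"] by (subst (3) RS) (simp add: algebra_simps)
    also have "\<dots> = (1/2) *\<^sub>R ((R (Suc n) + R n) * (R (Suc n) - R n))"
      using RR[of "Suc n" n] by (simp add: algebra_simps)
    finally have eq: "R (Suc (Suc n)) - R (Suc n) = (1/2) *\<^sub>R ((R (Suc n) + R n) * (R (Suc n) - R n))" .
    have "norm ((R (Suc n) + R n) * (R (Suc n) - R n))
        \<le> norm (R (Suc n) + R n) * norm (R (Suc n) - R n)"
      by (rule norm_mult_ineq)
    also have "\<dots> \<le> (sqrt_bound (Suc n) + sqrt_bound n) * (sqrt_bound (Suc n) - sqrt_bound n)"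
      using Suc bound[of n] bound[of "Suc n"] norm_triangle_ineq[of "R (Suc n)" "R n"] sqrt_bound_range
      by (intro mult_mono) (auto simp del: sqrt_bound.simps intro: add_nonneg_nonneg)
    finally show ?case unfolding eq sqrt_bound_step by simp
  qed (use assms in \<open>simp add: R0 RS\<close>)
  have le: "norm (R (n + k) - R n) \<le> sqrt_bound (n + k) - sqrt_bound n" for n k
  proof (induction k)
    case (Suc k)
    have "R (n + Suc k) - R n = (R (Suc (n + k)) - R (n + k)) + (R (n + k) - R n)" by simp
    then show ?case using norm_triangle_ineq[of "R (Suc (n + k)) - R (n + k)" "R (n + k) - R n"]
      step[of "n + k"] Suc by (simp del: sqrt_bound.simps)
  qed simp
  have "Cauchy R"
  proof (rule metric_CauchyI)
    fix e :: real assume "e > 0"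
    then obtain N where N: "\<And>m n. m \<ge> N \<Longrightarrow> n \<ge> N \<Longrightarrow> dist (sqrt_bound m) (sqrt_bound n) < e"
      using Cauchy_sqrt_bound by (metis metric_CauchyD)
    have *: "dist (R m) (R n) < e" if "n \<ge> N" "m \<ge> n" for m n
      using le[of n "m - n"] N[of m n] that by (simp add: dist_norm)
    show "\<exists>N. \<forall>m\<ge>N. \<forall>n\<ge>N. dist (R m) (R n) < e"
      by (rule exI[of _ N]) (metis * dist_commute nat_le_linear)
  qed
  then obtain l where l: "R \<longlonglongrightarrow> l" by (metis Cauchy_convergent convergent_def)
  have "(\<lambda>n. R (Suc n)) \<longlonglongrightarrow> (1/2) *\<^sub>R (x + l * l)"
    unfolding RS by (intro tendsto_intros l)
  then have "l = (1/2) *\<^sub>R (x + l * l)" using l LIMSEQ_Suc LIMSEQ_unique by blast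
  then have "2 *\<^sub>R l = 2 *\<^sub>R ((1/2) *\<^sub>R (x + l * l))" by simp
  then have l2: "l + l = x + l * l" by (simp add: scaleR_2)
  show ?thesis
  proof
    show "(1 - l) * (1 - l) = 1 - x" using l2 by (simp add: algebra_simps)
    show "star (1 - l) = 1 - l" if "star x = x"
    proof -
      have "star (R n) = R n" for n
        by (induction n) (simp_all add: R0 RS star_scaleR star_add star_mult that)
      then have "(\<lambda>n. R n) \<longlonglongrightarrow> star l" using tendsto_star[OF l] by simp
      then show ?thesis using l LIMSEQ_unique by (auto simp: star_diff)
    qed
    show "(1 - l) * y = y * (1 - l)" if "x * y = y * x" for y
    proof -
      have "(\<lambda>n. R n * y) \<longlonglongrightarrow> l * y" "(\<lambda>n. y * R n) \<longlonglongrightarrow> y * l" by (intro tendsto_intros l)+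
      then have "l * y = y * l" using comm[OF that] LIMSEQ_unique by auto
      then show ?thesis by (simp add: algebra_simps)
    qed
    have "norm (R n) \<le> 1" for n using bound[of n] sqrt_bound_range[of n] by linarith
    then have "norm l \<le> 1" by (intro LIMSEQ_le_const2[OF tendsto_norm[OF l]]) auto
    then show "norm (1 - (1 - l)) \<le> 1" by simp
  qed
qed

text \<open>With \<open>u = r + \<i> s\<close>, commutation gives
  \<open>star u * u = r^2 + s^2\<close>, so the norm identity bounds \<open>u\<close>, and
  \<open>r\<close> is the real part of \<open>u\<close>.\<close>

lemma norm_le_of_square_sum:
  fixes r s :: "'a::unital_cstar_algebra"
  assumes "star r = r" "star s = s" "r * s = s * r" "norm (r * r + s * s) \<le> c\<^sup>2" "c \<ge> 0"
  shows "norm r \<le> c"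
proof -
  define u where "u = r + \<i> *\<^sub>C s"
  have su: "star u = r - \<i> *\<^sub>C s"
    using assms by (simp add: u_def star_add star_scaleC)
      (metis add.commute add_eq_0_iff diff_conv_add_uminus right_minus_eq scaleC_add_left scaleC_zero_left)
  have ii: "\<i> *\<^sub>C (\<i> *\<^sub>C (s * s)) = - (s * s)"
    by (simp add: scaleC_scaleC)
  have "star u * u = r * r + s * s"
    unfolding su unfolding u_def using assms(3)
    by (simp add: algebra_simps mult_scaleC_left mult_scaleC_right)
      (metis (no_types, lifting) add.commute diff_add_cancel diff_minus_eq_add ii scaleC_add_right)
  then have "(norm u)\<^sup>2 \<le> c\<^sup>2" using cstar_identity[of u] assms by simp
  then have "norm u \<le> c" using assms(5) by (rule power2_le_imp_le)
  moreover have "2 *\<^sub>R r = u + star u" unfolding su by (simp add: u_def scaleR_2)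
  then have "2 * norm r \<le> norm u + norm (star u)"
    by (metis abs_numeral norm_scaleR norm_triangle_ineq)
  ultimately show ?thesis by simp
qed

text \<open>The root \<open>r\<close> of \<open>1 - a^2\<close> commutes with \<open>a\<close>, and
  \<open>r^2 + a^2 = 1\<close> bounds \<open>r\<close> by the previous lemma.\<close>

lemma norm_one_minus_square_le:
  fixes a :: "'a::unital_cstar_algebra"
  assumes "star a = a" "norm a \<le> 1"
  shows "norm (1 - a * a) \<le> 1"
proof -
  have "norm (a * a) \<le> 1" using assms by (simp add: norm_selfadjoint_square power_le_one)
  then obtain r where r: "r * r = 1 - a * a" "star (a * a) = a * a \<Longrightarrow> star r = r"
    "\<And>y. a * a * y = y * (a * a) \<Longrightarrow> r * y = y * r" by (rule sqrt_one_minus) blast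
  have "star r = r" using r(2) assms by (simp add: star_mult)
  moreover have "r * a = a * r" by (rule r(3)) (simp add: mult.assoc)
  ultimately have "norm r \<le> 1"
    using assms r(1) cstar_norm_one_le[where 'a='a] by (intro norm_le_of_square_sum[of r a]) auto
  then have "norm (r * r) \<le> 1"
    unfolding norm_selfadjoint_square[OF \<open>star r = r\<close>] by (simp add: power_le_one)
  then show ?thesis by (simp add: r(1))
qed

text \<open>The norm criterion for a nonnegative spectrum: a selfadjoint \<open>a\<close> has
  spectrum in \<open>[0, 2 t]\<close> exactly if \<open>t 1 - a\<close> has norm at most
  \<open>t\<close>. Sums are then handled by the triangle inequality, which the form
  \<open>star c * c\<close> does not offer.\<close>

definition spectrally_positive :: "'a::unital_cstar_algebra \<Rightarrow> bool" where
  "spectrally_positive a \<longleftrightarrow> star a = a \<and> (\<exists>t\<ge>0. norm (t *\<^sub>R 1 - a) \<le> t)"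

text \<open>Write \<open>a = t (1 - x)\<close> with \<open>norm x \<le> 1\<close>; the root is
  \<open>sqrt t\<close> times the root of \<open>1 - x\<close>. The degenerate witness
  \<open>t = 0\<close> forces \<open>a = 0\<close>.\<close>

lemma spectrally_positive_sqrt:
  fixes a :: "'a::unital_cstar_algebra"
  assumes "spectrally_positive a"
  obtains r where "star r = r" "r * r = a" "\<And>y. a * y = y * a \<Longrightarrow> r * y = y * r"
    "spectrally_positive r"
proof -
  obtain t where t: "t \<ge> 0" "norm (t *\<^sub>R 1 - a) \<le> t" and sa: "star a = a"
    using assms by (auto simp: spectrally_positive_def)
  show thesis
  proof (cases "t = 0")
    case True
    then have "a = 0" using t by simp
    then show ?thesis by (intro that[of 0]) (simp_all add: spectrally_positive_def exI[of _ 0])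
  next
    case False
    then have t0: "t > 0" using t by simp
    define x where "x = 1 - (1 / t) *\<^sub>R a"
    have "x = (1 / t) *\<^sub>R (t *\<^sub>R 1 - a)" using t0 by (simp add: x_def algebra_simps)
    then have "norm x = norm (t *\<^sub>R 1 - a) / t" using t0 by simp
    then have "norm x \<le> 1" using t t0 by (simp add: divide_le_eq)
    then obtain r where r: "r * r = 1 - x" "star x = x \<Longrightarrow> star r = r"
      "\<And>y. x * y = y * x \<Longrightarrow> r * y = y * r" "norm (1 - r) \<le> 1"
      by (rule sqrt_one_minus) blast
    show ?thesis
    proof (rule that[of "sqrt t *\<^sub>R r"])
      show "star (sqrt t *\<^sub>R r) = sqrt t *\<^sub>R r"
        using r(2) sa by (simp add: star_scaleR x_def star_diff)
      have "norm (sqrt t *\<^sub>R 1 - sqrt t *\<^sub>R r) = sqrt t * norm (1 - r)"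
        using t0 by (simp flip: scaleR_diff_right)
      also have "\<dots> \<le> sqrt t * 1" using r(4) t0 by (intro mult_left_mono) auto
      finally show "spectrally_positive (sqrt t *\<^sub>R r)"
        using \<open>star (sqrt t *\<^sub>R r) = sqrt t *\<^sub>R r\<close> t0
        by (auto simp: spectrally_positive_def intro!: exI[of _ "sqrt t"])
      have "sqrt t *\<^sub>R r * sqrt t *\<^sub>R r = (sqrt t * sqrt t) *\<^sub>R (r * r)" by simp
      then show "sqrt t *\<^sub>R r * sqrt t *\<^sub>R r = a" using r(1) t0 by (simp add: x_def)
      show "sqrt t *\<^sub>R r * y = y * sqrt t *\<^sub>R r" if "a * y = y * a" for y
        using r(3)[of y] that by (simp add: x_def algebra_simps)
    qed
  qed
qed

text \<open>After scaling to norm one this is \<open>norm_one_minus_square_le\<close>; the witness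
  is \<open>(norm r)^2\<close>.\<close>

lemma spectrally_positive_square:
  fixes r :: "'a::unital_cstar_algebra"
  assumes "star r = r"
  shows "spectrally_positive (r * r)"
proof (cases "r = 0")
  case True
  then show ?thesis by (auto simp: spectrally_positive_def)
next
  case False
  define c where "c = norm r"
  have c: "c > 0" using False by (simp add: c_def)
  have "norm (1 - ((1 / c) *\<^sub>R r) * ((1 / c) *\<^sub>R r)) \<le> 1"
    using assms c by (intro norm_one_minus_square_le) (simp_all add: star_scaleR c_def)
  then have "c\<^sup>2 * norm (1 - ((1 / c) *\<^sub>R r) * ((1 / c) *\<^sub>R r)) \<le> c\<^sup>2" using c by simp
  moreover have "c\<^sup>2 *\<^sub>R (1 - ((1 / c) *\<^sub>R r) * ((1 / c) *\<^sub>R r)) = c\<^sup>2 *\<^sub>R 1 - r * r"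
    using c by (simp add: scaleR_diff_right power2_eq_square)
  ultimately have "norm (c\<^sup>2 *\<^sub>R 1 - r * r) \<le> c\<^sup>2"
    by (metis abs_of_nonneg norm_scaleR zero_le_power2)
  then show ?thesis using assms by (auto simp: spectrally_positive_def star_mult intro!: exI[of _ "c\<^sup>2"])
qed

lemma spectrally_positive_add:
  assumes "spectrally_positive a" "spectrally_positive b"
  shows "spectrally_positive (a + b)"
proof -
  obtain t s where t: "t \<ge> 0" "norm (t *\<^sub>R 1 - a) \<le> t" and s: "s \<ge> 0" "norm (s *\<^sub>R 1 - b) \<le> s"
    using assms by (auto simp: spectrally_positive_def)
  have "(t + s) *\<^sub>R 1 - (a + b) = (t *\<^sub>R 1 - a) + (s *\<^sub>R 1 - b)" by (simp add: algebra_simps)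
  then have "norm ((t + s) *\<^sub>R 1 - (a + b)) \<le> t + s"
    by (metis add_mono norm_triangle_mono t(2) s(2))
  then show ?thesis using assms t s by (auto simp: spectrally_positive_def star_add intro!: exI[of _ "t + s"])
qed

lemma spectrally_positive_scaleR:
  assumes "spectrally_positive a" "c \<ge> 0"
  shows "spectrally_positive (c *\<^sub>R a)"
proof -
  obtain t where t: "t \<ge> 0" "norm (t *\<^sub>R 1 - a) \<le> t" using assms by (auto simp: spectrally_positive_def)
  have "(c * t) *\<^sub>R 1 - c *\<^sub>R a = c *\<^sub>R (t *\<^sub>R 1 - a)" by (simp add: algebra_simps)
  then have "norm ((c * t) *\<^sub>R 1 - c *\<^sub>R a) \<le> c * t" using t assms(2) by (simp add: mult_left_mono)
  then show ?thesis using assms t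
    by (auto simp: spectrally_positive_def star_scaleR intro!: exI[of _ "c * t"])
qed

lemma spectrally_positive_norm_minus:
  assumes "star a = a" "norm a \<le> c"
  shows "spectrally_positive (c *\<^sub>R 1 - a)"
  using assms order_trans[OF norm_ge_zero assms(2)]
  by (auto simp: spectrally_positive_def star_diff star_scaleR intro!: exI[of _ c])

text \<open>Commuting roots of \<open>x\<close> and \<open>c 1 - x\<close> have squares adding up to
  \<open>c 1\<close>, so the root of \<open>x\<close> has norm at most
  \<open>sqrt c\<close>.\<close>

lemma spectrally_positive_norm_le:
  fixes x :: "'a::unital_cstar_algebra"
  assumes "spectrally_positive x" "spectrally_positive (c *\<^sub>R 1 - x)" "c \<ge> 0"
  shows "norm x \<le> c"
proof -
  obtain r where r: "star r = r" "r * r = x" "\<And>y. x * y = y * x \<Longrightarrow> r * y = y * r"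
    using spectrally_positive_sqrt[OF assms(1)] by blast
  obtain s where s: "star s = s" "s * s = c *\<^sub>R 1 - x"
    "\<And>y. (c *\<^sub>R 1 - x) * y = y * (c *\<^sub>R 1 - x) \<Longrightarrow> s * y = y * s"
    using spectrally_positive_sqrt[OF assms(2)] by blast
  have "(c *\<^sub>R 1 - s * s) * s = s * (c *\<^sub>R 1 - s * s)"
    by (simp add: left_diff_distrib right_diff_distrib mult.assoc)
  moreover have "c *\<^sub>R 1 - s * s = x" by (simp add: s(2))
  ultimately have "x * s = s * x" by simp
  then have "r * s = s * r" by (rule r(3))
  moreover have "norm (r * r + s * s) \<le> (sqrt c)\<^sup>2"
    using cstar_norm_one_le[where 'a='a] assms(3) by (simp add: r(2) s(2) mult_left_le)
  ultimately have "norm r \<le> sqrt c" using r(1) s(1) assms(3) by (intro norm_le_of_square_sum[of r s]) auto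
  then have "(norm r)\<^sup>2 \<le> c" using assms(3) by (metis norm_ge_zero power_mono real_sqrt_pow2)
  then show ?thesis using r(1,2) by (metis norm_selfadjoint_square)
qed

lemma spectrally_positive_mono:
  assumes "spectrally_positive x" "spectrally_positive (y - x)"
  shows "norm x \<le> norm y"
proof (rule spectrally_positive_norm_le[OF assms(1)])
  have "star y = y"
    using assms unfolding spectrally_positive_def by (metis add_diff_cancel_left' diff_add_cancel star_add)
  then have "spectrally_positive ((norm y *\<^sub>R 1 - y) + (y - x))"
    by (intro spectrally_positive_add assms spectrally_positive_norm_minus) simp_all
  then show "spectrally_positive (norm y *\<^sub>R 1 - x)" by simp
qed simp

text \<open>The witness in \<open>spectrally_positive\<close> may thus always be taken to be
  \<open>norm a\<close>, which depends continuously on \<open>a\<close>; closedness of the cone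
  rests on this.\<close>

lemma spectrally_positive_diff_norm:
  assumes "spectrally_positive a"
  shows "norm (norm a *\<^sub>R 1 - a) \<le> norm a"
proof (rule spectrally_positive_norm_le)
  have sa: "star a = a" using assms by (simp add: spectrally_positive_def)
  show "spectrally_positive (norm a *\<^sub>R 1 - a)" by (rule spectrally_positive_norm_minus[OF sa]) simp
  show "spectrally_positive (norm a *\<^sub>R 1 - (norm a *\<^sub>R 1 - a))" using assms by simp
qed simp

lemma spectrally_positive_zero_one:
  "spectrally_positive (0::'a::unital_cstar_algebra)" "spectrally_positive (1::'a)"
  using spectrally_positive_square[of "0::'a"] spectrally_positive_square[of "1::'a"] by simp_all

text \<open>If \<open>-d\<^sup>*d\<close> is positive then \<open>\<parallel>(1 + d\<^sup>*d)\<^sup>k\<parallel> \<le> 1\<close>, while \<open>dd\<^sup>*\<close> is positive and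
  \<open>d (1 + d\<^sup>*d)\<^sup>k d\<^sup>* = dd\<^sup>* (1 + dd\<^sup>*)\<^sup>k \<ge> k (dd\<^sup>*)\<^sup>2\<close>.\<close>

lemma spectrally_positive_neg_star_mult:
  fixes d :: "'a::unital_cstar_algebra"
  assumes neg: "spectrally_positive (- (star d * d))" and "norm d \<le> 1"
  shows "d = 0"
proof -
  define p where "p = d * star d"
  define n where "n = - (star d * d)"
  \<comment> \<open>\<open>h\<close> and, up to sign, \<open>k\<close> are the real and imaginary
    parts of \<open>d\<close>. Twice the sum of their squares is
    \<open>d * star d + star d * d = p - n\<close>, so \<open>p\<close> is positive because
    \<open>n\<close> is.\<close>
  define h where "h = (1/2) *\<^sub>R (d + star d)"
  define k where "k = \<i> *\<^sub>C ((1/2) *\<^sub>R (d - star d))"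
  have sh: "star h = h" by (simp add: h_def star_scaleR star_add star_star add.commute)
  have sk: "star k = k"
  proof -
    have "star k = (- \<i>) *\<^sub>C ((1/2) *\<^sub>R (star d - d))"
      by (simp add: k_def star_scaleC star_scaleR star_diff star_star)
    also have "\<dots> = (- \<i>) *\<^sub>C ((- 1) *\<^sub>C ((1/2) *\<^sub>R (d - star d)))"
      by (simp add: scaleR_diff_right)
    also have "\<dots> = k" unfolding scaleC_scaleC k_def by simp
    finally show ?thesis .
  qed
  have kk: "k * k = - ((1/2) *\<^sub>R (d - star d) * (1/2) *\<^sub>R (d - star d))"
    unfolding k_def mult_scaleC_left mult_scaleC_right scaleC_scaleC by simp
  have hk: "2 *\<^sub>R (h * h) + 2 *\<^sub>R (k * k) = p - n"
  proof -
    have "4 *\<^sub>R (h * h) + 4 *\<^sub>R (k * k) = 2 *\<^sub>R (p - n)"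
      unfolding kk h_def p_def n_def by (simp add: algebra_simps scaleR_2)
    then have "(1/2) *\<^sub>R (4 *\<^sub>R (h * h) + 4 *\<^sub>R (k * k)) = (1/2) *\<^sub>R (2 *\<^sub>R (p - n))" by simp
    then show ?thesis by (simp add: algebra_simps)
  qed
  have pn: "spectrally_positive n" using neg by (simp add: n_def)
  have pp: "spectrally_positive p"
  proof -
    have "spectrally_positive (2 *\<^sub>R (h * h) + 2 *\<^sub>R (k * k) + n)"
      by (intro spectrally_positive_add spectrally_positive_scaleR spectrally_positive_square sh sk pn) simp_all
    then show ?thesis unfolding hk by simp
  qed
  have nle: "norm n \<le> 1" using cstar_identity[of d] assms(2) by (simp add: n_def power_le_one)
  have one_n: "norm (1 - n) \<le> 1"
  proof (rule spectrally_positive_norm_le)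
    show "spectrally_positive (1 - n)"
      using spectrally_positive_norm_minus[of n 1] nle pn by (simp add: spectrally_positive_def)
    show "spectrally_positive (1 *\<^sub>R 1 - (1 - n))" using pn by simp
  qed simp
  have conj: "d * (1 - n) ^ j * star d = p * (1 + p) ^ j" for j
  proof (induction j)
    case (Suc j)
    have "d * (1 - n) ^ Suc j * star d = d * (1 - n) ^ j * ((1 - n) * star d)"
      by (simp add: power_Suc2 mult.assoc del: power_Suc)
    also have "(1 - n) * star d = star d * (1 + p)" by (simp add: n_def p_def algebra_simps)
    finally have "d * (1 - n) ^ Suc j * star d = d * (1 - n) ^ j * star d * (1 + p)"
      by (simp add: mult.assoc)
    then show ?case unfolding Suc by (simp add: power_Suc2 mult.assoc del: power_Suc)
  qed (simp add: p_def)
  have grow: "spectrally_positive (p * (1 + p) ^ j - real j *\<^sub>R (p * p))" for j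
  proof -
    obtain r where r: "star r = r" "r * r = p" using spectrally_positive_sqrt[OF pp] by blast
    have rp: "r * p = p * r" using r by (metis mult.assoc)
    \<comment> \<open>Bernoulli's inequality for \<open>1 + p\<close>. Products of positive elements
      are positive here because their roots commute.\<close>
    have ind: "spectrally_positive ((1 + p) ^ j - 1 - real j *\<^sub>R p)" for j
    proof (induction j)
      case (Suc j)
      have "(1 + p) ^ Suc j - 1 - real (Suc j) *\<^sub>R p
          = ((1 + p) ^ j - 1 - real j *\<^sub>R p) + p * ((1 + p) ^ j - 1)"
        by (simp add: algebra_simps)
      moreover have "spectrally_positive (p * ((1 + p) ^ j - 1))"
      proof -
        have "spectrally_positive (((1 + p) ^ j - 1 - real j *\<^sub>R p) + real j *\<^sub>R p)"
          by (intro spectrally_positive_add Suc spectrally_positive_scaleR pp) simp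
        then have "spectrally_positive ((1 + p) ^ j - 1)" by simp
        then obtain q where q: "star q = q" "q * q = (1 + p) ^ j - 1"
          "\<And>y. ((1 + p) ^ j - 1) * y = y * ((1 + p) ^ j - 1) \<Longrightarrow> q * y = y * q"
          using spectrally_positive_sqrt by blast
        have "r * (1 + p) = (1 + p) * r" using rp by (simp add: algebra_simps)
        then have "(1 + p) ^ j * r = r * (1 + p) ^ j" by (metis power_commuting_commutes)
        then have "q * r = r * q" by (intro q(3)) (simp add: algebra_simps)
        then have "p * ((1 + p) ^ j - 1) = (r * q) * (r * q)" "star (r * q) = r * q"
          using r(1,2) q(1,2) \<open>q * r = r * q\<close> by (metis mult.assoc) (simp add: star_mult q(1) r(1) \<open>q * r = r * q\<close>)
        then show ?thesis using spectrally_positive_square[of "r * q"] by simp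
      qed
      ultimately show ?case using Suc spectrally_positive_add by metis
    qed (simp add: spectrally_positive_zero_one)
    obtain q where q: "star q = q" "q * q = (1 + p) ^ j - 1 - real j *\<^sub>R p"
      "\<And>y. ((1 + p) ^ j - 1 - real j *\<^sub>R p) * y = y * ((1 + p) ^ j - 1 - real j *\<^sub>R p) \<Longrightarrow> q * y = y * q"
      using spectrally_positive_sqrt[OF ind] by blast
    have "r * (1 + p) = (1 + p) * r" using rp by (simp add: algebra_simps)
    then have "(1 + p) ^ j * r = r * (1 + p) ^ j" by (metis power_commuting_commutes)
    then have "q * r = r * q" by (intro q(3)) (simp add: algebra_simps rp)
    then have "p * ((1 + p) ^ j - 1 - real j *\<^sub>R p) = (r * q) * (r * q)" "star (r * q) = r * q"
      using r(1,2) q(1,2) \<open>q * r = r * q\<close> by (metis mult.assoc) (simp add: star_mult q(1) r(1) \<open>q * r = r * q\<close>)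
    then have "spectrally_positive (p * ((1 + p) ^ j - 1 - real j *\<^sub>R p))"
      using spectrally_positive_square[of "r * q"] by simp
    moreover have "p * (1 + p) ^ j - real j *\<^sub>R (p * p) = p * ((1 + p) ^ j - 1 - real j *\<^sub>R p) + p"
      by (simp add: algebra_simps)
    ultimately show ?thesis using spectrally_positive_add[OF _ pp] by metis
  qed
  have sp: "star p = p" by (simp add: p_def star_mult star_star)
  have bounded: "real j * (norm p)\<^sup>2 \<le> 1" for j
  proof -
    have "norm (real j *\<^sub>R (p * p)) \<le> norm (p * (1 + p) ^ j)"
      by (intro spectrally_positive_mono grow spectrally_positive_scaleR spectrally_positive_square sp) simp
    also have "\<dots> = norm (d * (1 - n) ^ j * star d)" by (simp add: conj)
    also have "\<dots> \<le> norm (d * (1 - n) ^ j) * norm (star d)" by (rule norm_mult_ineq)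
    also have "\<dots> \<le> norm d * norm ((1 - n) ^ j) * norm (star d)"
      by (intro mult_right_mono norm_mult_ineq norm_ge_zero)
    also have "\<dots> \<le> 1 * 1 * 1"
      using assms(2) order_trans[OF cstar_norm_power_le power_le_one[OF norm_ge_zero one_n]]
      by (intro mult_mono) auto
    finally show ?thesis by (simp add: norm_selfadjoint_square[OF sp])
  qed
  have "norm p = 0"
  proof (rule ccontr)
    assume "norm p \<noteq> 0"
    then obtain j where "real j * (norm p)\<^sup>2 > 1" using reals_Archimedean3[of "(norm p)\<^sup>2"] by auto
    then show False using bounded[of j] by simp
  qed
  then have "(norm (star d))\<^sup>2 = 0" using cstar_identity[of "star d"] by (simp add: p_def star_star)
  then show ?thesis by simp
qed

text \<open>Let \<open>m\<close> be the absolute value of \<open>a = star c * c\<close> and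
  \<open>v\<close> the negative part of \<open>a\<close>. Then \<open>d = c * v\<close> satisfies
  \<open>star d * d = - (m * v^2)\<close>, so the preceding lemma, after scaling to norm one, gives
  \<open>d = 0\<close>. Hence \<open>m * v = 0\<close>, and \<open>v^2 = m * v\<close> forces
  \<open>v = 0\<close>, that is \<open>a = m\<close>.\<close>

lemma spectrally_positive_star_mult: "spectrally_positive (star c * (c::'a::unital_cstar_algebra))"
proof -
  define a where "a = star c * c"
  have sa: "star a = a" by (simp add: a_def star_mult star_star)
  obtain m where m: "star m = m" "m * m = a * a" "\<And>y. a * a * y = y * (a * a) \<Longrightarrow> m * y = y * m"
    "spectrally_positive m"
    using spectrally_positive_sqrt[OF spectrally_positive_square[OF sa]] by blast
  obtain q where q: "star q = q" "q * q = m" "\<And>y. m * y = y * m \<Longrightarrow> q * y = y * q"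
    using spectrally_positive_sqrt[OF m(4)] by blast
  have ma: "m * a = a * m" by (rule m(3)) (simp add: mult.assoc)
  have qa: "q * a = a * q" by (rule q(3)) (rule ma)
  have qm: "q * m = m * q" by (rule q(3)) simp
  define v where "v = (1/2) *\<^sub>R (m - a)"
  have sv: "star v = v" by (simp add: v_def star_scaleR star_diff sa m(1))
  have qv: "q * v = v * q" by (simp add: v_def qa qm algebra_simps)
  have av: "a * v = - (m * v)"
    by (simp add: v_def algebra_simps ma m(2))
  define d where "d = c * v"
  have "star d * d = v * (a * v)" by (simp add: d_def star_mult sv a_def mult.assoc)
  also have "\<dots> = - ((v * q) * (v * q))"
    unfolding av by (metis q(2) qv mult.assoc mult_minus_right)
  finally have dd: "star d * d = - ((v * q) * (v * q))" .
  have svq: "star (v * q) = v * q" by (simp add: star_mult sv q(1) qv)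
  have "d = 0"
  proof (rule ccontr)
    assume d: "d \<noteq> 0"
    define d' where "d' = (1 / norm d) *\<^sub>R d"
    have "- (star d' * d') = (1 / (norm d)\<^sup>2) *\<^sub>R ((v * q) * (v * q))"
      by (simp add: d'_def star_scaleR dd power2_eq_square)
    then have "spectrally_positive (- (star d' * d'))"
      using spectrally_positive_scaleR[OF spectrally_positive_square[OF svq]] by simp
    moreover have "norm d' \<le> 1" using d by (simp add: d'_def)
    ultimately have "d' = 0" by (rule spectrally_positive_neg_star_mult)
    then show False using d by (simp add: d'_def)
  qed
  then have "(v * q) * (v * q) = 0" using dd by simp
  then have "v * q = 0" using norm_selfadjoint_square[OF svq] by simp
  then have "m * v = 0" by (metis q(2) qv mult.assoc mult_zero_left mult_zero_right)
  moreover have "v * v = m * v"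
  proof -
    have "v * v = (1/4) *\<^sub>R ((m - a) * (m - a))" by (simp add: v_def)
    also have "(m - a) * (m - a) = 2 *\<^sub>R (m * (m - a))"
      by (simp add: left_diff_distrib right_diff_distrib ma m(2) scaleR_2)
    finally show ?thesis by (simp add: v_def)
  qed
  ultimately have "v * v = 0" by simp
  then have "v = 0" using norm_selfadjoint_square[OF sv] by simp
  then have "m = a" by (simp add: v_def)
  then show ?thesis using m(4) by (simp add: a_def)
qed

section \<open>Order and norm on the cone of elements \<open>star c * c\<close>\<close>

lemma cstar_positive_iff: "cstar_positive a \<longleftrightarrow> spectrally_positive a"
  by (metis cstar_positive_def spectrally_positive_sqrt spectrally_positive_star_mult)

lemma cstar_positive_selfadjoint: "cstar_positive a \<Longrightarrow> star a = a"
  by (simp add: cstar_positive_iff spectrally_positive_def)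

lemma cstar_positive_zero [simp]: "cstar_positive (0::'a::unital_cstar_algebra)"
  by (simp add: cstar_positive_iff spectrally_positive_zero_one)

lemma cstar_positive_add: "cstar_positive a \<Longrightarrow> cstar_positive b \<Longrightarrow> cstar_positive (a + b)"
  by (simp add: cstar_positive_iff spectrally_positive_add)

lemma cstar_positive_scaleR: "cstar_positive a \<Longrightarrow> c \<ge> 0 \<Longrightarrow> cstar_positive (c *\<^sub>R a)"
  by (simp add: cstar_positive_iff spectrally_positive_scaleR)

lemma cstar_positive_star_mult: "cstar_positive (star c * c)"
  by (auto simp: cstar_positive_def)

lemma cstar_positive_sum_list:
  "(\<And>x. x \<in> set xs \<Longrightarrow> cstar_positive (f x)) \<Longrightarrow> cstar_positive (\<Sum>x\<leftarrow>xs. f x)"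
  by (induction xs) (auto intro: cstar_positive_add)

lemma cstar_positive_norm_mono: "cstar_positive x \<Longrightarrow> cstar_positive (y - x) \<Longrightarrow> norm x \<le> norm y"
  by (simp add: cstar_positive_iff spectrally_positive_mono)

lemma cstar_positive_antisym: "cstar_positive a \<Longrightarrow> cstar_positive (- a) \<Longrightarrow> a = 0"
  using cstar_positive_norm_mono[of a 0] by simp

lemma cstar_positive_sum_list_eq_0:
  assumes "(\<Sum>x\<leftarrow>xs. f x) = 0" "\<And>x. x \<in> set xs \<Longrightarrow> cstar_positive (f x)" "x \<in> set xs"
  shows "f x = 0"
proof -
  obtain ys zs where xs: "xs = ys @ x # zs" using assms(3) by (metis split_list)
  have "cstar_positive ((\<Sum>x\<leftarrow>ys. f x) + (\<Sum>x\<leftarrow>zs. f x))"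
    using assms(2) by (intro cstar_positive_add cstar_positive_sum_list) (auto simp: xs)
  moreover have "(\<Sum>x\<leftarrow>ys. f x) + (\<Sum>x\<leftarrow>zs. f x) = - f x"
    using assms(1) by (simp add: xs algebra_simps add_eq_0_iff)
  ultimately show ?thesis using assms(2,3) by (intro cstar_positive_antisym) auto
qed

lemma norm_le_norm_sum_list:
  assumes "\<And>x. x \<in> set xs \<Longrightarrow> cstar_positive (f x)" "x \<in> set xs"
  shows "norm (f x) \<le> norm (\<Sum>x\<leftarrow>xs. f x)"
proof -
  obtain ys zs where xs: "xs = ys @ x # zs" using assms(2) by (metis split_list)
  have "cstar_positive ((\<Sum>x\<leftarrow>ys. f x) + (\<Sum>x\<leftarrow>zs. f x))"
    using assms(1) by (intro cstar_positive_add cstar_positive_sum_list) (auto simp: xs)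
  then show ?thesis using assms by (intro cstar_positive_norm_mono) (auto simp: xs algebra_simps)
qed

lemma cstar_positive_conj:
  assumes "cstar_positive p"
  shows "cstar_positive (star b * p * b)"
proof -
  obtain c where "p = star c * c" using assms by (auto simp: cstar_positive_def)
  then have "star b * p * b = star (c * b) * (c * b)" by (simp add: star_mult mult.assoc)
  then show ?thesis by (auto simp: cstar_positive_def)
qed

lemma cstar_positive_norm_minus: "star a = a \<Longrightarrow> norm a \<le> c \<Longrightarrow> cstar_positive (c *\<^sub>R 1 - a)"
  by (simp add: cstar_positive_iff spectrally_positive_norm_minus)

text \<open>Each member satisfies the norm criterion with its own norm as witness, and that
  inequality passes to the limit.\<close>

lemma cstar_positive_LIMSEQ:
  assumes "f \<longlonglongrightarrow> l" "\<And>n. cstar_positive (f n)"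
  shows "cstar_positive l"
proof -
  have "(\<lambda>n. star (f n)) \<longlonglongrightarrow> star l" by (rule tendsto_star[OF assms(1)])
  then have "star l = l"
    using assms(1) LIMSEQ_unique by (simp add: cstar_positive_selfadjoint[OF assms(2)]) blast
  moreover have "norm (norm l *\<^sub>R 1 - l) \<le> norm l"
    by (rule LIMSEQ_le[OF tendsto_norm[OF tendsto_diff[OF tendsto_scaleR[OF tendsto_norm[OF assms(1)]
      tendsto_const] assms(1)]] tendsto_norm[OF assms(1)]])
      (use assms(2) spectrally_positive_diff_norm in \<open>auto simp: cstar_positive_iff\<close>)
  ultimately show ?thesis by (auto simp: cstar_positive_iff spectrally_positive_def intro!: exI[of _ "norm l"])
qed

section \<open>Inverses, and the Cauchy-Schwarz inequality in the coefficient algebra\<close>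

lemma cstar_neumann:
  fixes x :: "'a::unital_cstar_algebra"
  assumes "norm x < 1"
  obtains q where "(1 - x) * q = 1" "q * (1 - x) = 1"
proof -
  have "summable (\<lambda>n. norm x ^ n)" using assms by (simp add: summable_geometric)
  then have sm: "summable (\<lambda>n. x ^ n)"
    by (rule summable_comparison_test[rotated]) (use cstar_norm_power_le in blast)
  define q where "q = (\<Sum>n. x ^ n)"
  have "q = x ^ 0 + (\<Sum>n. x ^ Suc n)"
    using suminf_split_head[OF sm] by (simp add: q_def)
  moreover have "(\<Sum>n. x ^ Suc n) = x * q" using suminf_mult[OF sm, of x] by (simp add: q_def)
  moreover have "(\<Sum>n. x ^ Suc n) = q * x"
    using suminf_mult2[OF sm, of x] by (simp add: q_def power_commutes)
  ultimately show thesis by (intro that[of q]) (simp_all add: algebra_simps)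
qed

text \<open>\<open>p\<close> is the inverse square root of \<open>s\<close>. A Neumann series
  inverts \<open>s = (t + e) (1 - x)\<close>, the inverse \<open>q = star q * s * q\<close> is
  positive, and \<open>p\<close> is its root. The last bound expresses that \<open>s \<ge> e\<close>
  forces \<open>e q \<le> 1\<close>.\<close>

lemma cstar_inverse_sqrt:
  fixes s :: "'a::unital_cstar_algebra"
  assumes "cstar_positive (s - e *\<^sub>R 1)" "e > 0"
  obtains p where "star p = p" "p * s * p = 1" "s * (p * p) = 1" "e * norm (p * p) \<le> 1"
proof -
  have sa: "star s = s"
    using cstar_positive_selfadjoint[OF assms(1)] by (simp add: star_diff star_scaleR)
  obtain t where t: "t \<ge> 0" "norm (t *\<^sub>R 1 - (s - e *\<^sub>R 1)) \<le> t"
    using assms(1) by (auto simp: cstar_positive_iff spectrally_positive_def)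
  define x where "x = (1 / (t + e)) *\<^sub>R (t *\<^sub>R 1 - (s - e *\<^sub>R 1))"
  have te: "t + e > 0" using t assms(2) by simp
  have "norm x < 1" using t te assms(2) by (simp add: x_def divide_less_eq)
  then obtain q' where q': "(1 - x) * q' = 1" "q' * (1 - x) = 1" by (rule cstar_neumann)
  have eq: "t *\<^sub>R 1 - (s - e *\<^sub>R 1) = (t + e) *\<^sub>R 1 - s" by (simp add: algebra_simps)
  have x: "1 - x = (1 / (t + e)) *\<^sub>R s"
    using te unfolding x_def eq by (simp add: scaleR_diff_right)
  define q where "q = (1 / (t + e)) *\<^sub>R q'"
  have q: "s * q = 1" "q * s = 1" using q' unfolding x by (simp_all add: q_def)
  have sq: "star q = q"
    by (metis q mult.assoc mult_1_left mult_1_right sa star_mult star_one)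
  have ps: "cstar_positive s"
    using cstar_positive_add[OF assms(1) cstar_positive_scaleR[OF cstar_positive_star_mult[of 1], of e]] assms(2)
    by simp
  have "star q * s * q = q" by (simp add: sq q)
  then have "cstar_positive q" using cstar_positive_conj[OF ps, of q] by simp
  then obtain p where p: "star p = p" "p * p = q" "\<And>y. q * y = y * q \<Longrightarrow> p * y = y * p"
    using spectrally_positive_sqrt unfolding cstar_positive_iff by blast
  have ps_comm: "p * s = s * p" by (rule p(3)) (simp add: q)
  have psp: "p * s * p = 1" using ps_comm p(2) q(1) by (metis mult.assoc)
  have "star p * (s - e *\<^sub>R 1) * p = 1 *\<^sub>R 1 - e *\<^sub>R q" by (simp add: p(1,2) psp left_diff_distrib right_diff_distrib)
  then have "spectrally_positive (1 *\<^sub>R 1 - e *\<^sub>R q)"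
    using cstar_positive_conj[OF assms(1), of p] by (simp add: cstar_positive_iff)
  then have "norm (e *\<^sub>R q) \<le> 1"
    using \<open>cstar_positive q\<close> assms(2)
    by (intro spectrally_positive_norm_le) (simp_all add: cstar_positive_iff spectrally_positive_scaleR)
  then show thesis using assms(2) by (intro that[of p]) (simp_all add: p(1,2) psp q)
qed

text \<open>The Cauchy-Schwarz inequality for \<open>p = \<langle>x, x\<rangle>\<close>, \<open>q = \<langle>y, y\<rangle>\<close>, \<open>a = \<langle>x, y\<rangle>\<close>; the hypothesis is
  the positivity of \<open>\<langle>y - x b, y - x b\<rangle>\<close>.\<close>

lemma cstar_cauchy_schwarz:
  fixes p q a :: "'a::unital_cstar_algebra"
  assumes pos: "\<And>b. cstar_positive (q - star a * b - star b * a + star b * p * b)"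
    and p: "cstar_positive p"
  shows "(norm a)\<^sup>2 \<le> norm p * norm q"
proof -
  \<comment> \<open>Any \<open>n > norm p\<close> takes the place of \<open>norm p\<close>, so that
    division is possible even for \<open>p = 0\<close>; letting \<open>n\<close> tend to
    \<open>norm p\<close> restores the claim.\<close>
  have *: "(norm a)\<^sup>2 \<le> n * norm q" if n: "n > norm p" for n
  proof -
    have n0: "n > 0" using n norm_ge_zero[of p] by linarith
    define b where "b = (1 / n) *\<^sub>R a"
    have "cstar_positive (star b * (n *\<^sub>R 1 - p) * b)"
      using n by (intro cstar_positive_conj cstar_positive_norm_minus cstar_positive_selfadjoint p) simp
    then have "cstar_positive ((q - star a * b - star b * a + star b * p * b) + star b * (n *\<^sub>R 1 - p) * b)"
      by (rule cstar_positive_add[OF pos])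
    moreover have "star b * (n *\<^sub>R 1 - p) * b = star b * a - star b * p * b"
      using n0 by (simp add: b_def star_scaleR algebra_simps)
    ultimately have "cstar_positive (q - star a * b)" by simp
    then have "cstar_positive (q - (1 / n) *\<^sub>R (star a * a))" by (simp add: b_def)
    then have "norm ((1 / n) *\<^sub>R (star a * a)) \<le> norm q"
      by (intro cstar_positive_norm_mono cstar_positive_scaleR cstar_positive_star_mult) (use n0 in simp_all)
    then show ?thesis using n0 by (simp add: cstar_identity divide_le_eq mult.commute)
  qed
  have "(\<lambda>k. (norm p + 1 / real (Suc k)) * norm q) \<longlonglongrightarrow> (norm p + 0) * norm q"
    by (intro tendsto_intros LIMSEQ_Suc[OF lim_1_over_n])
  then have "(norm a)\<^sup>2 \<le> (norm p + 0) * norm q"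
    by (rule LIMSEQ_le_const) (intro exI[of _ 0] allI impI *, simp)
  then show ?thesis by simp
qed

section \<open>Hilbert modules\<close>

definition hm_lim :: "('e, 'b::unital_cstar_algebra, 'z) hilbert_mod_scheme \<Rightarrow> (nat \<Rightarrow> 'e) \<Rightarrow> 'e \<Rightarrow> bool" where
  "hm_lim E u x \<longleftrightarrow> x \<in> hm_carrier E \<and> (\<lambda>n. hm_norm E (hm_diff E (u n) x)) \<longlonglongrightarrow> 0"

definition hm_sum :: "('e, 'b, 'z) hilbert_mod_scheme \<Rightarrow> ('i \<Rightarrow> 'e) \<Rightarrow> 'i list \<Rightarrow> 'e" where
  "hm_sum E f xs = foldr (\<lambda>x. hm_add E (f x)) xs (hm_zero E)"

lemma hm_sum_Nil [simp]: "hm_sum E f [] = hm_zero E"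
  and hm_sum_Cons [simp]: "hm_sum E f (x # xs) = hm_add E (f x) (hm_sum E f xs)"
  by (simp_all add: hm_sum_def)

lemma hm_sum_cong: "(\<And>x. x \<in> set xs \<Longrightarrow> f x = g x) \<Longrightarrow> hm_sum E f xs = hm_sum E g xs"
  by (induction xs) simp_all

lemma hm_sum_map: "hm_sum E f (map g xs) = hm_sum E (\<lambda>x. f (g x)) xs"
  by (induction xs) simp_all

context hilbert_module
begin

lemma diff_closed: "x \<in> hm_carrier E \<Longrightarrow> y \<in> hm_carrier E \<Longrightarrow> hm_diff E x y \<in> hm_carrier E"
  by (simp add: hm_diff_def add_closed scale_closed)

lemmas closed = add_closed zero_closed scale_closed act_closed diff_closed

lemma inner_diff:
  "\<lbrakk>x \<in> hm_carrier E; y \<in> hm_carrier E; z \<in> hm_carrier E\<rbrakk> \<Longrightarrow>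
    hm_inner E x (hm_diff E y z) = hm_inner E x y - hm_inner E x z"
  by (simp add: hm_diff_def inner_add inner_scale scale_closed)

lemma inner_zero: "x \<in> hm_carrier E \<Longrightarrow> hm_inner E x (hm_zero E) = 0"
  using inner_diff[of x x x] by (simp add: diff_self)

lemma inner_add_left:
  "\<lbrakk>x \<in> hm_carrier E; y \<in> hm_carrier E; z \<in> hm_carrier E\<rbrakk> \<Longrightarrow>
    hm_inner E (hm_add E x y) z = hm_inner E x z + hm_inner E y z"
  using star_inner[of z "hm_add E x y"] by (simp add: add_closed inner_add star_add star_inner)

lemma inner_scale_left:
  "\<lbrakk>x \<in> hm_carrier E; y \<in> hm_carrier E\<rbrakk> \<Longrightarrow> hm_inner E (hm_scale E c x) y = cnj c *\<^sub>C hm_inner E x y"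
  using star_inner[of y "hm_scale E c x"] by (simp add: scale_closed inner_scale star_scaleC star_inner)

lemma inner_act_left:
  "\<lbrakk>x \<in> hm_carrier E; y \<in> hm_carrier E\<rbrakk> \<Longrightarrow> hm_inner E (hm_act E x b) y = star b * hm_inner E x y"
  using star_inner[of y "hm_act E x b"] by (simp add: act_closed inner_act star_mult star_inner)

lemma inner_diff_left:
  "\<lbrakk>x \<in> hm_carrier E; y \<in> hm_carrier E; z \<in> hm_carrier E\<rbrakk> \<Longrightarrow>
    hm_inner E (hm_diff E x y) z = hm_inner E x z - hm_inner E y z"
  using star_inner[of z "hm_diff E x y"] by (simp add: diff_closed inner_diff star_diff star_inner)

lemma inner_zero_left: "x \<in> hm_carrier E \<Longrightarrow> hm_inner E (hm_zero E) x = 0"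
  using star_inner[of x "hm_zero E"] by (simp add: inner_zero zero_closed)

lemmas inner_simps = inner_add inner_add_left inner_scale inner_scale_left inner_act inner_act_left
  inner_diff inner_diff_left inner_zero inner_zero_left

lemma diff_eq_zeroD:
  assumes "x \<in> hm_carrier E" "y \<in> hm_carrier E" "hm_diff E x y = hm_zero E"
  shows "x = y"
proof -
  have y: "hm_add E (hm_scale E (- 1) y) y = hm_zero E"
    using diff_self[OF assms(2)] assms by (simp add: hm_diff_def add_commute scale_closed)
  have "x = hm_add E x (hm_add E (hm_scale E (- 1) y) y)"
    unfolding y using assms by (metis add_commute zero_add zero_closed)
  also have "\<dots> = hm_add E (hm_diff E x y) y"
    using assms(1,2) add_assoc[of x "hm_scale E (- 1) y" y] by (simp add: hm_diff_def scale_closed)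
  finally show ?thesis using assms zero_add by simp
qed

text \<open>Definiteness applied to the difference. Module identities are thereby reduced to
  identities in the coefficient algebra, and most computations with vectors below are done this
  way.\<close>

lemma inner_eqI:
  assumes "x \<in> hm_carrier E" "y \<in> hm_carrier E"
    and eq: "\<And>z. z \<in> hm_carrier E \<Longrightarrow> hm_inner E z x = hm_inner E z y"
  shows "x = y"
proof (rule diff_eq_zeroD)
  show "hm_diff E x y = hm_zero E"
    using assms eq[OF diff_closed[of x y]] by (intro inner_definite) (simp_all add: inner_simps closed)
qed (use assms in auto)

lemma norm_nonneg: "0 \<le> hm_norm E x"
  by (simp add: hm_norm_def)

lemma norm_power2: "(hm_norm E x)\<^sup>2 = norm (hm_inner E x x)"
  by (simp add: hm_norm_def)

lemma norm_eq_zeroD: "x \<in> hm_carrier E \<Longrightarrow> hm_norm E x = 0 \<Longrightarrow> x = hm_zero E"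
  by (rule inner_definite) (simp_all add: hm_norm_def)

lemma norm_zero: "hm_norm E (hm_zero E) = 0"
  by (simp add: hm_norm_def inner_zero zero_closed)

lemma cauchy_schwarz:
  assumes x: "x \<in> hm_carrier E" and y: "y \<in> hm_carrier E"
  shows "norm (hm_inner E x y) \<le> hm_norm E x * hm_norm E y"
proof -
  have "(norm (hm_inner E x y))\<^sup>2 \<le> norm (hm_inner E x x) * norm (hm_inner E y y)"
  proof (rule cstar_cauchy_schwarz)
    fix b
    let ?z = "hm_diff E y (hm_act E x b)"
    have "hm_inner E ?z ?z = hm_inner E y y - star (hm_inner E x y) * b - star b * hm_inner E x y
        + star b * hm_inner E x x * b"
      using assms by (simp add: inner_simps closed star_inner algebra_simps)
    then show "cstar_positive (hm_inner E y y - star (hm_inner E x y) * b - star b * hm_inner E x y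
        + star b * hm_inner E x x * b)"
      using inner_positive[of ?z] assms by (simp add: closed)
  qed (use x in \<open>rule inner_positive\<close>)
  then have "(norm (hm_inner E x y))\<^sup>2 \<le> (hm_norm E x * hm_norm E y)\<^sup>2"
    by (simp add: power_mult_distrib norm_power2)
  then show ?thesis by (rule power2_le_imp_le) (simp add: norm_nonneg)
qed

lemma norm_add_le:
  assumes x: "x \<in> hm_carrier E" and y: "y \<in> hm_carrier E"
  shows "hm_norm E (hm_add E x y) \<le> hm_norm E x + hm_norm E y"
proof (rule power2_le_imp_le)
  have eq: "hm_inner E (hm_add E x y) (hm_add E x y) =
      (hm_inner E x x + hm_inner E x y) + (hm_inner E y x + hm_inner E y y)"
    using assms by (simp add: inner_simps closed algebra_simps)
  have "(hm_norm E (hm_add E x y))\<^sup>2 \<le> (norm (hm_inner E x x) + norm (hm_inner E x y))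
      + (norm (hm_inner E y x) + norm (hm_inner E y y))"
    unfolding norm_power2 eq by (intro norm_triangle_mono norm_triangle_ineq)
  also have "\<dots> \<le> (hm_norm E x + hm_norm E y)\<^sup>2"
    using cauchy_schwarz[OF x y] cauchy_schwarz[OF y x]
    by (simp add: power2_sum norm_power2 mult.commute[of "hm_norm E y"])
  finally show "(hm_norm E (hm_add E x y))\<^sup>2 \<le> (hm_norm E x + hm_norm E y)\<^sup>2" .
qed (simp add: norm_nonneg)

lemma norm_scale: "x \<in> hm_carrier E \<Longrightarrow> hm_norm E (hm_scale E c x) = cmod c * hm_norm E x"
  by (simp add: hm_norm_def inner_simps closed norm_scaleC real_sqrt_mult)

lemma norm_act_le:
  assumes "x \<in> hm_carrier E"
  shows "hm_norm E (hm_act E x b) \<le> hm_norm E x * norm b"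
proof (rule power2_le_imp_le)
  have "(hm_norm E (hm_act E x b))\<^sup>2 = norm (star b * hm_inner E x x * b)"
    using assms by (simp add: norm_power2 inner_simps closed mult.assoc)
  also have "\<dots> \<le> norm (star b) * norm (hm_inner E x x) * norm b"
    by (rule order_trans[OF norm_mult_ineq mult_right_mono[OF norm_mult_ineq norm_ge_zero]])
  finally show "(hm_norm E (hm_act E x b))\<^sup>2 \<le> (hm_norm E x * norm b)\<^sup>2"
    by (simp add: power_mult_distrib norm_power2 power2_eq_square[of "norm b"] mult_ac)
qed (simp add: norm_nonneg)

lemma norm_diff_commute:
  "x \<in> hm_carrier E \<Longrightarrow> y \<in> hm_carrier E \<Longrightarrow> hm_norm E (hm_diff E x y) = hm_norm E (hm_diff E y x)"
  by (simp add: hm_norm_def inner_simps closed algebra_simps)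

lemma diff_diff_add:
  "\<lbrakk>x \<in> hm_carrier E; y \<in> hm_carrier E; z \<in> hm_carrier E\<rbrakk> \<Longrightarrow>
    hm_diff E x z = hm_add E (hm_diff E x y) (hm_diff E y z)"
  by (rule inner_eqI) (simp_all add: inner_simps closed)

lemma norm_diff_triangle:
  "\<lbrakk>x \<in> hm_carrier E; y \<in> hm_carrier E; z \<in> hm_carrier E\<rbrakk> \<Longrightarrow>
    hm_norm E (hm_diff E x z) \<le> hm_norm E (hm_diff E x y) + hm_norm E (hm_diff E y z)"
  using diff_diff_add[of x y z] norm_add_le[of "hm_diff E x y" "hm_diff E y z"] by (simp add: closed)

lemma diff_zero: "x \<in> hm_carrier E \<Longrightarrow> hm_diff E x (hm_zero E) = x"
  by (rule inner_eqI) (simp_all add: inner_simps closed)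

lemma norm_le_norm_diff:
  "x \<in> hm_carrier E \<Longrightarrow> y \<in> hm_carrier E \<Longrightarrow> hm_norm E x \<le> hm_norm E (hm_diff E x y) + hm_norm E y"
  using norm_diff_triangle[of x y "hm_zero E"] by (simp add: closed diff_zero)

lemma sum_closed: "(\<And>x. x \<in> set xs \<Longrightarrow> f x \<in> hm_carrier E) \<Longrightarrow> hm_sum E f xs \<in> hm_carrier E"
  by (induction xs) (auto simp: closed)

lemma inner_sum:
  "z \<in> hm_carrier E \<Longrightarrow> (\<And>x. x \<in> set xs \<Longrightarrow> f x \<in> hm_carrier E) \<Longrightarrow>
    hm_inner E z (hm_sum E f xs) = (\<Sum>x\<leftarrow>xs. hm_inner E z (f x))"
  by (induction xs) (auto simp: inner_simps sum_closed)

lemma inner_sum_left: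
  "z \<in> hm_carrier E \<Longrightarrow> (\<And>x. x \<in> set xs \<Longrightarrow> f x \<in> hm_carrier E) \<Longrightarrow>
    hm_inner E (hm_sum E f xs) z = (\<Sum>x\<leftarrow>xs. hm_inner E (f x) z)"
  by (induction xs) (auto simp: inner_simps sum_closed)

lemma sum_append:
  "(\<And>x. x \<in> set xs \<union> set ys \<Longrightarrow> f x \<in> hm_carrier E) \<Longrightarrow>
    hm_sum E f (xs @ ys) = hm_add E (hm_sum E f xs) (hm_sum E f ys)"
  by (induction xs) (auto simp: sum_closed zero_add add_assoc)

section \<open>Norm limits in a Hilbert module\<close>

lemma lim_closed: "hm_lim E u x \<Longrightarrow> x \<in> hm_carrier E"
  by (simp add: hm_lim_def)

lemma lim_boundI:
  assumes "x \<in> hm_carrier E" "c \<longlonglongrightarrow> 0" "\<And>n. hm_norm E (hm_diff E (u n) x) \<le> c n"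
  shows "hm_lim E u x"
  using assms by (auto simp: hm_lim_def intro: real_tendsto_sandwich[of "\<lambda>_. 0" _ _ c] simp: norm_nonneg)

lemma lim_const: "x \<in> hm_carrier E \<Longrightarrow> hm_lim E (\<lambda>_. x) x"
  by (simp add: hm_lim_def diff_self norm_zero)

lemma lim_add:
  assumes "hm_lim E u x" "hm_lim E v y" "\<And>n. u n \<in> hm_carrier E" "\<And>n. v n \<in> hm_carrier E"
  shows "hm_lim E (\<lambda>n. hm_add E (u n) (v n)) (hm_add E x y)"
proof (rule lim_boundI)
  have xy: "x \<in> hm_carrier E" "y \<in> hm_carrier E" using assms by (auto simp: hm_lim_def)
  then show "hm_add E x y \<in> hm_carrier E" by (rule add_closed)
  show "(\<lambda>n. hm_norm E (hm_diff E (u n) x) + hm_norm E (hm_diff E (v n) y)) \<longlonglongrightarrow> 0"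
    using tendsto_add[of _ 0 _ _ 0] assms by (auto simp: hm_lim_def)
  fix n
  have "hm_diff E (hm_add E (u n) (v n)) (hm_add E x y) = hm_add E (hm_diff E (u n) x) (hm_diff E (v n) y)"
    using assms(3,4)[of n] xy by (intro inner_eqI) (simp_all add: inner_simps closed)
  then show "hm_norm E (hm_diff E (hm_add E (u n) (v n)) (hm_add E x y))
      \<le> hm_norm E (hm_diff E (u n) x) + hm_norm E (hm_diff E (v n) y)"
    using assms(3,4)[of n] xy by (simp add: norm_add_le closed)
qed

lemma lim_scale:
  assumes "hm_lim E u x" "\<And>n. u n \<in> hm_carrier E"
  shows "hm_lim E (\<lambda>n. hm_scale E c (u n)) (hm_scale E c x)"
proof (rule lim_boundI)
  have x: "x \<in> hm_carrier E" using assms by (auto simp: hm_lim_def)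
  then show "hm_scale E c x \<in> hm_carrier E" by (rule scale_closed)
  show "(\<lambda>n. cmod c * hm_norm E (hm_diff E (u n) x)) \<longlonglongrightarrow> 0"
    using tendsto_mult_left[of _ 0] assms by (fastforce simp: hm_lim_def)
  fix n
  have "hm_diff E (hm_scale E c (u n)) (hm_scale E c x) = hm_scale E c (hm_diff E (u n) x)"
    using assms(2)[of n] x by (intro inner_eqI) (simp_all add: inner_simps closed algebra_simps
      flip: scaleC_add_right)
  then show "hm_norm E (hm_diff E (hm_scale E c (u n)) (hm_scale E c x)) \<le> cmod c * hm_norm E (hm_diff E (u n) x)"
    using assms(2)[of n] x by (simp add: norm_scale closed)
qed

lemma lim_act:
  assumes "hm_lim E u x" "\<And>n. u n \<in> hm_carrier E"
  shows "hm_lim E (\<lambda>n. hm_act E (u n) b) (hm_act E x b)"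
proof (rule lim_boundI)
  have x: "x \<in> hm_carrier E" using assms by (auto simp: hm_lim_def)
  then show "hm_act E x b \<in> hm_carrier E" by (rule act_closed)
  show "(\<lambda>n. hm_norm E (hm_diff E (u n) x) * norm b) \<longlonglongrightarrow> 0"
    using tendsto_mult_right[of _ 0] assms by (fastforce simp: hm_lim_def)
  fix n
  have "hm_diff E (hm_act E (u n) b) (hm_act E x b) = hm_act E (hm_diff E (u n) x) b"
    using assms(2)[of n] x by (intro inner_eqI) (simp_all add: inner_simps closed algebra_simps)
  then show "hm_norm E (hm_diff E (hm_act E (u n) b) (hm_act E x b)) \<le> hm_norm E (hm_diff E (u n) x) * norm b"
    using assms(2)[of n] x by (simp add: norm_act_le closed)
qed

lemma lim_norm:
  assumes "hm_lim E u x" "\<And>n. u n \<in> hm_carrier E"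
  shows "(\<lambda>n. hm_norm E (u n)) \<longlonglongrightarrow> hm_norm E x"
proof (rule LIM_zero_cancel, rule Lim_null_comparison)
  have x: "x \<in> hm_carrier E" using assms by (auto simp: hm_lim_def)
  show "\<forall>\<^sub>F n in sequentially. norm (hm_norm E (u n) - hm_norm E x) \<le> hm_norm E (hm_diff E (u n) x)"
  proof (rule always_eventually, rule allI)
    fix n
    show "norm (hm_norm E (u n) - hm_norm E x) \<le> hm_norm E (hm_diff E (u n) x)"
      using norm_le_norm_diff[of "u n" x] norm_le_norm_diff[of x "u n"] norm_diff_commute[of x "u n"]
        assms(2)[of n] x by auto
  qed
qed (use assms in \<open>simp add: hm_lim_def\<close>)

lemma lim_inner:
  assumes "hm_lim E u x" "hm_lim E v y" "\<And>n. u n \<in> hm_carrier E" "\<And>n. v n \<in> hm_carrier E"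
  shows "(\<lambda>n. hm_inner E (u n) (v n)) \<longlonglongrightarrow> hm_inner E x y"
proof (rule LIM_zero_cancel, rule Lim_null_comparison)
  have xy: "x \<in> hm_carrier E" "y \<in> hm_carrier E" using assms by (auto simp: hm_lim_def)
  let ?c = "\<lambda>n. hm_norm E (hm_diff E (u n) x) * hm_norm E (v n) + hm_norm E x * hm_norm E (hm_diff E (v n) y)"
  have "?c \<longlonglongrightarrow> 0 * hm_norm E y + hm_norm E x * 0"
    using assms lim_norm[OF assms(2,4)] by (intro tendsto_intros) (simp_all add: hm_lim_def)
  then show "?c \<longlonglongrightarrow> 0" by simp
  show "\<forall>\<^sub>F n in sequentially. norm (hm_inner E (u n) (v n) - hm_inner E x y) \<le> ?c n"
  proof (rule always_eventually, rule allI)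
    fix n
    have "hm_inner E (u n) (v n) - hm_inner E x y
        = hm_inner E (hm_diff E (u n) x) (v n) + hm_inner E x (hm_diff E (v n) y)"
      using assms(3,4)[of n] xy by (simp add: inner_simps)
    also have "norm \<dots> \<le> ?c n"
      using assms(3,4)[of n] xy by (intro norm_triangle_mono cauchy_schwarz) (simp_all add: closed)
    finally show "norm (hm_inner E (u n) (v n) - hm_inner E x y) \<le> ?c n" .
  qed
qed

lemma lim_unique:
  assumes "hm_lim E u x" "hm_lim E u y" "\<And>n. u n \<in> hm_carrier E"
  shows "x = y"
proof (rule inner_eqI)
  fix z assume z: "z \<in> hm_carrier E"
  show "hm_inner E z x = hm_inner E z y"
    using lim_inner[OF lim_const[OF z] assms(1)] lim_inner[OF lim_const[OF z] assms(2)] z assms(3)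
      LIMSEQ_unique by blast
qed (use assms in \<open>auto simp: hm_lim_def\<close>)

lemma cauchy_lim:
  assumes "\<And>n. u n \<in> hm_carrier E"
    "\<And>e. e > 0 \<Longrightarrow> \<exists>N. \<forall>m\<ge>N. \<forall>n\<ge>N. hm_norm E (hm_diff E (u m) (u n)) < e"
  obtains x where "hm_lim E u x"
  using complete[of u] assms by (auto simp: hm_lim_def)

lemma lim_cauchy:
  assumes "hm_lim E u x" "\<And>n. u n \<in> hm_carrier E" "e > 0"
  shows "\<exists>N. \<forall>m\<ge>N. \<forall>n\<ge>N. hm_norm E (hm_diff E (u m) (u n)) < e"
proof -
  have x: "x \<in> hm_carrier E" using assms by (auto simp: hm_lim_def)
  have "\<forall>\<^sub>F n in sequentially. hm_norm E (hm_diff E (u n) x) < e / 2"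
    using assms(1) \<open>e > 0\<close> by (intro order_tendstoD) (auto simp: hm_lim_def)
  then obtain N where N: "\<And>n. n \<ge> N \<Longrightarrow> hm_norm E (hm_diff E (u n) x) < e / 2"
    by (auto simp: eventually_sequentially)
  show ?thesis
  proof (intro exI[of _ N] allI impI)
    fix m n assume "m \<ge> N" "n \<ge> N"
    then have "hm_norm E (hm_diff E (u m) x) < e / 2" "hm_norm E (hm_diff E x (u n)) < e / 2"
      using N norm_diff_commute[OF assms(2) x] by auto
    then show "hm_norm E (hm_diff E (u m) (u n)) < e"
      using norm_diff_triangle[OF assms(2) x assms(2), of m n] by linarith
  qed
qed

lemma cauchy_lim_iff:
  assumes "\<And>n. u n \<in> hm_carrier E"
  shows "(\<forall>e>0. \<exists>N. \<forall>m\<ge>N. \<forall>n\<ge>N. hm_norm E (hm_diff E (u m) (u n)) < e) \<longleftrightarrow> (\<exists>x. hm_lim E u x)"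
proof
  assume *: "\<forall>e>0. \<exists>N. \<forall>m\<ge>N. \<forall>n\<ge>N. hm_norm E (hm_diff E (u m) (u n)) < e"
  obtain x where "hm_lim E u x" by (rule cauchy_lim[of u, OF assms]) (use * in auto)
  then show "\<exists>x. hm_lim E u x" ..
next
  assume "\<exists>x. hm_lim E u x"
  then obtain x where "hm_lim E u x" ..
  then show "\<forall>e>0. \<exists>N. \<forall>m\<ge>N. \<forall>n\<ge>N. hm_norm E (hm_diff E (u m) (u n)) < e"
    using lim_cauchy[of u, OF _ assms] by simp
qed

text \<open>Together with \<open>cauchy_lim_iff\<close> this translates Cauchy sequences modulo null
  distance into points of a complete module, which is how the classes of a Hausdorff completion are
  identified later.\<close>

lemma lim_lim_iff:
  assumes "hm_lim E u x" "\<And>n. u n \<in> hm_carrier E" "\<And>n. v n \<in> hm_carrier E"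
  shows "hm_lim E v x \<longleftrightarrow> (\<lambda>n. hm_norm E (hm_diff E (u n) (v n))) \<longlonglongrightarrow> 0"
proof
  have x: "x \<in> hm_carrier E" using assms by (auto simp: hm_lim_def)
  show "(\<lambda>n. hm_norm E (hm_diff E (u n) (v n))) \<longlonglongrightarrow> 0" if "hm_lim E v x"
  proof (rule real_tendsto_sandwich[of "\<lambda>_. 0" _ _
      "\<lambda>n. hm_norm E (hm_diff E (u n) x) + hm_norm E (hm_diff E (v n) x)"])
    show "(\<lambda>n. hm_norm E (hm_diff E (u n) x) + hm_norm E (hm_diff E (v n) x)) \<longlonglongrightarrow> 0"
      using tendsto_add[of _ 0 _ _ 0] assms(1) that by (auto simp: hm_lim_def)
    show "\<forall>\<^sub>F n in sequentially. hm_norm E (hm_diff E (u n) (v n))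
        \<le> hm_norm E (hm_diff E (u n) x) + hm_norm E (hm_diff E (v n) x)"
      using norm_diff_triangle[OF assms(2) x assms(3)] norm_diff_commute[OF x assms(3)] by simp
  qed (simp_all add: norm_nonneg)
  show "hm_lim E v x" if *: "(\<lambda>n. hm_norm E (hm_diff E (u n) (v n))) \<longlonglongrightarrow> 0"
  proof (rule lim_boundI[OF x])
    show "(\<lambda>n. hm_norm E (hm_diff E (u n) (v n)) + hm_norm E (hm_diff E (u n) x)) \<longlonglongrightarrow> 0"
      using tendsto_add[of _ 0 _ _ 0] assms(1) * by (auto simp: hm_lim_def)
    show "hm_norm E (hm_diff E (v n) x) \<le> hm_norm E (hm_diff E (u n) (v n)) + hm_norm E (hm_diff E (u n) x)" for n
      using norm_diff_triangle[OF assms(3) assms(2) x, of n n] norm_diff_commute[OF assms(3) assms(2), of n n]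
      by simp
  qed
qed

end

section \<open>Adjointable operators\<close>

context hilbert_module
begin

lemma adjoint_unique:
  assumes "b \<in> hm_carrier E \<rightarrow>\<^sub>E hm_carrier E" "b' \<in> hm_carrier E \<rightarrow>\<^sub>E hm_carrier E"
    "\<And>x y. x \<in> hm_carrier E \<Longrightarrow> y \<in> hm_carrier E \<Longrightarrow> hm_inner E x (b y) = hm_inner E x (b' y)"
  shows "b = b'"
proof (rule PiE_ext[OF assms(1,2)])
  fix y assume y: "y \<in> hm_carrier E"
  show "b y = b' y" by (rule inner_eqI) (use assms y in auto)
qed

lemma adj_opsI:
  assumes a: "a \<in> hm_carrier E \<rightarrow>\<^sub>E hm_carrier E" and b: "b \<in> hm_carrier E \<rightarrow>\<^sub>E hm_carrier E"
    and adj: "\<And>x y. x \<in> hm_carrier E \<Longrightarrow> y \<in> hm_carrier E \<Longrightarrow> hm_inner E (a x) y = hm_inner E x (b y)"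
  shows "a \<in> adj_ops E" and "op_adjoint E a = b"
proof -
  show "a \<in> adj_ops E" using assms unfolding adj_ops_def by blast
  show "op_adjoint E a = b"
    unfolding op_adjoint_def
  proof (rule the_equality)
    fix b' assume "b' \<in> hm_carrier E \<rightarrow>\<^sub>E hm_carrier E \<and>
      (\<forall>x\<in>hm_carrier E. \<forall>y\<in>hm_carrier E. hm_inner E (a x) y = hm_inner E x (b' y))"
    then show "b' = b" by (intro adjoint_unique) (auto simp: b adj[symmetric])
  qed (use assms in auto)
qed

lemma adj_ops_PiE: "a \<in> adj_ops E \<Longrightarrow> a \<in> hm_carrier E \<rightarrow>\<^sub>E hm_carrier E"
  by (simp add: adj_ops_def)

lemma adj_ops_closed: "a \<in> adj_ops E \<Longrightarrow> x \<in> hm_carrier E \<Longrightarrow> a x \<in> hm_carrier E"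
  using adj_ops_PiE by blast

lemma adj_ops_eqI:
  assumes "a \<in> adj_ops E" "b \<in> adj_ops E" "\<And>x. x \<in> hm_carrier E \<Longrightarrow> a x = b x"
  shows "a = b"
  using PiE_ext[OF adj_ops_PiE[OF assms(1)] adj_ops_PiE[OF assms(2)]] assms(3) by blast

lemma
  assumes "a \<in> adj_ops E"
  shows op_adjoint_adj_ops: "op_adjoint E a \<in> adj_ops E"
    and inner_adjoint: "x \<in> hm_carrier E \<Longrightarrow> y \<in> hm_carrier E \<Longrightarrow>
      hm_inner E (a x) y = hm_inner E x (op_adjoint E a y)"
    and inner_adjoint_left: "x \<in> hm_carrier E \<Longrightarrow> y \<in> hm_carrier E \<Longrightarrow>
      hm_inner E x (a y) = hm_inner E (op_adjoint E a x) y"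
    and op_adjoint_adjoint: "op_adjoint E (op_adjoint E a) = a"
proof -
  obtain b where b: "b \<in> hm_carrier E \<rightarrow>\<^sub>E hm_carrier E"
    "\<And>x y. x \<in> hm_carrier E \<Longrightarrow> y \<in> hm_carrier E \<Longrightarrow> hm_inner E (a x) y = hm_inner E x (b y)"
    and a: "a \<in> hm_carrier E \<rightarrow>\<^sub>E hm_carrier E"
    using assms unfolding adj_ops_def by blast
  have ab: "op_adjoint E a = b" by (rule adj_opsI(2)[OF a b])
  have b': "hm_inner E (b x) y = hm_inner E x (a y)" if "x \<in> hm_carrier E" "y \<in> hm_carrier E" for x y
  proof -
    have "b x \<in> hm_carrier E" "a y \<in> hm_carrier E" using that a b by blast+
    then have "hm_inner E (b x) y = star (hm_inner E y (b x))" using star_inner that by simp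
    also have "\<dots> = star (hm_inner E (a y) x)" using b(2) that by simp
    also have "\<dots> = hm_inner E x (a y)" using star_inner that \<open>a y \<in> hm_carrier E\<close> by simp
    finally show ?thesis .
  qed
  show "op_adjoint E a \<in> adj_ops E" "op_adjoint E (op_adjoint E a) = a"
    unfolding ab using adj_opsI[OF b(1) a b'] by auto
  show "hm_inner E (a x) y = hm_inner E x (op_adjoint E a y)"
    "hm_inner E x (a y) = hm_inner E (op_adjoint E a x) y"
    if "x \<in> hm_carrier E" "y \<in> hm_carrier E"
    unfolding ab using b(2) b' that by auto
qed

lemma
  assumes a: "a \<in> adj_ops E"
  shows adj_add: "x \<in> hm_carrier E \<Longrightarrow> y \<in> hm_carrier E \<Longrightarrow> a (hm_add E x y) = hm_add E (a x) (a y)"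
    and adj_scale: "x \<in> hm_carrier E \<Longrightarrow> a (hm_scale E c x) = hm_scale E c (a x)"
    and adj_act: "x \<in> hm_carrier E \<Longrightarrow> a (hm_act E x b) = hm_act E (a x) b"
    and adj_diff: "x \<in> hm_carrier E \<Longrightarrow> y \<in> hm_carrier E \<Longrightarrow> a (hm_diff E x y) = hm_diff E (a x) (a y)"
  by (rule inner_eqI; use a op_adjoint_adj_ops[OF a] in
      \<open>simp add: inner_adjoint_left inner_simps closed adj_ops_closed\<close>)+

lemma adj_zero: "a \<in> adj_ops E \<Longrightarrow> a (hm_zero E) = hm_zero E"
  using adj_diff[of a "hm_zero E" "hm_zero E"] by (simp add: closed diff_self adj_ops_closed)

lemma op_id_adj_ops: "op_id E \<in> adj_ops E" and op_adjoint_id: "op_adjoint E (op_id E) = op_id E"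
  using adj_opsI[of "op_id E" "op_id E"] by (auto simp: op_id_def)

lemma op_id_apply: "x \<in> hm_carrier E \<Longrightarrow> op_id E x = x"
  by (simp add: op_id_def)

lemma
  assumes a: "a \<in> adj_ops E" and b: "b \<in> adj_ops E"
  shows op_add_adj_ops: "op_add E a b \<in> adj_ops E"
    and op_adjoint_add: "op_adjoint E (op_add E a b) = op_add E (op_adjoint E a) (op_adjoint E b)"
proof -
  have *: "hm_inner E (op_add E a b x) y = hm_inner E x (op_add E (op_adjoint E a) (op_adjoint E b) y)"
    if "x \<in> hm_carrier E" "y \<in> hm_carrier E" for x y
    using that a b op_adjoint_adj_ops
    by (simp add: op_add_def inner_simps adj_ops_closed inner_adjoint)
  have **: "op_add E a b \<in> hm_carrier E \<rightarrow>\<^sub>E hm_carrier E"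
    "op_add E (op_adjoint E a) (op_adjoint E b) \<in> hm_carrier E \<rightarrow>\<^sub>E hm_carrier E"
    using a b op_adjoint_adj_ops by (auto simp: op_add_def closed adj_ops_closed)
  show "op_add E a b \<in> adj_ops E"
    "op_adjoint E (op_add E a b) = op_add E (op_adjoint E a) (op_adjoint E b)"
    using adj_opsI[OF ** *] by auto
qed

lemma
  assumes a: "a \<in> adj_ops E"
  shows op_scale_adj_ops: "op_scale E c a \<in> adj_ops E"
    and op_adjoint_scale: "op_adjoint E (op_scale E c a) = op_scale E (cnj c) (op_adjoint E a)"
proof -
  have *: "hm_inner E (op_scale E c a x) y = hm_inner E x (op_scale E (cnj c) (op_adjoint E a) y)"
    if "x \<in> hm_carrier E" "y \<in> hm_carrier E" for x y
    using that a op_adjoint_adj_ops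
    by (simp add: op_scale_def inner_simps adj_ops_closed inner_adjoint)
  have **: "op_scale E c a \<in> hm_carrier E \<rightarrow>\<^sub>E hm_carrier E"
    "op_scale E (cnj c) (op_adjoint E a) \<in> hm_carrier E \<rightarrow>\<^sub>E hm_carrier E"
    using a op_adjoint_adj_ops by (auto simp: op_scale_def closed adj_ops_closed)
  show "op_scale E c a \<in> adj_ops E"
    "op_adjoint E (op_scale E c a) = op_scale E (cnj c) (op_adjoint E a)"
    using adj_opsI[OF ** *] by auto
qed

lemma
  assumes a: "a \<in> adj_ops E" and b: "b \<in> adj_ops E"
  shows op_mult_adj_ops: "op_mult E a b \<in> adj_ops E"
    and op_adjoint_mult: "op_adjoint E (op_mult E a b) = op_mult E (op_adjoint E b) (op_adjoint E a)"
proof -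
  have *: "hm_inner E (op_mult E a b x) y = hm_inner E x (op_mult E (op_adjoint E b) (op_adjoint E a) y)"
    if "x \<in> hm_carrier E" "y \<in> hm_carrier E" for x y
    using that a b op_adjoint_adj_ops
    by (simp add: op_mult_def compose_def adj_ops_closed inner_adjoint)
  have **: "op_mult E a b \<in> hm_carrier E \<rightarrow>\<^sub>E hm_carrier E"
    "op_mult E (op_adjoint E b) (op_adjoint E a) \<in> hm_carrier E \<rightarrow>\<^sub>E hm_carrier E"
    using a b op_adjoint_adj_ops by (auto simp: op_mult_def compose_def adj_ops_closed)
  show "op_mult E a b \<in> adj_ops E"
    "op_adjoint E (op_mult E a b) = op_mult E (op_adjoint E b) (op_adjoint E a)"
    using adj_opsI[OF ** *] by auto
qed

lemma
  assumes x: "x \<in> hm_carrier E" and y: "y \<in> hm_carrier E"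
  shows rank_one_adj_ops: "rank_one E x y \<in> adj_ops E"
    and op_adjoint_rank_one: "op_adjoint E (rank_one E x y) = rank_one E y x"
proof -
  have *: "hm_inner E (rank_one E x y z) z' = hm_inner E z (rank_one E y x z')"
    if "z \<in> hm_carrier E" "z' \<in> hm_carrier E" for z z'
    using that x y by (simp add: rank_one_def inner_simps star_inner)
  have **: "rank_one E x y \<in> hm_carrier E \<rightarrow>\<^sub>E hm_carrier E" "rank_one E y x \<in> hm_carrier E \<rightarrow>\<^sub>E hm_carrier E"
    using x y by (auto simp: rank_one_def closed)
  show "rank_one E x y \<in> adj_ops E" "op_adjoint E (rank_one E x y) = rank_one E y x"
    using adj_opsI[OF ** *] by auto
qed

lemma rank_one_apply: "z \<in> hm_carrier E \<Longrightarrow> rank_one E x y z = hm_act E x (hm_inner E y z)"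
  by (simp add: rank_one_def)

lemma op_mult_apply: "x \<in> hm_carrier E \<Longrightarrow> op_mult E a b x = a (b x)"
  by (simp add: op_mult_def compose_def)

lemma op_add_apply: "x \<in> hm_carrier E \<Longrightarrow> op_add E a b x = hm_add E (a x) (b x)"
  by (simp add: op_add_def)

lemma op_scale_apply: "x \<in> hm_carrier E \<Longrightarrow> op_scale E c a x = hm_scale E c (a x)"
  by (simp add: op_scale_def)

lemmas op_apply = rank_one_apply op_mult_apply op_add_apply op_scale_apply op_id_apply

lemmas op_adj_ops = rank_one_adj_ops op_mult_adj_ops op_add_adj_ops op_scale_adj_ops op_id_adj_ops
  op_adjoint_adj_ops

lemma op_mult_rank_one:
  "a \<in> adj_ops E \<Longrightarrow> x \<in> hm_carrier E \<Longrightarrow> y \<in> hm_carrier E \<Longrightarrow>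
    op_mult E a (rank_one E x y) = rank_one E (a x) y"
  by (rule adj_ops_eqI) (simp_all add: op_adj_ops adj_ops_closed op_apply adj_act)

lemma rank_one_act:
  "x \<in> hm_carrier E \<Longrightarrow> y \<in> hm_carrier E \<Longrightarrow> rank_one E (hm_act E x b) y = rank_one E x (hm_act E y (star b))"
  by (rule adj_ops_eqI) (simp_all add: op_adj_ops op_apply act_act inner_simps closed star_star)

lemma rank_one_add:
  "x \<in> hm_carrier E \<Longrightarrow> x' \<in> hm_carrier E \<Longrightarrow> y \<in> hm_carrier E \<Longrightarrow>
    rank_one E (hm_add E x x') y = op_add E (rank_one E x y) (rank_one E x' y)"
  by (rule adj_ops_eqI) (simp_all add: op_adj_ops op_apply closed add_act)

section \<open>Boundedness of adjointable operators\<close>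

lemma lim_offset: "hm_lim E u x \<Longrightarrow> hm_lim E (\<lambda>n. u (n + k)) x"
  using LIMSEQ_ignore_initial_segment[of "\<lambda>n. hm_norm E (hm_diff E (u n) x)" 0 k] by (simp add: hm_lim_def)

text \<open>Uniform boundedness by Sokal's argument: \<open>x\<close> is the limit of steps \<open>\<plusminus>3\<^sup>-\<^sup>n e\<^sub>n\<close> with the sign
  chosen so that \<open>\<parallel>\<langle>a y\<^sub>n, x\<rangle>\<parallel>\<close> stays large.\<close>

lemma adj_bounded:
  assumes a: "a \<in> adj_ops E"
  obtains M where "M > 0" "\<And>x. x \<in> hm_carrier E \<Longrightarrow> hm_norm E (a x) \<le> M * hm_norm E x"
proof (rule ccontr)
  assume no: "\<not> thesis"
  \<comment> \<open>The rate \<open>4^n\<close> is chosen against the step size \<open>3^-n\<close>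
    below: in the end \<open>(4/3)^n\<close> would stay bounded.\<close>
  have ex: "\<exists>y. y \<in> hm_carrier E \<and> hm_norm E (a y) > 4 ^ n * hm_norm E y" for n :: nat
    using that[of "4 ^ n"] no by (metis not_le zero_less_numeral zero_less_power)
  define y where "y n = (SOME y. y \<in> hm_carrier E \<and> hm_norm E (a y) > 4 ^ n * hm_norm E y)" for n
  have y: "y n \<in> hm_carrier E" "hm_norm E (a (y n)) > 4 ^ n * hm_norm E (y n)" for n
    using someI_ex[OF ex[of n]] by (simp_all add: y_def)
  have ay: "a (y n) \<in> hm_carrier E" for n using a y by (simp add: adj_ops_closed)
  define c where "c n = hm_norm E (a (y n))" for n
  have c: "c n > 0" for n
    using y(2)[of n] by (simp add: c_def) (meson mult_nonneg_nonneg norm_nonneg not_less order_less_le_trans zero_le_numeral zero_le_power)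
  define e where "e n = hm_scale E (complex_of_real (1 / c n)) (a (y n))" for n
  have e: "e n \<in> hm_carrier E" "hm_norm E (e n) = 1" for n
    using c[of n] by (simp_all add: e_def ay closed norm_scale norm_divide c_def[symmetric])
  define f where "f n x = hm_inner E (a (y n)) x" for n x
  have fe: "norm (f n (e n)) = c n" for n
  proof -
    have "f n (e n) = (1 / c n) *\<^sub>R hm_inner E (a (y n)) (a (y n))"
      by (simp add: f_def e_def inner_simps ay flip: scaleC_of_real)
    then have "norm (f n (e n)) = (1 / c n) * (c n)\<^sup>2" using c[of n] by (simp add: c_def norm_power2)
    then show ?thesis using c[of n] by (simp add: power2_eq_square)
  qed
  define t :: "nat \<Rightarrow> real" where "t n = (1/3) ^ n" for n
  have t: "t n > 0" and tS: "t (Suc n) = t n / 3" for n by (simp_all add: t_def)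
  define p where "p n x = hm_add E x (hm_scale E (complex_of_real (t n)) (e n))" for n x
  define q where "q n x = hm_add E x (hm_scale E (complex_of_real (- t n)) (e n))" for n x
  define X where "X = rec_nat (hm_zero E) (\<lambda>n x. if norm (f n (p n x)) \<ge> t n * c n then p n x else q n x)"
  have X0: "X 0 = hm_zero E"
    and XS: "X (Suc n) = (if norm (f n (p n (X n))) \<ge> t n * c n then p n (X n) else q n (X n))" for n
    by (simp_all add: X_def)
  have X: "X n \<in> hm_carrier E" for n
    by (induction n) (simp_all add: X0 XS p_def q_def closed e)
  have big: "norm (f n (X (Suc n))) \<ge> t n * c n" for n
  proof (cases "norm (f n (p n (X n))) \<ge> t n * c n")
    case False
    have "f n (p n (X n)) - f n (q n (X n)) = (2 * t n) *\<^sub>R f n (e n)"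
    proof -
      have "f n (p n (X n)) - f n (q n (X n)) = t n *\<^sub>R f n (e n) - (- t n) *\<^sub>R f n (e n)"
        unfolding f_def p_def q_def scaleC_of_real[symmetric] by (simp add: inner_simps ay X e closed)
      then show ?thesis by (simp add: scaleR_left_distrib[symmetric])
    qed
    then have "norm (f n (p n (X n)) - f n (q n (X n))) = 2 * t n * c n" using t[of n] fe by simp
    then have "2 * t n * c n \<le> norm (f n (p n (X n))) + norm (f n (q n (X n)))"
      using norm_triangle_ineq4[of "f n (p n (X n))" "f n (q n (X n))"] by simp
    then show ?thesis using False by (simp add: XS)
  qed (simp add: XS)
  have step: "hm_norm E (hm_diff E (X (Suc n)) (X n)) = t n" for n
  proof -
    have "hm_diff E (hm_add E x z) x = z" if "x \<in> hm_carrier E" "z \<in> hm_carrier E" for x z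
      using that by (intro inner_eqI) (simp_all add: inner_simps closed)
    then show ?thesis using X[of n] e[of n] t[of n]
      by (simp add: XS p_def q_def closed norm_scale del: of_real_minus)
  qed
  have tail: "hm_norm E (hm_diff E (X (n + k)) (X n)) \<le> (3/2) * t n - (3/2) * t (n + k)" for n k
  proof (induction k)
    case 0
    then show ?case by (simp add: diff_self X norm_zero)
  next
    case (Suc k)
    have "hm_norm E (hm_diff E (X (n + Suc k)) (X n))
        \<le> hm_norm E (hm_diff E (X (Suc (n + k))) (X (n + k))) + hm_norm E (hm_diff E (X (n + k)) (X n))"
      using norm_diff_triangle[OF X X X] by simp
    then show ?case using Suc step[of "n + k"] by (simp add: t_def)
  qed
  obtain x where x: "hm_lim E X x"
  proof (rule cauchy_lim[of X, OF X])
    fix \<epsilon> :: real assume "\<epsilon> > 0"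
    then obtain N where N: "(1/3::real) ^ N < \<epsilon> / 3"
      using real_arch_pow_inv[of "\<epsilon> / 3" "1/3"] by auto
    have *: "hm_norm E (hm_diff E (X m) (X N)) \<le> (3/2) * t N" if "m \<ge> N" for m
      using tail[of N "m - N"] t[of m] that by simp
    show "\<exists>N. \<forall>m\<ge>N. \<forall>n\<ge>N. hm_norm E (hm_diff E (X m) (X n)) < \<epsilon>"
    proof (intro exI[of _ N] allI impI)
      fix m n assume "m \<ge> N" "n \<ge> N"
      then show "hm_norm E (hm_diff E (X m) (X n)) < \<epsilon>"
        using norm_diff_triangle[OF X[of m] X[of N] X[of n]] norm_diff_commute[OF X[of N] X[of n]] *[of m] *[of n] N
        by (simp add: t_def)
    qed
  qed blast
  have xc: "x \<in> hm_carrier E" using x by (rule lim_closed)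
  \<comment> \<open>The steps after step \<open>n\<close> add up to at most \<open>3^-n / 2\<close>,
    so they destroy at most half of what step \<open>n\<close> has secured.\<close>
  have close: "hm_norm E (hm_diff E (X (Suc n)) x) \<le> t n / 2" for n
  proof (rule LIMSEQ_le_const2)
    have "hm_lim E (\<lambda>k. hm_diff E (X (k + Suc n)) (X (Suc n))) (hm_diff E x (X (Suc n)))"
      unfolding hm_diff_def
      by (intro lim_add lim_const closed X lim_offset x)
    then have "(\<lambda>k. hm_norm E (hm_diff E (X (k + Suc n)) (X (Suc n)))) \<longlonglongrightarrow> hm_norm E (hm_diff E x (X (Suc n)))"
      by (rule lim_norm) (intro closed X)
    then show "(\<lambda>k. hm_norm E (hm_diff E (X (k + Suc n)) (X (Suc n)))) \<longlonglongrightarrow> hm_norm E (hm_diff E (X (Suc n)) x)"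
      by (simp add: norm_diff_commute[OF X xc])
    show "\<exists>N. \<forall>k\<ge>N. hm_norm E (hm_diff E (X (k + Suc n)) (X (Suc n))) \<le> t n / 2"
    proof (intro exI[of _ 0] allI impI)
      fix k
      show "hm_norm E (hm_diff E (X (k + Suc n)) (X (Suc n))) \<le> t n / 2"
        using tail[of "Suc n" k] t[of "Suc n + k"] tS[of n] by (simp add: add.commute[of k])
    qed
  qed
  define b where "b = op_adjoint E a"
  have b: "b x \<in> hm_carrier E" using a xc by (simp add: b_def op_adjoint_adj_ops adj_ops_closed)
  \<comment> \<open>The adjoint moves the operator from \<open>y n\<close> to the fixed vector
    \<open>x\<close>.\<close>
  have fx: "norm (f n x) \<le> hm_norm E (y n) * hm_norm E (b x)" for n
    using cauchy_schwarz[OF y(1)[of n] b] a y(1)[of n] xc by (simp add: f_def b_def inner_adjoint)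
  have low: "norm (f n x) \<ge> t n * c n / 2" for n
  proof -
    have "norm (f n (X (Suc n)) - f n x) \<le> c n * (t n / 2)"
    proof -
      have "norm (f n (X (Suc n)) - f n x) \<le> c n * hm_norm E (hm_diff E (X (Suc n)) x)"
        using cauchy_schwarz[OF ay[of n], of "hm_diff E (X (Suc n)) x"] X xc
        by (simp add: f_def inner_simps closed ay c_def)
      also have "\<dots> \<le> c n * (t n / 2)" using close c[of n] by (intro mult_left_mono) auto
      finally show ?thesis .
    qed
    then show ?thesis using big[of n] norm_triangle_ineq2[of "f n (X (Suc n))" "f n x"]
      by (simp add: mult.commute)
  qed
  have "(4/3) ^ n \<le> 2 * hm_norm E (b x)" for n :: nat
  proof -
    have yn: "hm_norm E (y n) > 0"
    proof (rule ccontr)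
      assume "\<not> ?thesis"
      then have "hm_norm E (y n) = 0" using norm_nonneg[of "y n"] by linarith
      then have "c n = 0" using norm_eq_zeroD[OF y(1)] adj_zero[OF a] by (simp add: c_def norm_zero)
      then show False using c[of n] by simp
    qed
    have "t n * (4 ^ n * hm_norm E (y n)) \<le> t n * c n"
      using y(2)[of n] t[of n] by (intro mult_left_mono) (auto simp: c_def)
    also have "\<dots> \<le> 2 * (hm_norm E (y n) * hm_norm E (b x))" using low[of n] fx[of n] by simp
    finally have "hm_norm E (y n) * (t n * 4 ^ n) \<le> hm_norm E (y n) * (2 * hm_norm E (b x))"
      by (simp add: mult_ac)
    then have "t n * 4 ^ n \<le> 2 * hm_norm E (b x)" using yn by simp
    then show ?thesis by (simp add: t_def power_divide)
  qed
  moreover obtain n where "2 * hm_norm E (b x) < (4/3) ^ n" using real_arch_pow[of "4/3"] by auto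
  ultimately show False by (meson not_le)
qed

lemma adj_lim:
  assumes "a \<in> adj_ops E" "hm_lim E u x" "\<And>n. u n \<in> hm_carrier E"
  shows "hm_lim E (\<lambda>n. a (u n)) (a x)"
proof -
  obtain M where M: "M > 0" "\<And>x. x \<in> hm_carrier E \<Longrightarrow> hm_norm E (a x) \<le> M * hm_norm E x"
    using adj_bounded[OF assms(1)] by blast
  have x: "x \<in> hm_carrier E" using assms by (simp add: hm_lim_def)
  show ?thesis
  proof (rule lim_boundI)
    show "a x \<in> hm_carrier E" using assms(1) x by (rule adj_ops_closed)
    show "(\<lambda>n. M * hm_norm E (hm_diff E (u n) x)) \<longlonglongrightarrow> 0"
      using tendsto_mult_left[of _ 0] assms(2) by (fastforce simp: hm_lim_def)
    show "hm_norm E (hm_diff E (a (u n)) (a x)) \<le> M * hm_norm E (hm_diff E (u n) x)" for n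
      using M(2)[of "hm_diff E (u n) x"] assms x by (simp add: closed adj_diff)
  qed
qed

end

section \<open>Square roots of operators and contractivity of representations\<close>

context hilbert_module
begin

lemma norm_adjoint_le:
  assumes a: "a \<in> adj_ops E" and M: "M \<ge> 0" "\<And>x. x \<in> hm_carrier E \<Longrightarrow> hm_norm E (a x) \<le> M * hm_norm E x"
    and x: "x \<in> hm_carrier E"
  shows "hm_norm E (op_adjoint E a x) \<le> M * hm_norm E x"
proof -
  let ?b = "op_adjoint E a"
  have b: "?b x \<in> hm_carrier E" using a x by (simp add: op_adjoint_adj_ops adj_ops_closed)
  have "hm_inner E (?b x) (?b x) = hm_inner E (a (?b x)) x" using inner_adjoint[OF a b x] by simp
  then have "(hm_norm E (?b x))\<^sup>2 \<le> hm_norm E (a (?b x)) * hm_norm E x"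
    using cauchy_schwarz[OF adj_ops_closed[OF a b] x] by (simp add: norm_power2)
  also have "\<dots> \<le> (M * hm_norm E (?b x)) * hm_norm E x"
    using M(2)[OF b] by (intro mult_right_mono norm_nonneg)
  finally have "hm_norm E (?b x) * hm_norm E (?b x) \<le> hm_norm E (?b x) * (M * hm_norm E x)"
    by (simp add: power2_eq_square mult_ac)
  then show ?thesis
    by (cases "hm_norm E (?b x) = 0") (use M(1) norm_nonneg[of x] norm_nonneg[of "?b x"] in auto)
qed

text \<open>The iteration of \<open>sqrt_one_minus\<close> again, with \<open>h\<close> in the role
  of \<open>x\<close>. The estimates are made for \<open>R n x\<close> at each vector, since
  operators on \<open>E\<close> are not elements of a type of the algebra class; the root is
  \<open>1 - L\<close> with \<open>L\<close> the pointwise limit.\<close>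

lemma operator_sqrt:
  assumes h: "h \<in> adj_ops E" "op_adjoint E h = h"
    and hn: "\<And>x. x \<in> hm_carrier E \<Longrightarrow> hm_norm E (h x) \<le> hm_norm E x"
  obtains s where "s \<in> adj_ops E" "op_adjoint E s = s"
    "\<And>x. x \<in> hm_carrier E \<Longrightarrow> s (s x) = hm_diff E x (h x)"
proof -
  define R where "R = rec_nat (op_scale E 0 (op_id E))
    (\<lambda>_ r. op_scale E (complex_of_real (1/2)) (op_add E h (op_mult E r r)))"
  have R0: "R 0 = op_scale E 0 (op_id E)"
    and RS: "R (Suc n) = op_scale E (complex_of_real (1/2)) (op_add E h (op_mult E (R n) (R n)))" for n
    by (simp_all add: R_def)
  have R: "R n \<in> adj_ops E \<and> op_adjoint E (R n) = R n" for n
    by (induction n) (simp_all add: R0 RS op_adj_ops op_adjoint_scale op_adjoint_id op_adjoint_add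
        op_adjoint_mult h)
  then have Ra: "R n \<in> adj_ops E" and Rs: "op_adjoint E (R n) = R n" for n by auto
  have Rc: "R n x \<in> hm_carrier E" if "x \<in> hm_carrier E" for n x using Ra that by (rule adj_ops_closed)
  have hc: "h x \<in> hm_carrier E" if "x \<in> hm_carrier E" for x using h(1) that by (rule adj_ops_closed)
  have RS': "R (Suc n) x = hm_scale E (complex_of_real (1/2)) (hm_add E (h x) (R n (R n x)))"
    if "x \<in> hm_carrier E" for n x
    using that Rc hc by (simp add: RS op_apply)
  have comm: "c (R n x) = R n (c x)"
    if c: "c \<in> adj_ops E" "\<And>x. x \<in> hm_carrier E \<Longrightarrow> c (h x) = h (c x)" and "x \<in> hm_carrier E" for c n x
    using \<open>x \<in> hm_carrier E\<close>
  proof (induction n arbitrary: x)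
    case (Suc n)
    then show ?case using Rc hc c adj_ops_closed[OF c(1)]
      by (simp add: RS' adj_scale adj_add closed)
  qed (simp add: R0 op_apply adj_scale c adj_ops_closed)
  have Rh: "R n (h x) = h (R n x)" if "x \<in> hm_carrier E" for n x
    using comm[OF h(1) _ that, of n] by simp
  have RR: "R m (R n x) = R n (R m x)" if "x \<in> hm_carrier E" for m n x
    by (rule comm[OF Ra Rh that])
  have bound: "hm_norm E (R n x) \<le> sqrt_bound n * hm_norm E x" if "x \<in> hm_carrier E" for n x
    using that
  proof (induction n arbitrary: x)
    case 0
    then show ?case by (simp add: R0 op_apply norm_scale)
  next
    case (Suc n)
    have "hm_norm E (R n (R n x)) \<le> sqrt_bound n * hm_norm E (R n x)" by (rule Suc.IH) (rule Rc[OF Suc.prems])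
    also have "\<dots> \<le> sqrt_bound n * (sqrt_bound n * hm_norm E x)"
      using Suc sqrt_bound_range by (intro mult_left_mono) auto
    finally have "hm_norm E (R n (R n x)) \<le> (sqrt_bound n)\<^sup>2 * hm_norm E x"
      by (simp add: power2_eq_square)
    moreover have "hm_norm E (hm_add E (h x) (R n (R n x))) \<le> hm_norm E (h x) + hm_norm E (R n (R n x))"
      by (intro norm_add_le hc Rc Suc.prems)
    ultimately have "hm_norm E (hm_add E (h x) (R n (R n x))) \<le> (1 + (sqrt_bound n)\<^sup>2) * hm_norm E x"
      using hn[OF Suc.prems] by (simp add: distrib_right)
    then show ?case using Suc.prems by (simp add: RS' norm_scale closed Rc hc norm_divide)
  qed
  have half: "hm_diff E (hm_scale E c (hm_add E u v)) (hm_scale E c (hm_add E u w)) = hm_scale E c (hm_diff E v w)"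
    if "u \<in> hm_carrier E" "v \<in> hm_carrier E" "w \<in> hm_carrier E" for c u v w
  proof (rule inner_eqI)
    fix z assume "z \<in> hm_carrier E"
    then show "hm_inner E z (hm_diff E (hm_scale E c (hm_add E u v)) (hm_scale E c (hm_add E u w))) =
        hm_inner E z (hm_scale E c (hm_diff E v w))"
      using that scaleC_add_right[of c "hm_inner E z v - hm_inner E z w" "hm_inner E z w"]
      by (simp add: inner_simps closed scaleC_add_right)
  qed (use that in \<open>simp_all add: closed\<close>)
  have step: "hm_norm E (hm_diff E (R (Suc n) x) (R n x)) \<le> (sqrt_bound (Suc n) - sqrt_bound n) * hm_norm E x"
    if "x \<in> hm_carrier E" for n x
    using that
  proof (induction n arbitrary: x)
    case 0
    have "hm_diff E (R (Suc 0) x) (R 0 x) = hm_scale E (complex_of_real (1/2)) (h x)"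
      using 0 by (intro inner_eqI)
        (simp_all add: RS' R0 op_apply inner_simps closed hc adj_ops_closed del: of_real_divide)
    then show ?case using 0 hn[OF 0] by (simp add: norm_scale hc norm_divide)
  next
    case (Suc n)
    let ?d = "hm_diff E (R (Suc n) x) (R n x)"
    have d: "?d \<in> hm_carrier E" using Suc.prems by (simp add: closed Rc)
    have eq: "hm_diff E (R (Suc (Suc n)) x) (R (Suc n) x) =
        hm_scale E (complex_of_real (1/2)) (hm_add E (R (Suc n) ?d) (R n ?d))"
    proof -
      have "hm_diff E (R (Suc (Suc n)) x) (R (Suc n) x) =
          hm_scale E (complex_of_real (1/2)) (hm_diff E (R (Suc n) (R (Suc n) x)) (R n (R n x)))"
        by (rule trans[OF arg_cong2[where f = "hm_diff E", OF RS'[OF Suc.prems] RS'[OF Suc.prems]]])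
          (intro half hc Rc Suc.prems)
      also have "hm_diff E (R (Suc n) (R (Suc n) x)) (R n (R n x)) = hm_add E (R (Suc n) ?d) (R n ?d)"
        using Suc.prems RR[OF Suc.prems, of n "Suc n"]
        by (intro inner_eqI) (simp_all add: inner_simps closed Rc adj_diff[OF Ra])
      finally show ?thesis .
    qed
    have "hm_norm E (hm_add E (R (Suc n) ?d) (R n ?d)) \<le> hm_norm E (R (Suc n) ?d) + hm_norm E (R n ?d)"
      by (intro norm_add_le Rc d)
    also have "\<dots> \<le> (sqrt_bound (Suc n) + sqrt_bound n) * hm_norm E ?d"
      using bound[OF d, of "Suc n"] bound[OF d, of n] by (simp add: distrib_right del: sqrt_bound.simps)
    also have "\<dots> \<le> (sqrt_bound (Suc n) + sqrt_bound n) * ((sqrt_bound (Suc n) - sqrt_bound n) * hm_norm E x)"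
      using Suc.IH[OF Suc.prems] sqrt_bound_range[of "Suc n"] sqrt_bound_range[of n]
      by (intro mult_left_mono) (auto simp del: sqrt_bound.simps)
    finally show ?case
      unfolding eq sqrt_bound_step using d by (simp add: norm_scale closed Rc norm_divide del: sqrt_bound.simps)
  qed
  have tail: "hm_norm E (hm_diff E (R (n + k) x) (R n x)) \<le> (sqrt_bound (n + k) - sqrt_bound n) * hm_norm E x"
    if x: "x \<in> hm_carrier E" for n k x
  proof (induction k)
    case 0
    then show ?case by (simp add: diff_self Rc x norm_zero)
  next
    case (Suc k)
    then show ?case
      using norm_diff_triangle[OF Rc[OF x, of "Suc (n + k)"] Rc[OF x, of "n + k"] Rc[OF x, of n]] step[OF x, of "n + k"]
      by (simp add: left_diff_distrib del: sqrt_bound.simps)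
  qed
  have ex: "\<exists>y. hm_lim E (\<lambda>n. R n x) y" if x: "x \<in> hm_carrier E" for x
  proof (rule cauchy_lim[of "\<lambda>n. R n x", OF Rc[OF x]])
    fix \<epsilon> :: real assume \<epsilon>: "\<epsilon> > 0"
    have "\<epsilon> / (hm_norm E x + 1) > 0" using \<epsilon> norm_nonneg[of x] by simp
    then obtain N where N: "\<And>m n. m \<ge> N \<Longrightarrow> n \<ge> N \<Longrightarrow> dist (sqrt_bound m) (sqrt_bound n) < \<epsilon> / (hm_norm E x + 1)"
      using Cauchy_sqrt_bound by (metis metric_CauchyD)
    have *: "hm_norm E (hm_diff E (R m x) (R n x)) < \<epsilon>" if "n \<ge> N" "m \<ge> n" for m n
    proof -
      have p: "hm_norm E x + 1 > 0" using norm_nonneg[of x] by simp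
      have "sqrt_bound m - sqrt_bound n < \<epsilon> / (hm_norm E x + 1)" using N[of m n] that by (simp add: dist_real_def)
      then have "(sqrt_bound m - sqrt_bound n) * hm_norm E x \<le> \<epsilon> / (hm_norm E x + 1) * hm_norm E x"
        using norm_nonneg[of x] by (intro mult_right_mono) auto
      also have "\<dots> < \<epsilon>" using \<epsilon> p by (simp add: field_simps)
      finally show ?thesis using tail[OF x, of n "m - n"] that by simp
    qed
    show "\<exists>N. \<forall>m\<ge>N. \<forall>n\<ge>N. hm_norm E (hm_diff E (R m x) (R n x)) < \<epsilon>"
    proof (intro exI[of _ N] allI impI)
      fix m n assume "m \<ge> N" "n \<ge> N"
      then show "hm_norm E (hm_diff E (R m x) (R n x)) < \<epsilon>"
        using *[of n m] *[of m n] norm_diff_commute[OF Rc[OF x, of m] Rc[OF x, of n]] by (cases "m \<ge> n") auto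
    qed
  qed blast
  define L where "L x = (SOME y. hm_lim E (\<lambda>n. R n x) y)" for x
  have L: "hm_lim E (\<lambda>n. R n x) (L x)" if "x \<in> hm_carrier E" for x
    unfolding L_def using someI_ex[OF ex[OF that]] .
  have Lc: "L x \<in> hm_carrier E" if "x \<in> hm_carrier E" for x using L[OF that] by (rule lim_closed)
  have Ls: "hm_inner E (L x) y = hm_inner E x (L y)" if "x \<in> hm_carrier E" "y \<in> hm_carrier E" for x y
  proof -
    have "(\<lambda>n. hm_inner E (R n x) y) \<longlonglongrightarrow> hm_inner E (L x) y"
      by (intro lim_inner L lim_const Rc that)
    moreover have "(\<lambda>n. hm_inner E x (R n y)) \<longlonglongrightarrow> hm_inner E x (L y)"
      by (intro lim_inner L lim_const Rc that)
    moreover have "hm_inner E (R n x) y = hm_inner E x (R n y)" for n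
      using inner_adjoint[OF Ra that] Rs by simp
    ultimately show ?thesis using LIMSEQ_unique by simp
  qed
  \<comment> \<open>The product \<open>R n (R n x)\<close> is tested against \<open>z\<close> and
    one factor is moved to \<open>z\<close>, so that convergence at single vectors is
    enough.\<close>
  have LL: "hm_add E (L x) (L x) = hm_add E (h x) (L (L x))" if x: "x \<in> hm_carrier E" for x
  proof (rule inner_eqI)
    fix z assume z: "z \<in> hm_carrier E"
    have "(\<lambda>n. hm_inner E z (h x) + hm_inner E (R n z) (R n x)) \<longlonglongrightarrow> hm_inner E z (h x) + hm_inner E (L z) (L x)"
      by (intro tendsto_add tendsto_const lim_inner L Rc x z)
    moreover have "hm_inner E z (h x) + hm_inner E (R n z) (R n x) = hm_inner E z (R (Suc n) x) + hm_inner E z (R (Suc n) x)" for n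
    proof -
      have "hm_inner E z (R (Suc n) x) + hm_inner E z (R (Suc n) x) = hm_inner E z (h x) + hm_inner E z (R n (R n x))"
        using x z by (simp add: RS' inner_simps closed hc Rc flip: scaleC_add_left)
      also have "hm_inner E z (R n (R n x)) = hm_inner E (R n z) (R n x)"
        using inner_adjoint_left[OF Ra z Rc[OF x]] Rs by simp
      finally show ?thesis by simp
    qed
    ultimately have "(\<lambda>n. hm_inner E z (R (Suc n) x) + hm_inner E z (R (Suc n) x)) \<longlonglongrightarrow> hm_inner E z (h x) + hm_inner E (L z) (L x)"
      by simp
    moreover have "(\<lambda>n. hm_inner E z (R n x)) \<longlonglongrightarrow> hm_inner E z (L x)"
      by (intro lim_inner L lim_const Rc x z)
    then have "(\<lambda>n. hm_inner E z (R (Suc n) x)) \<longlonglongrightarrow> hm_inner E z (L x)" by (rule LIMSEQ_Suc)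
    then have "(\<lambda>n. hm_inner E z (R (Suc n) x) + hm_inner E z (R (Suc n) x)) \<longlonglongrightarrow> hm_inner E z (L x) + hm_inner E z (L x)"
      by (intro tendsto_add)
    ultimately have "hm_inner E z (L x) + hm_inner E z (L x) = hm_inner E z (h x) + hm_inner E (L z) (L x)"
      using LIMSEQ_unique by blast
    then show "hm_inner E z (hm_add E (L x) (L x)) = hm_inner E z (hm_add E (h x) (L (L x)))"
      using x z Ls[OF z Lc[OF x]] by (simp add: inner_simps closed hc Lc)
  qed (use x Lc hc in \<open>simp_all add: closed\<close>)
  define s where "s = (\<lambda>x\<in>hm_carrier E. hm_diff E x (L x))"
  have s: "s \<in> hm_carrier E \<rightarrow>\<^sub>E hm_carrier E" by (auto simp: s_def closed Lc)
  have ss: "hm_inner E (s x) y = hm_inner E x (s y)" if "x \<in> hm_carrier E" "y \<in> hm_carrier E" for x y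
    using that Ls[OF that] by (simp add: s_def inner_simps closed Lc)
  show ?thesis
  proof (rule that[of s])
    show sa: "s \<in> adj_ops E" "op_adjoint E s = s" using adj_opsI[OF s s ss] by auto
    fix x assume x: "x \<in> hm_carrier E"
    have "s (s x) = hm_diff E (s x) (s (L x))"
      using adj_diff[OF sa(1) x Lc[OF x]] x by (simp add: s_def)
    also have "\<dots> = hm_diff E x (h x)"
    proof (rule inner_eqI)
      fix z assume z: "z \<in> hm_carrier E"
      have "hm_inner E z (L x) + hm_inner E z (L x) = hm_inner E z (h x) + hm_inner E z (L (L x))"
        using arg_cong[OF LL[OF x], of "hm_inner E z"] x z by (simp add: inner_simps closed hc Lc)
      then show "hm_inner E z (hm_diff E (s x) (s (L x))) = hm_inner E z (hm_diff E x (h x))"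
        using x z by (simp add: s_def inner_simps closed hc Lc algebra_simps)
    qed (use x Lc hc in \<open>simp_all add: closed s_def\<close>)
    finally show "s (s x) = hm_diff E x (h x)" .
  qed
qed

end

section \<open>Unital representations of the adjointable operators on another module\<close>

locale module_rep = E: hilbert_module E + F: hilbert_module F
  for E :: "('e, 'b::unital_cstar_algebra, 'y) hilbert_mod_scheme"
    and F :: "('f, 'b, 'z) hilbert_mod_scheme"
    and \<pi> :: "('e \<Rightarrow> 'e) \<Rightarrow> 'f \<Rightarrow> 'f" +
  assumes rep_star_hom: "star_hom E F \<pi>"
    and rep_unital: "\<pi> (op_id E) = op_id F"
begin

lemma rep_adj_ops: "a \<in> adj_ops E \<Longrightarrow> \<pi> a \<in> adj_ops F"
  using rep_star_hom by (auto simp: star_hom_def)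

lemma rep_closed: "a \<in> adj_ops E \<Longrightarrow> y \<in> hm_carrier F \<Longrightarrow> \<pi> a y \<in> hm_carrier F"
  using rep_adj_ops F.adj_ops_closed by blast

lemma rep_add:
  "a \<in> adj_ops E \<Longrightarrow> b \<in> adj_ops E \<Longrightarrow> y \<in> hm_carrier F \<Longrightarrow>
    \<pi> (op_add E a b) y = hm_add F (\<pi> a y) (\<pi> b y)"
  using rep_star_hom by (simp add: star_hom_def F.op_apply)

lemma rep_scale:
  "a \<in> adj_ops E \<Longrightarrow> y \<in> hm_carrier F \<Longrightarrow> \<pi> (op_scale E c a) y = hm_scale F c (\<pi> a y)"
  using rep_star_hom by (simp add: star_hom_def F.op_apply)

lemma rep_mult:
  "a \<in> adj_ops E \<Longrightarrow> b \<in> adj_ops E \<Longrightarrow> y \<in> hm_carrier F \<Longrightarrow> \<pi> (op_mult E a b) y = \<pi> a (\<pi> b y)"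
  using rep_star_hom by (simp add: star_hom_def F.op_apply)

lemma rep_id: "y \<in> hm_carrier F \<Longrightarrow> \<pi> (op_id E) y = y"
  by (simp add: rep_unital F.op_apply)

lemma rep_inner:
  "a \<in> adj_ops E \<Longrightarrow> x \<in> hm_carrier F \<Longrightarrow> y \<in> hm_carrier F \<Longrightarrow>
    hm_inner F (\<pi> a x) y = hm_inner F x (\<pi> (op_adjoint E a) y)"
  using rep_star_hom by (simp add: star_hom_def F.inner_adjoint rep_adj_ops)

text \<open>With \<open>K\<close> a bound for \<open>a\<close>, the operator
  \<open>1 - a^* a / K^2\<close> is the square of a selfadjoint operator \<open>s\<close>. Applying
  \<open>\<pi>\<close> and evaluating at \<open>y\<close> gives the positive element
  \<open>\<langle>\<pi> s y, \<pi> s y\<rangle>\<close>, which is the claimed estimate.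
  Contractivity is thus a consequence of the algebraic rules for \<open>\<pi>\<close>.\<close>

lemma rep_norm_le:
  assumes a: "a \<in> adj_ops E" and M: "M \<ge> 0" "\<And>x. x \<in> hm_carrier E \<Longrightarrow> hm_norm E (a x) \<le> M * hm_norm E x"
    and y: "y \<in> hm_carrier F"
  shows "hm_norm F (\<pi> a y) \<le> M * hm_norm F y"
proof (rule field_le_epsilon)
  \<comment> \<open>A positive bound can be divided by; the case \<open>M = 0\<close> is reached
    through \<open>M + ?d\<close>.\<close>
  have pos: "hm_norm F (\<pi> a y) \<le> K * hm_norm F y"
    if K: "K > 0" "\<And>x. x \<in> hm_carrier E \<Longrightarrow> hm_norm E (a x) \<le> K * hm_norm E x" for K
  proof -
    let ?a = "op_adjoint E a"
    have a': "?a \<in> adj_ops E" using a by (rule E.op_adjoint_adj_ops)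
    define h where "h = op_scale E (complex_of_real (1 / K\<^sup>2)) (op_mult E ?a a)"
    have h: "h \<in> adj_ops E" by (simp add: h_def E.op_adj_ops a a')
    have hs: "op_adjoint E h = h"
      by (simp add: h_def E.op_adj_ops a a' E.op_adjoint_scale E.op_adjoint_mult E.op_adjoint_adjoint)
    have hn: "hm_norm E (h x) \<le> hm_norm E x" if x: "x \<in> hm_carrier E" for x
    proof -
      have ax: "a x \<in> hm_carrier E" using a x by (rule E.adj_ops_closed)
      have "hm_norm E (?a (a x)) \<le> K * hm_norm E (a x)"
        using K by (intro E.norm_adjoint_le a ax) auto
      also have "\<dots> \<le> K * (K * hm_norm E x)" using K(2)[OF x] K(1) by (intro mult_left_mono) auto
      finally have "hm_norm E (?a (a x)) \<le> K\<^sup>2 * hm_norm E x" by (simp add: power2_eq_square)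
      then show ?thesis using K(1)
        by (simp add: h_def E.op_apply x E.norm_scale E.adj_ops_closed[OF a' ax] norm_divide norm_power divide_le_eq mult.commute)
    qed
    obtain s where s: "s \<in> adj_ops E" "op_adjoint E s = s"
      "\<And>x. x \<in> hm_carrier E \<Longrightarrow> s (s x) = hm_diff E x (h x)"
      using E.operator_sqrt[OF h hs hn] by blast
    have op: "op_mult E s s = op_add E (op_id E) (op_scale E (- 1) h)"
      by (rule E.adj_ops_eqI) (simp_all add: E.op_adj_ops s h E.op_apply hm_diff_def)
    have py: "\<pi> a y \<in> hm_carrier F" "\<pi> s y \<in> hm_carrier F" "\<pi> ?a (\<pi> a y) \<in> hm_carrier F"
      using a a' s y by (simp_all add: rep_closed)
    have "hm_inner F (\<pi> s y) (\<pi> s y) = hm_inner F y (\<pi> s (\<pi> s y))"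
      using rep_inner[OF s(1) y py(2)] s(2) by simp
    also have "\<pi> s (\<pi> s y) = \<pi> (op_mult E s s) y" using rep_mult[OF s(1) s(1) y] by simp
    also have "\<dots> = hm_add F y (hm_scale F (- 1) (hm_scale F (complex_of_real (1 / K\<^sup>2)) (\<pi> ?a (\<pi> a y))))"
      unfolding op using y a a' h
      by (simp add: rep_add rep_id rep_scale E.op_adj_ops) (simp add: h_def rep_scale rep_mult E.op_adj_ops)
    also have "hm_inner F y \<dots> = hm_inner F y y - (1 / K\<^sup>2) *\<^sub>R hm_inner F y (\<pi> ?a (\<pi> a y))"
      using y py unfolding scaleC_of_real[symmetric] by (simp add: F.inner_simps F.closed)
    also have "hm_inner F y (\<pi> ?a (\<pi> a y)) = hm_inner F (\<pi> a y) (\<pi> a y)"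
      using rep_inner[OF a y py(1)] by simp
    finally have "cstar_positive (hm_inner F y y - (1 / K\<^sup>2) *\<^sub>R hm_inner F (\<pi> a y) (\<pi> a y))"
      using F.inner_positive[OF py(2)] by simp
    then have "norm ((1 / K\<^sup>2) *\<^sub>R hm_inner F (\<pi> a y) (\<pi> a y)) \<le> norm (hm_inner F y y)"
      by (intro cstar_positive_norm_mono cstar_positive_scaleR F.inner_positive py) auto
    then have "(hm_norm F (\<pi> a y))\<^sup>2 \<le> (K * hm_norm F y)\<^sup>2"
      using K(1) by (simp add: F.norm_power2 power_mult_distrib divide_le_eq mult.commute)
    then show ?thesis by (rule power2_le_imp_le) (use K(1) F.norm_nonneg in auto)
  qed
  fix \<epsilon> :: real assume \<epsilon>: "\<epsilon> > 0"
  let ?d = "\<epsilon> / (hm_norm F y + 1)"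
  have p: "hm_norm F y + 1 > 0" using F.norm_nonneg[of y] by simp
  have d: "?d > 0" using \<epsilon> p by simp
  have "hm_norm F (\<pi> a y) \<le> (M + ?d) * hm_norm F y"
  proof (rule pos)
    show "hm_norm E (a x) \<le> (M + ?d) * hm_norm E x" if "x \<in> hm_carrier E" for x
      using M(2)[OF that] mult_nonneg_nonneg[OF less_imp_le[OF d] E.norm_nonneg[of x]]
      by (simp add: distrib_right)
  qed (use M(1) d in simp)
  also have "?d * hm_norm F y \<le> \<epsilon>" using \<epsilon> p by (simp add: field_simps)
  then have "(M + ?d) * hm_norm F y \<le> M * hm_norm F y + \<epsilon>" by (simp add: distrib_right)
  finally show "hm_norm F (\<pi> a y) \<le> M * hm_norm F y + \<epsilon>" .
qed

lemma rep_rank_one_norm_le: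
  assumes "x \<in> hm_carrier E" "x' \<in> hm_carrier E" "y \<in> hm_carrier F"
  shows "hm_norm F (\<pi> (rank_one E x x') y) \<le> hm_norm E x * hm_norm E x' * hm_norm F y"
proof (rule rep_norm_le)
  fix z assume z: "z \<in> hm_carrier E"
  have "hm_norm E (rank_one E x x' z) \<le> hm_norm E x * norm (hm_inner E x' z)"
    using assms z by (simp add: E.op_apply E.norm_act_le)
  also have "\<dots> \<le> hm_norm E x * (hm_norm E x' * hm_norm E z)"
    using assms z by (intro mult_left_mono E.cauchy_schwarz E.norm_nonneg)
  finally show "hm_norm E (rank_one E x x' z) \<le> hm_norm E x * hm_norm E x' * hm_norm E z" by simp
qed (use assms in \<open>simp_all add: E.rank_one_adj_ops E.norm_nonneg\<close>)

lemma rep_lim: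
  "a \<in> adj_ops E \<Longrightarrow> hm_lim F u y \<Longrightarrow> (\<And>n. u n \<in> hm_carrier F) \<Longrightarrow> hm_lim F (\<lambda>n. \<pi> a (u n)) (\<pi> a y)"
  by (rule F.adj_lim[OF rep_adj_ops])

end

section \<open>Positivity of the inner product of the dual tensor product\<close>

lemma tendsto_sum_list:
  fixes f :: "nat \<Rightarrow> 'i \<Rightarrow> 'a::real_normed_vector"
  shows "(\<And>x. x \<in> set xs \<Longrightarrow> (\<lambda>n. f n x) \<longlonglongrightarrow> g x) \<Longrightarrow> (\<lambda>n. \<Sum>x\<leftarrow>xs. f n x) \<longlonglongrightarrow> (\<Sum>x\<leftarrow>xs. g x)"
  by (induction xs) (auto intro: tendsto_add)

lemma sum_list_swap:
  "(\<Sum>x\<leftarrow>xs. \<Sum>y\<leftarrow>ys. f x y) = (\<Sum>y\<leftarrow>ys. \<Sum>x\<leftarrow>xs. f x y :: 'a::comm_monoid_add)"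
  by (induction xs) (simp_all add: sum_list_addf)

lemma sum_list_concat_map:
  "(\<Sum>x\<leftarrow>concat (map g ys). f x) = (\<Sum>y\<leftarrow>ys. \<Sum>x\<leftarrow>g y. f x :: 'a::monoid_add)"
  by (induction ys) simp_all

lemma sum_list_cong: "(\<And>x. x \<in> set xs \<Longrightarrow> f x = g x) \<Longrightarrow> (\<Sum>x\<leftarrow>xs. f x) = (\<Sum>x\<leftarrow>xs. g x)"
  by (simp cong: map_cong)

lemma mult_sum_list_mult:
  "a * (\<Sum>x\<leftarrow>xs. f x) * b = (\<Sum>x\<leftarrow>xs. a * f x * (b::'a::semiring_0))"
  by (induction xs) (simp_all add: algebra_simps)

section \<open>Approximate units and fullness\<close>

context hilbert_module
begin

text \<open>Put \<open>S = \<Sum>\<langle>x, x\<rangle>\<close> and \<open>q = (S + e)^-1\<close>.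
  The vectors \<open>z = x p\<close> with \<open>p^2 = q\<close> have
  \<open>\<Sum>\<langle>z, z\<rangle> = 1 - e q\<close>, so the error at \<open>x\<close> is
  \<open>e x q\<close>, and its squared norm is at most
  \<open>e^2 norm (q S q) \<le> e^2 norm q \<le> e\<close>. This stands in for a frame as long as
  the module is not known to be full.\<close>

lemma approximate_unit:
  assumes xs: "set xs \<subseteq> hm_carrier E" and e: "e > 0"
  obtains es where "set es \<subseteq> hm_carrier E"
    "\<And>x. x \<in> set xs \<Longrightarrow> (hm_norm E (hm_diff E x (hm_act E x (\<Sum>z\<leftarrow>es. hm_inner E z z))))\<^sup>2 \<le> e"
proof -
  define S where "S = (\<Sum>x\<leftarrow>xs. hm_inner E x x)"
  have S: "cstar_positive S" unfolding S_def using xs by (intro cstar_positive_sum_list inner_positive) auto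
  have "cstar_positive ((S + e *\<^sub>R 1) - e *\<^sub>R 1)" using S by simp
  then obtain p where p: "star p = p" "p * (S + e *\<^sub>R 1) * p = 1" "(S + e *\<^sub>R 1) * (p * p) = 1"
    "e * norm (p * p) \<le> 1" using cstar_inverse_sqrt[OF _ e] by blast
  define q where "q = p * p"
  have sq: "star q = q" by (simp add: q_def star_mult p(1))
  have Sq: "S * q = 1 - e *\<^sub>R q" using p(3) by (simp add: q_def algebra_simps)
  have pSp: "p * S * p = 1 - e *\<^sub>R q" using p(2) by (simp add: q_def algebra_simps)
  let ?es = "map (\<lambda>x. hm_act E x p) xs"
  have "(\<Sum>z\<leftarrow>?es. hm_inner E z z) = (\<Sum>x\<leftarrow>xs. p * hm_inner E x x * p)"
    using xs by (simp add: o_def) (intro sum_list_cong, auto simp: inner_simps closed p(1) mult.assoc)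
  then have u: "(\<Sum>z\<leftarrow>?es. hm_inner E z z) = 1 - e *\<^sub>R q"
    by (simp add: mult_sum_list_mult[symmetric] S_def[symmetric] pSp)
  show thesis
  proof (rule that[of ?es])
    show "set ?es \<subseteq> hm_carrier E" using xs by (auto simp: closed)
    fix x assume x: "x \<in> set xs"
    then have xc: "x \<in> hm_carrier E" using xs by auto
    have d: "hm_diff E x (hm_act E x (1 - e *\<^sub>R q)) = hm_act E x (e *\<^sub>R q)"
      using xc by (intro inner_eqI) (simp_all add: inner_simps closed algebra_simps)
    have "(hm_norm E (hm_act E x (e *\<^sub>R q)))\<^sup>2 = norm ((e * e) *\<^sub>R (q * hm_inner E x x * q))"
      using xc by (simp add: norm_power2 inner_simps closed star_scaleR sq mult.assoc)
    also have "\<dots> = (e * e) * norm (star q * hm_inner E x x * q)" using e by (simp add: sq)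
    also have "norm (star q * hm_inner E x x * q) \<le> norm (\<Sum>x\<leftarrow>xs. star q * hm_inner E x x * q)"
      using x xs by (intro norm_le_norm_sum_list cstar_positive_conj inner_positive) auto
    also have "(\<Sum>x\<leftarrow>xs. star q * hm_inner E x x * q) = q * S * q"
      by (simp add: mult_sum_list_mult[symmetric] S_def sq)
    \<comment> \<open>From \<open>S q = 1 - e q\<close> the difference \<open>q - q S q\<close> is
      \<open>e q^2\<close>, a positive element.\<close>
    also have "norm (q * S * q) \<le> norm q"
    proof (rule cstar_positive_norm_mono)
      show "cstar_positive (q * S * q)" using cstar_positive_conj[OF S, of q] by (simp add: sq)
      have "q - q * S * q = e *\<^sub>R (star q * q)" by (simp add: mult.assoc Sq sq algebra_simps)
      then show "cstar_positive (q - q * S * q)"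
        using e by (simp add: cstar_positive_scaleR cstar_positive_star_mult)
    qed
    finally have "(hm_norm E (hm_act E x (e *\<^sub>R q)))\<^sup>2 \<le> e * (e * norm q)"
      using e by (simp add: mult_left_mono)
    also have "\<dots> \<le> e * 1" using p(4) e by (intro mult_left_mono) (simp_all add: q_def)
    finally show "(hm_norm E (hm_diff E x (hm_act E x (\<Sum>z\<leftarrow>?es. hm_inner E z z))))\<^sup>2 \<le> e"
      by (simp only: u d mult_1_right)
  qed
qed

text \<open>Polarisation: with \<open>c = \<Sum>\<langle>x, y\<rangle>\<close>, positivity of
  \<open>\<langle>x - y, x - y\<rangle>\<close> gives \<open>\<Sum>(\<langle>x, x\<rangle> +
  \<langle>y, y\<rangle>) \<ge> c + star c\<close>, and \<open>c + star c \<ge> 1\<close> as soon as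
  \<open>c\<close> is within \<open>1/2\<close> of \<open>1\<close>. The left side is therefore
  invertible, and acting with its inverse square root normalises the vectors.\<close>

lemma full_of_approximate_one:
  assumes ps: "set ps \<subseteq> hm_carrier E \<times> hm_carrier E"
    and near: "norm ((\<Sum>p\<leftarrow>ps. hm_inner E (fst p) (snd p)) - 1) \<le> 1/2"
  obtains gs where "set gs \<subseteq> hm_carrier E" "(\<Sum>g\<leftarrow>gs. hm_inner E g g) = 1"
proof -
  define c where "c = (\<Sum>p\<leftarrow>ps. hm_inner E (fst p) (snd p))"
  define S where "S = (\<Sum>g\<leftarrow>map fst ps @ map snd ps. hm_inner E g g)"
  have "S - (c + star c) = (\<Sum>p\<leftarrow>ps. hm_inner E (hm_diff E (fst p) (snd p)) (hm_diff E (fst p) (snd p)))"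
  proof -
    have sc: "star c = (\<Sum>p\<leftarrow>ps. hm_inner E (snd p) (fst p))"
      unfolding c_def star_sum_list using ps by (simp add: o_def) (intro sum_list_cong star_inner, auto)
    have "(\<Sum>p\<leftarrow>ps. hm_inner E (hm_diff E (fst p) (snd p)) (hm_diff E (fst p) (snd p))) =
      (\<Sum>p\<leftarrow>ps. (hm_inner E (fst p) (fst p) + hm_inner E (snd p) (snd p)) -
        (hm_inner E (fst p) (snd p) + hm_inner E (snd p) (fst p)))"
      using ps by (intro sum_list_cong) (auto simp: inner_simps closed)
    then show ?thesis
      unfolding sc unfolding S_def c_def by (simp add: sum_list_subtractf sum_list_addf o_def)
  qed
  then have "cstar_positive (S - (c + star c))"
    using ps by (auto intro!: cstar_positive_sum_list inner_positive closed)
  moreover have "cstar_positive (1 *\<^sub>R 1 - (2 *\<^sub>R 1 - (c + star c)))"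
  proof (rule cstar_positive_norm_minus)
    show "star (2 *\<^sub>R 1 - (c + star c)) = 2 *\<^sub>R 1 - (c + star c)"
      by (simp add: star_diff star_add star_star star_scaleR add.commute)
    have "2 *\<^sub>R 1 - (c + star c) = - (c - 1) + - star (c - 1)" by (simp add: star_diff scaleR_2)
    also have "norm \<dots> \<le> norm (- (c - 1)) + norm (- star (c - 1))" by (rule norm_triangle_ineq)
    also have "\<dots> \<le> 1" unfolding norm_minus_cancel norm_star using near by (simp add: c_def)
    finally show "norm (2 *\<^sub>R 1 - (c + star c)) \<le> 1" .
  qed
  ultimately have "cstar_positive ((S - (c + star c)) + (1 *\<^sub>R 1 - (2 *\<^sub>R 1 - (c + star c))))"
    by (rule cstar_positive_add)
  moreover have "(S - (c + star c)) + (1 *\<^sub>R 1 - (2 *\<^sub>R 1 - (c + star c))) = S - 1 *\<^sub>R 1"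
    by (simp add: scaleR_2)
  ultimately have "cstar_positive (S - 1 *\<^sub>R 1)" by simp
  then obtain p where p: "star p = p" "p * S * p = 1" using cstar_inverse_sqrt[of S 1] by auto
  let ?hs = "map fst ps @ map snd ps"
  have hs: "set ?hs \<subseteq> hm_carrier E" using ps by auto
  show thesis
  proof (rule that[of "map (\<lambda>x. hm_act E x p) ?hs"])
    show "set (map (\<lambda>x. hm_act E x p) ?hs) \<subseteq> hm_carrier E" using ps by (auto simp: closed)
    have "(\<Sum>g\<leftarrow>map (\<lambda>x. hm_act E x p) ?hs. hm_inner E g g) = (\<Sum>x\<leftarrow>?hs. p * hm_inner E x x * p)"
      unfolding map_map o_def
      using hs by (intro sum_list_cong) (auto simp: inner_simps closed p(1) mult.assoc)
    also have "\<dots> = p * S * p" by (simp only: mult_sum_list_mult[symmetric] S_def)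
    finally show "(\<Sum>g\<leftarrow>map (\<lambda>x. hm_act E x p) ?hs. hm_inner E g g) = 1" by (simp only: p)
  qed
qed

end

section \<open>The semi-inner product of \<open>E^* \<odot> F\<close> on formal sums\<close>

locale dual_rep = module_rep E F \<pi>
  for E :: "('e, 'b::unital_cstar_algebra) hilbert_mod"
    and F :: "('f, 'b, 'z) hilbert_mod_scheme"
    and \<pi> :: "('e \<Rightarrow> 'e) \<Rightarrow> 'f \<Rightarrow> 'f"
begin

text \<open>The inner product of two elementary tensors; a pair of \<open>x\<close> and
  \<open>y\<close> stands for \<open>x^* \<odot> y\<close>.\<close>

abbreviation kernel :: "'e \<times> 'f \<Rightarrow> 'e \<times> 'f \<Rightarrow> 'b" where
  "kernel p q \<equiv> hm_inner F (snd p) (\<pi> (rank_one E (fst p) (fst q)) (snd q))"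

abbreviation dual_inner :: "('e \<times> 'f) list \<Rightarrow> ('e \<times> 'f) list \<Rightarrow> 'b" where
  "dual_inner \<equiv> formal_inner (dual_corr E) (with_lact F \<pi>)"

abbreviation formal_sums :: "('e \<times> 'f) list set" where
  "formal_sums \<equiv> lists (hm_carrier E \<times> hm_carrier F)"

lemma dual_inner_eq: "dual_inner s r = (\<Sum>p\<leftarrow>s. \<Sum>q\<leftarrow>r. kernel p q)"
  by (simp add: formal_inner_def dual_corr_def with_lact_def split_def)

lemma rep_rank_one_closed:
  "x \<in> hm_carrier E \<Longrightarrow> x' \<in> hm_carrier E \<Longrightarrow> y \<in> hm_carrier F \<Longrightarrow> \<pi> (rank_one E x x') y \<in> hm_carrier F"
  by (simp add: rep_closed E.rank_one_adj_ops)

lemma rep_rank_one_add: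
  "x \<in> hm_carrier E \<Longrightarrow> z \<in> hm_carrier E \<Longrightarrow> x' \<in> hm_carrier E \<Longrightarrow> y \<in> hm_carrier F \<Longrightarrow>
    \<pi> (rank_one E (hm_add E x z) x') y = hm_add F (\<pi> (rank_one E x x') y) (\<pi> (rank_one E z x') y)"
  by (simp add: E.rank_one_add rep_add E.rank_one_adj_ops)

text \<open>The product of the rank one operators of \<open>(x, e)\<close> and
  \<open>(e, x')\<close> is that of \<open>(x \<langle>e, e\<rangle>, x')\<close>. Read backwards:
  inserting \<open>\<langle>e, e\<rangle>\<close> next to \<open>x\<close> turns a value of
  \<open>kernel\<close> into a genuine inner product of vectors of \<open>F\<close>.\<close>

lemma rep_rank_one_inner:
  assumes "x \<in> hm_carrier E" "x' \<in> hm_carrier E" "e \<in> hm_carrier E" "y \<in> hm_carrier F" "y' \<in> hm_carrier F"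
  shows "hm_inner F (\<pi> (rank_one E e x) y) (\<pi> (rank_one E e x') y') =
    hm_inner F y (\<pi> (rank_one E (hm_act E x (hm_inner E e e)) x') y')"
proof -
  have "op_mult E (rank_one E x e) (rank_one E e x') = rank_one E (hm_act E x (hm_inner E e e)) x'"
    using assms by (simp add: E.op_mult_rank_one E.rank_one_adj_ops E.op_apply)
  then show ?thesis
    using assms rep_mult[of "rank_one E x e" "rank_one E e x'" y']
    by (simp add: rep_inner E.rank_one_adj_ops rep_rank_one_closed E.op_adjoint_rank_one)
qed

lemma rep_rank_one_act_sum:
  assumes x: "x \<in> hm_carrier E" "x' \<in> hm_carrier E" "y \<in> hm_carrier F" "y' \<in> hm_carrier F"
  shows "hm_inner F y (\<pi> (rank_one E (hm_act E x (\<Sum>b\<leftarrow>bs. f b)) x') y') =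
    (\<Sum>b\<leftarrow>bs. hm_inner F y (\<pi> (rank_one E (hm_act E x (f b)) x') y'))"
proof -
  define g where "g b = hm_inner F y (\<pi> (rank_one E (hm_act E x b) x') y')" for b
  have add: "g (b + c) = g b + g c" for b c
    using x by (simp add: g_def E.act_add rep_rank_one_add E.closed F.inner_simps rep_rank_one_closed)
  have "g 0 = 0" using add[of 0 0] by simp
  then have "g (\<Sum>b\<leftarrow>bs. f b) = (\<Sum>b\<leftarrow>bs. g (f b))" by (induction bs) (simp_all add: add)
  then show ?thesis by (simp add: g_def)
qed

text \<open>Inserting the approximate unit \<open>u n = \<Sum>\<langle>z, z\<rangle>\<close> next to
  each first component turns the form into \<open>\<Sum>\<langle>v z, v z\<rangle>\<close>, by
  \<open>rep_rank_one_inner\<close>. The error vanishes because \<open>\<pi>\<close> is contractive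
  on rank one operators, and the cone is closed.\<close>

lemma dual_inner_positive:
  assumes s: "s \<in> formal_sums"
  shows "cstar_positive (dual_inner s s)"
proof -
  have sc: "fst p \<in> hm_carrier E" "snd p \<in> hm_carrier F" if "p \<in> set s" for p
    using s that by auto
  have "\<exists>es. set es \<subseteq> hm_carrier E \<and> (\<forall>p\<in>set s.
      (hm_norm E (hm_diff E (fst p) (hm_act E (fst p) (\<Sum>z\<leftarrow>es. hm_inner E z z))))\<^sup>2 \<le> 1 / real (Suc n))" for n
  proof -
    obtain es where "set es \<subseteq> hm_carrier E" "\<And>x. x \<in> set (map fst s) \<Longrightarrow>
        (hm_norm E (hm_diff E x (hm_act E x (\<Sum>z\<leftarrow>es. hm_inner E z z))))\<^sup>2 \<le> 1 / real (Suc n)"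
      by (rule E.approximate_unit[of "map fst s" "1 / real (Suc n)"]) (use sc in auto)
    then show ?thesis by (intro exI[of _ es]) auto
  qed
  then obtain es where es: "\<And>n. set (es n) \<subseteq> hm_carrier E"
    "\<And>n p. p \<in> set s \<Longrightarrow>
      (hm_norm E (hm_diff E (fst p) (hm_act E (fst p) (\<Sum>z\<leftarrow>es n. hm_inner E z z))))\<^sup>2 \<le> 1 / real (Suc n)"
    by metis
  define u where "u n = (\<Sum>z\<leftarrow>es n. hm_inner E z z)" for n
  define g where "g n p q = hm_inner F (snd p) (\<pi> (rank_one E (hm_act E (fst p) (u n)) (fst q)) (snd q))" for n p q
  have conv: "(\<lambda>n. g n p q) \<longlonglongrightarrow> kernel p q" if p: "p \<in> set s" and q: "q \<in> set s" for p q
  proof (rule LIM_zero_cancel, rule Lim_null_comparison)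
    let ?c = "\<lambda>n. hm_norm F (snd p) * (sqrt (1 / real (Suc n)) * hm_norm E (fst q) * hm_norm F (snd q))"
    have "?c \<longlonglongrightarrow> hm_norm F (snd p) * (sqrt 0 * hm_norm E (fst q) * hm_norm F (snd q))"
      by (intro tendsto_intros LIMSEQ_Suc[OF lim_1_over_n])
    then show "?c \<longlonglongrightarrow> 0" by simp
    show "\<forall>\<^sub>F n in sequentially. norm (g n p q - kernel p q) \<le> ?c n"
    proof (rule always_eventually, rule allI)
      fix n
      let ?d = "hm_diff E (fst p) (hm_act E (fst p) (u n))"
      have d: "?d \<in> hm_carrier E" using sc[OF p] by (simp add: E.closed)
      have "fst p = hm_add E (hm_act E (fst p) (u n)) ?d"
        using sc[OF p] by (intro E.inner_eqI) (simp_all add: E.inner_simps E.closed)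
      then have "kernel p q = hm_inner F (snd p) (\<pi> (rank_one E (hm_add E (hm_act E (fst p) (u n)) ?d) (fst q)) (snd q))"
        by simp
      also have "\<dots> = g n p q + hm_inner F (snd p) (\<pi> (rank_one E ?d (fst q)) (snd q))"
        using sc[OF p] sc[OF q] d
        by (simp only: g_def rep_rank_one_add F.inner_add rep_rank_one_closed E.act_closed)
      finally have "norm (g n p q - kernel p q) = norm (hm_inner F (snd p) (\<pi> (rank_one E ?d (fst q)) (snd q)))"
        by (simp add: norm_minus_commute)
      also have "\<dots> \<le> hm_norm F (snd p) * hm_norm F (\<pi> (rank_one E ?d (fst q)) (snd q))"
        using sc[OF p] sc[OF q] d by (intro F.cauchy_schwarz rep_rank_one_closed)
      also have "\<dots> \<le> hm_norm F (snd p) * (hm_norm E ?d * hm_norm E (fst q) * hm_norm F (snd q))"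
        using sc[OF p] sc[OF q] d by (intro mult_left_mono rep_rank_one_norm_le F.norm_nonneg)
      also have "\<dots> \<le> ?c n"
        using es(2)[OF p, of n] by (intro mult_left_mono mult_right_mono F.norm_nonneg E.norm_nonneg)
          (simp add: u_def real_le_rsqrt)
      finally show "norm (g n p q - kernel p q) \<le> ?c n" .
    qed
  qed
  have "(\<lambda>n. \<Sum>p\<leftarrow>s. \<Sum>q\<leftarrow>s. g n p q) \<longlonglongrightarrow> (\<Sum>p\<leftarrow>s. \<Sum>q\<leftarrow>s. kernel p q)"
    by (intro tendsto_sum_list conv)
  moreover have "cstar_positive (\<Sum>p\<leftarrow>s. \<Sum>q\<leftarrow>s. g n p q)" for n
  proof -
    have esc: "z \<in> hm_carrier E" if "z \<in> set (es n)" for z using es(1) that by auto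
    define v where "v z = hm_sum F (\<lambda>p. \<pi> (rank_one E z (fst p)) (snd p)) s" for z
    have "(\<Sum>p\<leftarrow>s. \<Sum>q\<leftarrow>s. g n p q) = (\<Sum>p\<leftarrow>s. \<Sum>q\<leftarrow>s. \<Sum>z\<leftarrow>es n.
        hm_inner F (\<pi> (rank_one E z (fst p)) (snd p)) (\<pi> (rank_one E z (fst q)) (snd q)))"
      by (intro sum_list_cong) (simp add: g_def u_def rep_rank_one_act_sum rep_rank_one_inner sc esc cong: map_cong)
    also have "\<dots> = (\<Sum>p\<leftarrow>s. \<Sum>z\<leftarrow>es n. \<Sum>q\<leftarrow>s.
        hm_inner F (\<pi> (rank_one E z (fst p)) (snd p)) (\<pi> (rank_one E z (fst q)) (snd q)))"
      by (intro sum_list_cong sum_list_swap)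
    also have "\<dots> = (\<Sum>z\<leftarrow>es n. \<Sum>p\<leftarrow>s. \<Sum>q\<leftarrow>s.
        hm_inner F (\<pi> (rank_one E z (fst p)) (snd p)) (\<pi> (rank_one E z (fst q)) (snd q)))"
      by (rule sum_list_swap)
    also have "\<dots> = (\<Sum>z\<leftarrow>es n. hm_inner F (v z) (v z))"
    proof (rule sum_list_cong)
      fix z assume z: "z \<in> set (es n)"
      have "v z \<in> hm_carrier F" by (simp add: v_def F.sum_closed rep_rank_one_closed sc esc[OF z])
      then show "(\<Sum>p\<leftarrow>s. \<Sum>q\<leftarrow>s.
          hm_inner F (\<pi> (rank_one E z (fst p)) (snd p)) (\<pi> (rank_one E z (fst q)) (snd q))) = hm_inner F (v z) (v z)"
        by (simp add: v_def F.inner_sum_left F.inner_sum rep_rank_one_closed sc esc[OF z] F.sum_closed cong: map_cong)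
          (rule sum_list_swap)
    qed
    finally show ?thesis
      by (auto intro!: cstar_positive_sum_list F.inner_positive simp: v_def F.sum_closed rep_rank_one_closed sc esc)
  qed
  ultimately show ?thesis unfolding dual_inner_eq by (rule cstar_positive_LIMSEQ)
qed

section \<open>Seminorm and Cauchy-Schwarz inequality for formal sums\<close>

lemma dual_inner_append:
  "dual_inner (s @ s') r = dual_inner s r + dual_inner s' r"
  "dual_inner r (s @ s') = dual_inner r s + dual_inner r s'"
  by (simp_all add: dual_inner_eq sum_list_addf)

lemma dual_inner_act:
  assumes "s \<in> formal_sums" "r \<in> formal_sums"
  shows "dual_inner r (map (\<lambda>p. (fst p, hm_act F (snd p) b)) s) = dual_inner r s * b"
    "dual_inner (map (\<lambda>p. (fst p, hm_act F (snd p) b)) s) r = star b * dual_inner s r"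
proof -
  have c: "fst p \<in> hm_carrier E" "snd p \<in> hm_carrier F" if "p \<in> set s \<union> set r" for p
    using assms that by auto
  have k1: "kernel p (fst q, hm_act F (snd q) b) = 1 * kernel p q * b"
    if "p \<in> set r" "q \<in> set s" for p q
    using that c[of p] c[of q]
    by (simp add: F.adj_act[OF rep_adj_ops] E.rank_one_adj_ops F.inner_simps rep_rank_one_closed)
  have k2: "kernel (fst p, hm_act F (snd p) b) q = star b * kernel p q * 1"
    if "p \<in> set s" "q \<in> set r" for p q
    using that c[of p] c[of q] by (simp add: F.inner_simps rep_rank_one_closed)
  have "dual_inner r (map (\<lambda>p. (fst p, hm_act F (snd p) b)) s) = 1 * dual_inner r s * b"
    unfolding dual_inner_eq mult_sum_list_mult map_map o_def by (intro sum_list_cong k1)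
  then show "dual_inner r (map (\<lambda>p. (fst p, hm_act F (snd p) b)) s) = dual_inner r s * b" by simp
  have "dual_inner (map (\<lambda>p. (fst p, hm_act F (snd p) b)) s) r = star b * dual_inner s r * 1"
    unfolding dual_inner_eq mult_sum_list_mult map_map o_def by (intro sum_list_cong k2)
  then show "dual_inner (map (\<lambda>p. (fst p, hm_act F (snd p) b)) s) r = star b * dual_inner s r" by simp
qed

lemma star_dual_inner:
  assumes "s \<in> formal_sums" "r \<in> formal_sums"
  shows "star (dual_inner s r) = dual_inner r s"
proof -
  have c: "fst p \<in> hm_carrier E" "snd p \<in> hm_carrier F" if "p \<in> set s \<union> set r" for p
    using assms that by auto
  have k: "star (kernel p q) = kernel q p" if "p \<in> set s" "q \<in> set r" for p q
    using that c[of p] c[of q]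
    by (simp add: F.star_inner rep_rank_one_closed rep_inner E.rank_one_adj_ops E.op_adjoint_rank_one)
  have "star (dual_inner s r) = (\<Sum>p\<leftarrow>s. \<Sum>q\<leftarrow>r. star (kernel p q))"
    by (simp add: dual_inner_eq star_sum_list o_def)
  also have "\<dots> = (\<Sum>p\<leftarrow>s. \<Sum>q\<leftarrow>r. kernel q p)" by (intro sum_list_cong k)
  also have "\<dots> = dual_inner r s" unfolding dual_inner_eq by (rule sum_list_swap)
  finally show ?thesis .
qed

definition dual_norm :: "('e \<times> 'f) list \<Rightarrow> real" where
  "dual_norm s = sqrt (norm (dual_inner s s))"

definition dual_minus :: "('e \<times> 'f) list \<Rightarrow> ('e \<times> 'f) list \<Rightarrow> ('e \<times> 'f) list" where
  "dual_minus s r = s @ map (\<lambda>(x, y). (hm_scale (dual_corr E) (- 1) x, y)) r"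

lemma formal_dist_dual: "formal_dist (dual_corr E) (with_lact F \<pi>) s r = dual_norm (dual_minus s r)"
  by (simp add: formal_dist_def Let_def dual_norm_def dual_minus_def)

lemma dual_minus_closed: "s \<in> formal_sums \<Longrightarrow> r \<in> formal_sums \<Longrightarrow> dual_minus s r \<in> formal_sums"
  by (fastforce simp: dual_minus_def dual_corr_def E.closed)

lemma dual_cauchy_schwarz:
  assumes s: "s \<in> formal_sums" and r: "r \<in> formal_sums"
  shows "norm (dual_inner s r) \<le> dual_norm s * dual_norm r"
proof -
  have "(norm (dual_inner s r))\<^sup>2 \<le> norm (dual_inner s s) * norm (dual_inner r r)"
  proof (rule cstar_cauchy_schwarz)
    fix b
    \<comment> \<open>\<open>r @ ?m\<close> represents \<open>r - s b\<close>; the sign is carried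
      by \<open>b\<close>, which acts on the \<open>F\<close> component.\<close>
    let ?m = "map (\<lambda>p. (fst p, hm_act F (snd p) (- b))) s"
    have m: "?m \<in> formal_sums" using s by (fastforce simp: F.closed)
    have "dual_inner (r @ ?m) (r @ ?m) = dual_inner r r - star (dual_inner s r) * b
        - star b * dual_inner s r + star b * dual_inner s s * b"
      by (simp add: dual_inner_append dual_inner_act s r m star_dual_inner mult.assoc)
    then show "cstar_positive (dual_inner r r - star (dual_inner s r) * b
        - star b * dual_inner s r + star b * dual_inner s s * b)"
      using dual_inner_positive[of "r @ ?m"] r m by simp
  qed (rule dual_inner_positive[OF s])
  then have "(norm (dual_inner s r))\<^sup>2 \<le> (dual_norm s * dual_norm r)\<^sup>2"
    by (simp add: power_mult_distrib dual_norm_def)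
  then show ?thesis by (rule power2_le_imp_le) (simp add: dual_norm_def)
qed

lemma dual_inner_minus:
  assumes "s \<in> formal_sums" "s' \<in> formal_sums" "r \<in> formal_sums"
  shows "dual_inner (dual_minus s s') r = dual_inner s r - dual_inner s' r"
    "dual_inner r (dual_minus s s') = dual_inner r s - dual_inner r s'"
proof -
  let ?n = "map (\<lambda>(x, y). (hm_scale (dual_corr E) (- 1) x, y)) s'"
  have n: "?n \<in> formal_sums" using assms by (fastforce simp: dual_corr_def E.closed)
  have c: "fst p \<in> hm_carrier E" "snd p \<in> hm_carrier F" if "p \<in> set s' \<union> set r" for p
    using assms that by auto
  have "dual_inner ?n r = (\<Sum>p\<leftarrow>s'. \<Sum>q\<leftarrow>r. (- 1) * kernel p q * 1)"
    unfolding dual_inner_eq map_map o_def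
  proof (intro sum_list_cong)
    fix p q assume "p \<in> set s'" "q \<in> set r"
    then have c: "fst p \<in> hm_carrier E" "snd p \<in> hm_carrier F" "fst q \<in> hm_carrier E" "snd q \<in> hm_carrier F"
      using c by auto
    have "rank_one E (hm_scale E (- 1) (fst p)) (fst q) = op_scale E (- 1) (rank_one E (fst p) (fst q))"
      using c by (intro E.adj_ops_eqI) (simp_all add: E.op_adj_ops E.closed E.op_apply E.scale_act)
    then show "kernel (case p of (x, y) \<Rightarrow> (hm_scale (dual_corr E) (- 1) x, y)) q = (- 1) * kernel p q * 1"
      using c by (simp add: case_prod_beta dual_corr_def rep_scale E.rank_one_adj_ops F.inner_simps rep_rank_one_closed)
  qed
  also have "\<dots> = (- 1) * dual_inner s' r * 1" by (simp only: dual_inner_eq mult_sum_list_mult)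
  finally have n1: "dual_inner ?n r = - dual_inner s' r" by simp
  then have n2: "dual_inner r ?n = - dual_inner r s'"
    using star_dual_inner[OF n assms(3)] star_dual_inner[OF assms(2,3)] by simp
  show "dual_inner (dual_minus s s') r = dual_inner s r - dual_inner s' r"
    "dual_inner r (dual_minus s s') = dual_inner r s - dual_inner r s'"
    by (simp_all add: dual_minus_def dual_inner_append n1 n2)
qed

lemma dual_norm_le:
  assumes "s \<in> formal_sums" "r \<in> formal_sums"
  shows "dual_norm s \<le> dual_norm (dual_minus s r) + dual_norm r"
proof (cases "dual_norm s = 0")
  case False
  have pos: "dual_norm s > 0" using False by (simp add: dual_norm_def)
  have "dual_norm s * dual_norm s = norm (dual_inner (dual_minus s r) s + dual_inner r s)"
    using assms by (simp add: dual_inner_minus) (simp add: dual_norm_def)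
  also have "\<dots> \<le> dual_norm (dual_minus s r) * dual_norm s + dual_norm r * dual_norm s"
    using assms by (intro norm_triangle_mono dual_cauchy_schwarz dual_minus_closed)
  finally have "dual_norm s * dual_norm s \<le> (dual_norm (dual_minus s r) + dual_norm r) * dual_norm s"
    by (simp add: distrib_right)
  then show ?thesis using pos by simp
qed (simp add: dual_norm_def)

lemma dual_inner_diff_le:
  assumes "s \<in> formal_sums" "s' \<in> formal_sums" "r \<in> formal_sums" "r' \<in> formal_sums"
  shows "norm (dual_inner s r - dual_inner s' r') \<le>
    dual_norm (dual_minus s s') * dual_norm r + dual_norm s' * dual_norm (dual_minus r r')"
proof -
  have "dual_inner s r - dual_inner s' r' = dual_inner (dual_minus s s') r + dual_inner s' (dual_minus r r')"
    using assms by (simp add: dual_inner_minus)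
  also have "norm \<dots> \<le> dual_norm (dual_minus s s') * dual_norm r + dual_norm s' * dual_norm (dual_minus r r')"
    using assms by (intro norm_triangle_mono dual_cauchy_schwarz dual_minus_closed)
  finally show ?thesis .
qed

lemma formal_cauchy_dual_closed: "u \<in> formal_cauchy (dual_corr E) (with_lact F \<pi>) \<Longrightarrow> u n \<in> formal_sums"
  by (auto simp: formal_cauchy_def dual_corr_def with_lact_def)

lemma dual_norm_bounded:
  assumes u: "u \<in> formal_cauchy (dual_corr E) (with_lact F \<pi>)"
  shows "\<exists>B N. \<forall>n\<ge>N. dual_norm (u n) \<le> B"
proof -
  obtain N where N: "\<And>m n. m \<ge> N \<Longrightarrow> n \<ge> N \<Longrightarrow> dual_norm (dual_minus (u m) (u n)) < 1"
    using u by (auto simp: formal_cauchy_def formal_dist_dual) (metis zero_less_one)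
  have "dual_norm (u n) \<le> 1 + dual_norm (u N)" if "n \<ge> N" for n
    using dual_norm_le[OF formal_cauchy_dual_closed[OF u] formal_cauchy_dual_closed[OF u], of n N] N[of n N] that
    by simp
  then show ?thesis by blast
qed

text \<open>The inner product of the tensor product is a \<open>THE\<close> over all pairs of
  representatives, so a limit common to all of them has to be exhibited. The diagonal value is what
  the extraction of fullness needs, at a stage where no model of the tensor product is
  available.\<close>

lemma dual_tensor_inner_limit:
  assumes X: "X \<in> hm_carrier (tensor (dual_corr E) (with_lact F \<pi>))" and u: "u \<in> X"
  shows "(\<lambda>n. dual_inner (u n) (u n)) \<longlonglongrightarrow> hm_inner (tensor (dual_corr E) (with_lact F \<pi>)) X X"
    and "u n \<in> formal_sums"
proof -
  let ?C = "formal_cauchy (dual_corr E) (with_lact F \<pi>)"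
  let ?R = "formal_rel (dual_corr E) (with_lact F \<pi>)"
  obtain u0 where u0: "u0 \<in> ?C" "X = ?R `` {u0}" using X by (auto simp: tensor_def quotient_def)
  have XC: "v \<in> ?C" if "v \<in> X" for v using that u0 by (auto simp: formal_rel_def)
  have cl: "v n \<in> formal_sums" if "v \<in> ?C" for v n using formal_cauchy_dual_closed[OF that] .
  show "u n \<in> formal_sums" using cl XC u by blast
  obtain B N0 where B: "\<And>n. n \<ge> N0 \<Longrightarrow> dual_norm (u0 n) \<le> B" using dual_norm_bounded[OF u0(1)] by blast
  have B0: "B \<ge> 0" using B[of N0] by (simp add: dual_norm_def order_trans[OF _ B[of N0]])
  have "Cauchy (\<lambda>n. dual_inner (u0 n) (u0 n))"
  proof (rule metric_CauchyI)
    fix e :: real assume e: "e > 0"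
    \<comment> \<open>Two error terms arise, each at most \<open>B\<close> times this quantity; the
      \<open>+ 1\<close> covers \<open>B = 0\<close> and makes the final estimate strict.\<close>
    have "e / (2 * B + 1) > 0" using e B0 by simp
    then obtain N where N: "\<And>m n. m \<ge> N \<Longrightarrow> n \<ge> N \<Longrightarrow> dual_norm (dual_minus (u0 m) (u0 n)) < e / (2 * B + 1)"
      using u0(1) by (auto simp: formal_cauchy_def formal_dist_dual) metis
    show "\<exists>M. \<forall>m\<ge>M. \<forall>n\<ge>M. dist (dual_inner (u0 m) (u0 m)) (dual_inner (u0 n) (u0 n)) < e"
    proof (intro exI[of _ "max N N0"] allI impI)
      fix m n assume mn: "m \<ge> max N N0" "n \<ge> max N N0"
      have "norm (dual_inner (u0 m) (u0 m) - dual_inner (u0 n) (u0 n)) \<le>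
          dual_norm (dual_minus (u0 m) (u0 n)) * dual_norm (u0 m) + dual_norm (u0 n) * dual_norm (dual_minus (u0 m) (u0 n))"
        by (intro dual_inner_diff_le cl u0)
      also have "\<dots> \<le> e / (2 * B + 1) * B + B * (e / (2 * B + 1))"
        using N[of m n] B[of m] B[of n] mn B0 e by (intro add_mono mult_mono) (auto simp: dual_norm_def)
      also have "\<dots> = e * (2 * B / (2 * B + 1))" by simp
      also have "\<dots> < e * 1" using e B0 by (intro mult_strict_left_mono) simp_all
      finally show "dist (dual_inner (u0 m) (u0 m)) (dual_inner (u0 n) (u0 n)) < e" by (simp add: dist_norm)
    qed
  qed
  then obtain c where c: "(\<lambda>n. dual_inner (u0 n) (u0 n)) \<longlonglongrightarrow> c" by (metis Cauchy_convergent convergent_def)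
  have lim: "(\<lambda>n. dual_inner (v n) (w n)) \<longlonglongrightarrow> c" if v: "v \<in> X" and w: "w \<in> X" for v w
  proof -
    have vz: "(\<lambda>n. dual_norm (dual_minus (u0 n) (v n))) \<longlonglongrightarrow> 0" and wz: "(\<lambda>n. dual_norm (dual_minus (u0 n) (w n))) \<longlonglongrightarrow> 0"
      using v w u0 by (auto simp: formal_rel_def formal_dist_dual)
    obtain B' N' where B': "\<And>n. n \<ge> N' \<Longrightarrow> dual_norm (v n) \<le> B'" using dual_norm_bounded[OF XC[OF v]] by blast
    have "(\<lambda>n. dual_inner (u0 n) (u0 n) - dual_inner (v n) (w n)) \<longlonglongrightarrow> 0"
    proof (rule Lim_null_comparison)
      have "(\<lambda>n. dual_norm (dual_minus (u0 n) (v n)) * B + B' * dual_norm (dual_minus (u0 n) (w n))) \<longlonglongrightarrow> 0 * B + B' * 0"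
        by (intro tendsto_intros vz wz)
      then show "(\<lambda>n. dual_norm (dual_minus (u0 n) (v n)) * B + B' * dual_norm (dual_minus (u0 n) (w n))) \<longlonglongrightarrow> 0"
        by simp
      show "\<forall>\<^sub>F n in sequentially. norm (dual_inner (u0 n) (u0 n) - dual_inner (v n) (w n))
          \<le> dual_norm (dual_minus (u0 n) (v n)) * B + B' * dual_norm (dual_minus (u0 n) (w n))"
        unfolding eventually_sequentially
      proof (intro exI[of _ "max N0 N'"] allI impI)
        fix n assume n: "n \<ge> max N0 N'"
        have "norm (dual_inner (u0 n) (u0 n) - dual_inner (v n) (w n)) \<le>
          dual_norm (dual_minus (u0 n) (v n)) * dual_norm (u0 n) + dual_norm (v n) * dual_norm (dual_minus (u0 n) (w n))"
          by (intro dual_inner_diff_le cl u0 XC v w)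
        also have "\<dots> \<le> dual_norm (dual_minus (u0 n) (v n)) * B + B' * dual_norm (dual_minus (u0 n) (w n))"
          using B[of n] B'[of n] n by (intro add_mono mult_left_mono mult_right_mono) (auto simp: dual_norm_def)
        finally show "norm (dual_inner (u0 n) (u0 n) - dual_inner (v n) (w n))
          \<le> dual_norm (dual_minus (u0 n) (v n)) * B + B' * dual_norm (dual_minus (u0 n) (w n))" .
      qed
    qed
    from tendsto_diff[OF c this] show ?thesis by simp
  qed
  have "hm_inner (tensor (dual_corr E) (with_lact F \<pi>)) X X = c"
    unfolding tensor_def hilbert_mod.simps
  proof (rule the_equality)
    show "\<forall>u\<in>X. \<forall>v\<in>X. (\<lambda>n. dual_inner (u n) (v n)) \<longlonglongrightarrow> c" using lim by blast
    fix d assume "\<forall>u\<in>X. \<forall>v\<in>X. (\<lambda>n. dual_inner (u n) (v n)) \<longlonglongrightarrow> d"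
    then show "d = c" using lim[OF u u] u LIMSEQ_unique by blast
  qed
  then show "(\<lambda>n. dual_inner (u n) (u n)) \<longlonglongrightarrow> hm_inner (tensor (dual_corr E) (with_lact F \<pi>)) X X"
    using lim[OF u u] by simp
qed

end

text \<open>The values of the inner product of \<open>E\<^sup>* \<odot> E\<close> lie in the ideal generated by \<open>\<langle>E, E\<rangle>\<close>.\<close>

lemma full_of_unit_vector:
  fixes E :: "('e, 'b::unital_cstar_algebra) hilbert_mod"
  assumes "dual_rep E E \<pi>" and X: "X \<in> hm_carrier (tensor (dual_corr E) (with_lact E \<pi>))"
    and one: "hm_inner (tensor (dual_corr E) (with_lact E \<pi>)) X X = 1"
  obtains gs where "set gs \<subseteq> hm_carrier E" "(\<Sum>g\<leftarrow>gs. hm_inner E g g) = 1"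
proof -
  interpret dual_rep E E \<pi> by fact
  have "X \<noteq> {}"
  proof -
    obtain u0 where u0: "u0 \<in> formal_cauchy (dual_corr E) (with_lact E \<pi>)"
      "X = formal_rel (dual_corr E) (with_lact E \<pi>) `` {u0}" using X by (auto simp: tensor_def quotient_def)
    have "dual_norm (dual_minus s s) = 0" if "s \<in> formal_sums" for s
      unfolding dual_norm_def using that by (simp add: dual_inner_minus dual_minus_closed)
    then have "(u0, u0) \<in> formal_rel (dual_corr E) (with_lact E \<pi>)"
      using u0(1) formal_cauchy_dual_closed[OF u0(1)] by (simp add: formal_rel_def formal_dist_dual)
    then show ?thesis using u0(2) by auto
  qed
  then obtain u where u: "u \<in> X" by auto
  have "(\<lambda>n. dual_inner (u n) (u n)) \<longlonglongrightarrow> 1" using dual_tensor_inner_limit(1)[OF X u] one by simp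
  from LIMSEQ_D[OF this, of "1/2"] obtain n where n: "norm (dual_inner (u n) (u n) - 1) < 1/2" by auto
  \<comment> \<open>Because \<open>F\<close> is \<open>E\<close> here, every value of
    \<open>kernel\<close> is an inner product of two vectors of \<open>E\<close>, and the whole form
    is a finite sum of such.\<close>
  let ?ps = "concat (map (\<lambda>p. map (\<lambda>q. (snd p, \<pi> (rank_one E (fst p) (fst q)) (snd q))) (u n)) (u n))"
  have eq: "(\<Sum>p\<leftarrow>?ps. hm_inner E (fst p) (snd p)) = dual_inner (u n) (u n)"
    by (simp add: dual_inner_eq sum_list_concat_map o_def)
  show thesis
  proof (rule E.full_of_approximate_one[of ?ps])
    show "set ?ps \<subseteq> hm_carrier E \<times> hm_carrier E"
      using dual_tensor_inner_limit(2)[OF X u, of n] by (auto intro!: rep_rank_one_closed)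
    show "norm ((\<Sum>p\<leftarrow>?ps. hm_inner E (fst p) (snd p)) - 1) \<le> 1/2" using n unfolding eq by simp
  qed (use that in blast)
qed

section \<open>Transport of structure and recognition of tensor products\<close>

context hilbert_module
begin

lemma scale_zero: "hm_scale E c (hm_zero E) = hm_zero E"
  by (rule inner_eqI) (simp_all add: inner_simps closed)

lemma zero_act: "hm_act E (hm_zero E) b = hm_zero E"
  by (rule inner_eqI) (simp_all add: inner_simps closed)

lemma add_zero: "x \<in> hm_carrier E \<Longrightarrow> hm_add E x (hm_zero E) = x"
  using add_commute[of x "hm_zero E"] by (simp add: zero_add zero_closed)

end

text \<open>\<open>T\<close> is a bare record whose operations match those of \<open>G\<close> under
  \<open>\<Theta>\<close>; the module laws, completeness included, are carried over to it. The
  intended targets are tensor products and relabelled fibres.\<close>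

locale module_iso = G: hilbert_module G
  for G :: "('g, 'b::unital_cstar_algebra, 'y) hilbert_mod_scheme"
    and T :: "('t, 'b, 'z) hilbert_mod_scheme"
    and \<Theta> :: "'g \<Rightarrow> 't" +
  assumes carrier_eq: "hm_carrier T = \<Theta> ` hm_carrier G"
    and inj: "inj_on \<Theta> (hm_carrier G)"
    and iso_add: "x \<in> hm_carrier G \<Longrightarrow> y \<in> hm_carrier G \<Longrightarrow> hm_add T (\<Theta> x) (\<Theta> y) = \<Theta> (hm_add G x y)"
    and iso_zero: "hm_zero T = \<Theta> (hm_zero G)"
    and iso_scale: "x \<in> hm_carrier G \<Longrightarrow> hm_scale T c (\<Theta> x) = \<Theta> (hm_scale G c x)"
    and iso_act: "x \<in> hm_carrier G \<Longrightarrow> hm_act T (\<Theta> x) b = \<Theta> (hm_act G x b)"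
    and iso_inner: "x \<in> hm_carrier G \<Longrightarrow> y \<in> hm_carrier G \<Longrightarrow> hm_inner T (\<Theta> x) (\<Theta> y) = hm_inner G x y"
begin

lemma iso_diff: "x \<in> hm_carrier G \<Longrightarrow> y \<in> hm_carrier G \<Longrightarrow> hm_diff T (\<Theta> x) (\<Theta> y) = \<Theta> (hm_diff G x y)"
  by (simp add: hm_diff_def iso_add iso_scale G.closed)

lemma iso_norm: "x \<in> hm_carrier G \<Longrightarrow> hm_norm T (\<Theta> x) = hm_norm G x"
  by (simp add: hm_norm_def iso_inner)

lemmas iso_simps = iso_add iso_zero iso_scale iso_act iso_inner iso_diff iso_norm

lemma iso_closed: "x \<in> hm_carrier G \<Longrightarrow> \<Theta> x \<in> hm_carrier T"
  by (simp add: carrier_eq)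

lemma hilbert_module_iso: "hilbert_module T"
proof
  fix u :: "nat \<Rightarrow> 't" assume u: "\<And>n. u n \<in> hm_carrier T"
    and c: "\<And>e. e > 0 \<Longrightarrow> \<exists>N. \<forall>m\<ge>N. \<forall>n\<ge>N. hm_norm T (hm_diff T (u m) (u n)) < e"
  have "\<exists>v. \<forall>n. v n \<in> hm_carrier G \<and> u n = \<Theta> (v n)"
    using u unfolding carrier_eq by (intro choice) blast
  then obtain v where v: "\<And>n. v n \<in> hm_carrier G" "\<And>n. u n = \<Theta> (v n)" by blast
  obtain x where "hm_lim G v x"
    by (rule G.cauchy_lim[of v, OF v(1)]) (use c v in \<open>simp_all add: iso_simps G.closed\<close>)
  then show "\<exists>x\<in>hm_carrier T. (\<lambda>n. hm_norm T (hm_diff T (u n) x)) \<longlonglongrightarrow> 0"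
    using v by (auto simp: hm_lim_def carrier_eq iso_simps G.closed intro!: bexI[of _ x])
qed (auto simp: carrier_eq iso_simps G.closed G.add_assoc G.zero_add G.diff_self G.scale_add
      G.add_scale G.scale_scale G.scale_one G.add_act G.act_add G.act_act G.act_one G.scale_act G.act_scale
      G.inner_simps G.star_inner G.inner_positive G.inner_definite simp del: diff_minus_eq_add
      intro: arg_cong[OF G.add_commute] arg_cong[OF G.inner_definite])

sublocale T: hilbert_module T
  by (rule hilbert_module_iso)

text \<open>Conjugation by \<open>\<Theta>\<close>, cut off outside the carrier because operators
  are extensional.\<close>

definition lift :: "('g \<Rightarrow> 'g) \<Rightarrow> 't \<Rightarrow> 't" where
  "lift a = (\<lambda>X\<in>hm_carrier T. \<Theta> (a (inv_into (hm_carrier G) \<Theta> X)))"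

lemma lift_apply: "x \<in> hm_carrier G \<Longrightarrow> lift a (\<Theta> x) = \<Theta> (a x)"
  by (simp add: lift_def iso_closed inv_into_f_f inj)

lemma liftI:
  assumes "f \<in> extensional (hm_carrier T)" "\<And>x. x \<in> hm_carrier G \<Longrightarrow> f (\<Theta> x) = \<Theta> (a x)"
  shows "f = lift a"
proof
  fix X
  show "f X = lift a X"
    using assms by (cases "X \<in> hm_carrier T") (auto simp: carrier_eq lift_apply, auto simp: extensional_def lift_def carrier_eq)
qed

lemma
  assumes a: "a \<in> adj_ops G"
  shows lift_adj_ops: "lift a \<in> adj_ops T"
    and op_adjoint_lift: "op_adjoint T (lift a) = lift (op_adjoint G a)"
proof -
  have *: "lift c \<in> hm_carrier T \<rightarrow>\<^sub>E hm_carrier T" if "c \<in> adj_ops G" for c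
    using that by (auto simp: carrier_eq lift_apply G.adj_ops_closed) (auto simp: lift_def carrier_eq)
  have **: "hm_inner T (lift a x) y = hm_inner T x (lift (op_adjoint G a) y)"
    if "x \<in> hm_carrier T" "y \<in> hm_carrier T" for x y
    using that a G.op_adjoint_adj_ops[OF a]
    by (auto simp: carrier_eq lift_apply iso_inner G.adj_ops_closed G.inner_adjoint)
  show "lift a \<in> adj_ops T" "op_adjoint T (lift a) = lift (op_adjoint G a)"
    using T.adj_opsI[OF *[OF a] *[OF G.op_adjoint_adj_ops[OF a]] **] by auto
qed

lemma lift_eqI:
  "a \<in> adj_ops G \<Longrightarrow> f \<in> adj_ops T \<Longrightarrow> (\<And>x. x \<in> hm_carrier G \<Longrightarrow> f (\<Theta> x) = \<Theta> (a x)) \<Longrightarrow> f = lift a"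
  using T.adj_ops_PiE[of f] by (intro liftI) (auto simp: PiE_def)

lemma op_add_lift:
  "a \<in> adj_ops G \<Longrightarrow> b \<in> adj_ops G \<Longrightarrow> op_add T (lift a) (lift b) = lift (op_add G a b)"
  by (intro lift_eqI)
    (simp_all add: lift_adj_ops G.op_adj_ops T.op_adj_ops T.op_add_apply G.op_add_apply iso_closed lift_apply iso_add G.adj_ops_closed)

lemma op_scale_lift: "a \<in> adj_ops G \<Longrightarrow> op_scale T c (lift a) = lift (op_scale G c a)"
  by (intro lift_eqI)
    (simp_all add: lift_adj_ops G.op_adj_ops T.op_adj_ops T.op_scale_apply G.op_scale_apply iso_closed lift_apply iso_scale G.adj_ops_closed)

lemma op_mult_lift:
  "a \<in> adj_ops G \<Longrightarrow> b \<in> adj_ops G \<Longrightarrow> op_mult T (lift a) (lift b) = lift (op_mult G a b)"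
  by (intro lift_eqI)
    (simp_all add: lift_adj_ops G.op_adj_ops T.op_adj_ops T.op_mult_apply G.op_mult_apply iso_closed lift_apply G.adj_ops_closed)

lemma op_id_lift: "op_id T = lift (op_id G)"
  by (intro lift_eqI) (simp_all add: G.op_adj_ops T.op_adj_ops T.op_id_apply G.op_id_apply iso_closed)

lemma lift_inj:
  assumes "a \<in> adj_ops G" "b \<in> adj_ops G" "lift a = lift b"
  shows "a = b"
proof (rule G.adj_ops_eqI[OF assms(1,2)])
  fix x assume x: "x \<in> hm_carrier G"
  have "\<Theta> (a x) = \<Theta> (b x)" using lift_apply[OF x, of a] lift_apply[OF x, of b] assms(3) by simp
  then show "a x = b x" using inj_onD[OF inj] assms x G.adj_ops_closed by blast
qed

lemma lift_unitary:
  assumes "hm_unitary G G a"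
  shows "hm_unitary T T (lift a)"
proof -
  have ac: "a x \<in> hm_carrier G" if "x \<in> hm_carrier G" for x using assms that by (auto simp: hm_unitary_def)
  have "lift a ` hm_carrier T = \<Theta> ` (a ` hm_carrier G)"
    unfolding carrier_eq image_image by (rule image_cong) (simp_all add: lift_apply)
  then have "lift a ` hm_carrier T = hm_carrier T" using assms by (simp add: hm_unitary_def carrier_eq)
  moreover have "lift a \<in> extensional (hm_carrier T)" by (simp add: lift_def)
  ultimately show ?thesis
    using assms unfolding hm_unitary_def
    by (auto simp: PiE_def) (auto simp: carrier_eq lift_apply iso_inner ac)
qed

end

text \<open>A recognition principle: vectors \<open>\<phi> x y\<close> of a complete module that
  have the inner products prescribed for elementary tensors, and whose finite sums are dense,
  determine the Hausdorff completion up to isomorphism. \<open>E\<close> and \<open>F\<close> enter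
  as bare records, so that the dual, whose inner products are operators, fits as well.\<close>

locale tensor_model = G: hilbert_module G
  for E :: "('e, 'a, 'y) hilbert_mod_scheme"
    and F :: "('f, 'b::unital_cstar_algebra, 'a, 'z) corr_scheme"
    and G :: "('g, 'b, 'w) hilbert_mod_scheme"
    and \<phi> :: "'e \<Rightarrow> 'f \<Rightarrow> 'g" +
  assumes scale_closed_left: "x \<in> hm_carrier E \<Longrightarrow> hm_scale E c x \<in> hm_carrier E"
    and act_closed_right: "y \<in> hm_carrier F \<Longrightarrow> hm_act F y b \<in> hm_carrier F"
    and model_closed: "x \<in> hm_carrier E \<Longrightarrow> y \<in> hm_carrier F \<Longrightarrow> \<phi> x y \<in> hm_carrier G"
    and model_inner: "\<lbrakk>x \<in> hm_carrier E; y \<in> hm_carrier F; x' \<in> hm_carrier E; y' \<in> hm_carrier F\<rbrakk> \<Longrightarrow>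
      hm_inner G (\<phi> x y) (\<phi> x' y') = hm_inner F y (hm_lact F (hm_inner E x x') y')"
    and model_scale: "x \<in> hm_carrier E \<Longrightarrow> y \<in> hm_carrier F \<Longrightarrow> \<phi> (hm_scale E c x) y = hm_scale G c (\<phi> x y)"
    and model_act: "x \<in> hm_carrier E \<Longrightarrow> y \<in> hm_carrier F \<Longrightarrow> \<phi> x (hm_act F y b) = hm_act G (\<phi> x y) b"
    and total: "g \<in> hm_carrier G \<Longrightarrow> e > 0 \<Longrightarrow> \<exists>s\<in>lists (hm_carrier E \<times> hm_carrier F).
      hm_norm G (hm_diff G g (hm_sum G (\<lambda>p. \<phi> (fst p) (snd p)) s)) < e"
begin

abbreviation pair_sums :: "('e \<times> 'f) list set" where
  "pair_sums \<equiv> lists (hm_carrier E \<times> hm_carrier F)"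

definition eval_sum :: "('e \<times> 'f) list \<Rightarrow> 'g" where
  "eval_sum s = hm_sum G (\<lambda>p. \<phi> (fst p) (snd p)) s"

text \<open>The equivalence class itself: all sequences of formal sums whose values converge to
  \<open>g\<close>. The class map into the completion is thereby explicit, and the operations of
  \<open>tensor\<close> can be compared as sets.\<close>

definition tensor_class :: "'g \<Rightarrow> (nat \<Rightarrow> ('e \<times> 'f) list) set" where
  "tensor_class g = {u. (\<forall>n. u n \<in> pair_sums) \<and> hm_lim G (\<lambda>n. eval_sum (u n)) g}"

lemma sums_memD: "s \<in> pair_sums \<Longrightarrow> p \<in> set s \<Longrightarrow> fst p \<in> hm_carrier E \<and> snd p \<in> hm_carrier F"
  by auto

lemma eval_closed: "s \<in> pair_sums \<Longrightarrow> eval_sum s \<in> hm_carrier G"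
  unfolding eval_sum_def by (rule G.sum_closed) (simp add: model_closed sums_memD)

lemma formal_inner_eval:
  assumes s: "s \<in> pair_sums" and r: "r \<in> pair_sums"
  shows "formal_inner E F s r = hm_inner G (eval_sum s) (eval_sum r)"
proof -
  have "formal_inner E F s r = (\<Sum>p\<leftarrow>s. \<Sum>q\<leftarrow>r. hm_inner G (\<phi> (fst p) (snd p)) (\<phi> (fst q) (snd q)))"
    unfolding formal_inner_def split_def
    using sums_memD[OF s] sums_memD[OF r] by (intro sum_list_cong) (simp add: model_inner)
  also have "\<dots> = hm_inner G (eval_sum s) (eval_sum r)"
  proof -
    have "hm_inner G (eval_sum s) (eval_sum r) = (\<Sum>p\<leftarrow>s. hm_inner G (\<phi> (fst p) (snd p)) (eval_sum r))"
      unfolding eval_sum_def[of s] using sums_memD[OF s] eval_closed[OF r]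
      by (intro G.inner_sum_left) (simp_all add: model_closed)
    also have "\<dots> = (\<Sum>p\<leftarrow>s. \<Sum>q\<leftarrow>r. hm_inner G (\<phi> (fst p) (snd p)) (\<phi> (fst q) (snd q)))"
      unfolding eval_sum_def using sums_memD[OF s] sums_memD[OF r]
      by (intro sum_list_cong G.inner_sum) (simp_all add: model_closed)
    finally show ?thesis by simp
  qed
  finally show ?thesis .
qed

lemma eval_append: "s \<in> pair_sums \<Longrightarrow> r \<in> pair_sums \<Longrightarrow> eval_sum (s @ r) = hm_add G (eval_sum s) (eval_sum r)"
  unfolding eval_sum_def by (rule G.sum_append) (auto intro!: model_closed dest: sums_memD)

lemma eval_map:
  assumes "s \<in> pair_sums"
    and "\<And>x y. x \<in> hm_carrier E \<Longrightarrow> y \<in> hm_carrier F \<Longrightarrow> \<phi> (fst (f (x, y))) (snd (f (x, y))) = A (\<phi> x y)"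
    and "A (hm_zero G) = hm_zero G"
    and "\<And>g h. g \<in> hm_carrier G \<Longrightarrow> h \<in> hm_carrier G \<Longrightarrow> A (hm_add G g h) = hm_add G (A g) (A h)"
  shows "eval_sum (map f s) = A (eval_sum s)"
  using assms(1)
proof (induction s)
  case (Cons p s)
  then have "s \<in> pair_sums" "fst p \<in> hm_carrier E" "snd p \<in> hm_carrier F" by auto
  then show ?case
    using Cons.IH assms(2)[of "fst p" "snd p"] eval_closed[of s] assms(4)[of "\<phi> (fst p) (snd p)" "eval_sum s"]
    by (simp add: eval_sum_def model_closed)
qed (simp add: eval_sum_def assms(3))

lemma eval_scale: "s \<in> pair_sums \<Longrightarrow> eval_sum (map (\<lambda>(x, y). (hm_scale E c x, y)) s) = hm_scale G c (eval_sum s)"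
  by (rule eval_map)
    (simp_all add: model_scale G.scale_add G.scale_zero)

lemma formal_dist_eval:
  assumes s: "s \<in> pair_sums" and r: "r \<in> pair_sums"
  shows "formal_dist E F s r = hm_norm G (hm_diff G (eval_sum s) (eval_sum r))"
proof -
  let ?m = "map (\<lambda>(x, y). (hm_scale E (- 1) x, y)) r"
  have m: "?m \<in> pair_sums" using r by (fastforce simp: scale_closed_left)
  have "eval_sum (s @ ?m) = hm_diff G (eval_sum s) (eval_sum r)"
    by (simp add: eval_append[OF s m] eval_scale[OF r] hm_diff_def)
  moreover have "s @ ?m \<in> pair_sums" using s m by simp
  ultimately show ?thesis
    using formal_inner_eval[of "s @ ?m" "s @ ?m"] by (simp add: formal_dist_def hm_norm_def)
qed

lemma formal_cauchy_iff: "u \<in> formal_cauchy E F \<longleftrightarrow> (\<exists>g. u \<in> tensor_class g)"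
proof -
  have "u \<in> formal_cauchy E F \<longleftrightarrow> (\<forall>n. u n \<in> pair_sums) \<and>
      (\<forall>e>0. \<exists>N. \<forall>m\<ge>N. \<forall>n\<ge>N. hm_norm G (hm_diff G (eval_sum (u m)) (eval_sum (u n))) < e)"
    unfolding formal_cauchy_def mem_Collect_eq by (rule conj_cong) (simp_all add: formal_dist_eval)
  also have "\<dots> \<longleftrightarrow> (\<exists>g. u \<in> tensor_class g)"
    using G.cauchy_lim_iff[of "\<lambda>n. eval_sum (u n)"] eval_closed by (auto simp: tensor_class_def)
  finally show ?thesis .
qed

lemma tensor_class_closed: "u \<in> tensor_class g \<Longrightarrow> g \<in> hm_carrier G"
  by (simp add: tensor_class_def hm_lim_def)

lemma tensor_class_sums: "u \<in> tensor_class g \<Longrightarrow> u n \<in> pair_sums"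
  by (simp add: tensor_class_def)

lemma tensor_class_unique: "u \<in> tensor_class g \<Longrightarrow> u \<in> tensor_class h \<Longrightarrow> g = h"
  by (rule G.lim_unique[of "\<lambda>n. eval_sum (u n)"]) (simp_all add: tensor_class_def eval_closed)

lemma formal_rel_iff:
  assumes u: "u \<in> tensor_class g"
  shows "(u, v) \<in> formal_rel E F \<longleftrightarrow> v \<in> tensor_class g"
proof -
  have us: "u n \<in> pair_sums" for n using u by (rule tensor_class_sums)
  have lim: "hm_lim G (\<lambda>n. eval_sum (v n)) g \<longleftrightarrow> (\<lambda>n. formal_dist E F (u n) (v n)) \<longlonglongrightarrow> 0" if "\<And>n. v n \<in> pair_sums"
    using G.lim_lim_iff[of "\<lambda>n. eval_sum (u n)" g "\<lambda>n. eval_sum (v n)"] u that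
    by (simp add: formal_dist_eval us eval_closed) (simp add: tensor_class_def)
  show ?thesis
  proof
    assume "(u, v) \<in> formal_rel E F"
    then have "v \<in> formal_cauchy E F" "(\<lambda>n. formal_dist E F (u n) (v n)) \<longlonglongrightarrow> 0" by (auto simp: formal_rel_def)
    then show "v \<in> tensor_class g"
      using lim by (auto simp: formal_cauchy_iff) (auto simp: tensor_class_def)
  next
    assume v: "v \<in> tensor_class g"
    then show "(u, v) \<in> formal_rel E F"
      using u lim by (auto simp: formal_rel_def formal_cauchy_iff) (auto simp: tensor_class_def)
  qed
qed

lemma formal_rel_image: "u \<in> tensor_class g \<Longrightarrow> formal_rel E F `` {u} = tensor_class g"
  using formal_rel_iff by auto

lemma tensor_class_nonempty:
  assumes g: "g \<in> hm_carrier G"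
  obtains u where "u \<in> tensor_class g"
proof -
  have "\<forall>n. \<exists>s. s \<in> pair_sums \<and> hm_norm G (hm_diff G g (eval_sum s)) < 1 / real (Suc n)"
    using total[OF g] unfolding eval_sum_def by (auto simp: Bex_def)
  then obtain u where u: "\<And>n. u n \<in> pair_sums" "\<And>n. hm_norm G (hm_diff G g (eval_sum (u n))) < 1 / real (Suc n)"
    by metis
  have "hm_lim G (\<lambda>n. eval_sum (u n)) g"
  proof (rule G.lim_boundI[OF g LIMSEQ_Suc[OF lim_1_over_n]])
    show "hm_norm G (hm_diff G (eval_sum (u n)) g) \<le> 1 / real (Suc n)" for n
      using u(2)[of n] G.norm_diff_commute[OF g eval_closed[OF u(1)], of n] by simp
  qed
  then show thesis using u(1) by (intro that[of u]) (simp add: tensor_class_def)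
qed

lemma tensor_carrier: "hm_carrier (tensor E F) = tensor_class ` hm_carrier G"
proof -
  have "hm_carrier (tensor E F) = formal_cauchy E F // formal_rel E F" by (simp add: tensor_def)
  also have "\<dots> = tensor_class ` hm_carrier G"
  proof (rule equalityI; rule subsetI)
    fix X assume "X \<in> formal_cauchy E F // formal_rel E F"
    then obtain u where "u \<in> formal_cauchy E F" "X = formal_rel E F `` {u}" by (auto simp: quotient_def)
    then show "X \<in> tensor_class ` hm_carrier G"
      using formal_rel_image tensor_class_closed by (auto simp: formal_cauchy_iff)
  next
    fix X assume "X \<in> tensor_class ` hm_carrier G"
    then obtain g u where "X = tensor_class g" "u \<in> tensor_class g" by (auto elim: tensor_class_nonempty)
    then show "X \<in> formal_cauchy E F // formal_rel E F"
      using formal_rel_image[of u g] formal_cauchy_iff[of u] unfolding quotient_def by blast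
  qed
  finally show ?thesis .
qed

lemma inj_tensor_class: "inj_on tensor_class (hm_carrier G)"
  by (rule inj_onI) (metis tensor_class_nonempty tensor_class_unique)

text \<open>All representatives are sent into one class, so the union over representatives collapses
  to it. Continuity of \<open>A\<close> is required along sequences converging to
  \<open>g\<close>.\<close>

lemma tensor_map_class:
  assumes g: "g \<in> hm_carrier G"
    and f: "\<And>p. p \<in> hm_carrier E \<times> hm_carrier F \<Longrightarrow> f p \<in> hm_carrier E \<times> hm_carrier F"
    and eval: "\<And>s. s \<in> pair_sums \<Longrightarrow> eval_sum (map f s) = A (eval_sum s)"
    and lim: "\<And>u. (\<And>n. u n \<in> hm_carrier G) \<Longrightarrow> hm_lim G u g \<Longrightarrow> hm_lim G (\<lambda>n. A (u n)) (A g)"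
  shows "tensor_map E F f (tensor_class g) = tensor_class (A g)"
proof -
  have "(\<lambda>n. map f (u n)) \<in> tensor_class (A g)" if u: "u \<in> tensor_class g" for u
  proof -
    have us: "u n \<in> pair_sums" for n using u by (rule tensor_class_sums)
    have "map f (u n) \<in> pair_sums" for n using us[of n] f by fastforce
    moreover have "hm_lim G (\<lambda>n. A (eval_sum (u n))) (A g)"
      using u by (intro lim eval_closed us) (simp add: tensor_class_def)
    ultimately show ?thesis by (simp add: tensor_class_def eval us)
  qed
  then have "tensor_map E F f (tensor_class g) = (\<Union>u\<in>tensor_class g. tensor_class (A g))"
    unfolding tensor_map_def by (intro SUP_cong refl) (rule formal_rel_image)
  moreover obtain u where "u \<in> tensor_class g" using g by (rule tensor_class_nonempty)
  ultimately show ?thesis by auto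
qed

lemma tensor_zero_class: "hm_zero (tensor E F) = tensor_class (hm_zero G)"
proof -
  have "(\<lambda>n. []) \<in> tensor_class (hm_zero G)"
    by (simp add: tensor_class_def eval_sum_def G.lim_const G.closed)
  then show ?thesis by (simp add: tensor_def formal_rel_image)
qed

lemma tensor_add_class:
  assumes "g \<in> hm_carrier G" "h \<in> hm_carrier G"
  shows "hm_add (tensor E F) (tensor_class g) (tensor_class h) = tensor_class (hm_add G g h)"
proof -
  have "(\<lambda>n. u n @ v n) \<in> tensor_class (hm_add G g h)" if "u \<in> tensor_class g" "v \<in> tensor_class h" for u v
  proof -
    have s: "u n \<in> pair_sums" "v n \<in> pair_sums" for n using that by (auto dest: tensor_class_sums)
    have "hm_lim G (\<lambda>n. hm_add G (eval_sum (u n)) (eval_sum (v n))) (hm_add G g h)"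
      using that by (intro G.lim_add eval_closed s) (simp_all add: tensor_class_def)
    then show ?thesis using s by (simp add: tensor_class_def eval_append)
  qed
  then have "hm_add (tensor E F) (tensor_class g) (tensor_class h) =
      (\<Union>u\<in>tensor_class g. \<Union>v\<in>tensor_class h. tensor_class (hm_add G g h))"
    unfolding tensor_def hilbert_mod.simps by (intro SUP_cong refl) (rule formal_rel_image)
  moreover obtain u v where "u \<in> tensor_class g" "v \<in> tensor_class h"
    using assms by (meson tensor_class_nonempty)
  ultimately show ?thesis by auto
qed

lemma tensor_scale_class:
  "g \<in> hm_carrier G \<Longrightarrow> hm_scale (tensor E F) c (tensor_class g) = tensor_class (hm_scale G c g)"
  unfolding tensor_def hilbert_mod.simps
  by (rule tensor_map_class) (auto simp: scale_closed_left eval_scale G.lim_scale)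

lemma tensor_act_class:
  "g \<in> hm_carrier G \<Longrightarrow> hm_act (tensor E F) (tensor_class g) b = tensor_class (hm_act G g b)"
  unfolding tensor_def hilbert_mod.simps
proof (rule tensor_map_class[where A = "\<lambda>g. hm_act G g b"])
  fix s assume "s \<in> pair_sums"
  then show "eval_sum (map (\<lambda>(x, y). (x, hm_act F y b)) s) = hm_act G (eval_sum s) b"
    by (rule eval_map)
      (simp_all add: model_act G.add_act G.zero_act)
qed (auto simp: act_closed_right G.lim_act)

lemma tensor_inner_class:
  assumes "g \<in> hm_carrier G" "h \<in> hm_carrier G"
  shows "hm_inner (tensor E F) (tensor_class g) (tensor_class h) = hm_inner G g h"
  unfolding tensor_def hilbert_mod.simps
proof (rule the_equality)
  have lim: "(\<lambda>n. formal_inner E F (u n) (v n)) \<longlonglongrightarrow> hm_inner G g h"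
    if "u \<in> tensor_class g" "v \<in> tensor_class h" for u v
  proof -
    have s: "u n \<in> pair_sums" "v n \<in> pair_sums" for n using that by (auto dest: tensor_class_sums)
    have "(\<lambda>n. hm_inner G (eval_sum (u n)) (eval_sum (v n))) \<longlonglongrightarrow> hm_inner G g h"
      using that by (intro G.lim_inner eval_closed s) (simp_all add: tensor_class_def)
    then show ?thesis by (simp add: formal_inner_eval s)
  qed
  then show "\<forall>u\<in>tensor_class g. \<forall>v\<in>tensor_class h. (\<lambda>n. formal_inner E F (u n) (v n)) \<longlonglongrightarrow> hm_inner G g h"
    by blast
  fix c assume "\<forall>u\<in>tensor_class g. \<forall>v\<in>tensor_class h. (\<lambda>n. formal_inner E F (u n) (v n)) \<longlonglongrightarrow> c"
  moreover obtain u v where "u \<in> tensor_class g" "v \<in> tensor_class h"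
    using assms by (meson tensor_class_nonempty)
  ultimately show "c = hm_inner G g h" using lim LIMSEQ_unique by blast
qed

lemma elem_tensor_class:
  assumes "x \<in> hm_carrier E" "y \<in> hm_carrier F"
  shows "elem_tensor E F x y = tensor_class (\<phi> x y)"
proof -
  have z: "hm_add G (\<phi> x y) (hm_zero G) = \<phi> x y"
    using assms by (simp add: G.add_zero model_closed)
  have "(\<lambda>n. [(x, y)]) \<in> tensor_class (\<phi> x y)"
    using assms by (simp add: tensor_class_def eval_sum_def G.lim_const model_closed z)
  then show ?thesis by (simp add: elem_tensor_def formal_rel_image)
qed

sublocale tensor_iso: module_iso G "tensor E F" tensor_class
  by unfold_locales (simp_all add: tensor_carrier inj_tensor_class tensor_add_class tensor_zero_class
    tensor_scale_class tensor_act_class tensor_inner_class)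

lemma amplification_class:
  assumes g: "g \<in> hm_carrier G"
    and a: "\<And>x. x \<in> hm_carrier E \<Longrightarrow> a x \<in> hm_carrier E"
    and eval: "\<And>x y. x \<in> hm_carrier E \<Longrightarrow> y \<in> hm_carrier F \<Longrightarrow> \<phi> (a x) y = A (\<phi> x y)"
    and A: "A (hm_zero G) = hm_zero G"
      "\<And>g h. g \<in> hm_carrier G \<Longrightarrow> h \<in> hm_carrier G \<Longrightarrow> A (hm_add G g h) = hm_add G (A g) (A h)"
    and lim: "\<And>u. (\<And>n. u n \<in> hm_carrier G) \<Longrightarrow> hm_lim G u g \<Longrightarrow> hm_lim G (\<lambda>n. A (u n)) (A g)"
  shows "amplification E F a (tensor_class g) = tensor_class (A g)"
proof -
  have "tensor_map E F (\<lambda>(x, y). (a x, y)) (tensor_class g) = tensor_class (A g)"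
  proof (rule tensor_map_class[OF g])
    fix s assume "s \<in> pair_sums"
    then show "eval_sum (map (\<lambda>(x, y). (a x, y)) s) = A (eval_sum s)"
      by (rule eval_map) (simp_all add: eval A)
  qed (use a lim in auto)
  then show ?thesis using g by (simp add: amplification_def tensor_carrier)
qed

end

section \<open>The correspondence of intertwiners\<close>

context hilbert_module
begin

lemma zero_scale: "x \<in> hm_carrier E \<Longrightarrow> hm_scale E 0 x = hm_zero E"
  by (rule inner_eqI) (simp_all add: inner_simps closed)

lemma act_zero: "x \<in> hm_carrier E \<Longrightarrow> hm_act E x 0 = hm_zero E"
  by (rule inner_eqI) (simp_all add: inner_simps closed)

lemma act_sum: "x \<in> hm_carrier E \<Longrightarrow> hm_sum E (\<lambda>i. hm_act E x (f i)) is = hm_act E x (\<Sum>i\<leftarrow>is. f i)"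
  by (induction "is") (simp_all add: act_zero act_add)

lemma norm_sum_le:
  "(\<And>i. i \<in> set is \<Longrightarrow> f i \<in> hm_carrier E) \<Longrightarrow> hm_norm E (hm_sum E f is) \<le> (\<Sum>i\<leftarrow>is. hm_norm E (f i))"
proof (induction "is")
  case (Cons i "is")
  have "hm_norm E (hm_add E (f i) (hm_sum E f is)) \<le> hm_norm E (f i) + hm_norm E (hm_sum E f is)"
    using Cons.prems by (intro norm_add_le sum_closed) auto
  then show ?case using Cons by simp
qed (simp add: norm_zero)

lemma add_add_swap:
  "\<lbrakk>x \<in> hm_carrier E; y \<in> hm_carrier E; z \<in> hm_carrier E; w \<in> hm_carrier E\<rbrakk> \<Longrightarrow>
    hm_add E (hm_add E x y) (hm_add E z w) = hm_add E (hm_add E x z) (hm_add E y w)"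
  by (rule inner_eqI) (simp_all add: inner_simps closed)

lemma closed_span_self:
  assumes "S = hm_carrier E"
  shows "closed_span E S = hm_carrier E"
proof -
  have "x \<in> lin_span E S" if "x \<in> hm_carrier E" for x
    using lin_span.span_step[of x S "hm_zero E" E 1] that
    by (simp add: lin_span.span_zero scale_one add_zero assms)
  then show ?thesis using norm_zero by (force simp: closed_span_def diff_self)
qed

end

text \<open>Right linearity is deliberately absent: \<open>x \<mapsto> x \<odot> \<xi>\<close> sends
  \<open>x b\<close> to \<open>x \<odot> b \<xi>\<close>, so composing with the right action of
  \<open>E\<close> is the left action on intertwiners. Homogeneity comes from the operators
  \<open>c id\<close>, which are among the operators in the second clause.\<close>

definition intertwiners ::
  "('e, 'b, 'y) hilbert_mod_scheme \<Rightarrow> ('f, 'c, 'z) hilbert_mod_scheme \<Rightarrow> (('e \<Rightarrow> 'e) \<Rightarrow> 'f \<Rightarrow> 'f) \<Rightarrow> ('e \<Rightarrow> 'f) set" where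
  "intertwiners E F \<pi> = {R \<in> hm_carrier E \<rightarrow>\<^sub>E hm_carrier F.
    (\<forall>x\<in>hm_carrier E. \<forall>y\<in>hm_carrier E. R (hm_add E x y) = hm_add F (R x) (R y)) \<and>
    (\<forall>a\<in>adj_ops E. \<forall>x\<in>hm_carrier E. R (a x) = \<pi> a (R x))}"

text \<open>If \<open>\<Sum>\<langle>g, g\<rangle> = 1\<close> then an intertwiner satisfies \<open>R x = \<Sum>\<pi>(x g\<^sup>*) (R g)\<close>, so it is the operator
  \<open>x \<mapsto> x \<odot> \<xi>\<close> for \<open>\<xi> = \<Sum>g\<^sup>* \<odot> R g\<close>; no completion is needed.\<close>

definition int_corr ::
  "('e, 'b::unital_cstar_algebra, 'y) hilbert_mod_scheme \<Rightarrow> 'e list \<Rightarrow> ('f, 'b, 'z) hilbert_mod_scheme \<Rightarrow>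
    (('e \<Rightarrow> 'e) \<Rightarrow> 'f \<Rightarrow> 'f) \<Rightarrow> ('e \<Rightarrow> 'f, 'b, 'b) corr" where
  "int_corr E gs F \<pi> = \<lparr>hm_carrier = intertwiners E F \<pi>,
    hm_add = (\<lambda>R S. \<lambda>x\<in>hm_carrier E. hm_add F (R x) (S x)),
    hm_zero = (\<lambda>x\<in>hm_carrier E. hm_zero F),
    hm_scale = (\<lambda>c R. \<lambda>x\<in>hm_carrier E. hm_scale F c (R x)),
    hm_act = (\<lambda>R b. \<lambda>x\<in>hm_carrier E. hm_act F (R x) b),
    hm_inner = (\<lambda>R S. \<Sum>g\<leftarrow>gs. hm_inner F (R g) (S g)),
    hm_lact = (\<lambda>b R. \<lambda>x\<in>hm_carrier E. R (hm_act E x b))\<rparr>"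

lemma int_corr_simps [simp]:
  "hm_carrier (int_corr E gs F \<pi>) = intertwiners E F \<pi>"
  "hm_add (int_corr E gs F \<pi>) R S = (\<lambda>x\<in>hm_carrier E. hm_add F (R x) (S x))"
  "hm_zero (int_corr E gs F \<pi>) = (\<lambda>x\<in>hm_carrier E. hm_zero F)"
  "hm_scale (int_corr E gs F \<pi>) c R = (\<lambda>x\<in>hm_carrier E. hm_scale F c (R x))"
  "hm_act (int_corr E gs F \<pi>) R b = (\<lambda>x\<in>hm_carrier E. hm_act F (R x) b)"
  "hm_inner (int_corr E gs F \<pi>) R S = (\<Sum>g\<leftarrow>gs. hm_inner F (R g) (S g))"
  "hm_lact (int_corr E gs F \<pi>) b R = (\<lambda>x\<in>hm_carrier E. R (hm_act E x b))"
  by (simp_all add: int_corr_def)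

locale full_rep = dual_rep E F \<pi>
  for E :: "('e, 'b::unital_cstar_algebra) hilbert_mod"
    and F :: "('f, 'b, 'z) hilbert_mod_scheme"
    and \<pi> :: "('e \<Rightarrow> 'e) \<Rightarrow> 'f \<Rightarrow> 'f" +
  fixes gs :: "'e list"
  assumes frame_closed: "set gs \<subseteq> hm_carrier E"
    and frame_sum: "(\<Sum>g\<leftarrow>gs. hm_inner E g g) = 1"
begin

abbreviation Intw :: "('e \<Rightarrow> 'f) set" where
  "Intw \<equiv> intertwiners E F \<pi>"

abbreviation M :: "('e \<Rightarrow> 'f, 'b, 'b) corr" where
  "M \<equiv> int_corr E gs F \<pi>"

lemma frame_mem: "g \<in> set gs \<Longrightarrow> g \<in> hm_carrier E"
  using frame_closed by auto

lemma int_closed: "R \<in> Intw \<Longrightarrow> x \<in> hm_carrier E \<Longrightarrow> R x \<in> hm_carrier F"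
  by (auto simp: intertwiners_def)

lemma int_add: "R \<in> Intw \<Longrightarrow> x \<in> hm_carrier E \<Longrightarrow> y \<in> hm_carrier E \<Longrightarrow> R (hm_add E x y) = hm_add F (R x) (R y)"
  by (simp add: intertwiners_def)

lemma int_rep: "R \<in> Intw \<Longrightarrow> a \<in> adj_ops E \<Longrightarrow> x \<in> hm_carrier E \<Longrightarrow> R (a x) = \<pi> a (R x)"
  by (simp add: intertwiners_def)

lemma int_eqI: "R \<in> Intw \<Longrightarrow> S \<in> Intw \<Longrightarrow> (\<And>x. x \<in> hm_carrier E \<Longrightarrow> R x = S x) \<Longrightarrow> R = S"
  unfolding intertwiners_def by (auto intro: PiE_ext)

lemma intI:
  assumes "\<And>x. x \<in> hm_carrier E \<Longrightarrow> f x \<in> hm_carrier F"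
    "\<And>x y. x \<in> hm_carrier E \<Longrightarrow> y \<in> hm_carrier E \<Longrightarrow> f (hm_add E x y) = hm_add F (f x) (f y)"
    "\<And>a x. a \<in> adj_ops E \<Longrightarrow> x \<in> hm_carrier E \<Longrightarrow> f (a x) = \<pi> a (f x)"
  shows "(\<lambda>x\<in>hm_carrier E. f x) \<in> Intw"
  using assms by (auto simp: intertwiners_def E.closed E.adj_ops_closed)

lemma int_scale:
  assumes "R \<in> Intw" "x \<in> hm_carrier E"
  shows "R (hm_scale E c x) = hm_scale F c (R x)"
  using int_rep[OF assms(1) E.op_scale_adj_ops[OF E.op_id_adj_ops, of c] assms(2)] assms
  by (simp add: E.op_apply rep_scale rep_id E.op_adj_ops int_closed)

lemma int_zero: "R \<in> Intw \<Longrightarrow> R (hm_zero E) = hm_zero F"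
  using int_scale[of R "hm_zero E" 0] by (simp add: E.closed E.scale_zero F.zero_scale int_closed)

lemma int_sum:
  "R \<in> Intw \<Longrightarrow> (\<And>i. i \<in> set is \<Longrightarrow> f i \<in> hm_carrier E) \<Longrightarrow> R (hm_sum E f is) = hm_sum F (\<lambda>i. R (f i)) is"
  by (induction "is") (simp_all add: int_zero int_add E.sum_closed)

lemma int_expand:
  assumes R: "R \<in> Intw" and x: "x \<in> hm_carrier E"
  shows "R x = hm_sum F (\<lambda>g. \<pi> (rank_one E x g) (R g)) gs"
proof -
  have "hm_sum F (\<lambda>g. \<pi> (rank_one E x g) (R g)) gs = hm_sum F (\<lambda>g. R (hm_act E x (hm_inner E g g))) gs"
    using x frame_mem
    by (intro hm_sum_cong) (simp add: int_rep[OF R, symmetric] E.rank_one_adj_ops E.op_apply)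
  also have "\<dots> = R (hm_sum E (\<lambda>g. hm_act E x (hm_inner E g g)) gs)"
    using x by (intro int_sum[symmetric] R E.act_closed)
  finally show ?thesis using x by (simp add: E.act_sum frame_sum E.act_one)
qed

text \<open>In the cone a summand \<open>\<langle>R g, R g\<rangle>\<close> is dominated by the
  whole sum, and the expansion over the frame bounds \<open>R x\<close> by the values
  \<open>R g\<close>. Evaluation is thus continuous, and limits of intertwiners can be taken
  pointwise.\<close>

lemma int_norm_bound:
  assumes R: "R \<in> Intw" and x: "x \<in> hm_carrier E"
  shows "hm_norm F (R x) \<le> (\<Sum>g\<leftarrow>gs. hm_norm E x * hm_norm E g) * hm_norm M R"
proof -
  have "hm_norm F (R x) \<le> (\<Sum>g\<leftarrow>gs. hm_norm F (\<pi> (rank_one E x g) (R g)))"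
    unfolding int_expand[OF R x] using x frame_mem
    by (intro F.norm_sum_le rep_rank_one_closed int_closed R)
  also have "\<dots> \<le> (\<Sum>g\<leftarrow>gs. hm_norm E x * hm_norm E g * hm_norm M R)"
  proof (rule sum_list_mono)
    fix g assume g: "g \<in> set gs"
    have "norm (hm_inner F (R g) (R g)) \<le> norm (\<Sum>g\<leftarrow>gs. hm_inner F (R g) (R g))"
      using g frame_mem by (intro norm_le_norm_sum_list F.inner_positive int_closed R)
    then have "hm_norm F (R g) \<le> hm_norm M R" by (simp add: hm_norm_def)
    then have "hm_norm E x * hm_norm E g * hm_norm F (R g) \<le> hm_norm E x * hm_norm E g * hm_norm M R"
      by (intro mult_left_mono mult_nonneg_nonneg E.norm_nonneg)
    moreover have "hm_norm F (\<pi> (rank_one E x g) (R g)) \<le> hm_norm E x * hm_norm E g * hm_norm F (R g)"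
      using g by (intro rep_rank_one_norm_le x frame_mem int_closed R)
    ultimately show "hm_norm F (\<pi> (rank_one E x g) (R g)) \<le> hm_norm E x * hm_norm E g * hm_norm M R"
      by linarith
  qed
  also have "\<dots> = (\<Sum>g\<leftarrow>gs. hm_norm E x * hm_norm E g) * hm_norm M R"
    by (rule sum_list_mult_const)
  finally show ?thesis .
qed

lemma int_ops_closed:
  assumes "R \<in> Intw"
  shows "S \<in> Intw \<Longrightarrow> (\<lambda>x\<in>hm_carrier E. hm_add F (R x) (S x)) \<in> Intw"
    and "(\<lambda>x\<in>hm_carrier E. hm_scale F c (R x)) \<in> Intw"
    and "(\<lambda>x\<in>hm_carrier E. hm_act F (R x) b) \<in> Intw"
    and "(\<lambda>x\<in>hm_carrier E. R (hm_act E x b)) \<in> Intw"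
  using assms
  by (auto intro!: intI simp: F.closed E.closed int_closed int_add int_rep F.add_add_swap F.scale_add F.add_act
      E.add_act F.adj_add F.adj_scale F.adj_act rep_adj_ops E.adj_ops_closed E.adj_act[symmetric])

lemma int_zero_closed: "(\<lambda>x\<in>hm_carrier E. hm_zero F) \<in> Intw"
  by (rule intI) (simp_all add: F.closed F.zero_add F.adj_zero rep_adj_ops)

lemma int_diff:
  "hm_diff M R S = (\<lambda>x\<in>hm_carrier E. hm_diff F (R x) (S x))"
  by (auto simp: hm_diff_def)

lemma int_complete:
  assumes u: "\<And>n. u n \<in> Intw"
    and c: "\<And>e. e > 0 \<Longrightarrow> \<exists>N. \<forall>m\<ge>N. \<forall>n\<ge>N. hm_norm M (hm_diff M (u m) (u n)) < e"
  shows "\<exists>R\<in>Intw. (\<lambda>n. hm_norm M (hm_diff M (u n) R)) \<longlonglongrightarrow> 0"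
proof -
  have dI: "hm_diff M (u m) (u n) \<in> Intw" for m n
    using int_ops_closed(1)[OF u int_ops_closed(2)[OF u]] by (simp add: hm_diff_def)
  have ex: "\<exists>y. hm_lim F (\<lambda>n. u n x) y" if x: "x \<in> hm_carrier E" for x
  proof (rule F.cauchy_lim[of "\<lambda>n. u n x", OF int_closed[OF u x]])
    fix e :: real assume e: "e > 0"
    define B where "B = (\<Sum>g\<leftarrow>gs. hm_norm E x * hm_norm E g)"
    have B: "B \<ge> 0" unfolding B_def by (rule sum_list_nonneg) (auto simp: E.norm_nonneg)
    have "e / (B + 1) > 0" using e B by simp
    then obtain N where N: "\<And>m n. m \<ge> N \<Longrightarrow> n \<ge> N \<Longrightarrow> hm_norm M (hm_diff M (u m) (u n)) < e / (B + 1)"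
      using c by blast
    show "\<exists>N. \<forall>m\<ge>N. \<forall>n\<ge>N. hm_norm F (hm_diff F (u m x) (u n x)) < e"
    proof (intro exI[of _ N] allI impI)
      fix m n assume mn: "m \<ge> N" "n \<ge> N"
      have "hm_norm F (hm_diff F (u m x) (u n x)) \<le> B * hm_norm M (hm_diff M (u m) (u n))"
        using int_norm_bound[OF dI[of m n] x] x by (simp add: int_diff B_def)
      also have "\<dots> \<le> B * (e / (B + 1))" using N[OF mn] B by (intro mult_left_mono) auto
      also have "\<dots> < e" using e B by (simp add: field_simps)
      finally show "hm_norm F (hm_diff F (u m x) (u n x)) < e" .
    qed
  qed blast
  define L where "L x = (SOME y. hm_lim F (\<lambda>n. u n x) y)" for x
  have L: "hm_lim F (\<lambda>n. u n x) (L x)" if "x \<in> hm_carrier E" for x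
    unfolding L_def using someI_ex[OF ex[OF that]] .
  have Lc: "L x \<in> hm_carrier F" if "x \<in> hm_carrier E" for x using L[OF that] by (rule F.lim_closed)
  have I: "(\<lambda>x\<in>hm_carrier E. L x) \<in> Intw"
  proof (rule intI[OF Lc])
    fix x y assume xy: "x \<in> hm_carrier E" "y \<in> hm_carrier E"
    have "hm_lim F (\<lambda>n. u n (hm_add E x y)) (hm_add F (L x) (L y))"
      using F.lim_add[OF L[OF xy(1)] L[OF xy(2)]] u xy by (simp add: int_add int_closed)
    then show "L (hm_add E x y) = hm_add F (L x) (L y)"
      using L[of "hm_add E x y"] F.lim_unique[of "\<lambda>n. u n (hm_add E x y)"] u xy by (simp add: int_closed E.closed)
  next
    fix a x assume a: "a \<in> adj_ops E" and x: "x \<in> hm_carrier E"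
    have "hm_lim F (\<lambda>n. u n (a x)) (\<pi> a (L x))"
      using rep_lim[OF a L[OF x]] u x a by (simp add: int_rep int_closed)
    then show "L (a x) = \<pi> a (L x)"
      using L[of "a x"] F.lim_unique[of "\<lambda>n. u n (a x)"] u a x by (simp add: int_closed E.adj_ops_closed)
  qed
  show ?thesis
  proof (rule bexI[OF _ I])
    have "(\<lambda>n. \<Sum>g\<leftarrow>gs. hm_inner F (hm_diff F (u n g) (L g)) (hm_diff F (u n g) (L g))) \<longlonglongrightarrow> (\<Sum>g\<leftarrow>gs. 0)"
    proof (rule tendsto_sum_list)
      fix g assume g: "g \<in> set gs"
      have "(\<lambda>n. (hm_norm F (hm_diff F (u n g) (L g)))\<^sup>2) \<longlonglongrightarrow> 0"
        using L[OF frame_mem[OF g]] tendsto_power[of _ 0 _ 2] by (fastforce simp: hm_lim_def)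
      then have "(\<lambda>n. norm (hm_inner F (hm_diff F (u n g) (L g)) (hm_diff F (u n g) (L g)))) \<longlonglongrightarrow> 0"
        by (simp add: F.norm_power2)
      then show "(\<lambda>n. hm_inner F (hm_diff F (u n g) (L g)) (hm_diff F (u n g) (L g))) \<longlonglongrightarrow> 0"
        by (rule tendsto_norm_zero_cancel)
    qed
    then have "(\<lambda>n. sqrt (norm (\<Sum>g\<leftarrow>gs. hm_inner F (hm_diff F (u n g) (L g)) (hm_diff F (u n g) (L g))))) \<longlonglongrightarrow> sqrt (norm (\<Sum>g\<leftarrow>gs. 0::'b))"
      by (intro tendsto_real_sqrt tendsto_norm)
    then show "(\<lambda>n. hm_norm M (hm_diff M (u n) (\<lambda>x\<in>hm_carrier E. L x))) \<longlonglongrightarrow> 0"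
      using frame_mem by (simp add: hm_norm_def int_diff cong: map_cong)
  qed
qed

lemma int_hilbert_module: "hilbert_module M"
proof
  fix R assume R: "R \<in> hm_carrier M"
  show "cstar_positive (hm_inner M R R)"
    using R frame_mem by (auto intro!: cstar_positive_sum_list F.inner_positive int_closed)
  assume "hm_inner M R R = 0"
  then have "hm_inner F (R g) (R g) = 0" if "g \<in> set gs" for g
    using cstar_positive_sum_list_eq_0[of "\<lambda>g. hm_inner F (R g) (R g)" gs g] that R frame_mem
    by (auto intro!: F.inner_positive int_closed)
  then have Rg: "R g = hm_zero F" if "g \<in> set gs" for g
    using that R frame_mem by (intro F.inner_definite int_closed) auto
  have "R x = hm_zero F" if x: "x \<in> hm_carrier E" for x
  proof -
    have RI: "R \<in> Intw" using R by simp
    have "hm_sum F (\<lambda>g. hm_zero F) gs = hm_zero F" by (induction gs) (simp_all add: F.zero_add F.closed)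
    then show ?thesis unfolding int_expand[OF RI x] using x frame_mem
      by (simp add: Rg F.adj_zero rep_adj_ops E.rank_one_adj_ops cong: hm_sum_cong)
  qed
  then show "R = hm_zero M" using R int_zero_closed by (auto intro!: int_eqI)
next
  fix R assume "R \<in> hm_carrier M"
  then show "hm_add M (hm_zero M) R = R"
    using int_ops_closed(1)[OF int_zero_closed, of R] by (intro int_eqI) (simp_all add: F.zero_add int_closed)
next
  fix R S assume RS: "R \<in> hm_carrier M" "S \<in> hm_carrier M"
  show "star (hm_inner M R S) = hm_inner M S R"
    using RS frame_mem by (simp add: star_sum_list o_def F.star_inner int_closed cong: map_cong)
next
  fix u :: "nat \<Rightarrow> 'e \<Rightarrow> 'f"
  assume "\<And>n. u n \<in> hm_carrier M"
    and "\<And>e. e > 0 \<Longrightarrow> \<exists>N. \<forall>m\<ge>N. \<forall>n\<ge>N. hm_norm M (hm_diff M (u m) (u n)) < e"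
  then show "\<exists>x\<in>hm_carrier M. (\<lambda>n. hm_norm M (hm_diff M (u n) x)) \<longlonglongrightarrow> 0"
    using int_complete by simp
next
  fix R S Q assume RSQ: "R \<in> hm_carrier M" "S \<in> hm_carrier M" "Q \<in> hm_carrier M"
  show "hm_inner M R (hm_add M S Q) = hm_inner M R S + hm_inner M R Q"
    using RSQ frame_mem by (simp add: F.inner_add int_closed sum_list_addf[symmetric] cong: map_cong)
next
  fix R S c b assume RS: "R \<in> hm_carrier M" "S \<in> hm_carrier M"
  have "(\<Sum>g\<leftarrow>gs. c *\<^sub>C hm_inner F (R g) (S g)) = c *\<^sub>C (\<Sum>g\<leftarrow>gs. hm_inner F (R g) (S g))"
    by (induction gs) (simp_all add: scaleC_add_right)
  then show "hm_inner M R (hm_scale M c S) = c *\<^sub>C hm_inner M R S"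
    using RS frame_mem by (simp add: F.inner_scale int_closed cong: map_cong)
  have "(\<Sum>g\<leftarrow>gs. hm_inner F (R g) (S g) * b) = (\<Sum>g\<leftarrow>gs. hm_inner F (R g) (S g)) * b"
    by (rule sum_list_mult_const)
  then show "hm_inner M R (hm_act M S b) = hm_inner M R S * b"
    using RS frame_mem by (simp add: F.inner_act int_closed cong: map_cong)
qed (auto simp: int_ops_closed int_zero_closed int_diff F.add_assoc F.zero_add F.diff_self F.scale_add F.add_scale
    F.scale_scale F.scale_one F.add_act F.act_add F.act_act F.act_one F.scale_act F.act_scale int_closed
    intro!: restrict_ext int_eqI intro: F.add_commute)

sublocale M: hilbert_module M
  by (rule int_hilbert_module)

text \<open>Expanding \<open>R x\<close> over the frame and moving \<open>\<pi>\<close> to the other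
  side turns \<open>S y\<close> into \<open>S (g \<langle>x, y\<rangle>)\<close>. This is the inner
  product rule for elementary tensors \<open>x \<odot> R\<close>, so evaluation
  \<open>x \<odot> R \<mapsto> R x\<close> preserves inner products. It is used for fibres, for
  products of fibres and for \<open>E_-\<close> alike.\<close>

lemma inner_int_eval:
  assumes R: "R \<in> Intw" and S: "S \<in> Intw" and x: "x \<in> hm_carrier E" and y: "y \<in> hm_carrier E"
  shows "hm_inner F (R x) (S y) = hm_inner M R (hm_lact M (hm_inner E x y) S)"
proof -
  have "hm_inner F (R x) (S y) = (\<Sum>g\<leftarrow>gs. hm_inner F (\<pi> (rank_one E x g) (R g)) (S y))"
    unfolding int_expand[OF R x] using assms frame_mem
    by (intro F.inner_sum_left int_closed rep_rank_one_closed)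
  also have "\<dots> = (\<Sum>g\<leftarrow>gs. hm_inner F (R g) (S (hm_act E g (hm_inner E x y))))"
  proof (rule sum_list_cong)
    fix g assume "g \<in> set gs"
    then have g: "g \<in> hm_carrier E" by (rule frame_mem)
    have "hm_inner F (\<pi> (rank_one E x g) (R g)) (S y) = hm_inner F (R g) (\<pi> (rank_one E g x) (S y))"
      using assms g by (simp add: rep_inner E.rank_one_adj_ops int_closed E.op_adjoint_rank_one)
    also have "\<pi> (rank_one E g x) (S y) = S (hm_act E g (hm_inner E x y))"
      using int_rep[OF S E.rank_one_adj_ops[OF g x] y] y by (simp add: E.op_apply)
    finally show "hm_inner F (\<pi> (rank_one E x g) (R g)) (S y) = hm_inner F (R g) (S (hm_act E g (hm_inner E x y)))" .
  qed
  finally show ?thesis using frame_mem by (simp cong: map_cong)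
qed

lemma int_correspondence: "correspondence M"
proof
  fix b b' c R assume R: "R \<in> hm_carrier M"
  show "hm_lact M b R \<in> hm_carrier M" using R by (simp add: int_ops_closed)
  show "hm_lact M (b + b') R = hm_add M (hm_lact M b R) (hm_lact M b' R)"
    using R by (auto simp: E.act_add int_add E.closed)
  show "hm_lact M (c *\<^sub>C b) R = hm_scale M c (hm_lact M b R)"
    using R by (auto simp: E.act_scale int_scale E.closed)
  show "hm_lact M (b * b') R = hm_lact M b (hm_lact M b' R)"
    by (auto simp: E.act_act E.closed)
next
  fix b R S assume RS: "R \<in> hm_carrier M" "S \<in> hm_carrier M"
  define q where "q b = hm_inner M R (hm_lact M b S)" for b
  have add: "q (b + c) = q b + q c" for b c
    using RS frame_mem
    by (simp add: q_def E.act_add int_add E.closed F.inner_add int_closed sum_list_addf[symmetric] cong: map_cong)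
  have "q 0 = 0" using add[of 0 0] by simp
  then have qs: "q (\<Sum>g\<leftarrow>gs. f g) = (\<Sum>g\<leftarrow>gs. q (f g))" for f by (induction gs) (simp_all add: add)
  \<comment> \<open>\<open>inner_int_eval\<close> at \<open>g b\<close> and \<open>g\<close>
    produces the coefficient
    \<open>\<langle>g b, g\<rangle> = star b * \<langle>g, g\<rangle>\<close>, and these add up to
    \<open>star b\<close>.\<close>
  have "hm_inner M (hm_lact M b R) S = (\<Sum>g\<leftarrow>gs. q (star b * hm_inner E g g))"
    using RS frame_mem inner_int_eval[of R S]
    by (simp add: E.closed E.inner_act_left q_def cong: map_cong)
  also have "\<dots> = q (star b * 1)" unfolding frame_sum[symmetric] sum_list_const_mult qs[symmetric] ..
  finally show "hm_inner M (hm_lact M b R) S = hm_inner M R (hm_lact M (star b) S)" by (simp add: q_def)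
next
  have "R = hm_lact M 1 R" if "R \<in> Intw" for R
    using that int_ops_closed(4)[OF that, of 1] by (intro int_eqI) (simp_all add: E.act_one)
  moreover have "hm_lact M a R \<in> Intw" if "R \<in> Intw" for a R using that by (simp add: int_ops_closed)
  ultimately have "{hm_lact M a y | a y. y \<in> hm_carrier M} = hm_carrier M"
    unfolding int_corr_simps(1) by blast
  then show "closed_span M {hm_lact M a y | a y. y \<in> hm_carrier M} = hm_carrier M"
    by (rule M.closed_span_self)
qed

text \<open>The intertwiner that belongs to \<open>x^* \<odot> y\<close>: tensoring with
  \<open>z\<close> on the left identifies \<open>z \<odot> x^*\<close> with a rank one operator,
  which then acts on \<open>y\<close>.\<close>

definition dual_op :: "'e \<Rightarrow> 'f \<Rightarrow> 'e \<Rightarrow> 'f" where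
  "dual_op x y = (\<lambda>z\<in>hm_carrier E. \<pi> (rank_one E z x) y)"

lemma dual_op_int:
  assumes x: "x \<in> hm_carrier E" and y: "y \<in> hm_carrier F"
  shows "dual_op x y \<in> Intw"
  unfolding dual_op_def
proof (rule intI)
  fix a z assume a: "a \<in> adj_ops E" and z: "z \<in> hm_carrier E"
  show "\<pi> (rank_one E (a z) x) y = \<pi> a (\<pi> (rank_one E z x) y)"
    using rep_mult[OF a E.rank_one_adj_ops[OF z x] y] by (simp add: E.op_mult_rank_one a z x)
qed (use assms in \<open>simp_all add: rep_rank_one_closed rep_rank_one_add\<close>)

text \<open>The frame sum in the inner product is the expansion of \<open>R x\<close>. Evaluation at
  \<open>x\<close> is thus adjoint to \<open>y \<mapsto> x^* \<odot> y\<close>.\<close>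

lemma inner_dual_op:
  assumes x: "x \<in> hm_carrier E" and y: "y \<in> hm_carrier F" and R: "R \<in> Intw"
  shows "hm_inner M (dual_op x y) R = hm_inner F y (R x)"
proof -
  have "hm_inner M (dual_op x y) R = (\<Sum>g\<leftarrow>gs. hm_inner F (\<pi> (rank_one E g x) y) (R g))"
    using frame_mem by (simp add: dual_op_def cong: map_cong)
  also have "\<dots> = (\<Sum>g\<leftarrow>gs. hm_inner F y (\<pi> (rank_one E x g) (R g)))"
    using frame_mem assms
    by (intro sum_list_cong) (simp add: rep_inner E.rank_one_adj_ops int_closed E.op_adjoint_rank_one)
  also have "\<dots> = hm_inner F y (R x)"
    unfolding int_expand[OF R x] using assms frame_mem
    by (intro F.inner_sum[symmetric] rep_rank_one_closed int_closed[OF R])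
  finally show ?thesis .
qed

lemma int_dual_op_expand:
  assumes R: "R \<in> Intw"
  shows "R = hm_sum M (\<lambda>g. dual_op g (R g)) gs"
proof (rule M.inner_eqI)
  fix S assume S: "S \<in> hm_carrier M"
  have "hm_inner M S (hm_sum M (\<lambda>g. dual_op g (R g)) gs) = (\<Sum>g\<leftarrow>gs. hm_inner M S (dual_op g (R g)))"
    using S R frame_mem by (intro M.inner_sum) (simp_all add: dual_op_int int_closed)
  also have "\<dots> = (\<Sum>g\<leftarrow>gs. hm_inner F (S g) (R g))"
  proof (rule sum_list_cong)
    fix g assume "g \<in> set gs"
    then have g: "g \<in> hm_carrier E" "R g \<in> hm_carrier F" using frame_mem int_closed R by auto
    then have D: "dual_op g (R g) \<in> Intw" by (rule dual_op_int)
    have "hm_inner M S (dual_op g (R g)) = star (hm_inner M (dual_op g (R g)) S)"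
      using M.star_inner[of "dual_op g (R g)" S] S D by simp
    also have "\<dots> = hm_inner F (S g) (R g)"
      using S inner_dual_op[of g "R g" S] g by (simp add: F.star_inner int_closed)
    finally show "hm_inner M S (dual_op g (R g)) = hm_inner F (S g) (R g)" .
  qed
  finally show "hm_inner M S R = hm_inner M S (hm_sum M (\<lambda>g. dual_op g (R g)) gs)" by simp
next
  show "hm_sum M (\<lambda>g. dual_op g (R g)) gs \<in> hm_carrier M"
    using frame_mem R by (intro M.sum_closed) (simp add: dual_op_int int_closed)
qed (use R in simp)

text \<open>Every \<open>R\<close> is exactly the sum of the tensors \<open>g^* \<odot> R g\<close>,
  so density holds without approximation. The conjugated scalars of \<open>dual_corr\<close> become
  ordinary ones because \<open>dual_op\<close> is conjugate linear in the stored vector.\<close>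

sublocale dual_model: tensor_model "dual_corr E" "with_lact F \<pi>" M dual_op
proof
  fix x y c assume "x \<in> hm_carrier (dual_corr E)" "y \<in> hm_carrier (with_lact F \<pi>)"
  then have x: "x \<in> hm_carrier E" and y: "y \<in> hm_carrier F" by (simp_all add: dual_corr_def with_lact_def)
  have "rank_one E z (hm_scale E (cnj c) x) = op_scale E c (rank_one E z x)" if "z \<in> hm_carrier E" for z
    using x that by (intro E.adj_ops_eqI) (simp_all add: E.op_adj_ops E.closed E.op_apply E.inner_simps E.act_scale)
  then show "dual_op (hm_scale (dual_corr E) c x) y = hm_scale M c (dual_op x y)"
    using x y by (auto simp: dual_op_def dual_corr_def rep_scale E.rank_one_adj_ops)
next
  fix x y b assume "x \<in> hm_carrier (dual_corr E)" "y \<in> hm_carrier (with_lact F \<pi>)"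
  then have x: "x \<in> hm_carrier E" and y: "y \<in> hm_carrier F" by (simp_all add: dual_corr_def with_lact_def)
  show "dual_op x (hm_act (with_lact F \<pi>) y b) = hm_act M (dual_op x y) b"
    using x y by (auto simp: dual_op_def with_lact_def F.adj_act rep_adj_ops E.rank_one_adj_ops)
next
  fix x y x' y'
  assume "x \<in> hm_carrier (dual_corr E)" "y \<in> hm_carrier (with_lact F \<pi>)"
    "x' \<in> hm_carrier (dual_corr E)" "y' \<in> hm_carrier (with_lact F \<pi>)"
  then have "x \<in> hm_carrier E" "y \<in> hm_carrier F" "x' \<in> hm_carrier E" "y' \<in> hm_carrier F"
    by (simp_all add: dual_corr_def with_lact_def)
  then have "hm_inner M (dual_op x y) (dual_op x' y') = hm_inner F y (\<pi> (rank_one E x x') y')"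
    using inner_dual_op[of x y "dual_op x' y'"] dual_op_int[of x' y'] by (simp add: dual_op_def)
  then show "hm_inner M (dual_op x y) (dual_op x' y') =
      hm_inner (with_lact F \<pi>) y (hm_lact (with_lact F \<pi>) (hm_inner (dual_corr E) x x') y')"
    by (simp add: dual_corr_def with_lact_def)
next
  fix R e assume R: "R \<in> hm_carrier M" and e: "(e::real) > 0"
  let ?s = "map (\<lambda>g. (g, R g)) gs"
  have "?s \<in> lists (hm_carrier (dual_corr E) \<times> hm_carrier (with_lact F \<pi>))"
    using R frame_mem int_closed by (auto simp: dual_corr_def with_lact_def)
  moreover have "hm_sum M (\<lambda>p. dual_op (fst p) (snd p)) ?s = R"
    using int_dual_op_expand[of R] R by (simp add: hm_sum_map)
  ultimately show "\<exists>s\<in>lists (hm_carrier (dual_corr E) \<times> hm_carrier (with_lact F \<pi>)).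
      hm_norm M (hm_diff M R (hm_sum M (\<lambda>p. dual_op (fst p) (snd p)) s)) < e"
    using e R M.norm_zero M.diff_self[of R] by (intro bexI[of _ ?s]) simp_all
qed (auto simp: dual_corr_def with_lact_def E.closed F.closed dual_op_int)

end

section \<open>Approximation by finite sums\<close>

text \<open>Sums carry no coefficients, in accordance with formal sums of elementary tensors. The
  generating sets used below absorb scalars, so this is their closed span.\<close>

definition hm_approx :: "('e, 'b::unital_cstar_algebra, 'z) hilbert_mod_scheme \<Rightarrow> 'e set \<Rightarrow> 'e set" where
  "hm_approx E S = {x \<in> hm_carrier E. \<forall>e>0. \<exists>xs\<in>lists S. hm_norm E (hm_diff E x (hm_sum E (\<lambda>x. x) xs)) < e}"

context hilbert_module
begin

lemma approx_sum:
  assumes "S \<subseteq> hm_carrier E" "xs \<in> lists S"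
  shows "hm_sum E (\<lambda>x. x) xs \<in> hm_approx E S"
proof -
  have "hm_sum E (\<lambda>x. x) xs \<in> hm_carrier E" using assms by (intro sum_closed) auto
  then show ?thesis using assms(2) by (auto simp: hm_approx_def diff_self norm_zero intro!: bexI[of _ xs])
qed

lemma approx_mem: "S \<subseteq> hm_carrier E \<Longrightarrow> x \<in> S \<Longrightarrow> x \<in> hm_approx E S"
  using approx_sum[of S "[x]"] by (auto simp: add_zero)

lemma approx_closed: "x \<in> hm_approx E S \<Longrightarrow> x \<in> hm_carrier E"
  by (simp add: hm_approx_def)

lemma approxE:
  assumes "x \<in> hm_approx E S" "e > 0"
  obtains xs where "xs \<in> lists S" "hm_norm E (hm_diff E x (hm_sum E (\<lambda>x. x) xs)) < e"
  using assms unfolding hm_approx_def by blast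

lemma approx_zero: "hm_zero E \<in> hm_approx E S"
  by (auto simp: hm_approx_def closed diff_self norm_zero intro!: bexI[of _ "[]"])

lemma approx_add:
  assumes S: "S \<subseteq> hm_carrier E" and x: "x \<in> hm_approx E S" and y: "y \<in> hm_approx E S"
  shows "hm_add E x y \<in> hm_approx E S"
proof -
  have xy: "x \<in> hm_carrier E" "y \<in> hm_carrier E" using x y by (simp_all add: approx_closed)
  have "\<exists>zs\<in>lists S. hm_norm E (hm_diff E (hm_add E x y) (hm_sum E (\<lambda>x. x) zs)) < e" if e: "e > 0" for e
  proof -
    obtain xs where xs: "xs \<in> lists S" "hm_norm E (hm_diff E x (hm_sum E (\<lambda>x. x) xs)) < e / 2"
      by (rule approxE[OF x, of "e / 2"]) (use e in simp_all)
    obtain ys where ys: "ys \<in> lists S" "hm_norm E (hm_diff E y (hm_sum E (\<lambda>x. x) ys)) < e / 2"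
      by (rule approxE[OF y, of "e / 2"]) (use e in simp_all)
    define X Y where "X = hm_sum E (\<lambda>x. x) xs" and "Y = hm_sum E (\<lambda>x. x) ys"
    have XY: "X \<in> hm_carrier E" "Y \<in> hm_carrier E"
      using xs ys S unfolding X_def Y_def by (auto intro!: sum_closed)
    have "hm_sum E (\<lambda>x. x) (xs @ ys) = hm_add E X Y"
      unfolding X_def Y_def using xs ys S by (intro sum_append) auto
    moreover have "hm_diff E (hm_add E x y) (hm_add E X Y) = hm_add E (hm_diff E x X) (hm_diff E y Y)"
      using xy XY by (intro inner_eqI) (simp_all add: inner_simps closed)
    moreover have "hm_norm E (hm_add E (hm_diff E x X) (hm_diff E y Y)) < e"
      using norm_add_le[of "hm_diff E x X" "hm_diff E y Y"] xs ys xy XY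
      by (simp add: closed X_def[symmetric] Y_def[symmetric])
    ultimately show ?thesis using xs ys by (intro bexI[of _ "xs @ ys"]) simp_all
  qed
  then show ?thesis using xy by (simp add: hm_approx_def closed)
qed

lemma approx_hm_sum:
  "S \<subseteq> hm_carrier E \<Longrightarrow> (\<And>i. i \<in> set is \<Longrightarrow> f i \<in> hm_approx E S) \<Longrightarrow> hm_sum E f is \<in> hm_approx E S"
  by (induction "is") (simp_all add: approx_zero approx_add)

lemma approx_limit:
  assumes S: "S \<subseteq> hm_carrier E" and x: "x \<in> hm_carrier E"
    and near: "\<And>e. e > 0 \<Longrightarrow> \<exists>y\<in>hm_approx E S. hm_norm E (hm_diff E x y) < e"
  shows "x \<in> hm_approx E S"
proof -
  have "\<exists>xs\<in>lists S. hm_norm E (hm_diff E x (hm_sum E (\<lambda>x. x) xs)) < e" if e: "e > 0" for e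
  proof -
    obtain y where y: "y \<in> hm_approx E S" "hm_norm E (hm_diff E x y) < e / 2" using near[of "e / 2"] e by auto
    obtain xs where xs: "xs \<in> lists S" "hm_norm E (hm_diff E y (hm_sum E (\<lambda>x. x) xs)) < e / 2"
      by (rule approxE[OF y(1), of "e / 2"]) (use e in simp_all)
    have "hm_sum E (\<lambda>x. x) xs \<in> hm_carrier E" using xs S by (intro sum_closed) auto
    then show ?thesis
      using norm_diff_triangle[OF x approx_closed[OF y(1)], of "hm_sum E (\<lambda>x. x) xs"] y xs by (intro bexI[of _ xs]) auto
  qed
  then show ?thesis using x by (simp add: hm_approx_def)
qed

lemma approx_orthogonal:
  assumes S: "S \<subseteq> hm_carrier E" and x: "x \<in> hm_approx E S"
    and orth: "\<And>y. y \<in> S \<Longrightarrow> hm_inner E x y = 0"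
  shows "x = hm_zero E"
proof -
  have xc: "x \<in> hm_carrier E" using x by (rule approx_closed)
  have "(hm_norm E x)\<^sup>2 \<le> 0 + e" if e: "e > 0" for e
  proof -
    have p: "hm_norm E x + 1 > 0" using norm_nonneg[of x] by simp
    then have "e / (hm_norm E x + 1) > 0" using e by simp
    then obtain xs where xs: "xs \<in> lists S" "hm_norm E (hm_diff E x (hm_sum E (\<lambda>x. x) xs)) < e / (hm_norm E x + 1)"
      using x unfolding hm_approx_def by blast
    have Xc: "hm_sum E (\<lambda>x. x) xs \<in> hm_carrier E" using xs S by (intro sum_closed) auto
    have "hm_inner E x (hm_sum E (\<lambda>x. x) xs) = (\<Sum>y\<leftarrow>xs. hm_inner E x y)"
      using xs S xc by (intro inner_sum) auto
    also have "\<dots> = (\<Sum>y\<leftarrow>xs. 0)" using xs orth by (intro sum_list_cong) auto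
    finally have "hm_inner E x x = hm_inner E x (hm_diff E x (hm_sum E (\<lambda>x. x) xs))"
      using xc Xc by (simp add: inner_simps)
    then have "(hm_norm E x)\<^sup>2 \<le> hm_norm E x * hm_norm E (hm_diff E x (hm_sum E (\<lambda>x. x) xs))"
      using cauchy_schwarz[OF xc, of "hm_diff E x (hm_sum E (\<lambda>x. x) xs)"] xc Xc by (simp add: norm_power2 closed)
    also have "\<dots> \<le> hm_norm E x * (e / (hm_norm E x + 1))"
      using xs by (intro mult_left_mono norm_nonneg) auto
    also have "\<dots> \<le> e" using e p by (simp add: field_simps)
    finally show ?thesis by simp
  qed
  then have "(hm_norm E x)\<^sup>2 \<le> 0" by (rule field_le_epsilon)
  then show ?thesis using norm_eq_zeroD[OF xc] by simp
qed

text \<open>\<open>op_norm\<close> is a supremum of reals, which is meaningful for bounded sets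
  only; that the set is bounded is \<open>adj_bounded\<close>.\<close>

lemma op_norm_bound:
  assumes a: "a \<in> adj_ops E" and x: "x \<in> hm_carrier E"
  shows "hm_norm E (a x) \<le> op_norm E a * hm_norm E x"
proof (cases "hm_norm E x = 0")
  case True
  then have "x = hm_zero E" using norm_eq_zeroD[OF x] by simp
  then show ?thesis by (simp add: adj_zero[OF a] norm_zero)
next
  case False
  then have p: "hm_norm E x > 0" using norm_nonneg[of x] by simp
  obtain K where K: "K > 0" "\<And>x. x \<in> hm_carrier E \<Longrightarrow> hm_norm E (a x) \<le> K * hm_norm E x"
    using adj_bounded[OF a] by blast
  let ?y = "hm_scale E (complex_of_real (1 / hm_norm E x)) x"
  have bdd: "bdd_above ((\<lambda>x. hm_norm E (a x)) ` {x \<in> hm_carrier E. hm_norm E x \<le> 1})"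
  proof (rule bdd_aboveI2)
    fix z assume "z \<in> {x \<in> hm_carrier E. hm_norm E x \<le> 1}"
    then have z: "z \<in> hm_carrier E" "hm_norm E z \<le> 1" by auto
    then show "hm_norm E (a z) \<le> K"
      using K(2)[OF z(1)] mult_left_mono[OF z(2), of K] K(1) by linarith
  qed
  have "hm_norm E (a ?y) \<le> op_norm E a"
    unfolding op_norm_def by (rule cSUP_upper[OF _ bdd]) (use x p in \<open>simp add: closed norm_scale norm_divide\<close>)
  then have "hm_norm E (a x) / hm_norm E x \<le> op_norm E a"
    using x p a by (simp add: adj_scale norm_scale adj_ops_closed norm_divide)
  then show ?thesis using p by (simp add: divide_le_eq)
qed

end

text \<open>Strictness is stated with compact operators. By contractivity of \<open>\<pi>\<close>,
  norm approximation by finite rank operators survives under \<open>\<pi>\<close>, and scalar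
  coefficients can be absorbed into the vector \<open>z\<close>.\<close>

lemma (in dual_rep) approx_rank_one:
  assumes strict: "closed_span F {\<pi> k x | k x. k \<in> compact_ops E \<and> x \<in> hm_carrier F} = hm_carrier F"
    and y: "y \<in> hm_carrier F"
  shows "y \<in> hm_approx F {\<pi> (rank_one E x x') z | x x' z. x \<in> hm_carrier E \<and> x' \<in> hm_carrier E \<and> z \<in> hm_carrier F}"
    (is "_ \<in> hm_approx F ?S")
proof -
  have S: "?S \<subseteq> hm_carrier F" using rep_rank_one_closed by auto
  have zero: "op_zero E = op_scale E 0 (op_id E)"
    by (auto simp: op_zero_def op_scale_def E.op_id_apply E.zero_scale)
  have fin: "f \<in> adj_ops E \<and> (\<forall>z\<in>hm_carrier F. \<pi> f z \<in> hm_approx F ?S)" if "f \<in> finite_rank_ops E" for f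
    using that
  proof induction
    case finite_rank_zero
    then show ?case
      by (simp add: zero E.op_adj_ops rep_scale rep_id F.zero_scale F.approx_zero)
  next
    case (finite_rank_step x x' f c)
    have "\<pi> (op_add E (op_scale E c (rank_one E x x')) f) z \<in> hm_approx F ?S" if z: "z \<in> hm_carrier F" for z
    proof -
      have "hm_scale F c (\<pi> (rank_one E x x') z) = \<pi> (rank_one E x x') (hm_scale F c z)"
        using finite_rank_step z by (simp add: F.adj_scale rep_adj_ops E.rank_one_adj_ops)
      moreover have "\<pi> (rank_one E x x') (hm_scale F c z) \<in> hm_approx F ?S"
        using finite_rank_step z by (intro F.approx_mem[OF S]) (auto intro: F.closed)
      ultimately show ?thesis using finite_rank_step z
        by (simp add: rep_add rep_scale E.op_adj_ops F.approx_add[OF S])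
    qed
    then show ?case using finite_rank_step by (simp add: E.op_adj_ops)
  qed
  have cpt: "\<pi> k z \<in> hm_approx F ?S" if k: "k \<in> compact_ops E" and z: "z \<in> hm_carrier F" for k z
  proof (rule F.approx_limit[OF S])
    have ka: "k \<in> adj_ops E" using k by (simp add: compact_ops_def)
    show "\<pi> k z \<in> hm_carrier F" using ka z by (rule rep_closed)
    fix e :: real assume e: "e > 0"
    have p: "hm_norm F z + 1 > 0" using F.norm_nonneg[of z] by simp
    then have "e / (hm_norm F z + 1) > 0" using e by simp
    then obtain f where f: "f \<in> finite_rank_ops E"
      "op_norm E (op_add E k (op_scale E (- 1) f)) < e / (hm_norm F z + 1)"
      using k unfolding compact_ops_def by blast
    let ?d = "op_add E k (op_scale E (- 1) f)"
    have fa: "f \<in> adj_ops E" using fin[OF f(1)] by simp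
    have d: "?d \<in> adj_ops E" using ka fa by (simp add: E.op_adj_ops)
    have "hm_diff F (\<pi> k z) (\<pi> f z) = \<pi> ?d z"
      using ka fa z by (simp add: rep_add rep_scale E.op_adj_ops hm_diff_def)
    also have "hm_norm F (\<pi> ?d z) \<le> e / (hm_norm F z + 1) * hm_norm F z"
    proof (rule rep_norm_le[OF d _ _ z])
      show "0 \<le> e / (hm_norm F z + 1)" using e p by simp
      show "hm_norm E (?d x) \<le> e / (hm_norm F z + 1) * hm_norm E x" if "x \<in> hm_carrier E" for x
        using E.op_norm_bound[OF d that] mult_right_mono[OF less_imp_le[OF f(2)] E.norm_nonneg[of x]] by linarith
    qed
    also have "\<dots> < e" using e p by (simp add: field_simps)
    finally show "\<exists>y\<in>hm_approx F ?S. hm_norm F (hm_diff F (\<pi> k z) y) < e"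
      using fin[OF f(1)] z by blast
  qed
  let ?G = "{\<pi> k x | k x. k \<in> compact_ops E \<and> x \<in> hm_carrier F}"
  have scale: "hm_scale F c x \<in> hm_approx F ?S" if "x \<in> ?G" for c x
  proof -
    obtain k z where kz: "x = \<pi> k z" "k \<in> compact_ops E" "z \<in> hm_carrier F" using \<open>x \<in> ?G\<close> by auto
    then have "hm_scale F c x = \<pi> k (hm_scale F c z)"
      by (simp add: F.adj_scale rep_adj_ops compact_ops_def)
    then show ?thesis using kz by (simp add: cpt F.closed)
  qed
  have span: "x \<in> hm_approx F ?S" if "x \<in> lin_span F ?G" for x
    using that by induction (simp_all only: F.approx_zero F.approx_add[OF S] scale)
  show ?thesis
  proof (rule F.approx_limit[OF S y])
    fix e :: real assume "e > 0"
    moreover have "y \<in> closed_span F ?G" using y strict by simp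
    ultimately show "\<exists>z\<in>hm_approx F ?S. hm_norm F (hm_diff F y z) < e"
      using span unfolding closed_span_def by blast
  qed
qed

lemma total_of_approx:
  assumes "g \<in> hm_approx G {\<phi> x y | x y. x \<in> A \<and> y \<in> B}" "e > 0"
  shows "\<exists>s\<in>lists (A \<times> B). hm_norm G (hm_diff G g (hm_sum G (\<lambda>p. \<phi> (fst p) (snd p)) s)) < e"
proof -
  have "{\<phi> x y | x y. x \<in> A \<and> y \<in> B} = (\<lambda>p. \<phi> (fst p) (snd p)) ` (A \<times> B)" by force
  then obtain xs where xs: "xs \<in> lists ((\<lambda>p. \<phi> (fst p) (snd p)) ` (A \<times> B))"
    "hm_norm G (hm_diff G g (hm_sum G (\<lambda>x. x) xs)) < e"
    using assms unfolding hm_approx_def mem_Collect_eq by metis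
  then obtain s where "s \<in> lists (A \<times> B)" "xs = map (\<lambda>p. \<phi> (fst p) (snd p)) s"
    unfolding lists_image by auto
  then show ?thesis using xs(2) by (auto simp: hm_sum_map)
qed

section \<open>The product system in terms of intertwiners\<close>

lemma module_iso_relabel:
  fixes T' :: "('t, 'b::unital_cstar_algebra, 'a) corr"
  assumes T': "module_iso G T' \<Theta>" and k: "\<And>X. X \<in> hm_carrier T' \<Longrightarrow> k (j X) = X"
  shows "module_iso G (relabel j k T') (\<lambda>x. j (\<Theta> x))"
proof -
  interpret T': module_iso G T' \<Theta> by fact
  have kj: "k (j (\<Theta> x)) = \<Theta> x" if "x \<in> hm_carrier G" for x using k that by (simp add: T'.iso_closed)
  show ?thesis
  proof
    show "inj_on (\<lambda>x. j (\<Theta> x)) (hm_carrier G)"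
      by (rule inj_onI) (metis kj inj_onD[OF T'.inj])
  qed (auto simp: relabel_def T'.carrier_eq T'.iso_simps kj T'.G.closed image_image)
qed

lemma (in full_rep) lact_adj_ops: "(\<lambda>R\<in>hm_carrier M. hm_lact M b R) \<in> adj_ops M"
proof (rule M.adj_opsI(1))
  interpret C: correspondence M by (rule int_correspondence)
  show "(\<lambda>R\<in>hm_carrier M. hm_lact M b R) \<in> hm_carrier M \<rightarrow>\<^sub>E hm_carrier M"
    "(\<lambda>R\<in>hm_carrier M. hm_lact M (star b) R) \<in> hm_carrier M \<rightarrow>\<^sub>E hm_carrier M"
    using C.lact_closed by auto
  fix R S assume "R \<in> hm_carrier M" "S \<in> hm_carrier M"
  then show "hm_inner M ((\<lambda>R\<in>hm_carrier M. hm_lact M b R) R) S =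
      hm_inner M R ((\<lambda>R\<in>hm_carrier M. hm_lact M (star b) R) S)"
    using C.lact_star[of R S b] by (simp del: int_corr_simps)
qed

lemma (in full_rep) int_lact_sum:
  assumes R: "R \<in> Intw" and S: "S \<in> Intw"
  shows "(\<Sum>i\<leftarrow>is. hm_inner M R (hm_lact M (f i) S)) = hm_inner M R (hm_lact M (\<Sum>i\<leftarrow>is. f i) S)"
proof -
  interpret C: correspondence M by (rule int_correspondence)
  define q where "q b = hm_inner M R (hm_lact M b S)" for b
  have add: "q (b + c) = q b + q c" for b c
  proof -
    have RS: "R \<in> hm_carrier M" "S \<in> hm_carrier M" using R S by simp_all
    show ?thesis unfolding q_def C.lact_add[OF RS(2)]
      by (intro M.inner_add C.lact_closed RS)
  qed
  have "q 0 = 0" using add[of 0 0] by simp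
  then have "q (\<Sum>i\<leftarrow>is. f i) = (\<Sum>i\<leftarrow>is. q (f i))" by (induction "is") (simp_all add: add)
  then show ?thesis by (simp only: q_def)
qed

text \<open>Left multiplication in a fibre is an amplification; it is computed here as composition
  with the right action of \<open>E\<close>. Centrality of a unit thereby becomes a statement about
  intertwiners.\<close>

lemma (in full_rep) lact_tensor_class:
  assumes R: "R \<in> Intw"
  shows "hm_lact (tensor_corr (dual_corr E) (with_lact F \<pi>)) b (dual_model.tensor_class R) =
    dual_model.tensor_class (hm_lact M b R)"
proof -
  interpret C: correspondence M by (rule int_correspondence)
  let ?L = "\<lambda>R\<in>hm_carrier M. hm_lact M b R"
  have "amplification (dual_corr E) (with_lact F \<pi>) (hm_lact (dual_corr E) b) (dual_model.tensor_class R) =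
      dual_model.tensor_class (?L R)"
  proof (rule dual_model.amplification_class)
    show "R \<in> hm_carrier M" using R by simp
    show "hm_lact (dual_corr E) b x \<in> hm_carrier (dual_corr E)" if "x \<in> hm_carrier (dual_corr E)" for x
      using that by (simp add: dual_corr_def E.closed)
    show "dual_op (hm_lact (dual_corr E) b x) y = ?L (dual_op x y)"
      if "x \<in> hm_carrier (dual_corr E)" "y \<in> hm_carrier (with_lact F \<pi>)" for x y
    proof -
      have xy: "x \<in> hm_carrier E" "y \<in> hm_carrier F" using that by (simp_all add: dual_corr_def with_lact_def)
      then show ?thesis using dual_op_int[OF xy]
        by (auto simp: dual_op_def dual_corr_def E.closed E.rank_one_act)
    qed
    show "?L (hm_zero M) = hm_zero M" by (rule M.adj_zero[OF lact_adj_ops])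
    show "?L (hm_add M g h) = hm_add M (?L g) (?L h)" if "g \<in> hm_carrier M" "h \<in> hm_carrier M" for g h
      by (rule M.adj_add[OF lact_adj_ops that])
    show "hm_lim M (\<lambda>n. ?L (u n)) (?L R)" if "\<And>n. u n \<in> hm_carrier M" "hm_lim M u R" for u
      by (rule M.adj_lim[OF lact_adj_ops that(2,1)])
  qed
  then show ?thesis using R by (simp add: tensor_corr_def with_lact_def)
qed

section \<open>The semigroup and its fibres as modules of intertwiners\<close>

locale spatial_semigroup = E: hilbert_module E
  for E :: "('e, 'b::unital_cstar_algebra) hilbert_mod" +
  fixes T :: "real set" and \<theta> :: "real \<Rightarrow> ('e \<Rightarrow> 'e) \<Rightarrow> 'e \<Rightarrow> 'e"
  assumes index: "T = {0..} \<or> T = \<nat>"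
    and strict: "strict_E0_semigroup T E \<theta>"
    and spatial: "spatial T E \<theta>"
begin

lemma T_simps: "0 \<in> T" "1 \<in> T" "real n \<in> T" "s \<in> T \<Longrightarrow> t \<in> T \<Longrightarrow> s + t \<in> T"
  "t \<in> T \<Longrightarrow> 0 \<le> t"
  using index by (auto elim: Nats_cases)

lemma T_diff: "s \<in> T \<Longrightarrow> t \<in> T \<Longrightarrow> s \<le> t \<Longrightarrow> t - s \<in> T"
proof -
  assume st: "s \<in> T" "t \<in> T" "s \<le> t"
  show "t - s \<in> T"
    using index
  proof
    assume T: "T = \<nat>"
    then obtain m n where "s = of_nat m" "t = of_nat n" using st by (auto elim!: Nats_cases)
    then have "t - s = of_nat (n - m)" using st(3) by (simp add: of_nat_diff)
    then show ?thesis using T by simp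
  qed (use st in simp)
qed

lemma E0: "t \<in> T \<Longrightarrow> star_hom E E (\<theta> t)" "t \<in> T \<Longrightarrow> \<theta> t (op_id E) = op_id E"
  "a \<in> adj_ops E \<Longrightarrow> \<theta> 0 a = a"
  "s \<in> T \<Longrightarrow> t \<in> T \<Longrightarrow> a \<in> adj_ops E \<Longrightarrow> \<theta> (s + t) a = \<theta> s (\<theta> t a)"
  using strict by (simp_all add: strict_E0_semigroup_def E0_semigroup_def)

lemma dual_rep: "t \<in> T \<Longrightarrow> dual_rep E E (\<theta> t)"
  by unfold_locales (simp_all add: E0)

lemma fibre_pos: "t \<noteq> 0 \<Longrightarrow>
    ps_fibre E \<theta> t = relabel Inr projr (tensor_corr (dual_corr E) (with_lact E (\<theta> t)))"
  by (simp add: ps_fibre_def)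

text \<open>The index \<open>1\<close> belongs to both choices of \<open>T\<close> and is positive;
  the fibre at \<open>0\<close> is \<open>\<B>\<close> by definition and says nothing about
  \<open>E\<close>.\<close>

lemma full: obtains gs where "set gs \<subseteq> hm_carrier E" "(\<Sum>g\<leftarrow>gs. hm_inner E g g) = 1"
proof -
  obtain \<omega> where \<omega>: "unital_unit T E \<theta> \<omega>" using spatial by (auto simp: spatial_def)
  have "\<omega> 1 \<in> hm_carrier (ps_fibre E \<theta> 1)" "hm_inner (ps_fibre E \<theta> 1) (\<omega> 1) (\<omega> 1) = 1"
    using \<omega> T_simps(2) by (auto simp: unital_unit_def ps_unit_def)
  then obtain X where "X \<in> hm_carrier (tensor (dual_corr E) (with_lact E (\<theta> 1)))"
    "hm_inner (tensor (dual_corr E) (with_lact E (\<theta> 1))) X X = 1"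
    by (auto simp: fibre_pos relabel_def tensor_corr_def with_lact_def)
  then show thesis using full_of_unit_vector[OF dual_rep[OF T_simps(2)]] that by blast
qed

text \<open>Fixed once, since it enters the inner products of all modules of intertwiners, into
  \<open>E\<close> and later into \<open>H\<close>.\<close>

definition frame :: "'e list" where
  "frame = (SOME gs. set gs \<subseteq> hm_carrier E \<and> (\<Sum>g\<leftarrow>gs. hm_inner E g g) = 1)"

lemma frame: "set frame \<subseteq> hm_carrier E" "(\<Sum>g\<leftarrow>frame. hm_inner E g g) = 1"
proof -
  have "\<exists>gs. set gs \<subseteq> hm_carrier E \<and> (\<Sum>g\<leftarrow>gs. hm_inner E g g) = 1" by (rule full) blast
  then have "set frame \<subseteq> hm_carrier E \<and> (\<Sum>g\<leftarrow>frame. hm_inner E g g) = 1"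
    unfolding frame_def by (rule someI_ex)
  then show "set frame \<subseteq> hm_carrier E" "(\<Sum>g\<leftarrow>frame. hm_inner E g g) = 1" by auto
qed

lemma full_rep: "t \<in> T \<Longrightarrow> full_rep E E (\<theta> t) frame"
  using dual_rep[of t] frame by (simp add: full_rep_def full_rep_axioms_def)

abbreviation Int_t :: "real \<Rightarrow> ('e \<Rightarrow> 'e) set" where
  "Int_t t \<equiv> intertwiners E E (\<theta> t)"

abbreviation M_t :: "real \<Rightarrow> ('e \<Rightarrow> 'e, 'b, 'b) corr" where
  "M_t t \<equiv> int_corr E frame E (\<theta> t)"

abbreviation d_op :: "real \<Rightarrow> 'e \<Rightarrow> 'e \<Rightarrow> 'e \<Rightarrow> 'e" where
  "d_op t \<equiv> full_rep.dual_op E (\<theta> t)"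

definition encode :: "real \<Rightarrow> ('e \<Rightarrow> 'e) \<Rightarrow> ('e, 'b) ps_elem" where
  "encode t R = Inr (tensor_model.tensor_class (dual_corr E) (with_lact E (\<theta> t)) (M_t t) (d_op t) R)"

lemma encode_iso:
  assumes t: "t \<in> T" "t \<noteq> 0"
  shows "module_iso (M_t t) (ps_fibre E \<theta> t) (encode t)"
    and "R \<in> Int_t t \<Longrightarrow> hm_lact (ps_fibre E \<theta> t) b (encode t R) = encode t (hm_lact (M_t t) b R)"
proof -
  interpret full_rep E E "\<theta> t" frame by (rule full_rep[OF t(1)])
  have "module_iso (M_t t) (tensor_corr (dual_corr E) (with_lact E (\<theta> t))) dual_model.tensor_class"
    using dual_model.tensor_iso.module_iso_axioms
    unfolding module_iso_def module_iso_axioms_def tensor_corr_def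
    by (simp add: with_lact_def[of "tensor (dual_corr E) (with_lact E (\<theta> t))"])
  from module_iso_relabel[OF this, of projr Inr]
  show "module_iso (M_t t) (ps_fibre E \<theta> t) (encode t)"
    by (simp add: fibre_pos t encode_def[abs_def])
  show "hm_lact (ps_fibre E \<theta> t) b (encode t R) = encode t (hm_lact (M_t t) b R)" if "R \<in> Int_t t"
    using that by (simp add: fibre_pos t encode_def relabel_def lact_tensor_class del: int_corr_simps(7))
qed

lemma encode_elem:
  assumes t: "t \<in> T" and x: "x \<in> hm_carrier E" and y: "y \<in> hm_carrier E"
  shows "ps_elem_tensor E \<theta> t x y = encode t (d_op t x y)"
proof -
  interpret full_rep E E "\<theta> t" frame by (rule full_rep[OF t(1)])
  show ?thesis
    using x y dual_model.elem_tensor_class[of x y]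
    by (simp add: ps_elem_tensor_def encode_def dual_corr_def with_lact_def)
qed

lemma approx_theta:
  "t \<in> T \<Longrightarrow> y \<in> hm_carrier E \<Longrightarrow> y \<in> hm_approx E
    {\<theta> t (rank_one E x x') z | x x' z. x \<in> hm_carrier E \<and> x' \<in> hm_carrier E \<and> z \<in> hm_carrier E}"
  using strict by (intro dual_rep.approx_rank_one[OF dual_rep]) (auto simp: strict_E0_semigroup_def)

text \<open>The order of the factors is reversed: \<open>x \<odot> \<xi>_s \<odot> \<xi>_t\<close>
  is reached by applying \<open>S\<close> first and then \<open>R\<close>, and \<open>a\<close> has
  become \<open>\<theta> t (\<theta> s a)\<close> at the end.\<close>

lemma compose_int:
  assumes s: "s \<in> T" and t: "t \<in> T" and S: "S \<in> Int_t s" and R: "R \<in> Int_t t"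
  shows "compose (hm_carrier E) R S \<in> Int_t (s + t)"
proof -
  interpret s: full_rep E E "\<theta> s" frame by (rule full_rep[OF s])
  interpret t: full_rep E E "\<theta> t" frame by (rule full_rep[OF t])
  interpret st: full_rep E E "\<theta> (s + t)" frame by (rule full_rep[OF T_simps(4)[OF s t]])
  show ?thesis unfolding compose_def
  proof (rule st.intI)
    fix a x assume a: "a \<in> adj_ops E" and x: "x \<in> hm_carrier E"
    have "\<theta> (s + t) a = \<theta> t (\<theta> s a)" using E0(4)[OF t s a] by (simp add: add.commute)
    then show "R (S (a x)) = \<theta> (s + t) a (R (S x))"
      using a x S R by (simp add: s.int_rep t.int_rep s.rep_adj_ops s.int_closed)
  qed (use S R in \<open>simp_all add: s.int_closed t.int_closed s.int_add t.int_add\<close>)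
qed

text \<open>At each frame vector \<open>inner_int_eval\<close> extracts the coefficient
  \<open>\<langle>S g, S' g\<rangle>\<close>, and additivity of the left action collects these to
  \<open>\<langle>S, S'\<rangle>\<close>. The result is the inner product rule of the tensor product
  of two fibres.\<close>

lemma inner_compose:
  assumes s: "s \<in> T" and t: "t \<in> T" and S: "S \<in> Int_t s" "S' \<in> Int_t s" and R: "R \<in> Int_t t" "R' \<in> Int_t t"
  shows "hm_inner (M_t (s + t)) (compose (hm_carrier E) R S) (compose (hm_carrier E) R' S') =
    hm_inner (M_t t) R (hm_lact (M_t t) (hm_inner (M_t s) S S') R')"
proof -
  interpret s: full_rep E E "\<theta> s" frame by (rule full_rep[OF s])
  interpret t: full_rep E E "\<theta> t" frame by (rule full_rep[OF t])
  have "hm_inner (M_t (s + t)) (compose (hm_carrier E) R S) (compose (hm_carrier E) R' S') =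
      (\<Sum>g\<leftarrow>frame. hm_inner E (R (S g)) (R' (S' g)))"
    using s.frame_mem by (simp add: compose_def cong: map_cong)
  also have "\<dots> = (\<Sum>g\<leftarrow>frame. hm_inner (M_t t) R (hm_lact (M_t t) (hm_inner E (S g) (S' g)) R'))"
  proof (rule sum_list_cong)
    fix g assume "g \<in> set frame"
    then have "S g \<in> hm_carrier E" "S' g \<in> hm_carrier E" using S s.frame_mem s.int_closed by auto
    then show "hm_inner E (R (S g)) (R' (S' g)) = hm_inner (M_t t) R (hm_lact (M_t t) (hm_inner E (S g) (S' g)) R')"
      by (rule t.inner_int_eval[OF R])
  qed
  also have "\<dots> = hm_inner (M_t t) R (hm_lact (M_t t) (\<Sum>g\<leftarrow>frame. hm_inner E (S g) (S' g)) R')"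
    by (rule t.int_lact_sum[OF R])
  finally show ?thesis by simp
qed

text \<open>Multiplicativity of \<open>\<theta> t\<close> merges the two operators that act on
  \<open>y'\<close>. The outcome is the formula that defines \<open>u_st\<close> on elementary
  tensors.\<close>

lemma compose_d_op:
  assumes s: "s \<in> T" and t: "t \<in> T"
    and x: "x \<in> hm_carrier E" "x' \<in> hm_carrier E" "y \<in> hm_carrier E" "y' \<in> hm_carrier E"
  shows "compose (hm_carrier E) (d_op t y y') (d_op s x x') = d_op (s + t) x (\<theta> t (rank_one E x' y) y')"
proof -
  interpret s: full_rep E E "\<theta> s" frame by (rule full_rep[OF s])
  interpret t: full_rep E E "\<theta> t" frame by (rule full_rep[OF t])
  interpret st: full_rep E E "\<theta> (s + t)" frame by (rule full_rep[OF T_simps(4)[OF s t]])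
  have "\<theta> t (rank_one E (\<theta> s (rank_one E z x) x') y) y' = \<theta> (s + t) (rank_one E z x) (\<theta> t (rank_one E x' y) y')"
    if z: "z \<in> hm_carrier E" for z
  proof -
    have a: "\<theta> s (rank_one E z x) \<in> adj_ops E" using z x by (simp add: s.rep_adj_ops E.rank_one_adj_ops)
    have "\<theta> (s + t) (rank_one E z x) = \<theta> t (\<theta> s (rank_one E z x))"
      using E0(4)[OF t s E.rank_one_adj_ops[OF z x(1)]] by (simp add: add.commute)
    then show ?thesis
      using t.rep_mult[OF a E.rank_one_adj_ops[OF x(2,3)] x(4)] by (simp add: E.op_mult_rank_one a x)
  qed
  then show ?thesis using x
    by (auto simp: s.dual_op_def t.dual_op_def st.dual_op_def compose_def s.rep_rank_one_closed)
qed

end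

text \<open>Approximating sums are carried along by an additive Lipschitz map. The two applications
  are \<open>y \<mapsto> g^* \<odot> y\<close> and the embedding of one copy of \<open>E\<close>
  into the limit.\<close>

lemma approx_image:
  assumes "hilbert_module E" "hilbert_module G"
    and S: "S \<subseteq> hm_carrier E" and S': "S' \<subseteq> hm_carrier G" and x: "x \<in> hm_approx E S"
    and A: "\<And>x. x \<in> hm_carrier E \<Longrightarrow> A x \<in> hm_carrier G" "A (hm_zero E) = hm_zero G"
      "\<And>x y. x \<in> hm_carrier E \<Longrightarrow> y \<in> hm_carrier E \<Longrightarrow> A (hm_add E x y) = hm_add G (A x) (A y)"
    and K: "K \<ge> 0" "\<And>x y. x \<in> hm_carrier E \<Longrightarrow> y \<in> hm_carrier E \<Longrightarrow>
      hm_norm G (hm_diff G (A x) (A y)) \<le> K * hm_norm E (hm_diff E x y)"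
    and AS: "\<And>x. x \<in> S \<Longrightarrow> A x \<in> hm_approx G S'"
  shows "A x \<in> hm_approx G S'"
proof -
  interpret E: hilbert_module E by fact
  interpret G: hilbert_module G by fact
  have xc: "x \<in> hm_carrier E" using x by (rule E.approx_closed)
  show ?thesis
  proof (rule G.approx_limit[OF S' A(1)[OF xc]])
    fix e :: real assume e: "e > 0"
    then have "e / (K + 1) > 0" using K(1) by simp
    from E.approxE[OF x this] obtain xs where xs: "xs \<in> lists S"
      "hm_norm E (hm_diff E x (hm_sum E (\<lambda>x. x) xs)) < e / (K + 1)" by blast
    have "A (hm_sum E (\<lambda>x. x) xs) \<in> hm_approx G S' \<and> hm_sum E (\<lambda>x. x) xs \<in> hm_carrier E"
      using xs(1)
    proof (induction xs)
      case (Cons z xs)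
      then show ?case using S AS[of z] by (auto simp: A(3) E.closed G.approx_add[OF S'])
    qed (simp_all add: A G.approx_zero E.closed)
    then have c: "A (hm_sum E (\<lambda>x. x) xs) \<in> hm_approx G S'" "hm_sum E (\<lambda>x. x) xs \<in> hm_carrier E" by auto
    have "hm_norm G (hm_diff G (A x) (A (hm_sum E (\<lambda>x. x) xs))) \<le> K * (e / (K + 1))"
      using K(2)[OF xc c(2)] mult_left_mono[OF less_imp_le[OF xs(2)] K(1)] by linarith
    also have "\<dots> < e" using e K(1) by (simp add: field_simps)
    finally show "\<exists>y\<in>hm_approx G S'. hm_norm G (hm_diff G (A x) y) < e" using c(1) by blast
  qed
qed

context full_rep
begin

lemma dual_op_add:
  "x \<in> hm_carrier E \<Longrightarrow> y \<in> hm_carrier F \<Longrightarrow> y' \<in> hm_carrier F \<Longrightarrow>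
    dual_op x (hm_add F y y') = hm_add M (dual_op x y) (dual_op x y')"
  by (auto simp: dual_op_def F.adj_add rep_adj_ops E.rank_one_adj_ops)

lemma dual_op_diff:
  "x \<in> hm_carrier E \<Longrightarrow> y \<in> hm_carrier F \<Longrightarrow> y' \<in> hm_carrier F \<Longrightarrow>
    dual_op x (hm_diff F y y') = hm_diff M (dual_op x y) (dual_op x y')"
  by (auto simp: int_diff dual_op_def F.adj_diff rep_adj_ops E.rank_one_adj_ops)

lemma dual_op_zero: "x \<in> hm_carrier E \<Longrightarrow> dual_op x (hm_zero F) = hm_zero M"
  by (auto simp: dual_op_def F.adj_zero rep_adj_ops E.rank_one_adj_ops)

lemma dual_op_norm_le:
  assumes x: "x \<in> hm_carrier E" and y: "y \<in> hm_carrier F"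
  shows "hm_norm M (dual_op x y) \<le> hm_norm E x * hm_norm F y"
proof (rule power2_le_imp_le)
  have "(hm_norm M (dual_op x y))\<^sup>2 = norm (hm_inner F y (\<pi> (rank_one E x x) y))"
    using inner_dual_op[OF x y dual_op_int[OF x y]] x by (simp add: M.norm_power2 dual_op_def del: int_corr_simps)
  also have "\<dots> \<le> hm_norm F y * hm_norm F (\<pi> (rank_one E x x) y)"
    by (intro F.cauchy_schwarz rep_rank_one_closed x y)
  also have "\<dots> \<le> hm_norm F y * (hm_norm E x * hm_norm E x * hm_norm F y)"
    by (intro mult_left_mono rep_rank_one_norm_le F.norm_nonneg x y)
  finally show "(hm_norm M (dual_op x y))\<^sup>2 \<le> (hm_norm E x * hm_norm F y)\<^sup>2"
    by (simp add: power2_eq_square mult_ac)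
qed (simp add: E.norm_nonneg F.norm_nonneg)

end

section \<open>The product maps of the system as composition of intertwiners\<close>

context spatial_semigroup
begin

definition decode :: "real \<Rightarrow> ('e, 'b) ps_elem \<Rightarrow> 'e \<Rightarrow> 'e" where
  "decode t = inv_into (Int_t t) (encode t)"

lemma decode_encode:
  assumes "t \<in> T" "t \<noteq> 0" "R \<in> Int_t t"
  shows "decode t (encode t R) = R"
proof -
  interpret module_iso "M_t t" "ps_fibre E \<theta> t" "encode t" by (rule encode_iso[OF assms(1,2)])
  show ?thesis using inj assms(3) by (simp add: decode_def inv_into_f_f)
qed

lemma fibre_carrier: "t \<in> T \<Longrightarrow> t \<noteq> 0 \<Longrightarrow> hm_carrier (ps_fibre E \<theta> t) = encode t ` Int_t t"
  using module_iso.carrier_eq[OF encode_iso(1)] by simp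

text \<open>\<open>Q\<close> is a sum of tensors \<open>g^* \<odot> Q g\<close>. Strictness of
  \<open>\<theta> t\<close> approximates \<open>Q g\<close> by sums of vectors
  \<open>\<theta> t k z\<close> with \<open>k\<close> of rank one, and \<open>compose_d_op\<close>
  reads \<open>g^* \<odot> \<theta> t k z\<close> as a product of elementary tensors. This is where
  surjectivity of \<open>u_st\<close> comes from.\<close>

lemma product_total:
  assumes s: "s \<in> T" and t: "t \<in> T" and Q: "Q \<in> Int_t (s + t)"
  shows "Q \<in> hm_approx (M_t (s + t)) {compose (hm_carrier E) (d_op t y y') (d_op s x x') | x x' y y'.
    x \<in> hm_carrier E \<and> x' \<in> hm_carrier E \<and> y \<in> hm_carrier E \<and> y' \<in> hm_carrier E}"
    (is "_ \<in> hm_approx _ ?G")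
proof -
  interpret s: full_rep E E "\<theta> s" frame by (rule full_rep[OF s])
  interpret t: full_rep E E "\<theta> t" frame by (rule full_rep[OF t])
  interpret st: full_rep E E "\<theta> (s + t)" frame by (rule full_rep[OF T_simps(4)[OF s t]])
  let ?S = "{\<theta> t (rank_one E x x') z | x x' z. x \<in> hm_carrier E \<and> x' \<in> hm_carrier E \<and> z \<in> hm_carrier E}"
  have S: "?S \<subseteq> hm_carrier E" using t.rep_rank_one_closed by auto
  have G: "?G \<subseteq> hm_carrier (M_t (s + t))"
    using compose_int[OF s t s.dual_op_int t.dual_op_int] by auto
  have d: "st.dual_op g z \<in> hm_approx (M_t (s + t)) ?G" if g: "g \<in> hm_carrier E" and z: "z \<in> hm_carrier E" for g z
  proof (rule approx_image[OF E.hilbert_module_axioms st.M.hilbert_module_axioms S G approx_theta[OF t z]])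
    show "st.dual_op g x \<in> hm_carrier (M_t (s + t))" if "x \<in> hm_carrier E" for x
      using st.dual_op_int[OF g that] by simp
    show "hm_norm (M_t (s + t)) (hm_diff (M_t (s + t)) (st.dual_op g x) (st.dual_op g y))
        \<le> hm_norm E g * hm_norm E (hm_diff E x y)" if "x \<in> hm_carrier E" "y \<in> hm_carrier E" for x y
      using st.dual_op_norm_le[OF g, of "hm_diff E x y"] that by (simp only: st.dual_op_diff g E.closed)
    show "st.dual_op g x \<in> hm_approx (M_t (s + t)) ?G" if "x \<in> ?S" for x
    proof (rule st.M.approx_mem[OF G])
      obtain x1 x2 z' where "x = \<theta> t (rank_one E x1 x2) z'" "x1 \<in> hm_carrier E" "x2 \<in> hm_carrier E" "z' \<in> hm_carrier E"
        using \<open>x \<in> ?S\<close> by auto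
      then show "st.dual_op g x \<in> ?G"
        using compose_d_op[OF s t g, of x1 x2 z', symmetric] g by blast
    qed
  qed (use g in \<open>auto simp: st.dual_op_zero st.dual_op_add E.norm_nonneg simp del: int_corr_simps\<close>)
  show ?thesis
    by (subst st.int_dual_op_expand[OF Q], rule st.M.approx_hm_sum[OF G])
      (use Q st.frame_mem st.int_closed d in blast)
qed

text \<open>The inner product rule is \<open>inner_compose\<close> and density is
  \<open>product_total\<close>; the rest translates between the encoded fibres and
  intertwiners.\<close>

lemma product_model:
  assumes s: "s \<in> T" "s \<noteq> 0" and t: "t \<in> T" "t \<noteq> 0"
  shows "tensor_model (ps_fibre E \<theta> s) (ps_fibre E \<theta> t) (M_t (s + t))
    (\<lambda>X Y. compose (hm_carrier E) (decode t Y) (decode s X))"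
proof -
  interpret s: full_rep E E "\<theta> s" frame by (rule full_rep[OF s(1)])
  interpret t: full_rep E E "\<theta> t" frame by (rule full_rep[OF t(1)])
  interpret st: full_rep E E "\<theta> (s + t)" frame by (rule full_rep[OF T_simps(4)[OF s(1) t(1)]])
  interpret si: module_iso "M_t s" "ps_fibre E \<theta> s" "encode s" by (rule encode_iso[OF s])
  interpret ti: module_iso "M_t t" "ps_fibre E \<theta> t" "encode t" by (rule encode_iso[OF t])
  interpret C: correspondence "M_t t" by (rule t.int_correspondence)
  let ?\<phi> = "\<lambda>X Y. compose (hm_carrier E) (decode t Y) (decode s X)"
  have X: "\<exists>S\<in>Int_t s. X = encode s S \<and> decode s X = S" if "X \<in> hm_carrier (ps_fibre E \<theta> s)" for X
    using that decode_encode[OF s] by (auto simp: fibre_carrier s)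
  have Y: "\<exists>R\<in>Int_t t. Y = encode t R \<and> decode t Y = R" if "Y \<in> hm_carrier (ps_fibre E \<theta> t)" for Y
    using that decode_encode[OF t] by (auto simp: fibre_carrier t)
  show ?thesis
  proof
    fix X Y b c assume XY: "X \<in> hm_carrier (ps_fibre E \<theta> s)" "Y \<in> hm_carrier (ps_fibre E \<theta> t)"
    obtain S R where SR: "S \<in> Int_t s" "X = encode s S" "decode s X = S"
      "R \<in> Int_t t" "Y = encode t R" "decode t Y = R" using X[OF XY(1)] Y[OF XY(2)] by blast
    show "?\<phi> X Y \<in> hm_carrier (M_t (s + t))" using compose_int[OF s(1) t(1)] SR by simp
    have "hm_scale (M_t s) c S \<in> Int_t s" using s.M.scale_closed[of S c] SR by simp
    then have "decode s (hm_scale (ps_fibre E \<theta> s) c X) = hm_scale (M_t s) c S"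
      using SR si.iso_scale[of S c] decode_encode[OF s] by simp
    then show "?\<phi> (hm_scale (ps_fibre E \<theta> s) c X) Y = hm_scale (M_t (s + t)) c (?\<phi> X Y)"
      using SR by (auto simp: compose_def t.int_scale s.int_closed)
    have "hm_act (M_t t) R b \<in> Int_t t" using t.M.act_closed[of R b] SR by simp
    then have "decode t (hm_act (ps_fibre E \<theta> t) Y b) = hm_act (M_t t) R b"
      using SR ti.iso_act[of R b] decode_encode[OF t] by simp
    then show "?\<phi> X (hm_act (ps_fibre E \<theta> t) Y b) = hm_act (M_t (s + t)) (?\<phi> X Y) b"
      using SR by (auto simp: compose_def s.int_closed)
  next
    fix X Y X' Y'
    assume XY: "X \<in> hm_carrier (ps_fibre E \<theta> s)" "Y \<in> hm_carrier (ps_fibre E \<theta> t)"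
      "X' \<in> hm_carrier (ps_fibre E \<theta> s)" "Y' \<in> hm_carrier (ps_fibre E \<theta> t)"
    obtain S R S' R' where SR: "S \<in> Int_t s" "X = encode s S" "decode s X = S"
      "R \<in> Int_t t" "Y = encode t R" "decode t Y = R"
      "S' \<in> Int_t s" "X' = encode s S'" "decode s X' = S'"
      "R' \<in> Int_t t" "Y' = encode t R'" "decode t Y' = R'"
      using X[OF XY(1)] Y[OF XY(2)] X[OF XY(3)] Y[OF XY(4)] by blast
    have L: "hm_lact (M_t t) b R' \<in> hm_carrier (M_t t)" for b using C.lact_closed[of R' b] SR by simp
    have "hm_inner (ps_fibre E \<theta> t) Y (hm_lact (ps_fibre E \<theta> t) (hm_inner (ps_fibre E \<theta> s) X X') Y')
      = hm_inner (ps_fibre E \<theta> t) (encode t R) (encode t (hm_lact (M_t t) (hm_inner (M_t s) S S') R'))"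
      using SR si.iso_inner[of S S'] encode_iso(2)[OF t, of R'] by (simp del: int_corr_simps(6,7))
    also have "\<dots> = hm_inner (M_t t) R (hm_lact (M_t t) (hm_inner (M_t s) S S') R')"
      by (rule ti.iso_inner) (use SR L in \<open>simp_all del: int_corr_simps(6,7)\<close>)
    also have "\<dots> = hm_inner (M_t (s + t)) (?\<phi> X Y) (?\<phi> X' Y')"
      unfolding SR(3,6,9,12) using inner_compose[OF s(1) t(1) SR(1,7,4,10)] by (rule sym)
    finally show "hm_inner (M_t (s + t)) (?\<phi> X Y) (?\<phi> X' Y') =
      hm_inner (ps_fibre E \<theta> t) Y (hm_lact (ps_fibre E \<theta> t) (hm_inner (ps_fibre E \<theta> s) X X') Y')" by (rule sym)
  next
    fix Q :: "'e \<Rightarrow> 'e" and e :: real assume Q: "Q \<in> hm_carrier (M_t (s + t))" and e: "e > 0"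
    let ?G = "{compose (hm_carrier E) (t.dual_op y y') (s.dual_op x x') | x x' y y'.
      x \<in> hm_carrier E \<and> x' \<in> hm_carrier E \<and> y \<in> hm_carrier E \<and> y' \<in> hm_carrier E}"
    let ?G' = "{?\<phi> X Y | X Y. X \<in> hm_carrier (ps_fibre E \<theta> s) \<and> Y \<in> hm_carrier (ps_fibre E \<theta> t)}"
    have "?G \<subseteq> ?G'"
    proof
      fix Z assume "Z \<in> ?G"
      then obtain x x' y y' where Z: "Z = compose (hm_carrier E) (t.dual_op y y') (s.dual_op x x')"
        "x \<in> hm_carrier E" "x' \<in> hm_carrier E" "y \<in> hm_carrier E" "y' \<in> hm_carrier E" by auto
      then have I: "s.dual_op x x' \<in> Int_t s" "t.dual_op y y' \<in> Int_t t" by (simp_all add: s.dual_op_int t.dual_op_int)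
      then have "Z = ?\<phi> (encode s (s.dual_op x x')) (encode t (t.dual_op y y'))"
        by (simp add: Z decode_encode s t)
      then show "Z \<in> ?G'" using I by (auto simp: fibre_carrier s t)
    qed
    then have "lists ?G \<subseteq> lists ?G'" by (rule lists_mono)
    then have "Q \<in> hm_approx (M_t (s + t)) ?G'"
      using product_total[OF s(1) t(1), of Q] Q unfolding hm_approx_def by (simp del: int_corr_simps(2-7)) blast
    then show "\<exists>r\<in>lists (hm_carrier (ps_fibre E \<theta> s) \<times> hm_carrier (ps_fibre E \<theta> t)).
        hm_norm (M_t (s + t)) (hm_diff (M_t (s + t)) Q (hm_sum (M_t (s + t)) (\<lambda>p. ?\<phi> (fst p) (snd p)) r)) < e"
      by (rule total_of_approx[OF _ e])
  qed (simp_all add: si.T.closed ti.T.closed)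
qed

text \<open>\<open>ps_product\<close> is a \<open>THE\<close>, so a unitary with the prescribed
  values must be exhibited and shown to be unique. Existence comes from
  \<open>product_model\<close>; uniqueness holds because the elementary products are total and inner
  products are preserved.\<close>

lemma ps_product_encode:
  assumes s: "s \<in> T" "s \<noteq> 0" and t: "t \<in> T" "t \<noteq> 0" and S: "S \<in> Int_t s" and R: "R \<in> Int_t t"
  shows "ps_product E \<theta> s t (elem_tensor (ps_fibre E \<theta> s) (ps_fibre E \<theta> t) (encode s S) (encode t R)) =
    encode (s + t) (compose (hm_carrier E) R S)"
proof -
  have st: "s + t \<in> T" "s + t \<noteq> 0" using s t T_simps(4,5) by (simp, metis add_nonneg_eq_0_iff T_simps(5))
  interpret s: full_rep E E "\<theta> s" frame by (rule full_rep[OF s(1)])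
  interpret t: full_rep E E "\<theta> t" frame by (rule full_rep[OF t(1)])
  interpret st: full_rep E E "\<theta> (s + t)" frame by (rule full_rep[OF st(1)])
  interpret i: module_iso "M_t (s + t)" "ps_fibre E \<theta> (s + t)" "encode (s + t)" by (rule encode_iso[OF st])
  let ?\<phi> = "\<lambda>X Y. compose (hm_carrier E) (decode t Y) (decode s X)"
  interpret m: tensor_model "ps_fibre E \<theta> s" "ps_fibre E \<theta> t" "M_t (s + t)" ?\<phi>
    by (rule product_model[OF s t])
  let ?N = "tensor (ps_fibre E \<theta> s) (ps_fibre E \<theta> t)"
  have elem: "elem_tensor (ps_fibre E \<theta> s) (ps_fibre E \<theta> t) (encode s S') (encode t R') =
      m.tensor_class (compose (hm_carrier E) R' S')" if "S' \<in> Int_t s" "R' \<in> Int_t t" for S' R'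
    using that m.elem_tensor_class[of "encode s S'" "encode t R'"]
    by (simp add: fibre_carrier s t decode_encode)
  \<comment> \<open>The description in \<open>ps_product\<close> for positive indices, where its two
    clauses for index \<open>0\<close> are vacuous.\<close>
  define spec where "spec u \<longleftrightarrow> hm_unitary ?N (ps_fibre E \<theta> (s + t)) u \<and>
      (\<forall>x\<in>hm_carrier E. \<forall>x'\<in>hm_carrier E. \<forall>y\<in>hm_carrier E. \<forall>y'\<in>hm_carrier E.
        u (elem_tensor (ps_fibre E \<theta> s) (ps_fibre E \<theta> t)
            (ps_elem_tensor E \<theta> s x x') (ps_elem_tensor E \<theta> t y y')) =
        ps_elem_tensor E \<theta> (s + t) x (\<theta> t (rank_one E x' y) y'))" for u
  have gen: "elem_tensor (ps_fibre E \<theta> s) (ps_fibre E \<theta> t) (ps_elem_tensor E \<theta> s x x') (ps_elem_tensor E \<theta> t y y')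
      = m.tensor_class (compose (hm_carrier E) (t.dual_op y y') (s.dual_op x x'))"
    "ps_elem_tensor E \<theta> (s + t) x (\<theta> t (rank_one E x' y) y')
      = encode (s + t) (compose (hm_carrier E) (t.dual_op y y') (s.dual_op x x'))"
    if "x \<in> hm_carrier E" "x' \<in> hm_carrier E" "y \<in> hm_carrier E" "y' \<in> hm_carrier E" for x x' y y'
    using that s t st
    by (simp_all add: encode_elem elem s.dual_op_int t.dual_op_int t.rep_rank_one_closed compose_d_op)
  define u where "u = (\<lambda>X\<in>hm_carrier ?N. encode (s + t) (inv_into (Int_t (s + t)) m.tensor_class X))"
  have u: "u (m.tensor_class Q) = encode (s + t) Q" if "Q \<in> Int_t (s + t)" for Q
    using that m.inj_tensor_class by (simp add: u_def m.tensor_carrier)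
  have "spec u"
    unfolding spec_def
  proof (intro conjI ballI)
    have "u ` hm_carrier ?N = hm_carrier (ps_fibre E \<theta> (s + t))"
      unfolding m.tensor_carrier i.carrier_eq image_image by (rule image_cong) (simp_all add: u)
    moreover have "u \<in> extensional (hm_carrier ?N)" by (simp add: u_def)
    ultimately show "hm_unitary ?N (ps_fibre E \<theta> (s + t)) u"
      unfolding hm_unitary_def
      by (auto simp: PiE_def) (auto simp: m.tensor_carrier u m.tensor_inner_class i.iso_inner simp del: int_corr_simps(6))
  next
    fix x x' y y' assume x: "x \<in> hm_carrier E" "x' \<in> hm_carrier E" "y \<in> hm_carrier E" "y' \<in> hm_carrier E"
    then have "compose (hm_carrier E) (t.dual_op y y') (s.dual_op x x') \<in> Int_t (s + t)"
      by (intro compose_int s t s.dual_op_int t.dual_op_int)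
    then show "u (elem_tensor (ps_fibre E \<theta> s) (ps_fibre E \<theta> t)
            (ps_elem_tensor E \<theta> s x x') (ps_elem_tensor E \<theta> t y y')) =
        ps_elem_tensor E \<theta> (s + t) x (\<theta> t (rank_one E x' y) y')"
      using x by (simp add: gen u)
  qed
  moreover have "v = u" if v: "spec v" for v
  proof (rule extensionalityI[of _ "hm_carrier ?N"])
    have vu: "hm_unitary ?N (ps_fibre E \<theta> (s + t)) v" using v by (simp add: spec_def)
    then show "v \<in> extensional (hm_carrier ?N)" by (simp add: hm_unitary_def PiE_def)
    show "u \<in> extensional (hm_carrier ?N)" by (simp add: u_def)
    fix X assume X: "X \<in> hm_carrier ?N"
    then obtain Q where Q: "Q \<in> Int_t (s + t)" "X = m.tensor_class Q" by (auto simp: m.tensor_carrier)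
    have "v X \<in> hm_carrier (ps_fibre E \<theta> (s + t))" using vu X by (auto simp: hm_unitary_def)
    then obtain Q' where Q': "Q' \<in> Int_t (s + t)" "v X = encode (s + t) Q'" by (auto simp: fibre_carrier st)
    let ?G = "{compose (hm_carrier E) (t.dual_op y y') (s.dual_op x x') | x x' y y'.
      x \<in> hm_carrier E \<and> x' \<in> hm_carrier E \<and> y \<in> hm_carrier E \<and> y' \<in> hm_carrier E}"
    have G: "?G \<subseteq> hm_carrier (M_t (s + t))"
      using compose_int[OF s(1) t(1) s.dual_op_int t.dual_op_int] by auto
    have QM: "Q \<in> hm_carrier (M_t (s + t))" "Q' \<in> hm_carrier (M_t (s + t))" using Q Q' by simp_all
    \<comment> \<open>\<open>Q'\<close> and \<open>Q\<close> have the same inner product with every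
      product of elementary tensors, and these are total.\<close>
    have "hm_diff (M_t (s + t)) Q Q' = hm_zero (M_t (s + t))"
    proof (rule st.M.approx_orthogonal[OF G])
      show "hm_diff (M_t (s + t)) Q Q' \<in> hm_approx (M_t (s + t)) ?G"
        using product_total[OF s(1) t(1)] st.M.diff_closed[OF QM] by simp
      fix D assume D: "D \<in> ?G"
      then obtain x x' y y' where D': "D = compose (hm_carrier E) (t.dual_op y y') (s.dual_op x x')"
        "x \<in> hm_carrier E" "x' \<in> hm_carrier E" "y \<in> hm_carrier E" "y' \<in> hm_carrier E" by auto
      have DM: "D \<in> hm_carrier (M_t (s + t))" using D G by blast
      have vD: "v (m.tensor_class D) = encode (s + t) D"
      proof -
        have "v (elem_tensor (ps_fibre E \<theta> s) (ps_fibre E \<theta> t)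
            (ps_elem_tensor E \<theta> s x x') (ps_elem_tensor E \<theta> t y y')) =
          ps_elem_tensor E \<theta> (s + t) x (\<theta> t (rank_one E x' y) y')"
          using v D'(2-5) unfolding spec_def by blast
        then show ?thesis unfolding gen[OF D'(2-5)] D'(1) .
      qed
      have "m.tensor_class D \<in> hm_carrier ?N" using DM by (auto simp: m.tensor_carrier)
      then have "hm_inner (ps_fibre E \<theta> (s + t)) (v X) (v (m.tensor_class D)) = hm_inner ?N X (m.tensor_class D)"
        using vu X by (simp add: hm_unitary_def)
      then have "hm_inner (M_t (s + t)) Q' D = hm_inner (M_t (s + t)) Q D"
        using Q Q' DM QM by (simp add: vD i.iso_inner m.tensor_inner_class del: int_corr_simps(6))
      then show "hm_inner (M_t (s + t)) (hm_diff (M_t (s + t)) Q Q') D = 0"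
        using st.M.inner_diff_left[OF QM DM] by simp
    qed
    then have "Q = Q'" by (rule st.M.diff_eq_zeroD[OF QM])
    then show "v X = u X" using Q Q' u by simp
  qed
  ultimately have "(THE u. spec u) = u" by (rule the_equality)
  moreover have "ps_product E \<theta> s t = (THE u. spec u)"
    using s t by (simp add: ps_product_def spec_def)
  ultimately have "ps_product E \<theta> s t = u" by simp
  then show ?thesis using compose_int[OF s(1) t(1) S R] by (simp add: elem S R u)
qed

text \<open>\<open>W\<^sub>t x = x \<odot> \<omega>\<^sub>t\<close>: centrality of the unit makes \<open>W\<^sub>t\<close> right linear, and then adjointable.\<close>

lemma isometry_semigroup:
  obtains W where "\<And>t. t \<in> T \<Longrightarrow> W t \<in> adj_ops E"
    "\<And>t x y. t \<in> T \<Longrightarrow> x \<in> hm_carrier E \<Longrightarrow> y \<in> hm_carrier E \<Longrightarrow> hm_inner E (W t x) (W t y) = hm_inner E x y"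
    "\<And>x. x \<in> hm_carrier E \<Longrightarrow> W 0 x = x"
    "\<And>s t x. s \<in> T \<Longrightarrow> t \<in> T \<Longrightarrow> x \<in> hm_carrier E \<Longrightarrow> W (s + t) x = W s (W t x)"
    "\<And>t a x. t \<in> T \<Longrightarrow> a \<in> adj_ops E \<Longrightarrow> x \<in> hm_carrier E \<Longrightarrow> \<theta> t a (W t x) = W t (a x)"
proof -
  obtain \<omega> where c: "central_unit T E \<theta> \<omega>" and n: "unital_unit T E \<theta> \<omega>" using spatial by (auto simp: spatial_def)
  have \<omega>: "\<omega> t \<in> hm_carrier (ps_fibre E \<theta> t)"
      "hm_lact (ps_fibre E \<theta> t) b (\<omega> t) = hm_act (ps_fibre E \<theta> t) (\<omega> t) b"
      "hm_inner (ps_fibre E \<theta> t) (\<omega> t) (\<omega> t) = 1" if "t \<in> T" for t b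
    using c n that by (auto simp: central_unit_def unital_unit_def ps_unit_def)
  have \<omega>s: "ps_product E \<theta> s t (elem_tensor (ps_fibre E \<theta> s) (ps_fibre E \<theta> t) (\<omega> s) (\<omega> t)) = \<omega> (s + t)"
    if "s \<in> T" "t \<in> T" for s t
    using c that by (auto simp: central_unit_def ps_unit_def)
  \<comment> \<open>The fibre at \<open>0\<close> is \<open>\<B>\<close> and not a space of
    intertwiners, so \<open>W 0\<close> is set by hand.\<close>
  define W where "W t = (if t = 0 then op_id E else decode t (\<omega> t))" for t
  have W0: "W 0 = op_id E" by (simp add: W_def)
  have Wt: "W t \<in> Int_t t" "\<omega> t = encode t (W t)" if "t \<in> T" "t \<noteq> 0" for t
    using \<omega>(1)[OF that(1)] that decode_encode[OF that] by (auto simp: fibre_carrier W_def)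
  have WI: "W t \<in> Int_t t" if "t \<in> T" for t
  proof (cases "t = 0")
    case True
    interpret full_rep E E "\<theta> t" frame by (rule full_rep[OF that])
    show ?thesis unfolding True W0 op_id_def using intI[of "\<lambda>x. x"] by (simp add: True E0)
  qed (use Wt that in simp)
  have Wc: "W t x \<in> hm_carrier E" if "t \<in> T" "x \<in> hm_carrier E" for t x
    using WI[OF that(1)] that(2) by (auto simp: intertwiners_def)
  have inner: "hm_inner E (W t x) (W t y) = hm_inner E x y"
    if t: "t \<in> T" and xy: "x \<in> hm_carrier E" "y \<in> hm_carrier E" for t x y
  proof (cases "t = 0")
    case False
    interpret full_rep E E "\<theta> t" frame by (rule full_rep[OF t])
    interpret i: module_iso "M_t t" "ps_fibre E \<theta> t" "encode t" by (rule encode_iso[OF t False])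
    interpret C: correspondence "M_t t" by (rule int_correspondence)
    have WM: "W t \<in> hm_carrier (M_t t)" using WI[OF t] by simp
    have "encode t (hm_lact (M_t t) b (W t)) = encode t (hm_act (M_t t) (W t) b)" for b
      using \<omega>(2)[OF t, of b] encode_iso(2)[OF t False WI[OF t], of b] i.iso_act[OF WM, of b]
      by (simp add: Wt(2)[OF t False] del: int_corr_simps)
    \<comment> \<open>Centrality in terms of the intertwiner:
      \<open>W t (x b) = (W t x) b\<close>.\<close>
    then have lact: "hm_lact (M_t t) b (W t) = hm_act (M_t t) (W t) b" for b
      using inj_onD[OF i.inj] C.lact_closed[OF WM] M.act_closed[OF WM] by blast
    have one: "hm_inner (M_t t) (W t) (W t) = 1"
      using \<omega>(3)[OF t] i.iso_inner[OF WM WM] by (simp add: Wt(2)[OF t False] del: int_corr_simps)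
    \<comment> \<open>The coefficient \<open>\<langle>x, y\<rangle>\<close> acts on
      \<open>W t\<close> from the left; centrality moves it to the right, where it multiplies
      \<open>\<langle>W t, W t\<rangle> = 1\<close>.\<close>
    show ?thesis
      unfolding inner_int_eval[OF WI[OF t] WI[OF t] xy] lact M.inner_act[OF WM WM] one by simp
  qed (use xy in \<open>simp add: W0 E.op_apply\<close>)
  have semi: "W (s + t) x = W s (W t x)" if s: "s \<in> T" and t: "t \<in> T" and x: "x \<in> hm_carrier E" for s t x
  proof -
    consider "s = 0" | "t = 0" | "s \<noteq> 0" "t \<noteq> 0" by blast
    then show ?thesis
    proof cases
      case 3
      \<comment> \<open>The indices are swapped because the product of \<open>\<omega> t\<close> and
        \<open>\<omega> s\<close> corresponds to \<open>W s\<close> after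
        \<open>W t\<close>.\<close>
      have st: "t + s \<in> T" "t + s \<noteq> 0" using 3 s t T_simps(4,5) by (simp, metis add_nonneg_eq_0_iff T_simps(5))
      have I: "compose (hm_carrier E) (W s) (W t) \<in> Int_t (t + s)" by (intro compose_int s t WI)
      have "encode (t + s) (W (t + s)) = encode (t + s) (compose (hm_carrier E) (W s) (W t))"
        using \<omega>s[OF t s] ps_product_encode[OF t 3(2) s 3(1) WI[OF t] WI[OF s]]
        by (simp add: Wt(2) s t st 3)
      then have "decode (t + s) (encode (t + s) (W (t + s))) =
          decode (t + s) (encode (t + s) (compose (hm_carrier E) (W s) (W t)))" by (rule arg_cong)
      then have "W (t + s) = compose (hm_carrier E) (W s) (W t)"
        unfolding decode_encode[OF st WI[OF st(1)]] decode_encode[OF st I] .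
      then show ?thesis using x by (simp add: add.commute compose_def)
    qed (use x s t Wc in \<open>simp_all add: W0 E.op_apply\<close>)
  qed
  have adj: "W t \<in> adj_ops E" if t: "t \<in> T" for t
  proof -
    interpret full_rep E E "\<theta> t" frame by (rule full_rep[OF t])
    \<comment> \<open>\<open>P y v\<close> says that \<open>v\<close> is the value at
      \<open>y\<close> of the adjoint under construction. An isometry of Hilbert modules need not
      have an adjoint; here its values are written down on a total set, provided by strictness, and
      extended by continuity.\<close>
    define P where "P y v \<longleftrightarrow> v \<in> hm_carrier E \<and> (\<forall>x\<in>hm_carrier E. hm_inner E x v = hm_inner E (W t x) y)" for y v
    have Pn: "hm_norm E v \<le> hm_norm E y" if v: "P y v" and y: "y \<in> hm_carrier E" for y v
    proof -
      have vc: "v \<in> hm_carrier E" using v by (simp add: P_def)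
      have "(hm_norm E v)\<^sup>2 = norm (hm_inner E (W t v) y)" using v vc by (simp add: P_def E.norm_power2)
      also have "\<dots> \<le> hm_norm E (W t v) * hm_norm E y" by (intro E.cauchy_schwarz Wc t vc y)
      also have "hm_norm E (W t v) = hm_norm E v" using inner[OF t vc vc] by (simp add: hm_norm_def)
      finally show ?thesis
        using E.norm_nonneg[of v] E.norm_nonneg[of y] by (cases "hm_norm E v = 0") (simp_all add: power2_eq_square)
    qed
    let ?S = "{\<theta> t (rank_one E x x') z | x x' z. x \<in> hm_carrier E \<and> x' \<in> hm_carrier E \<and> z \<in> hm_carrier E}"
    have S: "?S \<subseteq> hm_carrier E" using rep_rank_one_closed by auto
    have gen: "\<exists>v. P y v" if "y \<in> ?S" for y
    proof -
      obtain x x' z where y: "y = \<theta> t (rank_one E x x') z" "x \<in> hm_carrier E" "x' \<in> hm_carrier E" "z \<in> hm_carrier E"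
        using \<open>y \<in> ?S\<close> by auto
      \<comment> \<open>Covariance carries the rank one operator across \<open>W t\<close>, which
        exhibits the value of the adjoint.\<close>
      have "P y (hm_act E x (hm_inner E (W t x') z))"
        unfolding P_def
      proof (intro conjI ballI)
        fix u assume u: "u \<in> hm_carrier E"
        have "hm_inner E (W t u) y = hm_inner E (\<theta> t (rank_one E x' x) (W t u)) z"
          using y u Wc t by (simp add: rep_inner E.rank_one_adj_ops E.op_adjoint_rank_one)
        also have "\<theta> t (rank_one E x' x) (W t u) = W t (hm_act E x' (hm_inner E x u))"
          using int_rep[OF WI[OF t] E.rank_one_adj_ops[OF y(3,2)] u] u by (simp add: E.op_apply)
        also have "hm_inner E (W t (hm_act E x' (hm_inner E x u))) z = star (hm_inner E x u) * hm_inner E (W t x') z"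
        proof -
          \<comment> \<open>Right linearity from preservation of inner products: the difference of
            the two sides has zero inner product with itself.\<close>
          have "W t (hm_act E x' b) = hm_act E (W t x') b" for b
            by (rule E.diff_eq_zeroD, (intro Wc t E.closed y)+, rule E.inner_definite)
              (use inner[OF t] y Wc t in \<open>simp_all add: E.closed E.inner_simps mult.assoc\<close>)
          then show ?thesis using y Wc t by (simp add: E.inner_simps)
        qed
        finally show "hm_inner E u (hm_act E x (hm_inner E (W t x') z)) = hm_inner E (W t u) y"
          using u y by (simp add: E.inner_simps E.star_inner)
      qed (simp add: E.closed y)
      then show ?thesis by blast
    qed
    have add: "P (hm_add E y y') (hm_add E v v')" if "P y v" "P y' v'" "y \<in> hm_carrier E" "y' \<in> hm_carrier E" for y y' v v'
      using that Wc t by (simp add: P_def E.closed E.inner_simps)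
    have sums: "\<exists>v. P (hm_sum E (\<lambda>x. x) xs) v" if "xs \<in> lists ?S" for xs
      using that
    proof (induction xs)
      case Nil
      have "P (hm_zero E) (hm_zero E)" using Wc t by (simp add: P_def E.closed E.inner_simps)
      then show ?case by auto
    next
      case (Cons x xs)
      then obtain v v' where "P x v" "P (hm_sum E (\<lambda>x. x) xs) v'" using gen by blast
      moreover have "x \<in> hm_carrier E" using Cons.hyps(1) S by blast
      moreover have "hm_sum E (\<lambda>x. x) xs \<in> hm_carrier E"
        using Cons.hyps(2) S by (intro E.sum_closed) auto
      ultimately show ?case unfolding hm_sum_Cons using add by blast
    qed
    have all: "\<exists>v. P y v" if y: "y \<in> hm_carrier E" for y
    proof -
      have ap: "y \<in> hm_approx E ?S" by (rule approx_theta[OF t y])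
      have "\<forall>n. \<exists>xs. xs \<in> lists ?S \<and> hm_norm E (hm_diff E y (hm_sum E (\<lambda>x. x) xs)) < 1 / real (Suc n)"
      proof
        fix n
        show "\<exists>xs. xs \<in> lists ?S \<and> hm_norm E (hm_diff E y (hm_sum E (\<lambda>x. x) xs)) < 1 / real (Suc n)"
          by (rule E.approxE[OF ap, of "1 / real (Suc n)"]) auto
      qed
      from choice[OF this] obtain xs where xs: "\<And>n. xs n \<in> lists ?S"
        "\<And>n. hm_norm E (hm_diff E y (hm_sum E (\<lambda>x. x) (xs n))) < 1 / real (Suc n)" by blast
      define Y where "Y n = hm_sum E (\<lambda>x. x) (xs n)" for n
      have Yc: "Y n \<in> hm_carrier E" for n
        unfolding Y_def using xs(1)[of n] S by (intro E.sum_closed) auto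
      have lim: "hm_lim E Y y"
        by (rule E.lim_boundI[OF y LIMSEQ_Suc[OF lim_1_over_n]])
          (use xs(2) in \<open>simp add: E.norm_diff_commute[OF Yc y] Y_def[symmetric] less_imp_le\<close>)
      have "\<forall>n. \<exists>v. P (Y n) v" using sums xs(1) by (simp add: Y_def)
      from choice[OF this] obtain v where v: "\<And>n. P (Y n) (v n)" by blast
      have vc: "v n \<in> hm_carrier E" for n using v[of n] by (simp add: P_def)
      have Pd: "P (hm_diff E (Y m) (Y n)) (hm_diff E (v m) (v n))" for m n
        using v[of m] v[of n] Yc Wc t by (simp add: P_def E.closed E.inner_simps)
      \<comment> \<open>By \<open>Pn\<close> a value of the adjoint is no longer than its argument,
        so the values along a convergent sequence are Cauchy.\<close>
      obtain l where l: "hm_lim E v l"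
      proof (rule E.cauchy_lim[of v, OF vc])
        fix e :: real assume "e > 0"
        then obtain N where N: "\<And>m n. m \<ge> N \<Longrightarrow> n \<ge> N \<Longrightarrow> hm_norm E (hm_diff E (Y m) (Y n)) < e"
          using E.lim_cauchy[of Y, OF lim Yc] by blast
        then show "\<exists>N. \<forall>m\<ge>N. \<forall>n\<ge>N. hm_norm E (hm_diff E (v m) (v n)) < e"
          using Pn[OF Pd E.diff_closed[OF Yc Yc]] by (intro exI[of _ N]) (meson le_less_trans)
      qed blast
      have "P y l"
        unfolding P_def
      proof (intro conjI ballI)
        fix x assume x: "x \<in> hm_carrier E"
        have "(\<lambda>n. hm_inner E x (v n)) \<longlonglongrightarrow> hm_inner E x l" by (intro E.lim_inner E.lim_const l x vc)
        moreover have "(\<lambda>n. hm_inner E (W t x) (Y n)) \<longlonglongrightarrow> hm_inner E (W t x) y"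
          by (intro E.lim_inner E.lim_const lim Wc t x Yc)
        moreover have "hm_inner E x (v n) = hm_inner E (W t x) (Y n)" for n using v[of n] x by (simp add: P_def)
        ultimately show "hm_inner E x l = hm_inner E (W t x) y" using LIMSEQ_unique by simp
      qed (rule E.lim_closed[OF l])
      then show ?thesis by blast
    qed
    define V where "V = (\<lambda>y\<in>hm_carrier E. SOME v. P y v)"
    have V: "P y (V y)" if "y \<in> hm_carrier E" for y
      using someI_ex[OF all[OF that]] that by (simp add: V_def)
    show ?thesis
    proof (rule E.adj_opsI(1)[of _ V])
      show "W t \<in> hm_carrier E \<rightarrow>\<^sub>E hm_carrier E" using WI[OF t] by (simp add: intertwiners_def)
      show "V \<in> hm_carrier E \<rightarrow>\<^sub>E hm_carrier E"
        using V by (auto simp: P_def) (simp add: V_def)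
      show "hm_inner E (W t x) y = hm_inner E x (V y)" if "x \<in> hm_carrier E" "y \<in> hm_carrier E" for x y
        using V[OF that(2)] that(1) by (simp add: P_def)
    qed
  qed
  show thesis
  proof (rule that[of W])
    show "\<theta> t a (W t x) = W t (a x)" if "t \<in> T" "a \<in> adj_ops E" "x \<in> hm_carrier E" for t a x
      using WI[OF that(1)] that by (simp add: intertwiners_def)
  qed (use adj inner semi W0 E.op_id_apply in auto)
qed

end

section \<open>The inductive limit of the isometries\<close>

locale spatial_dilation = spatial_semigroup E T \<theta>
  for E :: "('e, 'b::unital_cstar_algebra) hilbert_mod" and T :: "real set"
    and \<theta> :: "real \<Rightarrow> ('e \<Rightarrow> 'e) \<Rightarrow> 'e \<Rightarrow> 'e" +
  fixes W :: "real \<Rightarrow> 'e \<Rightarrow> 'e"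
  assumes W_adj: "t \<in> T \<Longrightarrow> W t \<in> adj_ops E"
    and W_inner: "t \<in> T \<Longrightarrow> x \<in> hm_carrier E \<Longrightarrow> y \<in> hm_carrier E \<Longrightarrow> hm_inner E (W t x) (W t y) = hm_inner E x y"
    and W_zero: "x \<in> hm_carrier E \<Longrightarrow> W 0 x = x"
    and W_add: "s \<in> T \<Longrightarrow> t \<in> T \<Longrightarrow> x \<in> hm_carrier E \<Longrightarrow> W (s + t) x = W s (W t x)"
    and W_cov: "t \<in> T \<Longrightarrow> a \<in> adj_ops E \<Longrightarrow> x \<in> hm_carrier E \<Longrightarrow> \<theta> t a (W t x) = W t (a x)"
begin

definition V :: "real \<Rightarrow> 'e \<Rightarrow> 'e" where
  "V t = op_adjoint E (W t)"

lemma rep: "t \<in> T \<Longrightarrow> module_rep E E (\<theta> t)"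
  using dual_rep by (simp add: dual_rep_def)

lemma V_adj: "t \<in> T \<Longrightarrow> V t \<in> adj_ops E"
  by (simp add: V_def E.op_adjoint_adj_ops W_adj)

lemma W_closed: "t \<in> T \<Longrightarrow> x \<in> hm_carrier E \<Longrightarrow> W t x \<in> hm_carrier E"
  using W_adj E.adj_ops_closed by blast

lemma V_closed: "t \<in> T \<Longrightarrow> x \<in> hm_carrier E \<Longrightarrow> V t x \<in> hm_carrier E"
  using V_adj E.adj_ops_closed by blast

lemma theta_adj: "t \<in> T \<Longrightarrow> a \<in> adj_ops E \<Longrightarrow> \<theta> t a \<in> adj_ops E"
  using module_rep.rep_adj_ops[OF rep] by blast

lemma theta_closed: "t \<in> T \<Longrightarrow> a \<in> adj_ops E \<Longrightarrow> x \<in> hm_carrier E \<Longrightarrow> \<theta> t a x \<in> hm_carrier E"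
  using theta_adj E.adj_ops_closed by blast

lemma inner_V: "t \<in> T \<Longrightarrow> x \<in> hm_carrier E \<Longrightarrow> y \<in> hm_carrier E \<Longrightarrow> hm_inner E x (V t y) = hm_inner E (W t x) y"
  by (simp add: V_def E.inner_adjoint W_adj)

lemma W_inner_V:
  "t \<in> T \<Longrightarrow> x \<in> hm_carrier E \<Longrightarrow> y \<in> hm_carrier E \<Longrightarrow> hm_inner E x (W t y) = hm_inner E (V t x) y"
  by (simp add: V_def E.inner_adjoint_left W_adj)

lemma V_W: "t \<in> T \<Longrightarrow> x \<in> hm_carrier E \<Longrightarrow> V t (W t x) = x"
  by (rule E.inner_eqI) (simp_all add: V_closed W_closed inner_V W_inner)

lemma V_add:
  assumes "s \<in> T" "t \<in> T" "x \<in> hm_carrier E"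
  shows "V (s + t) x = V s (V t x)"
proof (rule E.inner_eqI)
  fix z assume z: "z \<in> hm_carrier E"
  have "W (s + t) z = W t (W s z)" using W_add[OF assms(2,1) z] by (simp add: add.commute)
  then show "hm_inner E z (V (s + t) x) = hm_inner E z (V s (V t x))"
    using assms z by (simp add: inner_V V_closed W_closed T_simps)
qed (use assms in \<open>simp_all add: V_closed T_simps\<close>)

lemma norm_W: "t \<in> T \<Longrightarrow> x \<in> hm_carrier E \<Longrightarrow> hm_norm E (W t x) = hm_norm E x"
  by (simp add: hm_norm_def W_inner)

lemma theta_W:
  assumes "s \<in> T" "t \<in> T" "a \<in> adj_ops E" "x \<in> hm_carrier E"
  shows "\<theta> (s + t) a (W s x) = W s (\<theta> t a x)"
  using assms E0(4)[OF assms(1-3)] W_cov[OF assms(1) theta_adj[OF assms(2,3)] assms(4)] by simp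

text \<open>The adjoint form of \<open>theta_W\<close>, used for the adjoint of
  \<open>a\<close>.\<close>

lemma theta_V:
  assumes s: "s \<in> T" and t: "t \<in> T" and a: "a \<in> adj_ops E" and x: "x \<in> hm_carrier E"
  shows "V s (\<theta> (s + t) a x) = \<theta> t a (V s x)"
proof (rule E.inner_eqI)
  interpret st: module_rep E E "\<theta> (s + t)" by (rule rep) (simp add: s t T_simps)
  interpret t: module_rep E E "\<theta> t" by (rule rep[OF t])
  have st: "s + t \<in> T" using s t T_simps by simp
  show "V s (\<theta> (s + t) a x) \<in> hm_carrier E" "\<theta> t a (V s x) \<in> hm_carrier E"
    using s t st a x by (simp_all add: V_closed theta_closed)
  fix z assume z: "z \<in> hm_carrier E"
  have a': "op_adjoint E a \<in> adj_ops E" using a by (rule E.op_adjoint_adj_ops)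
  have "hm_inner E z (V s (\<theta> (s + t) a x)) = hm_inner E (W s z) (\<theta> (s + t) a x)"
    using s st a x z by (simp add: inner_V theta_closed)
  also have "\<dots> = hm_inner E (\<theta> (s + t) (op_adjoint E a) (W s z)) x"
    using s a' x z by (simp add: st.rep_inner W_closed E.op_adjoint_adjoint a)
  also have "\<dots> = hm_inner E (\<theta> t (op_adjoint E a) z) (V s x)"
    using s t a' x z by (simp add: theta_W inner_V theta_closed)
  also have "\<dots> = hm_inner E z (\<theta> t a (V s x))"
    using s a' x z by (simp add: t.rep_inner V_closed E.op_adjoint_adjoint a)
  finally show "hm_inner E z (V s (\<theta> (s + t) a x)) = hm_inner E z (\<theta> t a (V s x))" .
qed

text \<open>An element of the completed inductive limit is represented by the family of its projections
  to the complemented copies of \<open>E\<close> indexed by \<open>T\<close>.\<close>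

definition defect :: "(real \<Rightarrow> 'e) \<Rightarrow> real \<Rightarrow> real \<Rightarrow> 'e" where
  "defect h t s = hm_diff E (h (t + s)) (W s (h t))"

text \<open>Coherence under the projections \<open>V s\<close> alone need not even bound the norms.
  Small defects express that the family is a norm limit of vectors coming from a single copy of
  \<open>E\<close>; see \<open>level_dense\<close>.\<close>

definition Hc :: "(real \<Rightarrow> 'e) set" where
  "Hc = {h \<in> T \<rightarrow>\<^sub>E hm_carrier E. (\<forall>s\<in>T. \<forall>t\<in>T. V s (h (s + t)) = h t) \<and>
    (\<forall>e>0. \<exists>t\<in>T. \<forall>s\<in>T. hm_norm E (defect h t s) < e)}"

lemma Hc_closed: "h \<in> Hc \<Longrightarrow> t \<in> T \<Longrightarrow> h t \<in> hm_carrier E"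
  by (auto simp: Hc_def)

lemma Hc_V: "h \<in> Hc \<Longrightarrow> s \<in> T \<Longrightarrow> t \<in> T \<Longrightarrow> V s (h (s + t)) = h t"
  by (simp add: Hc_def)

lemma Hc_V': "h \<in> Hc \<Longrightarrow> s \<in> T \<Longrightarrow> t \<in> T \<Longrightarrow> V s (h (t + s)) = h t"
  using Hc_V by (simp add: add.commute)

lemma defect_closed: "h \<in> Hc \<Longrightarrow> t \<in> T \<Longrightarrow> s \<in> T \<Longrightarrow> defect h t s \<in> hm_carrier E"
  by (simp add: defect_def E.closed W_closed Hc_closed T_simps)

lemma Hc_eqI: "h \<in> Hc \<Longrightarrow> k \<in> Hc \<Longrightarrow> (\<And>t. t \<in> T \<Longrightarrow> h t = k t) \<Longrightarrow> h = k"
  unfolding Hc_def by (auto intro: PiE_ext)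

text \<open>Pythagoras: since \<open>V s (h (t + s)) = h t\<close>, the defect is orthogonal to the
  range of \<open>W s\<close>.\<close>

lemma inner_defect:
  assumes h: "h \<in> Hc" and k: "k \<in> Hc" and t: "t \<in> T" and s: "s \<in> T"
  shows "hm_inner E (defect h t s) (defect k t s) =
    hm_inner E (h (t + s)) (k (t + s)) - hm_inner E (h t) (k t)"
proof -
  have ts: "t + s \<in> T" using t s T_simps by simp
  have "hm_inner E (W s (h t)) (k (t + s)) = hm_inner E (h t) (k t)"
    using inner_V[OF s Hc_closed[OF h t] Hc_closed[OF k ts]] Hc_V'[OF k s t] by simp
  moreover have "hm_inner E (h (t + s)) (W s (k t)) = hm_inner E (h t) (k t)"
    using W_inner_V[OF s Hc_closed[OF h ts] Hc_closed[OF k t]] Hc_V'[OF h s t] by simp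
  ultimately show ?thesis
    using h k t s ts by (simp add: defect_def E.inner_simps E.closed W_closed Hc_closed W_inner)
qed

lemma Hc_norm_mono:
  assumes h: "h \<in> Hc" and t: "t \<in> T" and s: "s \<in> T"
  shows "hm_norm E (h t) \<le> hm_norm E (h (t + s))"
proof -
  have "cstar_positive (hm_inner E (h (t + s)) (h (t + s)) - hm_inner E (h t) (h t))"
    using E.inner_positive[OF defect_closed[OF h t s]] inner_defect[OF h h t s] by simp
  then have "norm (hm_inner E (h t) (h t)) \<le> norm (hm_inner E (h (t + s)) (h (t + s)))"
    by (intro cstar_positive_norm_mono E.inner_positive Hc_closed h t)
  then show ?thesis by (simp add: hm_norm_def)
qed

text \<open>The defect from \<open>t\<close> over \<open>r + s\<close> is the orthogonal sum of the
  one from \<open>t + r\<close> over \<open>s\<close> and an isometric image of the one from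
  \<open>t\<close> over \<open>r\<close>. A bound at \<open>t\<close> therefore persists at all
  later indices, which makes the existential clause in \<open>Hc\<close> usable.\<close>

lemma defect_mono:
  assumes h: "h \<in> Hc" and t: "t \<in> T" and r: "r \<in> T" and s: "s \<in> T"
  shows "hm_norm E (defect h (t + r) s) \<le> hm_norm E (defect h t (r + s))"
proof -
  have T: "t + r \<in> T" "r + s \<in> T" using t r s T_simps by auto
  have "hm_inner E (defect h t (r + s)) (defect h t (r + s)) - hm_inner E (defect h (t + r) s) (defect h (t + r) s)
      = hm_inner E (defect h t r) (defect h t r)"
    using h t r s T by (simp add: inner_defect add.assoc)
  then have "cstar_positive (hm_inner E (defect h t (r + s)) (defect h t (r + s)) -
      hm_inner E (defect h (t + r) s) (defect h (t + r) s))"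
    using E.inner_positive[OF defect_closed[OF h t r]] by simp
  then have "norm (hm_inner E (defect h (t + r) s) (defect h (t + r) s)) \<le>
      norm (hm_inner E (defect h t (r + s)) (defect h t (r + s)))"
    by (intro cstar_positive_norm_mono E.inner_positive defect_closed h T s)
  then show ?thesis by (simp add: hm_norm_def)
qed

lemma Hc_small:
  assumes h: "h \<in> Hc" and e: "e > 0"
  obtains t where "t \<in> T" "\<And>t' s. t' \<in> T \<Longrightarrow> t \<le> t' \<Longrightarrow> s \<in> T \<Longrightarrow> hm_norm E (defect h t' s) < e"
proof -
  obtain t where t: "t \<in> T" "\<And>s. s \<in> T \<Longrightarrow> hm_norm E (defect h t s) < e"
    using h e unfolding Hc_def by blast
  show thesis
  proof (rule that[OF t(1)])
    fix t' s assume t': "t' \<in> T" "t \<le> t'" and s: "s \<in> T"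
    have r: "t' - t \<in> T" using T_diff t t' by blast
    then have "t' - t + s \<in> T" using s T_simps by simp
    then show "hm_norm E (defect h t' s) < e"
      using defect_mono[OF h t(1) r s] t(2)[of "t' - t + s"] by simp
  qed
qed

lemma Hc_small2:
  assumes h: "h \<in> Hc" and k: "k \<in> Hc" and e: "e > 0"
  obtains t where "t \<in> T" "\<And>t' s. t' \<in> T \<Longrightarrow> t \<le> t' \<Longrightarrow> s \<in> T \<Longrightarrow>
    hm_norm E (defect h t' s) < e \<and> hm_norm E (defect k t' s) < e"
proof -
  obtain t1 where t1: "t1 \<in> T" "\<And>t' s. t' \<in> T \<Longrightarrow> t1 \<le> t' \<Longrightarrow> s \<in> T \<Longrightarrow> hm_norm E (defect h t' s) < e"
    by (rule Hc_small[OF h e]) blast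
  obtain t2 where t2: "t2 \<in> T" "\<And>t' s. t' \<in> T \<Longrightarrow> t2 \<le> t' \<Longrightarrow> s \<in> T \<Longrightarrow> hm_norm E (defect k t' s) < e"
    by (rule Hc_small[OF k e]) blast
  show thesis by (rule that[of "max t1 t2"]) (use t1 t2 in \<open>auto simp: max_def split: if_splits\<close>)
qed

text \<open>The defects of \<open>f\<close> are controlled by those of two members of
  \<open>Hc\<close>, and these are small from a common index on.\<close>

lemma HcI:
  assumes f: "f \<in> T \<rightarrow>\<^sub>E hm_carrier E" and V: "\<And>s t. s \<in> T \<Longrightarrow> t \<in> T \<Longrightarrow> V s (f (s + t)) = f t"
    and h: "h \<in> Hc" and k: "k \<in> Hc" and K: "K \<ge> 0"
    and le: "\<And>t s. t \<in> T \<Longrightarrow> s \<in> T \<Longrightarrow>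
      hm_norm E (defect f t s) \<le> K * (hm_norm E (defect h t s) + hm_norm E (defect k t s))"
  shows "f \<in> Hc"
proof -
  have "\<exists>t\<in>T. \<forall>s\<in>T. hm_norm E (defect f t s) < e" if e: "e > 0" for e
  proof -
    have "e / (2 * (K + 1)) > 0" using e K by simp
    then obtain t where t: "t \<in> T" "\<And>t' s. t' \<in> T \<Longrightarrow> t \<le> t' \<Longrightarrow> s \<in> T \<Longrightarrow>
        hm_norm E (defect h t' s) < e / (2 * (K + 1)) \<and> hm_norm E (defect k t' s) < e / (2 * (K + 1))"
      using Hc_small2[OF h k] by metis
    have "hm_norm E (defect f t s) < e" if s: "s \<in> T" for s
    proof -
      have "hm_norm E (defect f t s) \<le> K * (e / (2 * (K + 1)) + e / (2 * (K + 1)))"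
        using t(2)[OF t(1) order_refl s] K
        by (intro order_trans[OF le[OF t(1) s]] mult_left_mono add_mono) auto
      also have "e / (2 * (K + 1)) = (e / (K + 1)) / 2" by simp
      also have "K * ((e / (K + 1)) / 2 + (e / (K + 1)) / 2) = e * (K / (K + 1))"
        unfolding field_sum_of_halves by simp
      also have "\<dots> < e * 1" using e K by (intro mult_strict_left_mono) simp_all
      finally show ?thesis by simp
    qed
    then show ?thesis using t(1) by blast
  qed
  then show ?thesis using f V by (simp add: Hc_def)
qed

text \<open>The natural numbers are cofinal in both index sets, so a limit along them serves for
  \<open>[0, \<infinity>)\<close> as well.\<close>

definition Hinner :: "(real \<Rightarrow> 'e) \<Rightarrow> (real \<Rightarrow> 'e) \<Rightarrow> 'b" where
  "Hinner h k = lim (\<lambda>n. hm_inner E (h (real n)) (k (real n)))"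

lemma inner_near:
  assumes h: "h \<in> Hc" and k: "k \<in> Hc" and e: "e > 0"
  obtains t where "t \<in> T" "\<And>t' s. t' \<in> T \<Longrightarrow> t \<le> t' \<Longrightarrow> s \<in> T \<Longrightarrow>
    norm (hm_inner E (h (t' + s)) (k (t' + s)) - hm_inner E (h t') (k t')) < e"
proof -
  obtain t where t: "t \<in> T" "\<And>t' s. t' \<in> T \<Longrightarrow> t \<le> t' \<Longrightarrow> s \<in> T \<Longrightarrow>
      hm_norm E (defect h t' s) < sqrt e \<and> hm_norm E (defect k t' s) < sqrt e"
    by (rule Hc_small2[OF h k, of "sqrt e"]) (use e in auto)
  show thesis
  proof (rule that[OF t(1)])
    fix t' s assume t': "t' \<in> T" "t \<le> t'" "s \<in> T"
    have "norm (hm_inner E (h (t' + s)) (k (t' + s)) - hm_inner E (h t') (k t')) \<le>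
        hm_norm E (defect h t' s) * hm_norm E (defect k t' s)"
      unfolding inner_defect[OF h k t'(1,3), symmetric] by (intro E.cauchy_schwarz defect_closed h k t')
    also have "\<dots> < sqrt e * sqrt e"
      using t(2)[OF t'] e by (intro mult_strict_mono') (auto simp: E.norm_nonneg)
    finally show "norm (hm_inner E (h (t' + s)) (k (t' + s)) - hm_inner E (h t') (k t')) < e" using e by simp
  qed
qed

lemma Hinner_LIMSEQ:
  assumes h: "h \<in> Hc" and k: "k \<in> Hc"
  shows "(\<lambda>n. hm_inner E (h (real n)) (k (real n))) \<longlonglongrightarrow> Hinner h k"
proof -
  have "Cauchy (\<lambda>n. hm_inner E (h (real n)) (k (real n)))"
  proof (rule metric_CauchyI)
    fix e :: real assume "e > 0"
    then obtain t where t: "\<And>t' s. t' \<in> T \<Longrightarrow> t \<le> t' \<Longrightarrow> s \<in> T \<Longrightarrow>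
        norm (hm_inner E (h (t' + s)) (k (t' + s)) - hm_inner E (h t') (k t')) < e"
      using inner_near[OF h k] by metis
    obtain N where N: "t \<le> real N" using real_arch_simple by blast
    have *: "dist (hm_inner E (h (real m)) (k (real m))) (hm_inner E (h (real n)) (k (real n))) < e"
      if "n \<ge> N" "m \<ge> n" for m n
      using t[OF T_simps(3)[of n] _ T_simps(3)[of "m - n"]] N that by (simp add: dist_norm of_nat_diff)
    show "\<exists>N. \<forall>m\<ge>N. \<forall>n\<ge>N. dist (hm_inner E (h (real m)) (k (real m))) (hm_inner E (h (real n)) (k (real n))) < e"
    proof (intro exI[of _ N] allI impI)
      fix m n assume "m \<ge> N" "n \<ge> N"
      then show "dist (hm_inner E (h (real m)) (k (real m))) (hm_inner E (h (real n)) (k (real n))) < e"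
        using *[of n m] *[of m n] by (cases "m \<ge> n") (simp_all add: dist_commute)
    qed
  qed
  then show ?thesis unfolding Hinner_def by (simp add: Cauchy_convergent_iff convergent_LIMSEQ_iff)
qed

lemma Hinner_unique:
  "h \<in> Hc \<Longrightarrow> k \<in> Hc \<Longrightarrow> (\<lambda>n. hm_inner E (h (real n)) (k (real n))) \<longlonglongrightarrow> c \<Longrightarrow> Hinner h k = c"
  using Hinner_LIMSEQ LIMSEQ_unique by blast

text \<open>From some index on the inner products vary arbitrarily little, also over steps that are
  not integers. The invariance of the inner product under \<open>shift\<close> is read off from
  this.\<close>

lemma Hinner_shift:
  assumes h: "h \<in> Hc" and k: "k \<in> Hc" and s: "s \<in> T"
  shows "(\<lambda>n. hm_inner E (h (real n + s)) (k (real n + s))) \<longlonglongrightarrow> Hinner h k"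
proof -
  have "(\<lambda>n. hm_inner E (h (real n + s)) (k (real n + s)) - hm_inner E (h (real n)) (k (real n))) \<longlonglongrightarrow> 0"
  proof (rule LIMSEQ_I)
    fix e :: real assume "e > 0"
    then obtain t where t: "\<And>t' s. t' \<in> T \<Longrightarrow> t \<le> t' \<Longrightarrow> s \<in> T \<Longrightarrow>
        norm (hm_inner E (h (t' + s)) (k (t' + s)) - hm_inner E (h t') (k t')) < e"
      using inner_near[OF h k] by metis
    obtain N where N: "t \<le> real N" using real_arch_simple by blast
    show "\<exists>no. \<forall>n\<ge>no. norm (hm_inner E (h (real n + s)) (k (real n + s)) - hm_inner E (h (real n)) (k (real n)) - 0) < e"
      using t[OF T_simps(3) _ s] N by (intro exI[of _ N]) auto
  qed
  from tendsto_add[OF this Hinner_LIMSEQ[OF h k]] show ?thesis by simp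
qed

section \<open>The limit as a Hilbert module\<close>

definition H :: "(real \<Rightarrow> 'e, 'b) hilbert_mod" where
  "H = \<lparr>hm_carrier = Hc,
    hm_add = (\<lambda>h k. \<lambda>t\<in>T. hm_add E (h t) (k t)),
    hm_zero = (\<lambda>t\<in>T. hm_zero E),
    hm_scale = (\<lambda>c h. \<lambda>t\<in>T. hm_scale E c (h t)),
    hm_act = (\<lambda>h b. \<lambda>t\<in>T. hm_act E (h t) b),
    hm_inner = Hinner\<rparr>"

lemma H_simps [simp]:
  "hm_carrier H = Hc" "hm_add H h k = (\<lambda>t\<in>T. hm_add E (h t) (k t))" "hm_zero H = (\<lambda>t\<in>T. hm_zero E)"
  "hm_scale H c h = (\<lambda>t\<in>T. hm_scale E c (h t))" "hm_act H h b = (\<lambda>t\<in>T. hm_act E (h t) b)"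
  "hm_inner H h k = Hinner h k"
  by (simp_all add: H_def)

lemma Hc_zero: "(\<lambda>t\<in>T. hm_zero E) \<in> Hc"
  unfolding Hc_def
  using T_simps by (auto simp: defect_def E.closed E.adj_zero V_adj W_adj E.diff_self E.norm_zero)

text \<open>The common criterion for coordinatewise operations: compatibility with \<open>V\<close>
  gives coherence, compatibility with \<open>W\<close> carries the defect along, and a bound
  \<open>K\<close> shared by all indices keeps it small.\<close>

lemma Hc_image:
  assumes h: "h \<in> Hc" and K: "K \<ge> 0"
    and A: "\<And>t x. t \<in> T \<Longrightarrow> x \<in> hm_carrier E \<Longrightarrow> A t x \<in> hm_carrier E"
      "\<And>t x. t \<in> T \<Longrightarrow> x \<in> hm_carrier E \<Longrightarrow> hm_norm E (A t x) \<le> K * hm_norm E x"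
      "\<And>t x y. t \<in> T \<Longrightarrow> x \<in> hm_carrier E \<Longrightarrow> y \<in> hm_carrier E \<Longrightarrow> A t (hm_diff E x y) = hm_diff E (A t x) (A t y)"
      "\<And>s t x. s \<in> T \<Longrightarrow> t \<in> T \<Longrightarrow> x \<in> hm_carrier E \<Longrightarrow> V s (A (s + t) x) = A t (V s x)"
      "\<And>s t x. s \<in> T \<Longrightarrow> t \<in> T \<Longrightarrow> x \<in> hm_carrier E \<Longrightarrow> A (t + s) (W s x) = W s (A t x)"
  shows "(\<lambda>t\<in>T. A t (h t)) \<in> Hc"
proof (rule HcI[OF _ _ h h K])
  show "(\<lambda>t\<in>T. A t (h t)) \<in> T \<rightarrow>\<^sub>E hm_carrier E" using h by (auto simp: A Hc_closed)
  fix s t assume st: "s \<in> T" "t \<in> T"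
  then have stT: "s + t \<in> T" using T_simps by simp
  show "V s ((\<lambda>t\<in>T. A t (h t)) (s + t)) = (\<lambda>t\<in>T. A t (h t)) t"
    using st stT h by (simp add: A Hc_closed Hc_V)
next
  fix t s assume ts: "t \<in> T" "s \<in> T"
  then have tsT: "t + s \<in> T" using T_simps by simp
  have "defect (\<lambda>t\<in>T. A t (h t)) t s = A (t + s) (defect h t s)"
    using ts tsT h by (simp add: defect_def A Hc_closed W_closed)
  then have "hm_norm E (defect (\<lambda>t\<in>T. A t (h t)) t s) \<le> K * hm_norm E (defect h t s)"
    using A(2)[OF tsT defect_closed[OF h ts]] by simp
  then show "hm_norm E (defect (\<lambda>t\<in>T. A t (h t)) t s) \<le> K * (hm_norm E (defect h t s) + hm_norm E (defect h t s))"
    using mult_nonneg_nonneg[OF K E.norm_nonneg[of "defect h t s"]] by (simp add: distrib_left)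
qed

lemma Hc_scale: "h \<in> Hc \<Longrightarrow> (\<lambda>t\<in>T. hm_scale E c (h t)) \<in> Hc"
proof (rule Hc_image[of _ "cmod c" "\<lambda>t x. hm_scale E c x"])
  fix x y assume xy: "x \<in> hm_carrier E" "y \<in> hm_carrier E"
  show "hm_scale E c (hm_diff E x y) = hm_diff E (hm_scale E c x) (hm_scale E c y)"
    using E.adj_diff[OF E.op_scale_adj_ops[OF E.op_id_adj_ops] xy] xy by (simp add: E.op_apply E.closed)
qed (simp_all add: E.closed E.norm_scale E.adj_scale V_adj W_adj)

lemma Hc_act: "h \<in> Hc \<Longrightarrow> (\<lambda>t\<in>T. hm_act E (h t) b) \<in> Hc"
proof (rule Hc_image[of _ "norm b" "\<lambda>t x. hm_act E x b"])
  fix x y assume xy: "x \<in> hm_carrier E" "y \<in> hm_carrier E"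
  show "hm_act E (hm_diff E x y) b = hm_diff E (hm_act E x b) (hm_act E y b)"
    using xy by (intro E.inner_eqI) (simp_all add: E.closed E.inner_simps algebra_simps)
  show "hm_norm E (hm_act E x b) \<le> norm b * hm_norm E x" using E.norm_act_le[OF xy(1)] by (simp add: mult.commute)
qed (simp_all add: E.closed E.adj_act V_adj W_adj)

text \<open>A bound for \<open>a\<close> bounds every \<open>\<theta> t a\<close> by contractivity,
  so it does not depend on \<open>t\<close>.\<close>

lemma Hc_theta:
  assumes a: "a \<in> adj_ops E" and h: "h \<in> Hc"
  shows "(\<lambda>t\<in>T. \<theta> t a (h t)) \<in> Hc"
proof -
  obtain K where K: "K > 0" "\<And>x. x \<in> hm_carrier E \<Longrightarrow> hm_norm E (a x) \<le> K * hm_norm E x"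
    by (rule E.adj_bounded[OF a]) blast
  show ?thesis
  proof (rule Hc_image[OF h])
    show "hm_norm E (\<theta> t a x) \<le> K * hm_norm E x" if "t \<in> T" "x \<in> hm_carrier E" for t x
      using module_rep.rep_norm_le[OF rep[OF that(1)] a _ K(2) that(2)] K(1) by simp
  qed (use K a theta_W[of _ _ a] in \<open>simp_all add: theta_closed theta_V E.adj_diff theta_adj add.commute\<close>)
qed

lemma Hc_add:
  assumes h: "h \<in> Hc" and k: "k \<in> Hc"
  shows "(\<lambda>t\<in>T. hm_add E (h t) (k t)) \<in> Hc"
proof (rule HcI[OF _ _ h k, of _ 1])
  show "(\<lambda>t\<in>T. hm_add E (h t) (k t)) \<in> T \<rightarrow>\<^sub>E hm_carrier E" using h k by (auto simp: E.closed Hc_closed)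
  fix s t assume st: "s \<in> T" "t \<in> T"
  then have stT: "s + t \<in> T" using T_simps by simp
  show "V s ((\<lambda>t\<in>T. hm_add E (h t) (k t)) (s + t)) = (\<lambda>t\<in>T. hm_add E (h t) (k t)) t"
    using st stT h k by (simp add: E.adj_add V_adj Hc_closed Hc_V)
next
  fix t s assume ts: "t \<in> T" "s \<in> T"
  then have tsT: "t + s \<in> T" using T_simps by simp
  have "defect (\<lambda>t\<in>T. hm_add E (h t) (k t)) t s = hm_add E (defect h t s) (defect k t s)"
    using ts tsT h k
    by (intro E.inner_eqI) (simp_all add: defect_def E.adj_add W_adj Hc_closed W_closed E.closed E.inner_simps)
  then show "hm_norm E (defect (\<lambda>t\<in>T. hm_add E (h t) (k t)) t s) \<le> 1 * (hm_norm E (defect h t s) + hm_norm E (defect k t s))"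
    using E.norm_add_le[OF defect_closed[OF h ts] defect_closed[OF k ts]] by simp
qed simp

lemma Hdiff: "hm_diff H h k = (\<lambda>t\<in>T. hm_diff E (h t) (k t))"
  by (auto simp: hm_diff_def)

lemma Hdiff_closed: "h \<in> Hc \<Longrightarrow> k \<in> Hc \<Longrightarrow> hm_diff H h k \<in> Hc"
  using Hc_add[OF _ Hc_scale] by (simp add: hm_diff_def)

lemma Hinner_positive: "h \<in> Hc \<Longrightarrow> cstar_positive (Hinner h h)"
  by (rule cstar_positive_LIMSEQ[OF Hinner_LIMSEQ]) (auto intro: E.inner_positive Hc_closed T_simps)

lemma Hnorm_LIMSEQ: "h \<in> Hc \<Longrightarrow> (\<lambda>n. hm_norm E (h (real n))) \<longlonglongrightarrow> hm_norm H h"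
  unfolding hm_norm_def using tendsto_real_sqrt[OF tendsto_norm[OF Hinner_LIMSEQ]] by simp

lemma norm_le_Hnorm:
  assumes h: "h \<in> Hc" and t: "t \<in> T"
  shows "hm_norm E (h t) \<le> hm_norm H h"
proof (rule LIMSEQ_le_const[OF Hnorm_LIMSEQ[OF h]])
  obtain N where N: "t \<le> real N" using real_arch_simple by blast
  have "hm_norm E (h t) \<le> hm_norm E (h (real n))" if "n \<ge> N" for n
    using Hc_norm_mono[OF h t T_diff[OF t T_simps(3), of n]] N that by simp
  then show "\<exists>N. \<forall>n\<ge>N. hm_norm E (h t) \<le> hm_norm E (h (real n))" by blast
qed

lemma Hnorm_leI:
  assumes h: "h \<in> Hc" and t: "\<And>s. s \<in> T \<Longrightarrow> t \<le> s \<Longrightarrow> hm_norm E (h s) \<le> c"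
  shows "hm_norm H h \<le> c"
proof (rule LIMSEQ_le_const2[OF Hnorm_LIMSEQ[OF h]])
  obtain N where "t \<le> real N" using real_arch_simple by blast
  then show "\<exists>N. \<forall>n\<ge>N. hm_norm E (h (real n)) \<le> c" using t T_simps(3) by (intro exI[of _ N]) auto
qed

lemma H_complete:
  assumes u: "\<And>n. u n \<in> Hc"
    and c: "\<And>e. e > 0 \<Longrightarrow> \<exists>N. \<forall>m\<ge>N. \<forall>n\<ge>N. hm_norm H (hm_diff H (u m) (u n)) < e"
  shows "\<exists>h\<in>Hc. (\<lambda>n. hm_norm H (hm_diff H (u n) h)) \<longlonglongrightarrow> 0"
proof -
  have un: "hm_norm E (hm_diff E (u m t) (u n t)) \<le> hm_norm H (hm_diff H (u m) (u n))" if "t \<in> T" for m n t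
    using norm_le_Hnorm[OF Hdiff_closed[OF u u] that] that by (simp add: Hdiff)
  have uc: "u n t \<in> hm_carrier E" if "t \<in> T" for n t using u that by (rule Hc_closed)
  have ex: "\<exists>y. hm_lim E (\<lambda>n. u n t) y" if t: "t \<in> T" for t
  proof (rule E.cauchy_lim[of "\<lambda>n. u n t", OF uc[OF t]])
    fix e :: real assume "e > 0"
    then show "\<exists>N. \<forall>m\<ge>N. \<forall>n\<ge>N. hm_norm E (hm_diff E (u m t) (u n t)) < e"
      using c[of e] un[OF t] by (meson le_less_trans)
  qed blast
  define L where "L = (\<lambda>t\<in>T. SOME y. hm_lim E (\<lambda>n. u n t) y)"
  have L: "hm_lim E (\<lambda>n. u n t) (L t)" if "t \<in> T" for t
    using someI_ex[OF ex[OF that]] that by (simp add: L_def)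
  have Lc: "L t \<in> hm_carrier E" if "t \<in> T" for t using L[OF that] by (rule E.lim_closed)
  \<comment> \<open>Coordinates are dominated by the norm of \<open>H\<close>, so the convergence is
    uniform in \<open>t\<close>; only a uniform error can be compared with defects over all steps at
    once.\<close>
  have near: "\<exists>N. \<forall>n\<ge>N. \<forall>t\<in>T. hm_norm E (hm_diff E (u n t) (L t)) \<le> e" if e: "e > 0" for e
  proof -
    obtain N where N: "\<And>m n. m \<ge> N \<Longrightarrow> n \<ge> N \<Longrightarrow> hm_norm H (hm_diff H (u m) (u n)) < e" using c[OF e] by blast
    have "hm_norm E (hm_diff E (u n t) (L t)) \<le> e" if n: "n \<ge> N" and t: "t \<in> T" for n t
    proof (rule LIMSEQ_le_const2)
      have "hm_lim E (\<lambda>m. hm_diff E (u n t) (u m t)) (hm_diff E (u n t) (L t))"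
        unfolding hm_diff_def by (intro E.lim_add E.lim_const E.lim_scale L t uc E.closed)
      then show "(\<lambda>m. hm_norm E (hm_diff E (u n t) (u m t))) \<longlonglongrightarrow> hm_norm E (hm_diff E (u n t) (L t))"
        by (rule E.lim_norm) (intro E.closed uc t)
      show "\<exists>M. \<forall>m\<ge>M. hm_norm E (hm_diff E (u n t) (u m t)) \<le> e"
        using un[OF t, of n] N[OF n] by (intro exI[of _ N]) (meson less_imp_le order_trans)
    qed
    then show ?thesis by blast
  qed
  have LH: "L \<in> Hc"
    unfolding Hc_def
  proof (intro CollectI conjI ballI allI impI)
    show "L \<in> T \<rightarrow>\<^sub>E hm_carrier E" using Lc by (auto simp: L_def)
    fix s t assume s: "s \<in> T" and t: "t \<in> T"
    have st: "s + t \<in> T" using s t T_simps by simp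
    have "hm_lim E (\<lambda>n. V s (u n (s + t))) (V s (L (s + t)))" by (rule E.adj_lim[OF V_adj[OF s] L[OF st] uc[OF st]])
    then have "hm_lim E (\<lambda>n. u n t) (V s (L (s + t)))" by (simp add: Hc_V u s t)
    then show "V s (L (s + t)) = L t" using E.lim_unique[of "\<lambda>n. u n t", OF _ L[OF t]] uc[OF t] by blast
  next
    fix e :: real assume e: "e > 0"
    then have "e / 4 > 0" by simp
    from near[OF this] obtain n where n: "\<And>t. t \<in> T \<Longrightarrow> hm_norm E (hm_diff E (u n t) (L t)) \<le> e / 4" by blast
    obtain t where t: "t \<in> T" "\<And>s. s \<in> T \<Longrightarrow> hm_norm E (defect (u n) t s) < e / 4"
      using u[of n] \<open>e / 4 > 0\<close> unfolding Hc_def by blast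
    show "\<exists>t\<in>T. \<forall>s\<in>T. hm_norm E (defect L t s) < e"
    proof (intro bexI[OF _ t(1)] ballI)
      fix s assume s: "s \<in> T"
      have ts: "t + s \<in> T" using t(1) s T_simps by simp
      \<comment> \<open>Three contributions of at most \<open>e / 4\<close> each: the error at
        \<open>t + s\<close>, the defect of \<open>u n\<close>, and the error at \<open>t\<close>
        carried along by the isometry.\<close>
      have d: "defect L t s = hm_add E (hm_add E (hm_diff E (L (t + s)) (u n (t + s))) (defect (u n) t s))
          (W s (hm_diff E (u n t) (L t)))"
        using t(1) s ts Lc uc
        by (intro E.inner_eqI) (simp_all add: defect_def E.adj_diff W_adj W_closed E.closed E.inner_simps)
      have "hm_norm E (defect L t s) \<le> hm_norm E (hm_diff E (L (t + s)) (u n (t + s))) + hm_norm E (defect (u n) t s)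
          + hm_norm E (W s (hm_diff E (u n t) (L t)))"
        unfolding d using t(1) s ts Lc uc u
        by (intro order_trans[OF E.norm_add_le] add_mono E.norm_add_le order_refl)
          (simp_all add: E.closed W_closed defect_closed)
      also have "\<dots> \<le> e / 4 + e / 4 + e / 4"
        using n[OF ts] n[OF t(1)] t(2)[OF s] E.norm_diff_commute[OF Lc[OF ts] uc[OF ts], of n] t(1) s Lc uc
        by (simp add: norm_W E.closed)
      finally show "hm_norm E (defect L t s) < e" using e by simp
    qed
  qed
  have "(\<lambda>n. hm_norm H (hm_diff H (u n) L)) \<longlonglongrightarrow> 0"
  proof (rule LIMSEQ_I)
    fix e :: real assume e: "e > 0"
    then have "e / 2 > 0" by simp
    from near[OF this] obtain N where N: "\<And>n t. n \<ge> N \<Longrightarrow> t \<in> T \<Longrightarrow> hm_norm E (hm_diff E (u n t) (L t)) \<le> e / 2" by blast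
    have "hm_norm H (hm_diff H (u n) L) \<le> e / 2" if "n \<ge> N" for n
      by (rule Hnorm_leI[OF Hdiff_closed[OF u LH], of 0]) (use N[OF that] in \<open>simp add: Hdiff\<close>)
    moreover have "0 \<le> hm_norm H (hm_diff H (u n) L)" for n by (simp add: hm_norm_def)
    ultimately have "norm (hm_norm H (hm_diff H (u n) L) - 0) < e" if "n \<ge> N" for n
      using that e by (fastforce simp del: H_simps)
    then show "\<exists>N. \<forall>n\<ge>N. norm (hm_norm H (hm_diff H (u n) L) - 0) < e" by blast
  qed
  then show ?thesis using LH by blast
qed

lemma H_hilbert_module: "hilbert_module H"
proof
  fix h assume h: "h \<in> hm_carrier H"
  show "cstar_positive (hm_inner H h h)" using h by (simp add: Hinner_positive)
  assume "hm_inner H h h = 0"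
  then have "hm_norm H h = 0" by (simp add: hm_norm_def)
  then have "hm_norm E (h t) = 0" if "t \<in> T" for t
    using norm_le_Hnorm[of h t] h that E.norm_nonneg[of "h t"] by simp
  then show "h = hm_zero H" using h Hc_zero by (auto intro!: Hc_eqI E.norm_eq_zeroD Hc_closed)
next
  fix h assume "h \<in> hm_carrier H"
  then show "hm_add H (hm_zero H) h = h"
    using Hc_add[OF Hc_zero, of h] by (intro Hc_eqI) (simp_all add: E.zero_add Hc_closed)
next
  fix u :: "nat \<Rightarrow> real \<Rightarrow> 'e"
  assume "\<And>n. u n \<in> hm_carrier H"
    and "\<And>e. e > 0 \<Longrightarrow> \<exists>N. \<forall>m\<ge>N. \<forall>n\<ge>N. hm_norm H (hm_diff H (u m) (u n)) < e"
  then show "\<exists>x\<in>hm_carrier H. (\<lambda>n. hm_norm H (hm_diff H (u n) x)) \<longlonglongrightarrow> 0"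
    using H_complete by simp
next
  fix h k assume "h \<in> hm_carrier H" "k \<in> hm_carrier H"
  then have hk: "h \<in> Hc" "k \<in> Hc" by simp_all
  have "(\<lambda>n. star (hm_inner E (h (real n)) (k (real n)))) \<longlonglongrightarrow> star (Hinner h k)"
    by (intro tendsto_star Hinner_LIMSEQ hk)
  then show "star (hm_inner H h k) = hm_inner H k h"
    using Hinner_unique[OF hk(2,1)] hk by (simp add: E.star_inner Hc_closed T_simps)
  fix b
  have "(\<lambda>n. hm_inner E (h (real n)) (k (real n)) * b) \<longlonglongrightarrow> Hinner h k * b"
    by (intro tendsto_mult_right Hinner_LIMSEQ hk)
  then show "hm_inner H h (hm_act H k b) = hm_inner H h k * b"
    using Hinner_unique[OF hk(1) Hc_act[OF hk(2)]] hk by (simp add: E.inner_act Hc_closed T_simps)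
  fix c
  have "bounded_linear (\<lambda>x::'b. c *\<^sub>C x)"
    by (rule bounded_linear_intro[of _ "cmod c"])
      (simp_all add: scaleC_add_right norm_scaleC mult.commute scaleC_of_real[symmetric] scaleC_scaleC)
  from bounded_linear.tendsto[OF this Hinner_LIMSEQ[OF hk]]
  show "hm_inner H h (hm_scale H c k) = c *\<^sub>C hm_inner H h k"
    using Hinner_unique[OF hk(1) Hc_scale[OF hk(2)]] hk by (simp add: E.inner_scale Hc_closed T_simps)
next
  fix h k l assume "h \<in> hm_carrier H" "k \<in> hm_carrier H" "l \<in> hm_carrier H"
  then have hkl: "h \<in> Hc" "k \<in> Hc" "l \<in> Hc" by simp_all
  have "(\<lambda>n. hm_inner E (h (real n)) (k (real n)) + hm_inner E (h (real n)) (l (real n))) \<longlonglongrightarrow> Hinner h k + Hinner h l"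
    by (intro tendsto_add Hinner_LIMSEQ hkl)
  then show "hm_inner H h (hm_add H k l) = hm_inner H h k + hm_inner H h l"
    using Hinner_unique[OF hkl(1) Hc_add[OF hkl(2,3)]] hkl by (simp add: E.inner_add Hc_closed T_simps)
qed (auto simp: Hc_add Hc_zero Hc_scale Hc_act Hdiff E.add_assoc E.diff_self E.scale_add E.add_scale
    E.scale_scale E.scale_one E.add_act E.act_add E.act_act E.act_one E.scale_act E.act_scale Hc_closed
    intro!: restrict_ext Hc_eqI intro: E.add_commute)

sublocale H: hilbert_module H
  by (rule H_hilbert_module)

text \<open>The vector of the inductive limit that is represented by \<open>z\<close> in the copy
  with index \<open>t\<close>.\<close>

definition level :: "real \<Rightarrow> 'e \<Rightarrow> real \<Rightarrow> 'e" where
  "level t z = (\<lambda>r\<in>T. if t \<le> r then W (r - t) z else V (t - r) z)"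

text \<open>Both \<open>level\<close> and the inverse of the shift are obtained by extending a family from \<open>{t..}\<close> downwards.\<close>

lemma Hc_extend:
  assumes t: "t \<in> T" and f: "\<And>r. r \<in> T \<Longrightarrow> f r \<in> hm_carrier E"
    and V: "\<And>s r. s \<in> T \<Longrightarrow> r \<in> T \<Longrightarrow> V s (f (s + r)) = f r"
    and small: "\<And>e. e > 0 \<Longrightarrow> \<exists>r\<in>T. \<forall>s\<in>T. hm_norm E (defect f r s) < e"
  shows "(\<lambda>r\<in>T. if t \<le> r then f (r - t) else V (t - r) (f 0)) \<in> Hc" (is "?f \<in> Hc")
  unfolding Hc_def
proof (intro CollectI conjI ballI allI impI)
  show "?f \<in> T \<rightarrow>\<^sub>E hm_carrier E"
    using f t T_diff T_simps by (auto intro!: V_closed)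
  fix s r assume s: "s \<in> T" and r: "r \<in> T"
  have sr: "s + r \<in> T" using s r T_simps by simp
  consider "t \<le> r" | "r < t" "t \<le> s + r" | "s + r < t" using T_simps(5)[OF s] by linarith
  then show "V s (?f (s + r)) = ?f r"
  proof cases
    case 1
    then have "r - t \<in> T" using T_diff t r by blast
    then show ?thesis using V[OF s, of "r - t"] 1 s r sr T_simps(5)[OF s] by (simp add: add_diff_eq)
  next
    case 2
    have T: "t - r \<in> T" "s + r - t \<in> T" using T_diff t r sr 2 by auto
    have "V s (f (s + r - t)) = V ((t - r) + (s + r - t)) (f (s + r - t))" by simp
    also have "\<dots> = V (t - r) (V (s + r - t) (f (s + r - t)))" using T f by (intro V_add)
    also have "V (s + r - t) (f (s + r - t)) = f 0" using V[OF T(2) T_simps(1)] by simp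
    finally show ?thesis using 2 r sr by simp
  next
    case 3
    have T: "t - (s + r) \<in> T" using T_diff t sr 3 by simp
    have "V s (V (t - (s + r)) (f 0)) = V (s + (t - (s + r))) (f 0)"
      using V_add[OF s T f[OF T_simps(1)]] by simp
    then show ?thesis using 3 r sr T_simps(5)[OF s] by simp
  qed
next
  fix e :: real assume "e > 0"
  then obtain r where r: "r \<in> T" "\<And>s. s \<in> T \<Longrightarrow> hm_norm E (defect f r s) < e" using small by blast
  have "r + t \<in> T" using r t T_simps by simp
  moreover have "defect ?f (r + t) s = defect f r s" if s: "s \<in> T" for s
  proof -
    have "r + t + s \<in> T" using \<open>r + t \<in> T\<close> s T_simps by simp
    moreover have "r + t + s - t = r + s" by simp
    ultimately show ?thesis using \<open>r + t \<in> T\<close> T_simps(5)[OF r(1)] T_simps(5)[OF s] by (simp add: defect_def)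
  qed
  ultimately show "\<exists>t\<in>T. \<forall>s\<in>T. hm_norm E (defect ?f t s) < e" using r(2) by (intro bexI[of _ "r + t"]) simp_all
qed

lemma level_closed:
  assumes t: "t \<in> T" and z: "z \<in> hm_carrier E"
  shows "level t z \<in> Hc"
proof -
  have "(\<lambda>r\<in>T. if t \<le> r then W (r - t) z else V (t - r) (W 0 z)) \<in> Hc"
  proof (rule Hc_extend[OF t])
    show "V s (W (s + r) z) = W r z" if "s \<in> T" "r \<in> T" for s r
      using that z by (simp add: W_add V_W W_closed)
    show "\<exists>r\<in>T. \<forall>s\<in>T. hm_norm E (defect (\<lambda>r. W r z) r s) < e" if "e > 0" for e
      using that z T_simps(1)
      by (intro bexI[of _ 0]) (simp_all add: defect_def W_zero E.diff_self W_closed E.norm_zero)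
  qed (use z in \<open>simp add: W_closed\<close>)
  then show ?thesis unfolding level_def W_zero[OF z] .
qed

text \<open>Beyond \<open>t\<close> the difference of \<open>h\<close> and
  \<open>level t (h t)\<close> is the defect itself.\<close>

lemma level_dense:
  assumes h: "h \<in> Hc" and e: "e > 0"
  shows "\<exists>t\<in>T. hm_norm H (hm_diff H h (level t (h t))) < e"
proof -
  have e2: "e / 2 > 0" using e by simp
  obtain t where t: "t \<in> T" "\<And>s. s \<in> T \<Longrightarrow> hm_norm E (defect h t s) < e / 2" using h e2 unfolding Hc_def by blast
  have l: "level t (h t) \<in> Hc" using level_closed t(1) Hc_closed[OF h] by blast
  have "hm_norm H (hm_diff H h (level t (h t))) \<le> e / 2"
  proof (rule Hnorm_leI[OF Hdiff_closed[OF h l], of t])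
    fix s assume s: "s \<in> T" "t \<le> s"
    then have "s - t \<in> T" using T_diff t by blast
    then show "hm_norm E (hm_diff H h (level t (h t)) s) \<le> e / 2"
      using t(2)[of "s - t"] s by (simp add: Hdiff level_def defect_def)
  qed
  then show ?thesis using t(1) e by (intro bexI[of _ t]) linarith+
qed

section \<open>The operators of \<open>E\<close> acting on the limit\<close>

definition Hrep :: "('e \<Rightarrow> 'e) \<Rightarrow> (real \<Rightarrow> 'e) \<Rightarrow> real \<Rightarrow> 'e" where
  "Hrep a = (\<lambda>h\<in>Hc. \<lambda>t\<in>T. \<theta> t a (h t))"

lemma Hrep_apply: "h \<in> Hc \<Longrightarrow> t \<in> T \<Longrightarrow> Hrep a h t = \<theta> t a (h t)"
  by (simp add: Hrep_def)

lemma Hrep_closed: "a \<in> adj_ops E \<Longrightarrow> h \<in> Hc \<Longrightarrow> Hrep a h \<in> Hc"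
  by (simp add: Hrep_def Hc_theta)

lemma
  assumes a: "a \<in> adj_ops E"
  shows Hrep_adj_ops: "Hrep a \<in> adj_ops H" and Hrep_adjoint: "op_adjoint H (Hrep a) = Hrep (op_adjoint E a)"
proof -
  have a': "op_adjoint E a \<in> adj_ops E" using a by (rule E.op_adjoint_adj_ops)
  have *: "Hrep c \<in> hm_carrier H \<rightarrow>\<^sub>E hm_carrier H" if "c \<in> adj_ops E" for c
    using Hrep_closed[OF that] by (auto simp: Hrep_def)
  have **: "hm_inner H (Hrep a h) k = hm_inner H h (Hrep (op_adjoint E a) k)"
    if "h \<in> hm_carrier H" "k \<in> hm_carrier H" for h k
  proof -
    have hk: "h \<in> Hc" "k \<in> Hc" using that by simp_all
    have "hm_inner E (Hrep a h (real n)) (k (real n)) = hm_inner E (h (real n)) (Hrep (op_adjoint E a) k (real n))" for n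
      using module_rep.rep_inner[OF rep[OF T_simps(3)] a] hk by (simp add: Hrep_apply T_simps Hc_closed)
    then show ?thesis
      using Hinner_LIMSEQ[OF hk(1) Hrep_closed[OF a' hk(2)]] Hinner_unique[OF Hrep_closed[OF a hk(1)] hk(2)] by simp
  qed
  show "Hrep a \<in> adj_ops H" "op_adjoint H (Hrep a) = Hrep (op_adjoint E a)"
    using H.adj_opsI[OF *[OF a] *[OF a'] **] by auto
qed

lemma Hrep_eqI:
  assumes a: "a \<in> adj_ops E" and f: "f \<in> adj_ops H"
    and eq: "\<And>h t. h \<in> Hc \<Longrightarrow> t \<in> T \<Longrightarrow> f h t = \<theta> t a (h t)"
  shows "Hrep a = f"
proof (rule H.adj_ops_eqI[OF Hrep_adj_ops[OF a] f])
  fix h assume "h \<in> hm_carrier H"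
  then show "Hrep a h = f h"
    using H.adj_ops_closed[OF f, of h] Hrep_closed[OF a, of h] eq by (intro Hc_eqI) (simp_all add: Hrep_apply)
qed

lemma Hrep_module_rep: "full_rep E H Hrep frame"
proof
  show "star_hom E H Hrep"
    unfolding star_hom_def
  proof (intro conjI ballI allI)
    show "Hrep \<in> adj_ops E \<rightarrow> adj_ops H" using Hrep_adj_ops by blast
    fix a assume a: "a \<in> adj_ops E"
    show "Hrep (op_adjoint E a) = op_adjoint H (Hrep a)" using Hrep_adjoint[OF a] by simp
    show "Hrep (op_scale E c a) = op_scale H c (Hrep a)" for c
      using a by (intro Hrep_eqI)
        (simp_all add: E.op_adj_ops H.op_adj_ops Hrep_adj_ops H.op_scale_apply Hrep_apply module_rep.rep_scale[OF rep] Hc_closed)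
    fix b assume b: "b \<in> adj_ops E"
    show "Hrep (op_add E a b) = op_add H (Hrep a) (Hrep b)"
      using a b by (intro Hrep_eqI)
        (simp_all add: E.op_adj_ops H.op_adj_ops Hrep_adj_ops H.op_add_apply Hrep_apply module_rep.rep_add[OF rep] Hc_closed)
    show "Hrep (op_mult E a b) = op_mult H (Hrep a) (Hrep b)"
      using a b by (intro Hrep_eqI)
        (simp_all add: E.op_adj_ops H.op_adj_ops Hrep_adj_ops H.op_mult_apply Hrep_apply Hrep_closed module_rep.rep_mult[OF rep] Hc_closed)
  qed
  show "Hrep (op_id E) = op_id H"
    by (intro Hrep_eqI) (simp_all add: E.op_adj_ops H.op_adj_ops H.op_id_apply module_rep.rep_id[OF rep] Hc_closed)
qed (use frame in auto)

text \<open>On \<open>level 0 x\<close> the coordinate at \<open>0\<close> is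
  \<open>\<theta> 0 a x = a x\<close>, so \<open>a\<close> can be recovered.\<close>

lemma Hrep_inj:
  assumes "a \<in> adj_ops E" "b \<in> adj_ops E" "Hrep a = Hrep b"
  shows "a = b"
proof (rule E.adj_ops_eqI[OF assms(1,2)])
  fix x assume x: "x \<in> hm_carrier E"
  then have l: "level 0 x \<in> Hc" and l0: "level 0 x 0 = x"
    using level_closed[OF T_simps(1)] T_simps(1) by (simp_all add: level_def W_zero)
  show "a x = b x"
    using fun_cong[OF fun_cong[OF assms(3), of "level 0 x"], of 0] assms(1,2)
    by (simp add: Hrep_apply l l0 T_simps E0)
qed

lemma Hrep_level:
  assumes a: "a \<in> adj_ops E" and t: "t \<in> T" and z: "z \<in> hm_carrier E"
  shows "Hrep a (level t z) = level t (\<theta> t a z)"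
proof (rule Hc_eqI)
  show "Hrep a (level t z) \<in> Hc" "level t (\<theta> t a z) \<in> Hc"
    using a t z by (simp_all add: Hrep_closed level_closed theta_closed)
  fix r assume r: "r \<in> T"
  show "Hrep a (level t z) r = level t (\<theta> t a z) r"
  proof (cases "t \<le> r")
    case True
    then have "r - t \<in> T" using T_diff t r by blast
    then show ?thesis
      using theta_W[of "r - t" t a z] True a t z r by (simp add: Hrep_apply level_closed) (simp add: level_def)
  next
    case False
    then have "t - r \<in> T" using T_diff t r by simp
    then show ?thesis
      using theta_V[of "t - r" r a z] False a t z r by (simp add: Hrep_apply level_closed) (simp add: level_def)
  qed
qed

text \<open>For \<open>k\<close> of rank one, \<open>level t (\<theta> t k z)\<close> is
  \<open>Hrep k\<close> of a level vector and hence a value of some \<open>dual_op\<close>. By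
  strictness such vectors approximate every level vector, and level vectors are dense. This gives
  the density of the values of evaluation in \<open>H\<close>.\<close>

lemma Hrep_total:
  assumes h: "h \<in> Hc"
  shows "h \<in> hm_approx H {R x | x R. x \<in> hm_carrier E \<and> R \<in> intertwiners E H Hrep}" (is "_ \<in> hm_approx H ?G")
proof -
  interpret full_rep E H Hrep frame by (rule Hrep_module_rep)
  have G: "?G \<subseteq> hm_carrier H" using int_closed by auto
  have lev: "level t z \<in> hm_approx H ?G" if t: "t \<in> T" and z: "z \<in> hm_carrier E" for t z
  proof -
    let ?S = "{\<theta> t (rank_one E x x') z | x x' z. x \<in> hm_carrier E \<and> x' \<in> hm_carrier E \<and> z \<in> hm_carrier E}"
    have S: "?S \<subseteq> hm_carrier E" using t by (auto intro!: theta_closed E.rank_one_adj_ops)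
    have lz: "level t (hm_zero E) = hm_zero H"
      using t T_diff by (auto simp: level_def E.adj_zero W_adj V_adj)
    have ld: "hm_diff H (level t x) (level t y) = level t (hm_diff E x y)"
      if "x \<in> hm_carrier E" "y \<in> hm_carrier E" for x y
      unfolding Hdiff using that t T_diff by (auto simp: level_def E.adj_diff W_adj V_adj)
    have la: "level t (hm_add E x y) = hm_add H (level t x) (level t y)"
      if "x \<in> hm_carrier E" "y \<in> hm_carrier E" for x y
      using that t T_diff by (auto simp: level_def E.adj_add W_adj V_adj)
    show ?thesis
    proof (rule approx_image[OF E.hilbert_module_axioms H.hilbert_module_axioms S G approx_theta[OF t z]])
      show "hm_norm H (hm_diff H (level t x) (level t y)) \<le> 1 * hm_norm E (hm_diff E x y)"
        if "x \<in> hm_carrier E" "y \<in> hm_carrier E" for x y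
        unfolding ld[OF that]
      proof (rule Hnorm_leI[of _ t])
        fix s assume "s \<in> T" "t \<le> s"
        then show "hm_norm E (level t (hm_diff E x y) s) \<le> 1 * hm_norm E (hm_diff E x y)"
          using T_diff[OF t, of s] that by (simp add: level_def norm_W E.closed)
      qed (use t that in \<open>simp add: level_closed E.closed\<close>)
      show "level t x \<in> hm_approx H ?G" if x: "x \<in> ?S" for x
      proof (rule H.approx_mem[OF G])
        obtain x1 x2 z' where x: "x = \<theta> t (rank_one E x1 x2) z'" "x1 \<in> hm_carrier E" "x2 \<in> hm_carrier E" "z' \<in> hm_carrier E"
          using \<open>x \<in> ?S\<close> by auto
        have "level t x = Hrep (rank_one E x1 x2) (level t z')"
          using x t by (simp add: Hrep_level E.rank_one_adj_ops)
        also have "\<dots> = dual_op x2 (level t z') x1" using x by (simp add: dual_op_def)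
        finally show "level t x \<in> ?G"
          using dual_op_int[of x2 "level t z'"] x t level_closed by force
      qed
    qed (use t in \<open>simp_all add: level_closed lz la del: H_simps(2-6)\<close>)
  qed
  show ?thesis
  proof (rule H.approx_limit[OF G])
    show "h \<in> hm_carrier H" using h by simp
    fix e :: real assume "e > 0"
    then obtain t where "t \<in> T" "hm_norm H (hm_diff H h (level t (h t))) < e" using level_dense[OF h] by blast
    then show "\<exists>y\<in>hm_approx H ?G. hm_norm H (hm_diff H h y) < e" using lev Hc_closed[OF h] by blast
  qed
qed

section \<open>The shift\<close>

text \<open>In terms of levels, \<open>level t z\<close> becomes \<open>level 0 z\<close>, and
  \<open>level 0 x\<close> becomes \<open>level 0 (W t x)\<close>; this is the sense in which it
  extends \<open>W t\<close>.\<close>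

definition shift :: "real \<Rightarrow> (real \<Rightarrow> 'e) \<Rightarrow> real \<Rightarrow> 'e" where
  "shift t = (\<lambda>h\<in>Hc. \<lambda>r\<in>T. h (r + t))"

text \<open>Below \<open>t\<close> the coordinates are not values of \<open>h\<close>; coherence
  forces them to be the projections of \<open>h 0\<close>.\<close>

definition unshift :: "real \<Rightarrow> (real \<Rightarrow> 'e) \<Rightarrow> real \<Rightarrow> 'e" where
  "unshift t = (\<lambda>h\<in>Hc. \<lambda>r\<in>T. if t \<le> r then h (r - t) else V (t - r) (h 0))"

lemma shift_closed:
  assumes t: "t \<in> T" and h: "h \<in> Hc"
  shows "shift t h \<in> Hc"
  unfolding Hc_def
proof (intro CollectI conjI ballI allI impI)
  have T: "r + t \<in> T" if "r \<in> T" for r using that t T_simps by simp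
  show "shift t h \<in> T \<rightarrow>\<^sub>E hm_carrier E" using h T by (auto simp: shift_def Hc_closed)
  show "V s (shift t h (s + r)) = shift t h r" if "s \<in> T" "r \<in> T" for s r
    using that h T Hc_V[OF h that(1) T[OF that(2)]] T_simps by (simp add: shift_def add.assoc)
  fix e :: real assume "e > 0"
  then obtain r where r: "r \<in> T" "\<And>t' s. t' \<in> T \<Longrightarrow> r \<le> t' \<Longrightarrow> s \<in> T \<Longrightarrow> hm_norm E (defect h t' s) < e"
    using Hc_small[OF h] by metis
  have "defect (shift t h) r s = defect h (r + t) s" if "s \<in> T" for s
    using that r(1) h T_simps by (simp add: shift_def defect_def add_ac)
  then show "\<exists>r\<in>T. \<forall>s\<in>T. hm_norm E (defect (shift t h) r s) < e"
    using r(2)[OF T[OF r(1)]] r(1) T_simps(5)[OF t] by (intro bexI[of _ r]) simp_all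
qed

lemma unshift_closed:
  assumes t: "t \<in> T" and h: "h \<in> Hc"
  shows "unshift t h \<in> Hc"
proof -
  have "(\<lambda>r\<in>T. if t \<le> r then h (r - t) else V (t - r) (h 0)) \<in> Hc"
    by (rule Hc_extend[OF t]) (use h in \<open>auto simp: Hc_closed Hc_V\<close>, auto simp: Hc_def)
  then show ?thesis using h by (simp add: unshift_def)
qed

lemma shift_unshift:
  assumes t: "t \<in> T" and h: "h \<in> Hc"
  shows "shift t (unshift t h) = h" "unshift t (shift t h) = h"
proof -
  have T: "r + t \<in> T" if "r \<in> T" for r using that t T_simps by simp
  show "shift t (unshift t h) = h"
    using h t T T_simps(5) by (intro Hc_eqI)
      (simp_all add: shift_closed unshift_closed, simp add: shift_def unshift_closed, simp add: unshift_def)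
  show "unshift t (shift t h) = h"
  proof (rule Hc_eqI)
    fix r assume r: "r \<in> T"
    show "unshift t (shift t h) r = h r"
    proof (cases "t \<le> r")
      case True
      then show ?thesis using T_diff[OF t r] r h t
        by (simp add: unshift_def shift_closed) (simp add: shift_def)
    next
      case False
      then have "t - r \<in> T" using T_diff[OF r t] by simp
      then show ?thesis using Hc_V[OF h _ r, of "t - r"] False r h t T_simps(1)
        by (simp add: unshift_def shift_closed) (simp add: shift_def)
    qed
  qed (use h t in \<open>simp_all add: shift_closed unshift_closed\<close>)
qed

lemma shift_inner:
  assumes t: "t \<in> T" and h: "h \<in> Hc" and k: "k \<in> Hc"
  shows "Hinner (shift t h) (shift t k) = Hinner h k"
  using Hinner_unique[OF shift_closed[OF t h] shift_closed[OF t k]] Hinner_shift[OF h k t] h k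
  by (simp add: shift_def T_simps)

lemma
  assumes t: "t \<in> T"
  shows shift_adj_ops: "shift t \<in> adj_ops H"
    and shift_adjoint: "op_adjoint H (shift t) = unshift t"
    and shift_unitary: "hm_unitary H H (shift t)"
proof -
  have *: "shift t \<in> hm_carrier H \<rightarrow>\<^sub>E hm_carrier H" "unshift t \<in> hm_carrier H \<rightarrow>\<^sub>E hm_carrier H"
    using shift_closed[OF t] unshift_closed[OF t] by (auto simp: shift_def[of t] unshift_def[of t])
  have **: "hm_inner H (shift t h) k = hm_inner H h (unshift t k)" if "h \<in> hm_carrier H" "k \<in> hm_carrier H" for h k
    using shift_inner[OF t, of h "unshift t k"] that t by (simp add: unshift_closed shift_unshift)
  show "shift t \<in> adj_ops H" "op_adjoint H (shift t) = unshift t"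
    using H.adj_opsI[OF * **] by auto
  have "h \<in> shift t ` Hc" if "h \<in> Hc" for h
    using shift_unshift(1)[OF t that] unshift_closed[OF t that] by force
  then show "hm_unitary H H (shift t)"
    using * shift_closed[OF t] shift_inner[OF t] by (auto simp: hm_unitary_def)
qed

lemma shift_add:
  assumes s: "s \<in> T" and t: "t \<in> T"
  shows "shift (s + t) = op_mult H (shift s) (shift t)"
proof (rule H.adj_ops_eqI)
  show "shift (s + t) \<in> adj_ops H" "op_mult H (shift s) (shift t) \<in> adj_ops H"
    using s t T_simps by (simp_all add: shift_adj_ops H.op_adj_ops)
  fix h assume h: "h \<in> hm_carrier H"
  have st: "s + t \<in> T" using s t T_simps by simp
  have "shift (s + t) h r = shift s (shift t h) r" if "r \<in> T" for r
    using that h s t st T_simps by (simp add: shift_closed shift_def[of s] shift_def[of "s + t"]) (simp add: shift_def add.assoc)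
  then show "shift (s + t) h = op_mult H (shift s) (shift t) h"
    using h s t st by (simp add: H.op_mult_apply) (intro Hc_eqI, simp_all add: shift_closed)
qed

lemma shift_zero: "shift 0 = op_id H"
  by (rule H.adj_ops_eqI)
    (simp_all add: shift_adj_ops T_simps H.op_adj_ops H.op_id_apply, rule Hc_eqI, simp_all add: shift_closed T_simps, simp add: shift_def)

text \<open>At coordinate \<open>r\<close> the left side applies \<open>\<theta> (r + t) a\<close>
  to \<open>h r\<close>, and the semigroup law rewrites this operator as
  \<open>\<theta> r (\<theta> t a)\<close>.\<close>

lemma shift_covariant:
  assumes t: "t \<in> T" and a: "a \<in> adj_ops E"
  shows "op_mult H (op_mult H (shift t) (Hrep a)) (op_adjoint H (shift t)) = Hrep (\<theta> t a)"
proof (rule Hrep_eqI[symmetric])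
  show "\<theta> t a \<in> adj_ops E" using t a by (rule theta_adj)
  show "op_mult H (op_mult H (shift t) (Hrep a)) (op_adjoint H (shift t)) \<in> adj_ops H"
    using t a by (simp add: H.op_adj_ops shift_adj_ops Hrep_adj_ops)
  fix h r assume h: "h \<in> Hc" and r: "r \<in> T"
  have u: "unshift t h \<in> Hc" using t h by (rule unshift_closed)
  have rt: "r + t \<in> T" using r t T_simps by simp
  have "unshift t h (r + t) = h r"
    using h r rt T_simps(5)[OF r] by (simp add: unshift_def)
  moreover have "op_mult H (op_mult H (shift t) (Hrep a)) (op_adjoint H (shift t)) h = shift t (Hrep a (unshift t h))"
    using h u by (simp add: H.op_mult_apply shift_adjoint[OF t])
  ultimately show "op_mult H (op_mult H (shift t) (Hrep a)) (op_adjoint H (shift t)) h r = \<theta> r (\<theta> t a) (h r)"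
    using h u r rt a E0(4)[OF r t a] Hrep_closed[OF a u] by (simp add: shift_def Hrep_apply)
qed

end

section \<open>The dilation\<close>

text \<open>Since \<open>1\<close> acts as the identity, the left action is already onto, and
  nondegeneracy is transported without approximation.\<close>

lemma relabel_correspondence:
  fixes G :: "('g, 'b::unital_cstar_algebra, 'a::unital_cstar_algebra) corr"
  assumes G: "correspondence G" and k: "\<And>x. x \<in> hm_carrier G \<Longrightarrow> k (j x) = x"
    and one: "\<And>x. x \<in> hm_carrier G \<Longrightarrow> hm_lact G 1 x = x"
  shows "correspondence (relabel j k G)"
proof -
  interpret G: correspondence G by fact
  interpret i: module_iso G "relabel j k G" j
    by unfold_locales (auto simp: relabel_def k G.closed intro!: inj_onI, metis k)
  have lact: "hm_lact (relabel j k G) a (j x) = j (hm_lact G a x)" if "x \<in> hm_carrier G" for a x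
    using that by (simp add: relabel_def k)
  show ?thesis
  proof
    have "{hm_lact (relabel j k G) a y | a y. y \<in> hm_carrier (relabel j k G)} = hm_carrier (relabel j k G)"
    proof (rule equalityI; rule subsetI)
      fix X assume "X \<in> hm_carrier (relabel j k G)"
      then obtain x where x: "x \<in> hm_carrier G" "X = j x" by (auto simp: i.carrier_eq)
      then have "X = hm_lact (relabel j k G) 1 (j x)" by (simp add: lact one)
      then show "X \<in> {hm_lact (relabel j k G) a y | a y. y \<in> hm_carrier (relabel j k G)}"
        using i.iso_closed[OF x(1)] by blast
    qed (auto simp: i.carrier_eq lact G.lact_closed)
    then show "closed_span (relabel j k G) {hm_lact (relabel j k G) a y | a y. y \<in> hm_carrier (relabel j k G)} =
        hm_carrier (relabel j k G)"
      by (rule i.T.closed_span_self)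
  qed (auto simp: i.carrier_eq lact i.iso_simps G.lact_closed G.lact_star G.lact_add G.lact_scale G.lact_mult)
qed

text \<open>An intertwiner into \<open>H\<close> is a function of a vector and an index. Its graph
  is stored as constant sequences of one-term formal sums tagged with the index, which places
  \<open>E_-\<close> inside the prescribed type \<open>limit_elem\<close>.\<close>

definition graph_code :: "('e \<Rightarrow> real \<Rightarrow> 'e) \<Rightarrow> 'e limit_elem" where
  "graph_code R = {(\<lambda>_. (t, [(x, R x t)])) | t x. True}"

lemma inj_graph_code: "inj graph_code"
proof (rule injI)
  fix R S :: "'e \<Rightarrow> real \<Rightarrow> 'e" assume eq: "graph_code R = graph_code S"
  show "R = S"
  proof (intro ext)
    fix x t
    have "(\<lambda>_. (t, [(x, R x t)])) \<in> graph_code S" unfolding eq[symmetric] by (auto simp: graph_code_def)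
    then show "R x t = S x t" by (auto simp: graph_code_def dest: fun_cong)
  qed
qed

context spatial_dilation
begin

lemma dilation_exists:
  "\<exists>(Em :: ('e limit_elem, 'b, 'b) corr) w.
    correspondence Em \<and>
    unitary_semigroup T (tensor E Em) w \<and>
    star_hom E (tensor E Em) (amplification E Em) \<and>
    bij_betw (amplification E Em) (adj_ops E) (amplification E Em ` adj_ops E) \<and>
    (\<forall>t\<in>T. \<forall>a\<in>adj_ops E.
      op_mult (tensor E Em) (op_mult (tensor E Em) (w t) (amplification E Em a))
        (op_adjoint (tensor E Em) (w t)) = amplification E Em (\<theta> t a))"
proof -
  interpret full_rep E H Hrep frame by (rule Hrep_module_rep)
  define dec :: "'e limit_elem \<Rightarrow> 'e \<Rightarrow> real \<Rightarrow> 'e" where "dec = inv graph_code"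
  have dec: "dec (graph_code R) = R" for R by (simp add: dec_def inj_graph_code)
  define Em where "Em = relabel graph_code dec M"
  interpret C: correspondence M by (rule int_correspondence)
  have one: "hm_lact M 1 R = R" if "R \<in> hm_carrier M" for R
    using that int_ops_closed(4)[of R 1] by (intro int_eqI) (simp_all add: E.act_one)
  have corr: "correspondence Em"
    unfolding Em_def by (rule relabel_correspondence[OF C.correspondence_axioms dec one])
  have Em_carrier: "hm_carrier Em = graph_code ` Intw" by (simp add: Em_def relabel_def)
  \<comment> \<open>Evaluation \<open>x \<odot> R \<mapsto> R x\<close> is the model of
    \<open>E \<odot> E_-\<close>: inner products are \<open>inner_int_eval\<close>, density is
    \<open>Hrep_total\<close>.\<close>
  interpret m: tensor_model E Em H "\<lambda>x Y. dec Y x"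
  proof
    show "hm_scale E c x \<in> hm_carrier E" if "x \<in> hm_carrier E" for x c using that by (rule E.scale_closed)
    show "hm_act Em Y b \<in> hm_carrier Em" if "Y \<in> hm_carrier Em" for Y b
      using that int_ops_closed(3) by (auto simp: Em_def relabel_def dec)
    show "dec Y x \<in> hm_carrier H" if "x \<in> hm_carrier E" "Y \<in> hm_carrier Em" for x Y
      using that int_closed by (auto simp: Em_carrier dec)
    show "dec Y (hm_scale E c x) = hm_scale H c (dec Y x)" if "x \<in> hm_carrier E" "Y \<in> hm_carrier Em" for x Y c
      using that int_scale by (auto simp: Em_carrier dec simp del: H_simps)
    show "dec (hm_act Em Y b) x = hm_act H (dec Y x) b" if "x \<in> hm_carrier E" "Y \<in> hm_carrier Em" for x Y b
      using that by (simp add: Em_def relabel_def dec del: H_simps)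
    show "hm_inner H (dec Y x) (dec Y' x') = hm_inner Em Y (hm_lact Em (hm_inner E x x') Y')"
      if xy: "x \<in> hm_carrier E" "Y \<in> hm_carrier Em" "x' \<in> hm_carrier E" "Y' \<in> hm_carrier Em" for x Y x' Y'
    proof -
      obtain R R' where R: "R \<in> Intw" "Y = graph_code R" "R' \<in> Intw" "Y' = graph_code R'"
        using xy(2,4) unfolding Em_carrier by blast
      then have "hm_inner Em Y (hm_lact Em (hm_inner E x x') Y') = hm_inner M R (hm_lact M (hm_inner E x x') R')"
        by (simp add: Em_def relabel_def dec del: H_simps int_corr_simps(6,7))
      then show ?thesis using inner_int_eval[OF R(1,3) xy(1,3)] R by (simp only: dec)
    qed
    fix h and e :: real assume h: "h \<in> hm_carrier H" and e: "e > 0"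
    have "{R x | x R. x \<in> hm_carrier E \<and> R \<in> Intw} = {dec Y x | x Y. x \<in> hm_carrier E \<and> Y \<in> hm_carrier Em}"
      by (force simp: Em_carrier dec)
    then have "h \<in> hm_approx H {dec Y x | x Y. x \<in> hm_carrier E \<and> Y \<in> hm_carrier Em}"
      using Hrep_total[of h] h by simp
    then show "\<exists>s\<in>lists (hm_carrier E \<times> hm_carrier Em).
        hm_norm H (hm_diff H h (hm_sum H (\<lambda>p. dec (snd p) (fst p)) s)) < e"
      by (rule total_of_approx[where \<phi> = "\<lambda>x Y. dec Y x", OF _ e])
  qed
  let ?N = "tensor E Em"
  \<comment> \<open>The intertwining property says that evaluation carries
    \<open>a \<odot> id\<close> to \<open>Hrep a\<close>.\<close>
  have amp: "amplification E Em a = m.tensor_iso.lift (Hrep a)" if a: "a \<in> adj_ops E" for a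
  proof (rule m.tensor_iso.liftI)
    show "amplification E Em a \<in> extensional (hm_carrier ?N)" by (simp add: amplification_def)
    fix h assume h: "h \<in> hm_carrier H"
    show "amplification E Em a (m.tensor_class h) = m.tensor_class (Hrep a h)"
    proof (rule m.amplification_class[OF h])
      show "dec Y (a x) = Hrep a (dec Y x)" if "x \<in> hm_carrier E" "Y \<in> hm_carrier Em" for x Y
        using that int_rep a by (auto simp: Em_carrier dec)
    qed (use a in \<open>auto intro: E.adj_ops_closed H.adj_zero H.adj_add H.adj_lim Hrep_adj_ops simp del: H_simps\<close>)
  qed
  \<comment> \<open>The translations of \<open>H\<close>, transported to the tensor product.\<close>
  define w where "w t = m.tensor_iso.lift (shift t)" for t
  have "unitary_semigroup T ?N w"
    unfolding unitary_semigroup_def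
  proof (intro conjI ballI)
    show "w t \<in> adj_ops ?N" "hm_unitary ?N ?N (w t)" if "t \<in> T" for t
      using that by (simp_all add: w_def m.tensor_iso.lift_adj_ops m.tensor_iso.lift_unitary shift_adj_ops shift_unitary)
    show "w 0 = op_id ?N" by (simp add: w_def shift_zero m.tensor_iso.op_id_lift)
    show "w (s + t) = op_mult ?N (w s) (w t)" if "s \<in> T" "t \<in> T" for s t
      using that by (simp add: w_def shift_add m.tensor_iso.op_mult_lift shift_adj_ops)
  qed
  moreover have "star_hom E ?N (amplification E Em)"
    using rep_star_hom unfolding star_hom_def
    by (simp add: amp Hrep_adj_ops E.op_adj_ops m.tensor_iso.op_add_lift m.tensor_iso.op_scale_lift
        m.tensor_iso.op_mult_lift m.tensor_iso.op_adjoint_lift m.tensor_iso.lift_adj_ops Pi_iff)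
  moreover have "inj_on (amplification E Em) (adj_ops E)"
  proof (rule inj_onI)
    fix a b assume ab: "a \<in> adj_ops E" "b \<in> adj_ops E" "amplification E Em a = amplification E Em b"
    then have "Hrep a = Hrep b" using m.tensor_iso.lift_inj Hrep_adj_ops by (simp add: amp)
    then show "a = b" using ab Hrep_inj by blast
  qed
  then have "bij_betw (amplification E Em) (adj_ops E) (amplification E Em ` adj_ops E)"
    by (rule inj_on_imp_bij_betw)
  moreover have "op_mult ?N (op_mult ?N (w t) (amplification E Em a)) (op_adjoint ?N (w t)) = amplification E Em (\<theta> t a)"
    if t: "t \<in> T" and a: "a \<in> adj_ops E" for t a
  proof -
    have "op_mult ?N (op_mult ?N (w t) (amplification E Em a)) (op_adjoint ?N (w t)) =
        m.tensor_iso.lift (op_mult H (op_mult H (shift t) (Hrep a)) (op_adjoint H (shift t)))"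
      using shift_adj_ops[OF t] Hrep_adj_ops[OF a]
      by (simp add: w_def amp a m.tensor_iso.op_adjoint_lift m.tensor_iso.op_mult_lift H.op_adj_ops)
    then show ?thesis by (simp add: shift_covariant t a amp theta_adj)
  qed
  ultimately show ?thesis using corr by blast
qed

end

theorem mainTheorem1:
  fixes Ep :: "('e, 'b::unital_cstar_algebra) hilbert_mod"
    and T :: "real set"
    and \<theta> :: "real \<Rightarrow> ('e \<Rightarrow> 'e) \<Rightarrow> 'e \<Rightarrow> 'e"
  assumes "hilbert_module Ep"
    and "T = {0..} \<or> T = \<nat>"
    and "strict_E0_semigroup T Ep \<theta>"
    and "spatial T Ep \<theta>"
  shows "\<exists>(Em :: ('e limit_elem, 'b, 'b) corr) w.
    correspondence Em \<and>
    unitary_semigroup T (tensor Ep Em) w \<and>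
    star_hom Ep (tensor Ep Em) (amplification Ep Em) \<and>
    bij_betw (amplification Ep Em) (adj_ops Ep) (amplification Ep Em ` adj_ops Ep) \<and>
    (\<forall>t\<in>T. \<forall>a\<in>adj_ops Ep.
      op_mult (tensor Ep Em) (op_mult (tensor Ep Em) (w t) (amplification Ep Em a))
        (op_adjoint (tensor Ep Em) (w t)) = amplification Ep Em (\<theta> t a))"
proof -
  interpret spatial_semigroup Ep T \<theta>
    using assms by (simp add: spatial_semigroup_def spatial_semigroup_axioms_def)
  obtain W where "spatial_dilation Ep T \<theta> W"
    by (rule isometry_semigroup) (blast intro: spatial_dilation.intro spatial_dilation_axioms.intro spatial_semigroup_axioms)
  then show ?thesis by (rule spatial_dilation.dilation_exists)
qed

end
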